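(* Let $\mathcal{A}\supset\mathcal{D}\subset\mathcal{B}$ be unital inclusions of unital MF algebras, where $\mathcal{D}$ is an AF algebra. Then the unital full free product $\mathcal{A}\ast_{\mathcal{D}}\mathcal{B}$ of $\mathcal{A}$ and $\mathcal{B}$ with amalgamation over $\mathcal{D}$ is an MF algebra if and only if there exist a sequence $\{n_k\}_{k=1}^{\infty}$ of positive integers and unital embeddings $$q_1:\mathcal{A}\to\prod_{k}\mathcal{M}_{n_k}(\mathbb{C})\Big/\sum_{k}\mathcal{M}_{n_k}(\mathbb{C}),\qquad q_2:\mathcal{B}\to\prod_{k}\mathcal{M}_{n_k}(\mathbb{C})\Big/\sum_{k}\mathcal{M}_{n_k}(\mathbb{C})$$ such that $q_1|_{\mathcal{D}}=q_2|_{\mathcal{D}}$.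
   Context: Embeddings are injective *-homomorphisms. For positive integers $n_k$, $\prod_k\mathcal{M}_{n_k}(\mathbb{C})$ is the C*-algebra of norm-bounded sequences $(Y_k)_k$, $Y_k\in\mathcal{M}_{n_k}(\mathbb{C})$, with the sup norm, and $\sum_k\mathcal{M}_{n_k}(\mathbb{C})$ is the closed two-sided ideal of sequences with $\lim_k\|Y_k\|=0$. A separable C*-algebra is an MF algebra if it embeds as a C*-subalgebra of $\prod_k\mathcal{M}_{n_k}(\mathbb{C})/\sum_k\mathcal{M}_{n_k}(\mathbb{C})$ for some sequence $\{n_k\}$ of positive integers. An AF algebra is the norm closure of the union of an increasing sequence of finite-dimensional C*-subalgebras. For unital inclusions $\mathcal{A}\supseteq\mathcal{D}\subseteq\mathcal{B}$, the unital full amalgamated free product $\mathcal{A}\ast_{\mathcal{D}}\mathcal{B}$ is the C*-algebra $\mathcal{C}$ with unital embeddings $\sigma_{\mathcal{A}}:\mathcal{A}\to\mathcal{C}$, $\sigma_{\mathcal{B}}:\mathcal{B}\to\mathcal{C}$ such that $\sigma_{\mathcal{A}}|_{\mathcal{D}}=\sigma_{\mathcal{B}}|_{\mathcal{D}}$, $\mathcal{C}$ is generated by $\sigma_{\mathcal{A}}(\mathcal{A})\cup\sigma_{\mathcal{B}}(\mathcal{B})$, and whenever $\pi_{\mathcal{A}}:\mathcal{A}\to\mathcal{E}$, $\pi_{\mathcal{B}}:\mathcal{B}\to\mathcal{E}$ are *-homomorphisms into a C*-algebra $\mathcal{E}$ with $\pi_{\mathcal{A}}|_{\mathcal{D}}=\pi_{\mathcal{B}}|_{\mathcal{D}}$,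 there is a *-homomorphism $\pi:\mathcal{C}\to\mathcal{E}$ with $\pi\circ\sigma_{\mathcal{A}}=\pi_{\mathcal{A}}$ and $\pi\circ\sigma_{\mathcal{B}}=\pi_{\mathcal{B}}$. *)

theory Defs
  imports
    "HOL-Algebra.QuotRing"
    "HOL-Library.Countable_Set"
    "Jordan_Normal_Form.VS_Connect"
    "Jordan_Normal_Form.Schur_Decomposition"
begin

section \<open>C*-algebras\<close>

text \<open>
  A C*-algebra is a complex \<open>module\<close> record with carrier, extended by an involution and a norm.
  C*-algebras need not be unital: the field \<open>one\<close>, inherited from the record, is unconstrained
  in \<open>cstar_algebra\<close> and only becomes meaningful in \<open>unital_cstar_algebra\<close>.
\<close>

record 'a cstar = "(complex, 'a) module" +
  star :: "'a \<Rightarrow> 'a"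
  cnorm :: "'a \<Rightarrow> real"

definition cdist :: "'a cstar \<Rightarrow> 'a \<Rightarrow> 'a \<Rightarrow> real" where
  "cdist A x y = cnorm A (x \<ominus>\<^bsub>A\<^esub> y)"

definition ctendsto :: "'a cstar \<Rightarrow> (nat \<Rightarrow> 'a) \<Rightarrow> 'a \<Rightarrow> bool" where
  "ctendsto A X x \<longleftrightarrow> (\<lambda>m. cdist A (X m) x) \<longlonglongrightarrow> 0"

definition cCauchy :: "'a cstar \<Rightarrow> (nat \<Rightarrow> 'a) \<Rightarrow> bool" where
  "cCauchy A X \<longleftrightarrow> (\<forall>e>0. \<exists>N. \<forall>m\<ge>N. \<forall>n\<ge>N. cdist A (X m) (X n) < e)"

locale cstar_algebra = Module.module "class_ring :: complex ring" A
  for A :: "'a cstar" (structure) +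
  assumes mult_closed: "\<lbrakk>x \<in> carrier A; y \<in> carrier A\<rbrakk> \<Longrightarrow> x \<otimes> y \<in> carrier A"
    and mult_assoc: "\<lbrakk>x \<in> carrier A; y \<in> carrier A; z \<in> carrier A\<rbrakk>
      \<Longrightarrow> (x \<otimes> y) \<otimes> z = x \<otimes> (y \<otimes> z)"
    and mult_add_left: "\<lbrakk>x \<in> carrier A; y \<in> carrier A; z \<in> carrier A\<rbrakk>
      \<Longrightarrow> (x \<oplus> y) \<otimes> z = x \<otimes> z \<oplus> y \<otimes> z"
    and mult_add_right: "\<lbrakk>x \<in> carrier A; y \<in> carrier A; z \<in> carrier A\<rbrakk>
      \<Longrightarrow> x \<otimes> (y \<oplus> z) = x \<otimes> y \<oplus> x \<otimes> z"
    and smult_mult_left: "\<lbrakk>x \<in> carrier A; y \<in> carrier A\<rbrakk> \<Longrightarrow> (c \<odot> x) \<otimes> y = c \<odot> (x \<otimes> y)"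
    and smult_mult_right: "\<lbrakk>x \<in> carrier A; y \<in> carrier A\<rbrakk> \<Longrightarrow> x \<otimes> (c \<odot> y) = c \<odot> (x \<otimes> y)"
    and star_closed: "x \<in> carrier A \<Longrightarrow> star A x \<in> carrier A"
    and star_star: "x \<in> carrier A \<Longrightarrow> star A (star A x) = x"
    and star_add: "\<lbrakk>x \<in> carrier A; y \<in> carrier A\<rbrakk> \<Longrightarrow> star A (x \<oplus> y) = star A x \<oplus> star A y"
    and star_smult: "x \<in> carrier A \<Longrightarrow> star A (c \<odot> x) = cnj c \<odot> star A x"
    and star_mult: "\<lbrakk>x \<in> carrier A; y \<in> carrier A\<rbrakk> \<Longrightarrow> star A (x \<otimes> y) = star A y \<otimes> star A x"
    and cnorm_eq_zero: "\<lbrakk>x \<in> carrier A; cnorm A x = 0\<rbrakk> \<Longrightarrow> x = \<zero>"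
    and cnorm_triangle: "\<lbrakk>x \<in> carrier A; y \<in> carrier A\<rbrakk> \<Longrightarrow> cnorm A (x \<oplus> y) \<le> cnorm A x + cnorm A y"
    and cnorm_smult: "x \<in> carrier A \<Longrightarrow> cnorm A (c \<odot> x) = cmod c * cnorm A x"
    and cnorm_mult: "\<lbrakk>x \<in> carrier A; y \<in> carrier A\<rbrakk> \<Longrightarrow> cnorm A (x \<otimes> y) \<le> cnorm A x * cnorm A y"
    and cnorm_cstar: "x \<in> carrier A \<Longrightarrow> cnorm A (star A x \<otimes> x) = (cnorm A x)\<^sup>2"
    and complete: "\<lbrakk>\<And>m. X m \<in> carrier A; cCauchy A X\<rbrakk> \<Longrightarrow> \<exists>x\<in>carrier A. ctendsto A X x"

text \<open>
  Unital C*-algebras are nonzero: without \<open>1 \<noteq> 0\<close> there would be no unital embedding of the zero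
  algebra into a corona of matrix algebras, although the zero algebra is MF.
\<close>

locale unital_cstar_algebra = cstar_algebra +
  assumes one_closed: "\<one> \<in> carrier A"
    and one_mult: "x \<in> carrier A \<Longrightarrow> \<one> \<otimes> x = x"
    and mult_one: "x \<in> carrier A \<Longrightarrow> x \<otimes> \<one> = x"
    and one_neq_zero: "\<one> \<noteq> \<zero>"

definition separable_cstar :: "'a cstar \<Rightarrow> bool" where
  "separable_cstar A \<longleftrightarrow>
     (\<exists>S. countable S \<and> S \<subseteq> carrier A \<and> (\<forall>x\<in>carrier A. \<forall>e>0. \<exists>s\<in>S. cdist A x s < e))"

definition cstar_subalgebra :: "'a set \<Rightarrow> 'a cstar \<Rightarrow> bool" where
  "cstar_subalgebra F A \<longleftrightarrow>
     Module.submodule F (class_ring :: complex ring) A \<and>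
     (\<forall>x\<in>F. \<forall>y\<in>F. x \<otimes>\<^bsub>A\<^esub> y \<in> F) \<and>
     (\<forall>x\<in>F. star A x \<in> F) \<and>
     (\<forall>X. \<forall>x\<in>carrier A. (\<forall>m. X m \<in> F) \<longrightarrow> ctendsto A X x \<longrightarrow> x \<in> F)"

definition generated_by :: "'a cstar \<Rightarrow> 'a set \<Rightarrow> bool" where
  "generated_by A S \<longleftrightarrow> (\<forall>F. cstar_subalgebra F A \<longrightarrow> S \<subseteq> F \<longrightarrow> F = carrier A)"

definition star_hom :: "'a cstar \<Rightarrow> 'b cstar \<Rightarrow> ('a \<Rightarrow> 'b) \<Rightarrow> bool" where
  "star_hom A B h \<longleftrightarrow>
     h \<in> carrier A \<rightarrow> carrier B \<and>
     (\<forall>x\<in>carrier A. \<forall>y\<in>carrier A. h (x \<oplus>\<^bsub>A\<^esub> y) = h x \<oplus>\<^bsub>B\<^esub> h y) \<and>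
     (\<forall>c. \<forall>x\<in>carrier A. h (c \<odot>\<^bsub>A\<^esub> x) = c \<odot>\<^bsub>B\<^esub> h x) \<and>
     (\<forall>x\<in>carrier A. \<forall>y\<in>carrier A. h (x \<otimes>\<^bsub>A\<^esub> y) = h x \<otimes>\<^bsub>B\<^esub> h y) \<and>
     (\<forall>x\<in>carrier A. h (star A x) = star B (h x))"

definition embedding :: "'a cstar \<Rightarrow> 'b cstar \<Rightarrow> ('a \<Rightarrow> 'b) \<Rightarrow> bool" where
  "embedding A B h \<longleftrightarrow> star_hom A B h \<and> inj_on h (carrier A)"

definition unital_embedding :: "'a cstar \<Rightarrow> 'b cstar \<Rightarrow> ('a \<Rightarrow> 'b) \<Rightarrow> bool" where
  "unital_embedding A B h \<longleftrightarrow> embedding A B h \<and> h \<one>\<^bsub>A\<^esub> = \<one>\<^bsub>B\<^esub>"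

definition AF_algebra :: "'a cstar \<Rightarrow> bool" where
  "AF_algebra A \<longleftrightarrow> cstar_algebra A \<and>
     (\<exists>F :: nat \<Rightarrow> 'a set. incseq F \<and>
        (\<forall>k. cstar_subalgebra (F k) A \<and>
             vectorspace.fin_dim (class_ring :: complex ring) (A\<lparr>carrier := F k\<rparr>)) \<and>
        (\<forall>x\<in>carrier A. \<forall>e>0. \<exists>y\<in>(\<Union>k. F k). cdist A x y < e))"


section \<open>Products of matrix algebras modulo null sequences\<close>

definition vec_l2norm :: "complex vec \<Rightarrow> real" where
  "vec_l2norm v = sqrt (Re (v \<bullet>c v))"

definition mat_opnorm :: "complex mat \<Rightarrow> real" where
  "mat_opnorm M = (SUP v\<in>{v \<in> carrier_vec (dim_col M). vec_l2norm v \<le> 1}. vec_l2norm (M *\<^sub>v v))"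

definition mat_prod :: "(nat \<Rightarrow> nat) \<Rightarrow> (nat \<Rightarrow> complex mat) cstar" where
  "mat_prod n = \<lparr>
     carrier = {Y. (\<forall>k. Y k \<in> carrier_mat (n k) (n k)) \<and> bdd_above (range (\<lambda>k. mat_opnorm (Y k)))},
     monoid.mult = (\<lambda>Y Z k. Y k * Z k),
     one = (\<lambda>k. 1\<^sub>m (n k)),
     zero = (\<lambda>k. 0\<^sub>m (n k) (n k)),
     add = (\<lambda>Y Z k. Y k + Z k),
     module.smult = (\<lambda>c Y k. c \<cdot>\<^sub>m Y k),
     star = (\<lambda>Y k. mat_adjoint (Y k)),
     cnorm = (\<lambda>Y. SUP k. mat_opnorm (Y k))\<rparr>"

definition mat_sum :: "(nat \<Rightarrow> nat) \<Rightarrow> (nat \<Rightarrow> complex mat) set" where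
  "mat_sum n = {Y \<in> carrier (mat_prod n). (\<lambda>k. mat_opnorm (Y k)) \<longlonglongrightarrow> 0}"

text \<open>
  The ring structure is that of the library's quotient ring, whose elements are cosets; scalar
  multiplication and involution are defined in the same style as \<open>rcoset_mult\<close>.
\<close>

definition cstar_quotient :: "'a cstar \<Rightarrow> 'a set \<Rightarrow> 'a set cstar" where
  "cstar_quotient A I = \<lparr>
     carrier = carrier (A Quot I),
     monoid.mult = monoid.mult (A Quot I),
     one = one (A Quot I),
     zero = zero (A Quot I),
     add = add (A Quot I),
     module.smult = (\<lambda>c X. \<Union>x\<in>X. I +>\<^bsub>A\<^esub> (c \<odot>\<^bsub>A\<^esub> x)),
     star = (\<lambda>X. \<Union>x\<in>X. I +>\<^bsub>A\<^esub> star A x),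
     cnorm = (\<lambda>X. INF x\<in>X. cnorm A x)\<rparr>"

definition mat_corona :: "(nat \<Rightarrow> nat) \<Rightarrow> (nat \<Rightarrow> complex mat) set cstar" where
  "mat_corona n = cstar_quotient (mat_prod n) (mat_sum n)"

definition MF_algebra :: "'a cstar \<Rightarrow> bool" where
  "MF_algebra A \<longleftrightarrow> cstar_algebra A \<and> separable_cstar A \<and>
     (\<exists>n. (\<forall>k. n k > 0) \<and> (\<exists>h. embedding A (mat_corona n) h))"


section \<open>Full amalgamated free products\<close>

text \<open>
  The inclusions of \<open>D\<close> into \<open>A\<close> and \<open>B\<close> are given by unital embeddings \<open>iA\<close> and \<open>iB\<close>. The algebra
  \<open>C\<close> with \<open>sA\<close> and \<open>sB\<close> is a unital full free product of \<open>A\<close> and \<open>B\<close> with amalgamation over \<open>D\<close>.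

  The target \<open>E\<close> of the universal property ranges over all (not necessarily unital) C*-algebras
  whose carrier is a set of elements of the type \<open>'e\<close>, as a formula cannot quantify over types.
  For separable \<open>A\<close> and \<open>B\<close> every type \<open>'e\<close> with at least continuum many elements yields
  the full universal property: \<open>E\<close> may be replaced by its C*-subalgebra generated by the images of
  \<open>A\<close> and \<open>B\<close>, which is separable and hence has at most continuum many elements.
\<close>

definition amalgamated_free_product ::
  "'e itself \<Rightarrow> 'a cstar \<Rightarrow> 'b cstar \<Rightarrow> 'd cstar \<Rightarrow> ('d \<Rightarrow> 'a) \<Rightarrow> ('d \<Rightarrow> 'b) \<Rightarrow>
   'c cstar \<Rightarrow> ('a \<Rightarrow> 'c) \<Rightarrow> ('b \<Rightarrow> 'c) \<Rightarrow> bool" where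
  "amalgamated_free_product TYPE('e) A B D iA iB C sA sB \<longleftrightarrow>
     unital_cstar_algebra C \<and>
     unital_embedding A C sA \<and> unital_embedding B C sB \<and>
     (\<forall>d\<in>carrier D. sA (iA d) = sB (iB d)) \<and>
     generated_by C (sA ` carrier A \<union> sB ` carrier B) \<and>
     (\<forall>(E :: 'e cstar) pA pB.
        cstar_algebra E \<longrightarrow> star_hom A E pA \<longrightarrow> star_hom B E pB \<longrightarrow>
        (\<forall>d\<in>carrier D. pA (iA d) = pB (iB d)) \<longrightarrow>
        (\<exists>p. star_hom C E p \<and>
             (\<forall>a\<in>carrier A. p (sA a) = pA a) \<and> (\<forall>b\<in>carrier B. p (sB b) = pB b)))"

end

theory Submission
 imports
  Defs
  "HOL-Analysis.Abstract_Topology_2"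
  "HOL-Analysis.L2_Norm"
  "HOL-Computational_Algebra.Fundamental_Theorem_Algebra"
begin

text \<open>Since \<open>C\<close> is separable it carries a faithful state \<open>f\<close>, so it suffices to model finitely many
  vectors of its GNS space approximately. By a Hahn-Banach argument the Gram matrix of finitely many
  vectors, together with the action of finitely many elements of \<open>A\<close>, is approximated in direct sums of
  coordinate representations of \<open>\<Prod>\<^sub>k M\<^sub>n\<^sub>k\<close>, and likewise for \<open>B\<close>. If the vectors span a space invariant
  under a finite-dimensional subalgebra of \<open>D\<close>, matching almost orthonormal bases gives a contraction
  \<open>T\<close> that almost intertwines the two representations on this subalgebra. In the corona of the direct
  sums a symmetry \<open>U\<close> built from \<open>T\<close> commutes with \<open>D\<close>; conjugating the representation of \<open>A\<close> by \<open>U\<close>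
  keeps the agreement on \<open>D\<close> and makes \<open>A\<close> and \<open>B\<close> act on the same model vectors. The universal
  property then yields \<open>p\<close> on \<open>C\<close> with \<open>f (c\<^sup>*c) \<le> \<parallel>p c\<parallel>\<^sup>2 f 1\<close>, which is injective as \<open>f\<close> is faithful.
  Conversely, an embedding \<open>h\<close> of \<open>C\<close> becomes unital after cutting down by projections lifting \<open>h 1\<close>.\<close>

text \<open>The homomorphism that \<open>q1\<close> and \<open>q2\<close> induce on \<open>C\<close>
  need not be injective; the two embeddings only supply a stock of coordinate representations. The
  models obtained for \<open>A\<close> and for \<open>B\<close> come from separate convexity
  arguments and live on unrelated spaces, so both representations of the product are put on the sum
  of the two spaces, where \<open>D\<close> acts in the same way through either algebra. Every
  symmetry commuting with \<open>D\<close> may then twist \<open>A\<close>. The AF hypothesis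
  supplies one: a finite-dimensional subalgebra moves finitely many vectors inside a
  finite-dimensional space, on which it acts by matrices that both models share up to small errors.
  \<open>T\<close> is only a contraction, which is why a square root of \<open>1 - S ** S\<close>
  has to complete it to a symmetry. The representation at stage \<open>j\<close> sees only
  coordinates from \<open>j\<close> on, so null sequences go to null sequences and everything
  descends to the coronas. Positivity is defined through norms and square roots come from an
  iteration, so the spectrum of an element is never introduced; eigenvalues occur only for hermitian
  matrices, in the converse direction.\<close>

abbreviation (input) "nrm \<equiv> vec_l2norm"
abbreviation (input) "opn \<equiv> mat_opnorm"
abbreviation (input) "cvec \<equiv> carrier_vec"
abbreviation (input) "cmat \<equiv> carrier_mat"
abbreviation (input) "adj \<equiv> mat_adjoint"
abbreviation (input) "cor \<equiv> mat_corona"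
abbreviation (input) "cr \<equiv> complex_of_real"
abbreviation (input) eventually_seq (binder "EV " 10) where "eventually_seq P \<equiv> eventually P sequentially"
abbreviation (input) mult_in ("(_ *[_] _)" [70, 0, 71] 70) where "x *[R] y \<equiv> monoid.mult R x y"
abbreviation (input) add_in ("(_ +[_] _)" [65, 0, 66] 65) where "x +[R] y \<equiv> ring.add R x y"
abbreviation (input) minus_in ("(_ -[_] _)" [65, 0, 66] 65) where "x -[R] y \<equiv> a_minus R x y"
abbreviation (input) smult_in ("(_ .[_] _)" [70, 0, 71] 70) where "c .[R] x \<equiv> module.smult R c x"
abbreviation (input) zero_in ("0[_]") where "0[R] \<equiv> ring.zero R"
abbreviation (input) one_in ("1[_]") where "1[R] \<equiv> monoid.one R"
notation (input) monoid.mult (infixl "**\<index>" 70)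
notation (input) LIMSEQ ("((_)/ ----> (_))" [60, 60] 60)
notation (input) mult_mat_vec (infixl "*v" 70)
notation (input) smult_vec (infixl "*s" 70)
notation (input) smult_mat (infixl "*m" 70)
abbreviation (input) cinner (infixl "*c" 70) where "v *c w \<equiv> v \<bullet>c w"
notation (input) ring.add (infixl "+.\<index>" 65)
notation (input) module.smult (infixl "*.\<index>" 70)
notation (input) a_minus ("(_ -.\<index> _)" [65, 66] 65)
lemmas mvc = mult_mat_vec_carrier and mmc = mult_carrier_mat

section \<open>Complex vectors and the operator norm\<close>

lemma cip_sum:
 fixes v w :: "complex vec"
 assumes "w : cvec n"
 shows "v *c w = (SUM i<n. v $ i * cnj (w $ i))"
 using assms by (auto simp: scalar_prod_def atLeast0LessThan intro!: sum.cong)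

lemma cip_self:
 assumes "v : cvec n"
 shows "v *c v = cr (SUM i<n. (cmod (v $ i))\<^sup>2)"
 unfolding cip_sum[OF assms] of_real_sum by (intro sum.cong refl) (simp only: of_real_power complex_norm_square[symmetric])

lemma l2norm_sum:
 assumes "v : cvec n"
 shows "nrm v = sqrt (SUM i<n. (cmod (v $ i))\<^sup>2)"
 unfolding vec_l2norm_def cip_self[OF assms] by simp

lemma l2norm_nonneg [simp]: "0 <= nrm v"
 using l2norm_sum[of v "dim_vec v"] by (simp add: sum_nonneg)

lemma l2norm_sq:
 assumes "v : cvec n"
 shows "(nrm v)\<^sup>2 = (SUM i<n. (cmod (v $ i))\<^sup>2)"
 unfolding l2norm_sum[OF assms] by (simp add: sum_nonneg)

lemma cip_self_l2norm: "v *c v = cr ((nrm v)\<^sup>2)"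
 using cip_self[of v "dim_vec v"] l2norm_sq[of v "dim_vec v"] by simp

lemma l2norm_Re: "(nrm v)\<^sup>2 = Re (v *c v)"
 by (simp add: cip_self_l2norm)

lemma cip_add_left:
 fixes u v w :: "complex vec"
 assumes "u : cvec n" "v : cvec n" "w : cvec n"
 shows "(u + v) *c w = u *c w + v *c w"
 using assms by (simp add: add_scalar_prod_distrib[of _ n])

lemma cip_add_right:
 fixes u v w :: "complex vec"
 assumes "u : cvec n" "v : cvec n" "w : cvec n"
 shows "u *c (v + w) = u *c v + u *c w"
 using assms by (simp add: conjugate_add_vec[of _ n] scalar_prod_add_distrib[of _ n])

lemma cip_smult_left:
 fixes v w :: "complex vec"
 assumes "v : cvec n" "w : cvec n"
 shows "(c *s v) *c w = c * (v *c w)"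
 using assms by (simp add: smult_scalar_prod_distrib[of _ n])

lemma cip_smult_right:
 fixes v w :: "complex vec"
 assumes "v : cvec n" "w : cvec n"
 shows "v *c (c *s w) = cnj c * (v *c w)"
 using assms by (simp add: conjugate_smult_vec scalar_prod_smult_distrib[of _ n])

lemma cip_minus_left:
 fixes u v w :: "complex vec"
 assumes "u : cvec n" "v : cvec n" "w : cvec n"
 shows "(u - v) *c w = u *c w - v *c w"
 using assms by (simp add: minus_scalar_prod_distrib[of _ n])

lemma cip_minus_right:
 fixes u v w :: "complex vec"
 assumes "u : cvec n" "v : cvec n" "w : cvec n"
 shows "u *c (v - w) = u *c v - u *c w"
 using assms by (simp add: cip_sum[of _ n] sum_subtractf algebra_simps)

lemma cip_commute:
 fixes v w :: "complex vec"
 assumes "v : cvec n" "w : cvec n"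
 shows "w *c v = cnj (v *c w)"
 using assms by (simp add: cip_sum[of _ n] mult.commute)

lemmas cip_simps = cip_add_left cip_add_right cip_smult_left cip_smult_right cip_minus_left cip_minus_right

lemma cip_zero_left [simp]: "w : cvec n ==> 0\<^sub>v n *c (w :: complex vec) = 0"
 by simp

lemma cip_zero_right [simp]: "v : cvec n ==> (v :: complex vec) *c 0\<^sub>v n = 0"
 by simp

lemma cip_Cauchy_Schwarz:
 assumes v: "v : cvec n" and w: "w : cvec n"
 shows "cmod (v *c w) <= nrm v * nrm w"
proof -
 have "cmod (v *c w) <= (SUM i<n. cmod (v $ i) * cmod (w $ i))"
  unfolding cip_sum[OF w] by (rule order_trans[OF norm_sum]) (simp add: norm_mult)
 also have "... <= nrm v * nrm w"
  using L2_set_mult_ineq[of "%i. cmod (v $ i)" "%i. cmod (w $ i)" "{..<n}"]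
  unfolding l2norm_sum[OF v] l2norm_sum[OF w] by (simp add: L2_set_def)
 finally show ?thesis .
qed

lemma l2norm_zero [simp]: "nrm (0\<^sub>v n) = 0"
 by (simp add: l2norm_sum[of _ n])

lemma l2norm_eq_zero:
 assumes "v : cvec n" "nrm v = 0"
 shows "v = 0\<^sub>v n"
proof -
 have "(SUM i<n. (cmod (v $ i))\<^sup>2) = 0"
  using l2norm_sq[OF assms(1)] assms(2) by simp
 hence "ALL i<n. v $ i = 0"
  by (subst (asm) sum_nonneg_eq_0_iff) auto
 thus ?thesis using assms(1) by auto
qed

lemma l2norm_smult: "nrm (c *s v) = cmod c * nrm v"
proof -
 have "(nrm (c *s v))\<^sup>2 = (cmod c * nrm v)\<^sup>2"
  by (simp add: l2norm_sq[of _ "dim_vec v"] norm_mult power_mult_distrib sum_distrib_left)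
 thus ?thesis by (simp add: power2_eq_iff_nonneg)
qed

lemma l2norm_triangle:
 assumes v: "v : cvec n" and w: "w : cvec n"
 shows "nrm (v + w) <= nrm v + nrm w"
proof -
 have "(nrm (v + w))\<^sup>2 = (nrm v)\<^sup>2 + (nrm w)\<^sup>2 + 2 * Re (v *c w)"
  using v w by (simp add: l2norm_Re cip_simps[of _ n] cip_commute[OF v w])
 also have "Re (v *c w) <= nrm v * nrm w"
  using cip_Cauchy_Schwarz[OF v w] complex_Re_le_cmod order_trans by blast
 finally have "(nrm (v + w))\<^sup>2 <= (nrm v + nrm w)\<^sup>2"
  by (simp add: power2_sum)
 thus ?thesis by (rule power2_le_imp_le) simp
qed

lemma l2norm_minus_commute:
 assumes v: "v : cvec n" and w: "w : cvec n"
 shows "nrm (v - w) = nrm (w - v)"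
proof -
 have "(-1) *s (w - v) = v - w" using v w by auto
 thus ?thesis using l2norm_smult[of "-1" "w - v"] by simp
qed

lemma l2norm_triangle_minus:
 assumes v: "v : cvec n" and w: "w : cvec n"
 shows "nrm (v - w) <= nrm v + nrm w"
proof -
 have "v - w = v + (-1) *s w" using v w by auto
 thus ?thesis using l2norm_triangle[OF v, of "(-1) *s w"] w by (simp add: l2norm_smult)
qed

lemma l2norm_triangle3:
 assumes "u : cvec n" "v : cvec n" "w : cvec n"
 shows "nrm (u - w) <= nrm (u - v) + nrm (v - w)"
proof -
 have "u - w = (u - v) + (v - w)" using assms by auto
 thus ?thesis using l2norm_triangle[of "u - v" n "v - w"] assms by simp
qed

lemma l2norm_diff_le:
 assumes v: "v : cvec n" and w: "w : cvec n"
 shows "\<bar>nrm v - nrm w\<bar> <= nrm (v - w)"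
proof -
 have "v = (v - w) + w" "w = (w - v) + v" using v w by auto
 hence "nrm v <= nrm (v - w) + nrm w" "nrm w <= nrm (w - v) + nrm v"
  using l2norm_triangle[of "v - w" n w] l2norm_triangle[of "w - v" n v] v w by auto
 thus ?thesis using l2norm_minus_commute[OF v w] by linarith
qed

lemma mult_mat_vec_smult:
 fixes A :: "complex mat"
 assumes "A : cmat m n" "v : cvec n"
 shows "A *v (c *s v) = c *s (A *v v)"
 using assms by (intro eq_vecI) (auto simp: scalar_prod_smult_distrib[of _ n])

lemma mult_mat_vec_minus:
 fixes A :: "complex mat"
 assumes "A : cmat m n" "v : cvec n" "w : cvec n"
 shows "A *v (v - w) = A *v v - A *v w"
 using assms by (intro eq_vecI) (auto simp: scalar_prod_minus_distrib[of _ n])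

lemma smult_mat_mult_vec:
 fixes A :: "complex mat"
 assumes "A : cmat m n" "v : cvec n"
 shows "(c *m A) *v v = c *s (A *v v)"
 using assms by (intro eq_vecI) (auto simp: smult_scalar_prod_distrib[of _ n])

lemma mult_mat_vec_dim_row [simp]: "A *v v : cvec (dim_row A)"
 by (rule carrier_vecI) simp

text \<open>By Cauchy-Schwarz each entry of \<open>M *v v\<close> is bounded by the norm of a row,
  so the images of the unit ball are bounded by the Hilbert-Schmidt norm. Without such a bound the
  real supremum in \<open>mat_opnorm\<close> would carry no information.\<close>

lemma opnorm_bdd:
 "bdd_above (nrm ` (%v. M *v v) ` {v : cvec (dim_col M). nrm v <= 1})"
proof -
 have bd: "nrm (M *v v) <= sqrt (SUM i<dim_row M. (nrm (conjugate (row M i)))\<^sup>2)"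
  if v: "v : cvec (dim_col M)" "nrm v <= 1" for v
 proof -
  let ?w = "M *v v"
  have row: "cmod (?w $ i) <= nrm (conjugate (row M i))" if "i < dim_row M" for i
  proof -
   have "?w $ i = v *c conjugate (row M i)"
    using that v by (simp add: comm_scalar_prod[of _ "dim_col M"])
   also have "cmod ... <= nrm v * nrm (conjugate (row M i))"
    by (rule cip_Cauchy_Schwarz[of _ "dim_col M"]) (use v in auto)
   also have "... <= 1 * nrm (conjugate (row M i))"
    using v by (intro mult_right_mono) auto
   finally show ?thesis by simp
  qed
  have "?w : cvec (dim_row M)" by (rule mvc[OF _ v(1)]) simp
  thus ?thesis unfolding l2norm_sum[OF `?w : _`]
   by (intro real_sqrt_le_mono sum_mono power_mono row) auto
 qed
 show ?thesis by (rule bdd_aboveI) (use bd in blast)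
qed

lemma opnorm_le:
 assumes "0 <= r" and "!!v. v : cvec (dim_col M) ==> nrm (M *v v) <= r * nrm v"
 shows "opn M <= r"
 unfolding mat_opnorm_def
proof (rule cSUP_least)
 have "0\<^sub>v (dim_col M) : {v : cvec (dim_col M). nrm v <= 1}" by simp
 thus "{v : cvec (dim_col M). nrm v <= 1} ~= {}" by blast
 fix v :: "complex vec" assume "v : {v : cvec (dim_col M). nrm v <= 1}"
 thus "nrm (M *v v) <= r"
  using assms(2)[of v] mult_left_mono[of "nrm v" 1 r] assms(1) by auto
qed

lemma opnorm_nonneg [simp]: "0 <= opn M"
proof -
 have "nrm (M *v 0\<^sub>v (dim_col M)) <= opn M"
  unfolding mat_opnorm_def
  by (rule cSUP_upper) (use opnorm_bdd[of M] in \<open>auto simp: image_image\<close>)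
 thus ?thesis using l2norm_nonneg order_trans by blast
qed

lemma opnorm_vec:
 assumes "M : cmat m n" "v : cvec n"
 shows "nrm (M *v v) <= opn M * nrm v"
proof (cases "nrm v = 0")
 case True
 then have "v = 0\<^sub>v n" using l2norm_eq_zero assms by blast
 then have "M *v v = 0\<^sub>v m" using assms by auto
 then show ?thesis using True by simp
next
 case False
 define c where "c = cr (1 / nrm v)"
 have pos: "nrm v > 0" using False l2norm_nonneg[of v] by linarith
 have c: "cmod c = 1 / nrm v" using pos by (simp add: c_def norm_divide)
 have "nrm (M *v (c *s v)) <= opn M"
  unfolding mat_opnorm_def
  by (rule cSUP_upper) (use opnorm_bdd[of M] assms c pos in \<open>auto simp: image_image l2norm_smult\<close>)
 also have "M *v (c *s v) = c *s (M *v v)" by (rule mult_mat_vec_smult[OF assms])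
 finally show ?thesis using pos by (simp add: l2norm_smult c field_simps)
qed

lemma opnorm_sesq:
 assumes "M : cmat m n" "v : cvec n" "w : cvec m"
 shows "cmod ((M *v v) *c w) <= opn M * nrm v * nrm w"
proof -
 have "cmod ((M *v v) *c w) <= nrm (M *v v) * nrm w"
  by (rule cip_Cauchy_Schwarz[of _ m]) (use assms in auto)
 also have "... <= (opn M * nrm v) * nrm w"
  by (intro mult_right_mono opnorm_vec[OF assms(1,2)]) simp
 finally show ?thesis .
qed

lemma opnorm_zero [simp]: "opn (0\<^sub>m m n) = 0"
proof -
 have "0\<^sub>m m n *v v = 0\<^sub>v m" if "v : cvec n" for v :: "complex vec"
  using that by (intro eq_vecI) auto
 hence "opn (0\<^sub>m m n) <= 0" by (intro opnorm_le) auto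
 thus ?thesis using opnorm_nonneg[of "0\<^sub>m m n"] by linarith
qed

lemma opnorm_add:
 assumes "M : cmat m n" "N : cmat m n"
 shows "opn (M + N) <= opn M + opn N"
proof (rule opnorm_le)
 fix v :: "complex vec" assume "v : cvec (dim_col (M + N))"
 hence v: "v : cvec n" using assms by auto
 have "nrm ((M + N) *v v) <= nrm (M *v v) + nrm (N *v v)"
  using assms v by (simp add: add_mult_distrib_mat_vec[of _ m n] l2norm_triangle[of _ m])
 also have "... <= opn M * nrm v + opn N * nrm v"
  using opnorm_vec[OF assms(1) v] opnorm_vec[OF assms(2) v] by simp
 finally show "nrm ((M + N) *v v) <= (opn M + opn N) * nrm v"
  by (simp add: algebra_simps)
qed simp

lemma opnorm_smult_le: "opn (c *m M) <= cmod c * opn M"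
proof (rule opnorm_le)
 fix v :: "complex vec" assume "v : cvec (dim_col (c *m M))"
 hence v: "v : cvec (dim_col M)" by simp
 show "nrm ((c *m M) *v v) <= cmod c * opn M * nrm v"
  using smult_mat_mult_vec[of M "dim_row M" "dim_col M" v c] v opnorm_vec[of M "dim_row M" "dim_col M" v]
  by (auto simp: l2norm_smult mult.assoc intro!: mult_left_mono)
qed simp

lemma opnorm_smult: "opn (c *m M) = cmod c * opn M"
proof (cases "c = 0")
 case True
 have "0 *m M = 0\<^sub>m (dim_row M) (dim_col M)" by auto
 then show ?thesis using True by simp
next
 case False
 have "opn M = opn (inverse c *m (c *m M))"
  using False by (auto intro!: arg_cong[of _ _ opn])
 also have "... <= cmod (inverse c) * opn (c *m M)" by (rule opnorm_smult_le)
 finally have "cmod c * opn M <= opn (c *m M)"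
  using mult_left_mono[of "opn M" "cmod (inverse c) * opn (c *m M)" "cmod c"] False
  by (simp add: norm_inverse mult.assoc[symmetric])
 then show ?thesis using opnorm_smult_le[of c M] by linarith
qed

lemma opnorm_uminus: "opn (- M) = opn M"
proof -
 have "- M = (-1) *m M" by auto
 thus ?thesis using opnorm_smult[of "-1" M] by simp
qed

lemma opnorm_minus:
 assumes "M : cmat m n" "N : cmat m n"
 shows "opn (M - N) <= opn M + opn N"
proof -
 have "M - N = M + (- N)" using assms by auto
 thus ?thesis using opnorm_add[of M m n "- N"] assms by (simp add: opnorm_uminus)
qed

lemma opnorm_mult:
 assumes "M : cmat l m" "N : cmat m n"
 shows "opn (M * N) <= opn M * opn N"
proof (rule opnorm_le)
 fix v :: "complex vec" assume "v : cvec (dim_col (M * N))"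
 hence v: "v : cvec n" using assms by auto
 have "nrm ((M * N) *v v) = nrm (M *v (N *v v))"
  using assms v by (simp add: assoc_mult_mat_vec)
 also have "... <= opn M * nrm (N *v v)"
  by (rule opnorm_vec[OF assms(1)]) (use assms v in auto)
 also have "... <= opn M * (opn N * nrm v)"
  by (intro mult_left_mono opnorm_vec[OF assms(2) v]) simp
 finally show "nrm ((M * N) *v v) <= opn M * opn N * nrm v"
  by (simp add: mult.assoc)
qed simp

lemma opnorm_one_le: "opn (1\<^sub>m n) <= 1"
 by (rule opnorm_le) auto

lemma l2norm_unit_vec [simp]: "i < n ==> nrm (unit_vec n i) = 1"
proof -
 assume i: "i < n"
 have "(SUM k<n. (cmod (unit_vec n i $ k))\<^sup>2) = (SUM k<n. if k = i then 1 else 0)"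
  using i by (intro sum.cong) auto
 thus ?thesis using i by (simp add: l2norm_sum[of _ n])
qed

lemma opnorm_one [simp]: "n > 0 ==> opn (1\<^sub>m n) = 1"
 using opnorm_one_le[of n] opnorm_vec[of "1\<^sub>m n" n n "unit_vec n 0"] by simp

section \<open>Adjoints\<close>

lemma adj_carrier [simp]: "A : cmat m n ==> adj A : cmat n m"
 by (auto simp: mat_adjoint_def)

lemma adj_dim [simp]: "dim_row (adj A) = dim_col A" "dim_col (adj A) = dim_row A"
 by (auto simp: mat_adjoint_def)

lemma adj_index:
 fixes A :: "complex mat"
 shows "i < dim_col A ==> j < dim_row A ==> adj A $$ (i,j) = cnj (A $$ (j,i))"
 by (simp add: mat_adjoint_def mat_of_rows_def)

lemma adj_adj [simp]: "adj (adj (A :: complex mat)) = A"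
 by (rule eq_matI) (auto simp: adj_index)

lemma adj_add:
 fixes A B :: "complex mat"
 assumes "A : cmat m n" "B : cmat m n"
 shows "adj (A + B) = adj A + adj B"
 by (rule eq_matI) (use assms in \<open>simp_all add: adj_index\<close>)

lemma adj_minus:
 fixes A B :: "complex mat"
 assumes "A : cmat m n" "B : cmat m n"
 shows "adj (A - B) = adj A - adj B"
 by (rule eq_matI) (use assms in \<open>simp_all add: adj_index\<close>)

lemma adj_smult: "adj (c *m A) = cnj c *m adj A"
 by (rule eq_matI) (simp_all add: adj_index)

lemma adj_mult:
 fixes A B :: "complex mat"
 assumes "A : cmat l m" "B : cmat m n"
 shows "adj (A * B) = adj B * adj A"
 by (rule eq_matI) (use assms in \<open>auto simp: adj_index scalar_prod_def mult.commute intro!: sum.cong\<close>)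

lemma adj_one [simp]: "adj (1\<^sub>m n :: complex mat) = 1\<^sub>m n"
 by (rule eq_matI) (simp_all add: adj_index)

lemma adj_zero [simp]: "adj (0\<^sub>m m n :: complex mat) = 0\<^sub>m n m"
 by (rule eq_matI) (simp_all add: adj_index)

lemma cip_adj:
 fixes A :: "complex mat"
 assumes A: "A : cmat m n" and v: "v : cvec n" and w: "w : cvec m"
 shows "(A *v v) *c w = v *c (adj A *v w)"
proof -
 have l: "(A *v v) $ i = (SUM j<n. A $$ (i,j) * v $ j)" if "i < m" for i
  using assms that by (auto simp: scalar_prod_def atLeast0LessThan)
 have r: "(adj A *v w) $ j = (SUM i<m. cnj (A $$ (i,j)) * w $ i)" if "j < n" for j
  using assms that by (auto simp: scalar_prod_def atLeast0LessThan adj_index intro!: sum.cong)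
 have "(A *v v) *c w = (SUM i<m. SUM j<n. A $$ (i,j) * v $ j * cnj (w $ i))"
  using w l by (simp add: cip_sum[of _ m] sum_distrib_right)
 also have "... = (SUM j<n. SUM i<m. A $$ (i,j) * v $ j * cnj (w $ i))"
  using sum.swap .
 also have "... = (SUM j<n. v $ j * cnj (SUM i<m. cnj (A $$ (i,j)) * w $ i))"
  by (simp add: sum_distrib_left mult.assoc mult.left_commute)
 also have "... = (SUM j<n. v $ j * cnj ((adj A *v w) $ j))"
  by (intro sum.cong refl) (simp only: r lessThan_iff)
 also have "... = v *c (adj A *v w)"
  by (rule cip_sum[symmetric]) (rule mvc[OF adj_carrier[OF A] w])
 finally show ?thesis .
qed

lemma cip_adj':
 fixes A :: "complex mat"
 assumes "A : cmat m n" "v : cvec m" "w : cvec n"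
 shows "(adj A *v v) *c w = v *c (A *v w)"
 using cip_adj[of "adj A" n m v w] assms by simp

text \<open>For the image \<open>w\<close> of \<open>v\<close> under the adjoint, the square of
  \<open>nrm w\<close> is at most \<open>opn A * nrm w * nrm v\<close>, and one factor
  \<open>nrm w\<close> cancels.\<close>

lemma opnorm_adj_le: "opn (adj A) <= opn A"
proof (rule opnorm_le)
 fix v :: "complex vec" assume "v : cvec (dim_col (adj A))"
 hence v: "v : cvec (dim_row A)" by simp
 have A: "A : cmat (dim_row A) (dim_col A)" by simp
 define w where "w = adj A *v v"
 have w: "w : cvec (dim_col A)" unfolding w_def by (rule mvc[OF _ v]) simp
 have "(nrm w)\<^sup>2 = cmod (w *c w)"
  by (simp add: cip_self_l2norm norm_power)
 also have "w *c w = v *c (A *v w)"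
  using cip_adj'[OF A v w] unfolding w_def .
 also have "... = cnj ((A *v w) *c v)"
  by (rule cip_commute[of _ "dim_row A"]) (use A v w in auto)
 also have "cmod ... <= opn A * nrm w * nrm v"
  unfolding complex_mod_cnj by (rule opnorm_sesq[OF A w v])
 finally have *: "nrm w * nrm w <= nrm w * (opn A * nrm v)"
  by (simp add: power2_eq_square algebra_simps)
 have "nrm w <= opn A * nrm v"
 proof (cases "nrm w = 0")
  case False
  hence "nrm w > 0" using l2norm_nonneg[of w] by linarith
  with * show ?thesis by (simp only: mult_le_cancel_left_pos)
 qed simp
 thus "nrm (adj A *v v) <= opn A * nrm v" unfolding w_def .
qed simp

lemma opnorm_adj [simp]: "opn (adj A) = opn A"
 using opnorm_adj_le[of A] opnorm_adj_le[of "adj A"] by simp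

text \<open>The lower bound uses that the squared norm of \<open>A *v v\<close> is the inner product
  with \<open>v\<close> of the image of \<open>v\<close> under \<open>adj A * A\<close>.\<close>

lemma opnorm_cstar: "opn (adj A * A) = (opn A)\<^sup>2"
proof (rule antisym)
 have A: "A : cmat (dim_row A) (dim_col A)" by simp
 have AA: "adj A * A : cmat (dim_col A) (dim_col A)"
  by (rule mmc[OF adj_carrier[OF A] A])
 show "opn (adj A * A) <= (opn A)\<^sup>2"
  using opnorm_mult[OF adj_carrier[OF A] A] by (simp add: power2_eq_square)
 define r where "r = opn (adj A * A)"
 have r: "0 <= r" by (simp add: r_def)
 have "opn A <= sqrt r"
 proof (rule opnorm_le)
  fix v :: "complex vec" assume v: "v : cvec (dim_col A)"
  have "(nrm (A *v v))\<^sup>2 = cmod ((A *v v) *c (A *v v))"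
   by (simp add: cip_self_l2norm norm_power)
  also have "(A *v v) *c (A *v v) = (adj A *v (A *v v)) *c v"
   by (rule cip_adj'[OF A _ v, symmetric]) simp
  also have "adj A *v (A *v v) = (adj A * A) *v v"
   by (rule assoc_mult_mat_vec[OF adj_carrier[OF A] A v, symmetric])
  also have "cmod (((adj A * A) *v v) *c v) <= r * nrm v * nrm v"
   unfolding r_def by (rule opnorm_sesq[OF AA v v])
  also have "... = (sqrt r * nrm v)\<^sup>2"
   using r by (simp only: power_mult_distrib real_sqrt_pow2) (simp add: power2_eq_square)
  finally show "nrm (A *v v) <= sqrt r * nrm v"
   by (rule power2_le_imp_le) (use r in simp)
 qed (use r in simp)
 hence "(opn A)\<^sup>2 <= (sqrt r)\<^sup>2" by (rule power_mono) simp
 thus "(opn A)\<^sup>2 <= opn (adj A * A)" using r by (simp add: r_def)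
qed

section \<open>Elementary theory of C*-algebras\<close>

context cstar_algebra
begin

lemma sm_closed [simp]: "x : carrier A ==> c *. x : carrier A"
 by (rule smult_closed) simp_all

lemma sm_add_left: "x : carrier A ==> (a + b) *. x = a *. x +. b *. x"
 using smult_l_distr[of a b x] by simp

lemma sm_add_right: "x : carrier A ==> y : carrier A ==> a *. (x +. y) = a *. x +. a *. y"
 using smult_r_distr[of a x y] by simp

lemma sm_assoc: "x : carrier A ==> a *. (b *. x) = (a * b) *. x"
 using smult_assoc1[of a b x] by simp

lemma sm_one [simp]: "x : carrier A ==> (1::complex) *. x = x"
 using smult_one[of x] by simp

lemma sm_zero_left [simp]: "x : carrier A ==> (0::complex) *. x = \<zero>"
 using smult_l_null[of x] by simp

lemma sm_zero_right [simp]: "(c::complex) *. \<zero> = \<zero>"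
 using smult_r_null[of c] by simp

lemma sm_minus_one: "x : carrier A ==> (-1::complex) *. x = \<ominus> x"
proof -
 assume x: "x : carrier A"
 have "(-1::complex) *. x +. x = ((-1) + 1) *. x"
  using x sm_add_left[of x "-1" 1] by simp
 hence "(-1::complex) *. x +. x = \<zero>" using x by simp
 thus ?thesis using x by (simp add: M.minus_equality)
qed

lemma sm_minus_right: "x : carrier A ==> c *. (\<ominus> x) = \<ominus> (c *. x)"
 using sm_assoc[of x c "-1"] sm_assoc[of x "-1" c] by (simp add: sm_minus_one[symmetric])

lemma sm_uminus_left: "x : carrier A ==> (- c) *. x = \<ominus> (c *. x)"
 using sm_assoc[of x "-1" c] by (simp add: sm_minus_one[symmetric])

lemma sm_diff_right: "x : carrier A ==> y : carrier A ==> c *. (x -. y) = c *. x -. c *. y"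
 by (simp add: a_minus_def sm_add_right sm_minus_right)

lemma half_double [simp]: "x : carrier A ==> (1/2 :: complex) *. x +. (1/2 :: complex) *. x = x"
 by (simp add: sm_add_left[symmetric])

declare mult_closed [simp] star_closed [simp] star_star [simp]

lemma mult_zero_right [simp]: "x : carrier A ==> x ** \<zero> = \<zero>"
 using smult_mult_right[of x \<zero> 0] by simp

lemma mult_zero_left [simp]: "x : carrier A ==> \<zero> ** x = \<zero>"
 using smult_mult_left[of \<zero> x 0] by simp

lemma mult_minus_right: "x : carrier A ==> y : carrier A ==> x ** (\<ominus> y) = \<ominus> (x ** y)"
 using smult_mult_right[of x y "-1"] by (simp add: sm_minus_one)

lemma mult_minus_left: "x : carrier A ==> y : carrier A ==> (\<ominus> x) ** y = \<ominus> (x ** y)"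
 using smult_mult_left[of x y "-1"] by (simp add: sm_minus_one)

lemma mult_diff_right: "x : carrier A ==> y : carrier A ==> z : carrier A ==> x ** (y -. z) = x ** y -. x ** z"
 by (simp add: a_minus_def mult_add_right mult_minus_right)

lemma mult_diff_left: "x : carrier A ==> y : carrier A ==> z : carrier A ==> (y -. z) ** x = y ** x -. z ** x"
 by (simp add: a_minus_def mult_add_left mult_minus_left)

lemma star_zero [simp]: "star A \<zero> = \<zero>"
 using star_smult[of \<zero> 0] by simp

lemma star_minus: "x : carrier A ==> star A (\<ominus> x) = \<ominus> (star A x)"
 using star_smult[of x "-1"] by (simp add: sm_minus_one)

lemma star_diff: "x : carrier A ==> y : carrier A ==> star A (x -. y) = star A x -. star A y"
 by (simp add: a_minus_def star_add star_minus)

lemma diff_self [simp]: "x : carrier A ==> x -. x = \<zero>"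
 by (simp add: a_minus_def M.r_neg)

lemma diff_eq_zero: "x : carrier A ==> y : carrier A ==> x -. y = \<zero> ==> x = y"
 by (metis M.a_inv_closed M.minus_equality M.minus_minus a_minus_def)

lemma diff_add_cancel: "x : carrier A ==> y : carrier A ==> (x -. y) +. y = x"
 by (simp add: a_minus_def M.a_assoc M.l_neg)

lemma add_diff_cancel: "x : carrier A ==> y : carrier A ==> (x +. y) -. y = x"
 by (simp add: a_minus_def M.a_assoc M.r_neg)

lemma diff_diff_add: "x : carrier A ==> y : carrier A ==> z : carrier A ==> (x -. y) +. (y -. z) = x -. z"
proof -
 assume "x : carrier A" "y : carrier A" "z : carrier A"
 moreover from this have "\<ominus> y +. (y +. \<ominus> z) = \<ominus> z"
  by (metis M.a_assoc M.a_inv_closed M.l_neg M.l_zero)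
 ultimately show ?thesis by (simp add: a_minus_def M.a_assoc)
qed

lemma uminus_diff: "x : carrier A ==> y : carrier A ==> \<ominus> (x -. y) = y -. x"
 by (simp add: a_minus_def M.minus_add M.a_comm)

lemma add_diff_add: "x : carrier A ==> y : carrier A ==> u : carrier A ==> v : carrier A ==>
 (x +. y) -. (u +. v) = (x -. u) +. (y -. v)"
 by (simp add: a_minus_def M.minus_add M.a_ac)

lemma nm_zero [simp]: "cnorm A \<zero> = 0"
 using cnorm_smult[of \<zero> 0] by simp

lemma nm_minus [simp]: "x : carrier A ==> cnorm A (\<ominus> x) = cnorm A x"
 using cnorm_smult[of x "-1"] by (simp add: sm_minus_one)

lemma nm_nonneg [simp]: "x : carrier A ==> 0 <= cnorm A x"
 using cnorm_triangle[of x "\<ominus> x"] by (simp add: M.r_neg)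

lemma nm_diff_commute: "x : carrier A ==> y : carrier A ==> cnorm A (x -. y) = cnorm A (y -. x)"
 using nm_minus[of "x -. y"] by (simp add: uminus_diff)

lemma nm_diff: "x : carrier A ==> y : carrier A ==> cnorm A (x -. y) <= cnorm A x + cnorm A y"
 using cnorm_triangle[of x "\<ominus> y"] by (simp add: a_minus_def)

lemma nm_triangle3: "x : carrier A ==> y : carrier A ==> z : carrier A ==>
 cnorm A (x -. z) <= cnorm A (x -. y) + cnorm A (y -. z)"
 using cnorm_triangle[of "x -. y" "y -. z"] by (simp add: diff_diff_add)

lemma nm_le_diff: "x : carrier A ==> y : carrier A ==> cnorm A x <= cnorm A (x -. y) + cnorm A y"
 using cnorm_triangle[of "x -. y" y] by (simp add: diff_add_cancel)

lemma nm_star [simp]: "x : carrier A ==> cnorm A (star A x) = cnorm A x"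
proof -
 have *: "cnorm A x <= cnorm A (star A x)" if x: "x : carrier A" for x
 proof (cases "cnorm A x = 0")
  case False
  hence pos: "cnorm A x > 0" using nm_nonneg[OF x] by linarith
  have "cnorm A x * cnorm A x <= cnorm A (star A x) * cnorm A x"
   using cnorm_mult[of "star A x" x] cnorm_cstar[of x] x by (simp add: power2_eq_square)
  thus ?thesis using pos by simp
 qed (use x in simp)
 assume "x : carrier A"
 thus ?thesis using *[of x] *[of "star A x"] by simp
qed

lemma nm_herm_sq: "x : carrier A ==> star A x = x ==> cnorm A (x ** x) = (cnorm A x)\<^sup>2"
 using cnorm_cstar[of x] by simp

lemma ctendsto_iff: "ctendsto A X x \<longleftrightarrow> (%m. cnorm A (X m -. x)) ----> 0"
 by (simp add: ctendsto_def cdist_def)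

lemma ctendsto_const: "x : carrier A ==> ctendsto A (%_. x) x"
 by (simp add: ctendsto_iff)

lemma ctendsto_sandwich:
 assumes "!!m. X m : carrier A" "x : carrier A" "!!m. cnorm A (X m -. x) <= g m" "g ----> 0"
 shows "ctendsto A X x"
 unfolding ctendsto_iff
 by (rule tendsto_sandwich[OF _ _ tendsto_const assms(4)]) (use assms in auto)

lemma ctendsto_unique:
 assumes "!!m. X m : carrier A" "x : carrier A" "y : carrier A" "ctendsto A X x" "ctendsto A X y"
 shows "x = y"
proof -
 have "(%m. cnorm A (X m -. x) + cnorm A (X m -. y)) ----> 0 + 0"
  using assms(4,5) unfolding ctendsto_iff by (rule tendsto_add)
 moreover have "EX N. ALL m>=N. cnorm A (x -. y) <= cnorm A (X m -. x) + cnorm A (X m -. y)"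
  using nm_triangle3[OF assms(2) assms(1) assms(3)] nm_diff_commute[OF assms(2) assms(1)] by metis
 ultimately have le: "cnorm A (x -. y) <= 0 + 0" by (rule LIMSEQ_le_const)
 have c: "x -. y : carrier A" by (rule M.minus_closed[OF assms(2,3)])
 have "cnorm A (x -. y) = 0" using le nm_nonneg[OF c] by linarith
 thus ?thesis by (intro diff_eq_zero[OF assms(2,3)] cnorm_eq_zero[OF c])
qed

lemma ctendsto_add:
 assumes "!!m. X m : carrier A" "!!m. Y m : carrier A" "x : carrier A" "y : carrier A"
  and "ctendsto A X x" "ctendsto A Y y"
 shows "ctendsto A (%m. X m +. Y m) (x +. y)"
proof (rule ctendsto_sandwich)
 show "(%m. cnorm A (X m -. x) + cnorm A (Y m -. y)) ----> 0"
  using tendsto_add[OF assms(5,6)[unfolded ctendsto_iff]] by simp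
 show "cnorm A ((X m +. Y m) -. (x +. y)) <= cnorm A (X m -. x) + cnorm A (Y m -. y)" for m
  using assms cnorm_triangle[of "X m -. x" "Y m -. y"] by (simp add: add_diff_add)
qed (use assms in auto)

lemma ctendsto_star:
 assumes "!!m. X m : carrier A" "x : carrier A" "ctendsto A X x"
 shows "ctendsto A (%m. star A (X m)) (star A x)"
 using assms nm_star[of "X _ -. x"] unfolding ctendsto_iff by (simp add: star_diff[symmetric])

lemma ctendsto_mult:
 assumes X: "!!m. X m : carrier A" and Y: "!!m. Y m : carrier A" and x: "x : carrier A" and y: "y : carrier A"
  and lim: "ctendsto A X x" "ctendsto A Y y"
 shows "ctendsto A (%m. X m ** Y m) (x ** y)"
proof (rule ctendsto_sandwich)
 note l = lim[unfolded ctendsto_iff]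
 let ?g = "%m. (cnorm A (X m -. x) + cnorm A x) * cnorm A (Y m -. y) + cnorm A (X m -. x) * cnorm A y"
 have "?g ----> (0 + cnorm A x) * 0 + 0 * cnorm A y"
  by (intro tendsto_intros l)
 thus "?g ----> 0" by simp
 fix m
 have "X m ** Y m -. x ** y = X m ** (Y m -. y) +. (X m -. x) ** y"
  using X Y x y by (simp add: mult_diff_right mult_diff_left diff_diff_add)
 also have "cnorm A ... <= cnorm A (X m) * cnorm A (Y m -. y) + cnorm A (X m -. x) * cnorm A y"
  using X Y x y cnorm_triangle[of "X m ** (Y m -. y)" "(X m -. x) ** y"]
   cnorm_mult[of "X m" "Y m -. y"] cnorm_mult[of "X m -. x" y] by simp
 also have "... <= ?g m"
  using X Y x y nm_le_diff[of "X m" x] by (intro add_mono mult_right_mono) auto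
 finally show "cnorm A (X m ** Y m -. x ** y) <= ?g m" .
qed (use X Y x y in auto)

lemma ctendsto_norm:
 assumes "!!m. X m : carrier A" "x : carrier A" "ctendsto A X x"
 shows "(%m. cnorm A (X m)) ----> cnorm A x"
proof -
 have b: "\<bar>cnorm A (X m) - cnorm A x\<bar> <= cnorm A (X m -. x)" for m
  using nm_le_diff[OF assms(1,2), of m] nm_le_diff[OF assms(2,1), of m] nm_diff_commute[OF assms(1,2), of m]
  by linarith
 have "(%m. \<bar>cnorm A (X m) - cnorm A x\<bar>) ----> 0"
 proof (rule tendsto_sandwich[OF _ _ tendsto_const assms(3)[unfolded ctendsto_iff]])
  show "EV m. 0 <= \<bar>cnorm A (X m) - cnorm A x\<bar>" by simp
  show "EV m. \<bar>cnorm A (X m) - cnorm A x\<bar> <= cnorm A (X m -. x)"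
   by (rule always_eventually) (rule allI, rule b)
 qed
 hence "(%m. cnorm A (X m) - cnorm A x) ----> 0" by (rule tendsto_rabs_zero_cancel)
 thus ?thesis by (rule LIM_zero_cancel)
qed

end

context unital_cstar_algebra
begin

declare one_closed [simp] one_mult [simp] mult_one [simp]

lemma ring_A: "ring A"
proof -
 have "monoid A" by unfold_locales (auto simp: mult_assoc)
 thus ?thesis
  by (intro ring.intro ring_axioms.intro) (auto simp: M.abelian_group_axioms mult_add_left mult_add_right)
qed

end

sublocale unital_cstar_algebra \<subseteq> U: ring A
 by (rule ring_A)

context unital_cstar_algebra
begin

text \<open>Real constants inside the algebra. The inequality \<open>a <= t\<close> for a hermitian
  \<open>a\<close> is expressed below as \<open>pos (rs t -. a)\<close>.\<close>

definition rs :: "real => 'a" where "rs t = cr t *. \<one>"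

lemma rs_closed [simp]: "rs t : carrier A"
 by (simp add: rs_def)

lemma star_one [simp]: "star A \<one> = \<one>"
 using star_mult[of "star A \<one>" \<one>] by simp

lemma nm_one [simp]: "cnorm A \<one> = 1"
proof -
 have "cnorm A \<one> ~= 0" using cnorm_eq_zero[of \<one>] one_neq_zero by auto
 thus ?thesis using cnorm_cstar[of \<one>] by (simp add: power2_eq_square)
qed

lemma star_rs [simp]: "star A (rs t) = rs t"
 by (simp add: rs_def star_smult)

lemma rs_one [simp]: "rs 1 = \<one>" and rs_zero [simp]: "rs 0 = \<zero>"
 by (simp_all add: rs_def)

lemma rs_add: "rs (s + t) = rs s +. rs t"
 by (simp add: rs_def sm_add_left)

lemma rs_minus: "rs (- t) = \<ominus> (rs t)"
 by (simp add: rs_def sm_uminus_left)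

lemma rs_mult: "x : carrier A ==> rs t ** x = cr t *. x"
 by (simp add: rs_def smult_mult_left)

lemma mult_rs: "x : carrier A ==> x ** rs t = cr t *. x"
 by (simp add: rs_def smult_mult_right)

lemma rs_commute: "x : carrier A ==> x ** rs t = rs t ** x"
 by (simp add: rs_mult mult_rs)

lemma sm_rs: "cr s *. rs t = rs (s * t)"
 by (simp add: rs_def sm_assoc)

lemma rs_rs: "rs s ** rs t = rs (s * t)"
 by (simp add: rs_mult sm_rs)

lemma nm_rs [simp]: "cnorm A (rs t) = \<bar>t\<bar>"
 by (simp add: rs_def cnorm_smult)

section \<open>Square roots by a majorised iteration\<close>

primrec sqrt_seq :: "'a => nat => 'a" where
 "sqrt_seq a 0 = \<zero>"
| "sqrt_seq a (Suc n) = rs (1/2) ** (a +. sqrt_seq a n ** sqrt_seq a n)"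

end

text \<open>The recursion of \<open>sqrt_seq\<close> for the number \<open>a = 1\<close>. It
  majorises the norms and the increments of \<open>sqrt_seq\<close>, so a bounded increasing real
  sequence provides the Cauchy property even when \<open>a\<close> has norm 1, where no contraction
  constant below 1 is available.\<close>

primrec sqrt_bound :: "nat => real" where
 "sqrt_bound 0 = 0"
| "sqrt_bound (Suc n) = (1 + (sqrt_bound n)\<^sup>2) / 2"

lemma sqrt_bound_01: "0 <= sqrt_bound n & sqrt_bound n <= 1"
proof (induction n)
 case (Suc n)
 hence "(sqrt_bound n)\<^sup>2 <= 1\<^sup>2" by (intro power_mono) auto
 thus ?case by simp
qed simp

lemma sqrt_bound_incseq: "incseq sqrt_bound"
proof (rule incseq_SucI)
 fix n
 have "0 <= (1 - sqrt_bound n)\<^sup>2" by simp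
 thus "sqrt_bound n <= sqrt_bound (Suc n)" by (simp add: power2_eq_square algebra_simps)
qed

lemma sqrt_bound_Cauchy: "Cauchy sqrt_bound"
 by (rule convergent_Cauchy, rule Bseq_monoseq_convergent, rule BseqI'[of _ 1])
  (use sqrt_bound_01 sqrt_bound_incseq in \<open>auto simp: monoseq_def incseq_def\<close>)

context unital_cstar_algebra
begin

lemma sqrt_seq_closed [simp]: "a : carrier A ==> sqrt_seq a n : carrier A"
 by (induction n) auto

lemma sqrt_seq_herm: "a : carrier A ==> star A a = a ==> star A (sqrt_seq a n) = sqrt_seq a n"
 by (induction n) (simp_all add: star_mult star_add rs_commute)

lemma sqrt_seq_commute:
 assumes "a : carrier A" "z : carrier A" "z ** a = a ** z"
 shows "z ** sqrt_seq a n = sqrt_seq a n ** z"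
proof (induction n)
 case (Suc n)
 let ?y = "sqrt_seq a n"
 have y: "?y : carrier A" using assms by simp
 have "z ** (?y ** ?y) = (?y ** ?y) ** z"
  using assms y Suc by (metis mult_assoc)
 hence zw: "z ** (a +. ?y ** ?y) = (a +. ?y ** ?y) ** z"
  using assms y by (simp only: mult_add_right mult_add_left mult_closed)
 have w: "a +. ?y ** ?y : carrier A" using assms y by simp
 have "z ** (rs (1/2) ** (a +. ?y ** ?y)) = (z ** rs (1/2)) ** (a +. ?y ** ?y)"
  using assms(2) w by (simp only: mult_assoc rs_closed)
 also have "... = rs (1/2) ** (z ** (a +. ?y ** ?y))"
  using assms(2) w by (simp only: rs_commute mult_assoc rs_closed)
 also have "... = (rs (1/2) ** (a +. ?y ** ?y)) ** z"
  unfolding zw using assms(2) w by (simp only: mult_assoc rs_closed)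
 finally show ?case by simp
qed (use assms in simp)

lemma nm_half: "x : carrier A ==> cnorm A (rs (1/2) ** x) = cnorm A x / 2"
 by (simp only: rs_mult cnorm_smult) simp

lemma sqrt_seq_norm:
 assumes a: "a : carrier A" and "cnorm A a <= 1"
 shows "cnorm A (sqrt_seq a n) <= sqrt_bound n"
proof (induction n)
 case (Suc n)
 let ?y = "sqrt_seq a n"
 have y: "?y : carrier A" using a by simp
 have "cnorm A (?y ** ?y) <= cnorm A ?y * cnorm A ?y" by (rule cnorm_mult[OF y y])
 also have "... <= sqrt_bound n * sqrt_bound n"
  using Suc y sqrt_bound_01[of n] by (intro mult_mono) auto
 finally have "cnorm A (a +. ?y ** ?y) <= 1 + (sqrt_bound n)\<^sup>2"
  using cnorm_triangle[of a "?y ** ?y"] assms y by (simp add: power2_eq_square)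
 thus ?case using a y by (simp add: nm_half del: rs_mult)
qed simp

text \<open>The difference of two squares is \<open>z ** (z -. y) +. (z -. y) ** y\<close>, also
  when \<open>z\<close> and \<open>y\<close> do not commute; with the scalar bounds inserted it
  collapses to the increment of \<open>sqrt_bound\<close>.\<close>

lemma sqrt_seq_diff_Suc:
 assumes a: "a : carrier A" and "cnorm A a <= 1"
 shows "cnorm A (sqrt_seq a (Suc n) -. sqrt_seq a n) <= sqrt_bound (Suc n) - sqrt_bound n"
proof (induction n)
 case 0
 show ?case using assms nm_half[of a] by (simp add: a_minus_def)
next
 case (Suc n)
 let ?y = "sqrt_seq a n" let ?z = "sqrt_seq a (Suc n)"
 have y: "?y : carrier A" and z: "?z : carrier A" using a by (simp_all del: sqrt_seq.simps)
 have "sqrt_seq a (Suc (Suc n)) -. ?z = rs (1/2) ** (a +. ?z ** ?z) -. rs (1/2) ** (a +. ?y ** ?y)"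
  by simp
 also have "... = rs (1/2) ** (?z ** (?z -. ?y) +. (?z -. ?y) ** ?y)"
  using a y z rs_closed[of "1/2"] by algebra
 finally have h1: "cnorm A (sqrt_seq a (Suc (Suc n)) -. ?z) = cnorm A (?z ** (?z -. ?y) +. (?z -. ?y) ** ?y) / 2"
  using y z by (simp add: nm_half del: sqrt_seq.simps)
 have "cnorm A (?z ** (?z -. ?y) +. (?z -. ?y) ** ?y)
   <= cnorm A ?z * cnorm A (?z -. ?y) + cnorm A (?z -. ?y) * cnorm A ?y"
  using y z cnorm_triangle[of "?z ** (?z -. ?y)" "(?z -. ?y) ** ?y"]
   cnorm_mult[of ?z "?z -. ?y"] cnorm_mult[of "?z -. ?y" ?y] by (simp del: sqrt_seq.simps)
 also have "... <= sqrt_bound (Suc n) * (sqrt_bound (Suc n) - sqrt_bound n)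
   + (sqrt_bound (Suc n) - sqrt_bound n) * sqrt_bound n" (is "_ <= ?R")
  using y z sqrt_seq_norm[OF assms] Suc sqrt_bound_01 incseq_SucD[OF sqrt_bound_incseq, of n]
  by (intro add_mono mult_mono) (auto simp del: sqrt_seq.simps sqrt_bound.simps intro: order_trans[OF nm_nonneg])
 also have "?R = (sqrt_bound (Suc n))\<^sup>2 - (sqrt_bound n)\<^sup>2"
  by (simp only: power2_eq_square algebra_simps)
 finally have "cnorm A (sqrt_seq a (Suc (Suc n)) -. ?z) <= ((sqrt_bound (Suc n))\<^sup>2 - (sqrt_bound n)\<^sup>2) / 2"
  unfolding h1 by simp
 also have "... = sqrt_bound (Suc (Suc n)) - sqrt_bound (Suc n)"
  by (simp only: sqrt_bound.simps(2)[of "Suc n"] sqrt_bound.simps(2)[of n]) (simp add: field_simps)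
 finally show ?case .
qed

lemma sqrt_seq_diff:
 assumes a: "a : carrier A" and "cnorm A a <= 1" and "n <= m"
 shows "cnorm A (sqrt_seq a m -. sqrt_seq a n) <= sqrt_bound m - sqrt_bound n"
 using `n <= m`
proof (induction m rule: dec_induct)
 case base
 show ?case using a by simp
next
 case (step m)
 have "cnorm A (sqrt_seq a (Suc m) -. sqrt_seq a n)
   <= cnorm A (sqrt_seq a (Suc m) -. sqrt_seq a m) + cnorm A (sqrt_seq a m -. sqrt_seq a n)"
  by (rule nm_triangle3) (use a in \<open>simp_all del: sqrt_seq.simps\<close>)
 thus ?case using step.IH sqrt_seq_diff_Suc[OF assms(1,2), of m] by linarith
qed

lemma sqrt_seq_Cauchy:
 assumes a: "a : carrier A" and "cnorm A a <= 1"
 shows "cCauchy A (sqrt_seq a)"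
 unfolding cCauchy_def cdist_def
proof (intro allI impI)
 fix e :: real assume "e > 0"
 then obtain N where N: "!!m n. m >= N ==> n >= N ==> dist (sqrt_bound m) (sqrt_bound n) < e"
  using sqrt_bound_Cauchy unfolding Cauchy_def by meson
 have "cnorm A (sqrt_seq a m -. sqrt_seq a n) < e" if "m >= N" "n >= N" for m n
 proof (cases "n <= m")
  case True
  thus ?thesis using sqrt_seq_diff[OF assms True] N[OF that] by (simp add: dist_real_def)
 next
  case False
  thus ?thesis using sqrt_seq_diff[OF assms, of m n] N[OF that] a
   nm_diff_commute[of "sqrt_seq a m" "sqrt_seq a n"] by (simp add: dist_real_def)
 qed
 thus "EX N. ALL m>=N. ALL n>=N. cnorm A (sqrt_seq a m -. sqrt_seq a n) < e" by blast
qed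

text \<open>The iteration \<open>y \<mapsto> (a + y\<^sup>2) / 2\<close> converges to a solution of \<open>(1 - y)\<^sup>2 = 1 - a\<close>.\<close>

lemma sqrt_one_minus:
 assumes a: "a : carrier A" and h: "star A a = a" and n: "cnorm A a <= 1"
 obtains r where "r : carrier A" "star A r = r" "r ** r = \<one> -. a" "cnorm A (\<one> -. r) <= 1"
  "!!z. z : carrier A ==> z ** a = a ** z ==> z ** r = r ** z"
proof -
 obtain y where y: "y : carrier A" and lim: "ctendsto A (sqrt_seq a) y"
  using complete[OF sqrt_seq_closed[OF a] sqrt_seq_Cauchy[OF a n]] by blast
 note cl = sqrt_seq_closed[OF a]
 have "ctendsto A (%m. star A (sqrt_seq a m)) (star A y)" by (rule ctendsto_star[OF cl y lim])
 hence yh: "star A y = y" using ctendsto_unique[OF cl _ y, of "star A y"] lim y sqrt_seq_herm[OF a h] by simp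
 have "ctendsto A (%m. rs (1/2) ** (a +. sqrt_seq a m ** sqrt_seq a m)) (rs (1/2) ** (a +. y ** y))"
  by (intro ctendsto_mult ctendsto_add ctendsto_const lim) (use a y in auto)
 moreover have "ctendsto A (%m. sqrt_seq a (Suc m)) y"
  using lim unfolding ctendsto_iff by (rule LIMSEQ_Suc)
 ultimately have eq: "y = rs (1/2) ** (a +. y ** y)"
  using a y by (intro ctendsto_unique[of "%m. sqrt_seq a (Suc m)"]) auto
 have "y +. y = rs 2 ** y" using rs_add[of 1 1] y by (simp add: mult_add_left)
 also have "... = rs 2 ** (rs (1/2) ** (a +. y ** y))" using eq by simp
 also have "... = a +. y ** y" using a y by (simp add: mult_assoc[symmetric] rs_rs)
 finally have yy: "y +. y = a +. y ** y" .
 \<comment> \<open>So the root \<open>1 - y\<close> is at distance at most 1 from the unit, which is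
   positivity in the sense of \<open>pos\<close> below, with constant 1.\<close>
 have "cnorm A y <= 1"
  using ctendsto_norm[OF cl y lim] order_trans[OF sqrt_seq_norm[OF a n]] sqrt_bound_01
  by (intro LIMSEQ_le_const2[of "%m. cnorm A (sqrt_seq a m)"]) auto
 show ?thesis
 proof (rule that[of "\<one> -. y"])
  have "(\<one> -. y) ** (\<one> -. y) = \<one> -. (y +. y) +. y ** y"
   using y by (simp add: mult_diff_left mult_diff_right, algebra)
  also have "... = \<one> -. (a +. y ** y) +. y ** y" unfolding yy ..
  also have "... = \<one> -. a" using y a by algebra
  finally show "(\<one> -. y) ** (\<one> -. y) = \<one> -. a" .
  have "\<one> -. (\<one> -. y) = y" using y by algebra
  thus "cnorm A (\<one> -. (\<one> -. y)) <= 1" using `cnorm A y <= 1` by simp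
  fix z assume z: "z : carrier A" "z ** a = a ** z"
  have "ctendsto A (%m. z ** sqrt_seq a m) (z ** y)" "ctendsto A (%m. sqrt_seq a m ** z) (y ** z)"
   using a y z by (auto intro!: ctendsto_mult ctendsto_const lim)
  hence "z ** y = y ** z"
   using sqrt_seq_commute[OF a z] a y z by (intro ctendsto_unique[of "%m. z ** sqrt_seq a m"]) auto
  thus "z ** (\<one> -. y) = (\<one> -. y) ** z" using z y by (simp add: mult_diff_left mult_diff_right)
 qed (use y yh in \<open>auto simp: star_diff\<close>)
qed

text \<open>Scaling by \<open>1/t\<close> reduces to \<open>t = 1\<close>; for \<open>t = 0\<close>
  the element itself is zero.\<close>

lemma sqrt_rs_minus:
 assumes a: "a : carrier A" and h: "star A a = a" and n: "cnorm A a <= t"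
 obtains r where "r : carrier A" "star A r = r" "r ** r = rs t -. a" "cnorm A (rs (sqrt t) -. r) <= sqrt t"
  "!!z. z : carrier A ==> z ** a = a ** z ==> z ** r = r ** z"
proof (cases "t = 0")
 case True
 hence "a = \<zero>" using n nm_nonneg[OF a] cnorm_eq_zero[OF a] by simp
 thus ?thesis using True by (intro that[of \<zero>]) auto
next
 case False
 hence t: "t > 0" using n nm_nonneg[OF a] by linarith
 let ?a = "rs (1/t) ** a"
 have na: "cnorm A ?a <= 1" using a t n by (simp add: rs_mult cnorm_smult norm_divide)
 have ha: "star A ?a = ?a" using a h by (simp add: star_mult rs_commute)
 obtain r where r: "r : carrier A" "star A r = r" "r ** r = \<one> -. ?a" "cnorm A (\<one> -. r) <= 1"
  "!!z. z : carrier A ==> z ** ?a = ?a ** z ==> z ** r = r ** z"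
  using sqrt_one_minus[of ?a] na ha a by (metis mult_closed rs_closed)
 have ta: "rs t ** ?a = a" using a t by (simp add: mult_assoc[symmetric] rs_rs)
 show ?thesis
 proof (rule that[of "rs (sqrt t) ** r"])
  have "(rs (sqrt t) ** r) ** (rs (sqrt t) ** r) = rs (sqrt t) ** ((r ** rs (sqrt t)) ** r)"
   using r(1) by (simp add: mult_assoc)
  also have "... = rs (sqrt t) ** rs (sqrt t) ** (r ** r)"
   using r(1) rs_commute[of r] by (simp add: mult_assoc)
  also have "... = rs t -. a" using t r(3) a ta by (simp add: rs_rs mult_diff_right)
  finally show "(rs (sqrt t) ** r) ** (rs (sqrt t) ** r) = rs t -. a" .
  have "rs (sqrt t) -. rs (sqrt t) ** r = rs (sqrt t) ** (\<one> -. r)" using r(1) by (simp add: mult_diff_right)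
  thus "cnorm A (rs (sqrt t) -. rs (sqrt t) ** r) <= sqrt t"
   using r(1,4) t by (simp add: rs_mult cnorm_smult)
  fix z assume z: "z : carrier A" "z ** a = a ** z"
  have "z ** ?a = ?a ** z" using z a rs_commute[OF z(1)] by (metis mult_assoc rs_closed)
  hence "z ** r = r ** z" using r(5) z by blast
  thus "z ** (rs (sqrt t) ** r) = rs (sqrt t) ** r ** z"
   using z r(1) rs_commute[OF z(1)] by (metis mult_assoc rs_closed)
 qed (use r in \<open>auto simp: star_mult rs_commute\<close>)
qed

section \<open>Positive elements\<close>

text \<open>Membership of the spectrum in \<open>[0, 2t]\<close>, expressed without spectra.\<close>

definition pos :: "'a => bool" where
 "pos a \<longleftrightarrow> a : carrier A & star A a = a & (EX t>=0. cnorm A (rs t -. a) <= t)"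

lemma posD: "pos a ==> a : carrier A" "pos a ==> star A a = a"
 by (auto simp: pos_def)

lemma posI: "a : carrier A ==> star A a = a ==> cnorm A (rs t -. a) <= t ==> pos a"
 using order_trans[OF nm_nonneg[of "rs t -. a"]] by (auto simp: pos_def)

lemma pos_add: "pos a ==> pos b ==> pos (a +. b)"
proof -
 assume ab: "pos a" "pos b"
 then obtain s t where st: "cnorm A (rs s -. a) <= s" "cnorm A (rs t -. b) <= t" by (auto simp: pos_def)
 note c = posD[OF ab(1)] posD[OF ab(2)]
 show "pos (a +. b)"
  using c st cnorm_triangle[of "rs s -. a" "rs t -. b"]
  by (intro posI[of _ "s + t"]) (auto simp: star_add rs_add add_diff_add)
qed

lemma pos_smult: "pos a ==> c >= 0 ==> pos (cr c *. a)"
proof -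
 assume a: "pos a" and c: "c >= 0"
 then obtain t where t: "cnorm A (rs t -. a) <= t" by (auto simp: pos_def)
 note ca = posD[OF a]
 have "rs (c * t) -. cr c *. a = cr c *. (rs t -. a)"
  using ca by (simp add: sm_diff_right sm_rs)
 thus "pos (cr c *. a)"
  using ca c t by (intro posI[of _ "c * t"]) (auto simp: star_smult cnorm_smult mult_left_mono)
qed

lemma pos_rs: "t >= 0 ==> pos (rs t)"
 by (rule posI[of _ t]) auto

lemma rs_minus_rs_minus: "b : carrier A ==> rs t -. (rs t -. b) = b"
 using rs_closed[of t] by algebra

lemma pos_norm_minus: "b : carrier A ==> star A b = b ==> cnorm A b <= t ==> pos (rs t -. b)"
 by (rule posI[of _ t]) (auto simp: star_diff rs_minus_rs_minus)

text \<open>Apply the scaled root to \<open>rs t -. a\<close>, whose norm is at most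
  \<open>t\<close>. The commutation clause replaces the statement that the root is a limit of
  polynomials in \<open>a\<close>; it makes roots of commuting elements commute.\<close>

lemma pos_sqrt:
 assumes "pos a"
 obtains s where "pos s" "s ** s = a" "!!z. z : carrier A ==> z ** a = a ** z ==> z ** s = s ** z"
proof -
 obtain t where t: "cnorm A (rs t -. a) <= t" using assms by (auto simp: pos_def)
 note a = posD[OF assms]
 have c: "rs t -. a : carrier A" "star A (rs t -. a) = rs t -. a" using a by (simp_all add: star_diff)
 obtain r where r: "r : carrier A" "star A r = r" "r ** r = rs t -. (rs t -. a)"
  "cnorm A (rs (sqrt t) -. r) <= sqrt t"
  "!!z. z : carrier A ==> z ** (rs t -. a) = (rs t -. a) ** z ==> z ** r = r ** z"
  by (rule sqrt_rs_minus[OF c t]) (rule that)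
 show ?thesis
 proof (rule that[of r])
  show "pos r" using r by (intro posI[of _ "sqrt t"]) auto
  show "r ** r = a" using r(3) a by (simp add: rs_minus_rs_minus)
  fix z assume z: "z : carrier A" "z ** a = a ** z"
  have "z ** (rs t -. a) = (rs t -. a) ** z"
   using z(1) a(1) unfolding mult_diff_right[OF z(1) rs_closed a(1)] mult_diff_left[OF z(1) rs_closed a(1)]
   by (simp only: z(2) rs_commute)
  thus "z ** r = r ** z" by (rule r(5)[OF z(1)])
 qed
qed

text \<open>For \<open>u = s + i r\<close> the cross terms in \<open>star A u ** u\<close> cancel,
  which leaves \<open>rs (t^2)\<close>. By the C*-identity \<open>u\<close> has norm
  \<open>t\<close>, and \<open>s\<close> is the mean of \<open>u\<close> and its adjoint.\<close>

lemma unitary_bound: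
 assumes s: "s : carrier A" "star A s = s" and r: "r : carrier A" "star A r = r" and sr: "s ** r = r ** s"
  and eq: "s ** s +. r ** r = rs (t\<^sup>2)" and t: "t >= 0"
 shows "cnorm A s <= t"
proof -
 define w where "w = \<i> *. r"
 define u where "u = s +. w"
 have w: "w : carrier A" "star A w = \<ominus> w" using r by (auto simp: w_def star_smult sm_uminus_left)
 have ws: "w ** w = \<ominus> (r ** r)" using r
  by (simp add: w_def smult_mult_left smult_mult_right sm_assoc sm_minus_one)
 have sw: "s ** w = w ** s" using r s sr by (simp add: w_def smult_mult_left smult_mult_right)
 have u: "u : carrier A" using s w by (simp add: u_def)
 have su: "star A u = s -. w" using s w by (simp add: u_def star_add a_minus_def)
 have "star A u ** u = s ** s +. s ** w -. w ** s -. w ** w"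
  unfolding su unfolding u_def using s(1) w(1) by algebra
 also have "... = s ** s -. w ** w" unfolding sw using s(1) w(1) by algebra
 also have "... = rs (t\<^sup>2)" unfolding ws eq[symmetric] using s(1) r(1) by algebra
 finally have "(cnorm A u)\<^sup>2 = t\<^sup>2" using cnorm_cstar[OF u] by simp
 hence nu: "cnorm A u = t" using t u by (simp add: power2_eq_iff_nonneg)
 have "u +. star A u = s +. s" unfolding su unfolding u_def using s(1) w(1) by algebra
 hence "s = rs (1/2) ** (u +. star A u)" using s by (simp add: rs_mult sm_add_right)
 hence "cnorm A s = cnorm A (u +. star A u) / 2" using nm_half[of "u +. star A u"] u by simp
 thus ?thesis using cnorm_triangle[of u "star A u"] u nu by simp
qed

text \<open>The root \<open>r\<close> of \<open>rs t -. s ** s\<close> and \<open>s\<close> itself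
  are the two legs of \<open>unitary_bound\<close> with constant \<open>sqrt t\<close>; here the
  bound is used for the leg \<open>r\<close>.\<close>

lemma sq_norm_pos:
 assumes s: "s : carrier A" "star A s = s" and t: "(cnorm A s)\<^sup>2 <= t"
 shows "cnorm A (rs t -. s ** s) <= t"
proof -
 have t0: "t >= 0" using t order_trans[OF zero_le_power2] by blast
 have c: "s ** s : carrier A" "star A (s ** s) = s ** s" "cnorm A (s ** s) <= t"
  using s t by (simp_all add: star_mult nm_herm_sq)
 obtain r where r: "r : carrier A" "star A r = r" "r ** r = rs t -. s ** s"
  "!!z. z : carrier A ==> z ** (s ** s) = (s ** s) ** z ==> z ** r = r ** z"
  by (rule sqrt_rs_minus[OF c]) (rule that)
 have sr: "s ** r = r ** s" by (rule r(4)) (use s in \<open>simp_all add: mult_assoc\<close>)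
 have "r ** r +. s ** s = rs ((sqrt t)\<^sup>2)" using r(3) s t0 by (simp add: diff_add_cancel)
 hence "cnorm A r <= sqrt t" using t0 by (intro unitary_bound[OF r(1,2) s sr[symmetric]]) auto
 hence "(cnorm A r)\<^sup>2 <= (sqrt t)\<^sup>2" using r by (intro power_mono) auto
 thus ?thesis using r t0 nm_herm_sq[of r] by simp
qed

lemma sq_pos: "s : carrier A ==> star A s = s ==> pos (s ** s)"
 using sq_norm_pos[of s "(cnorm A s)\<^sup>2"] by (intro posI[of _ "(cnorm A s)\<^sup>2"]) (auto simp: star_mult)

text \<open>The definition of \<open>pos\<close> supplies one constant, whereas every bound of the
  norm is a valid one. Writing \<open>a\<close> as the square of its root turns the claim into
  \<open>sq_norm_pos\<close>.\<close>

lemma pos_norm: "pos a ==> cnorm A a <= t ==> cnorm A (rs t -. a) <= t"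
proof -
 assume a: "pos a" and t: "cnorm A a <= t"
 obtain s where "pos s" "s ** s = a" using pos_sqrt[OF a] by blast
 thus ?thesis using sq_norm_pos[of s t] posD[of s] nm_herm_sq[of s] t by auto
qed

lemma commute_mult:
 assumes "z : carrier A" "x : carrier A" "y : carrier A" "z ** x = x ** z" "z ** y = y ** z"
 shows "z ** (x ** y) = x ** y ** z"
proof -
 have "z ** (x ** y) = (z ** x) ** y" using assms(1-3) by (simp only: mult_assoc)
 also have "... = x ** (z ** y)" unfolding assms(4) using assms(1-3) by (simp only: mult_assoc)
 also have "... = x ** y ** z" unfolding assms(5) using assms(1-3) by (simp only: mult_assoc)
 finally show ?thesis .
qed

text \<open>The product of the two roots is hermitian and squares to \<open>a ** b\<close>; all
  commutations come from the clause in \<open>pos_sqrt\<close>. The element \<open>g\<close> is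
  meant as a second leg for \<open>unitary_bound\<close>.\<close>

lemma pos_commute_mult:
 assumes "pos a" "pos b" "a ** b = b ** a"
 shows "EX g. g : carrier A & star A g = g & g ** g = a ** b &
  (ALL z:carrier A. z ** a = a ** z --> z ** b = b ** z --> z ** g = g ** z)"
proof -
 obtain s where s: "pos s" "s ** s = a" "!!z. z : carrier A ==> z ** a = a ** z ==> z ** s = s ** z"
  using pos_sqrt[OF assms(1)] by blast
 obtain r where r: "pos r" "r ** r = b" "!!z. z : carrier A ==> z ** b = b ** z ==> z ** r = r ** z"
  using pos_sqrt[OF assms(2)] by blast
 note c = posD[OF s(1)] posD[OF r(1)] posD[OF assms(1)] posD[OF assms(2)]
 have bs: "b ** s = s ** b" using s(3)[OF posD(1)[OF assms(2)] assms(3)[symmetric]] .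
 have sr: "s ** r = r ** s" using r(3)[OF posD(1)[OF s(1)] bs[symmetric]] .
 have "(s ** r) ** (s ** r) = s ** (r ** s) ** r" using c by (simp add: mult_assoc)
 also have "... = (s ** s) ** (r ** r)" unfolding sr[symmetric] using c by (simp add: mult_assoc)
 finally have sq: "(s ** r) ** (s ** r) = a ** b" using s r by simp
 show ?thesis
 proof (intro exI conjI ballI impI)
  show "star A (s ** r) = s ** r" using c sr by (simp add: star_mult)
  fix z assume z: "z : carrier A" "z ** a = a ** z" "z ** b = b ** z"
  show "z ** (s ** r) = s ** r ** z"
   using s(3)[OF z(1,2)] r(3)[OF z(1,3)] z(1) c by (intro commute_mult)
 qed (use c sq in auto)
qed

text \<open>The two positive elements commute and their product is
  \<open>rs (T^2) -. b ** b\<close>. With a hermitian root \<open>g\<close> of this product,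
  \<open>b\<close> and \<open>g\<close> are the legs of \<open>unitary_bound\<close>.\<close>

lemma pm_norm:
 assumes b: "b : carrier A" "star A b = b" and T: "T >= 0" and p: "pos (rs T -. b)" "pos (rs T +. b)"
 shows "cnorm A b <= T"
proof -
 note rb = rs_commute[OF b(1), of T]
 have "(rs T -. b) ** (rs T +. b) = (rs T +. b) ** (rs T -. b)"
 proof -
  have "(rs T -. b) ** (rs T +. b) = rs T ** rs T +. rs T ** b -. b ** rs T -. b ** b"
   using b(1) rs_closed[of T] by algebra
  also have "... = rs T ** rs T -. rs T ** b +. b ** rs T -. b ** b"
   unfolding rb using b(1) rs_closed[of T] by (simp add: add_diff_cancel diff_add_cancel)
  also have "... = (rs T +. b) ** (rs T -. b)"
   using b(1) rs_closed[of T] by algebra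
  finally show ?thesis .
 qed
 then obtain g where g: "g : carrier A" "star A g = g" "g ** g = (rs T -. b) ** (rs T +. b)"
  "ALL z:carrier A. z ** (rs T -. b) = (rs T -. b) ** z --> z ** (rs T +. b) = (rs T +. b) ** z --> z ** g = g ** z"
  using pos_commute_mult[OF p] by blast
 have "b ** g = g ** b"
  using g(4)[rule_format, OF b(1)] b rb by (simp add: mult_diff_left mult_diff_right mult_add_left mult_add_right)
 moreover have "g ** g = rs T ** rs T +. rs T ** b -. b ** rs T -. b ** b"
  unfolding g(3) using b(1) rs_closed[of T] by algebra
 hence "g ** g = rs (T\<^sup>2) -. b ** b" unfolding rb rs_rs using b(1) rs_closed[of T] rs_closed[of "T * T"]
  by (simp add: add_diff_cancel power2_eq_square)
 hence "b ** b +. g ** g = rs (T\<^sup>2)" 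
  using b g(1) diff_add_cancel[of "rs (T\<^sup>2)" "b ** b"] M.a_comm[of "b ** b" "g ** g"] by simp
 ultimately show ?thesis using b g T by (intro unitary_bound[of b g T]) auto
qed

lemma pos_le_norm:
 assumes "pos a" "pos (rs T -. a)" "T >= 0"
 shows "cnorm A a <= T"
 using pm_norm[of a T] assms posD[of a] pos_add[OF pos_rs[OF assms(3)] assms(1)] by simp

lemma pos_antisym:
 assumes "pos a" "pos (\<ominus> a)"
 shows "a = \<zero>"
proof -
 have a: "a : carrier A" by (rule posD(1)[OF assms(1)])
 have "cnorm A a <= 0" using assms a by (intro pos_le_norm) (auto simp: a_minus_def)
 thus ?thesis using nm_nonneg[OF a] cnorm_eq_zero[OF a] by linarith
qed

lemma pos_minus_sq: "x : carrier A ==> star A x = x ==> x ** x = \<zero> ==> x = \<zero>"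
 using nm_herm_sq[of x] cnorm_eq_zero[of x] by simp

end

section \<open>Positivity of \<open>star A x ** x\<close> and uniqueness of positive roots\<close>

context unital_cstar_algebra
begin

text \<open>The product expands to \<open>tu^2 h + 2 tu h^2 + h^3\<close> with three positive terms,
  so the middle one alone has norm at most \<open>tu^3\<close>; but its norm is exactly
  \<open>2 tu^3\<close>.\<close>

lemma nm_sq_pos_le:
 assumes "pos h" "h = g ** g" "g : carrier A" "star A g = g" "0 <= tu" "cnorm A h = tu"
  and le: "cnorm A ((rs tu +. h) ** (rs tu +. h) ** h) <= tu ^ 3"
 shows "tu = 0"
proof -
 note h = posD[OF assms(1)]
 let ?q = "(rs tu +. h) ** (rs tu +. h) ** h"
 let ?m = "cr (2 * tu) *. (h ** h)"
 let ?l = "cr (tu * tu) *. h"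
 have hg: "h ** g = g ** h" using assms by (simp add: mult_assoc)
 have h3: "h ** h ** h = (h ** g) ** (h ** g)"
 proof -
  have "(h ** g) ** (h ** g) = h ** (g ** h) ** g" using h assms(3) by (simp add: mult_assoc)
  also have "... = h ** h ** (g ** g)" unfolding hg[symmetric] using h assms(3) by (simp add: mult_assoc)
  finally show ?thesis using assms(2) by simp
 qed
 have "star A (h ** g) = h ** g" using h assms(3,4) hg by (simp add: star_mult)
 hence p3: "pos (h ** h ** h)" unfolding h3 using h assms(3) by (intro sq_pos) auto
 have p1: "pos ?l" using assms(1,5) by (intro pos_smult) auto
 have p2: "pos (h ** h)" using h by (intro sq_pos)
 have "?q = rs tu ** rs tu ** h +. (rs tu ** h ** h +. h ** rs tu ** h) +. h ** h ** h"
  using h(1) rs_closed[of tu] by algebra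
 also have "... = ?l +. ?m +. h ** h ** h"
  using h(1) sm_add_left[of "h ** h" tu tu]
  by (simp add: rs_rs rs_mult mult_rs smult_mult_left sm_assoc flip: mult_2)
 finally have q: "?q = ?m +. (?l +. h ** h ** h)" using h(1) by (simp add: M.a_ac)
 have pr: "pos (?l +. h ** h ** h)" by (rule pos_add[OF p1 p3])
 have pm: "pos ?m" using assms(5) by (intro pos_smult p2) auto
 have pq: "pos ?q" unfolding q by (rule pos_add[OF pm pr])
 have "pos (rs (tu ^ 3) -. ?q)" by (rule pos_norm_minus[OF posD[OF pq] le])
 hence "pos ((rs (tu ^ 3) -. ?q) +. (?l +. h ** h ** h))" by (rule pos_add[OF _ pr])
 also have "(rs (tu ^ 3) -. ?q) +. (?l +. h ** h ** h) = rs (tu ^ 3) -. ?m"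
  unfolding q using posD(1)[OF pm] posD(1)[OF pr] rs_closed[of "tu ^ 3"] by algebra
 finally have "cnorm A ?m <= tu ^ 3" using assms(5) by (intro pos_le_norm[OF pm]) auto
 moreover have "cnorm A ?m = 2 * tu ^ 3"
  using h assms(5,6) nm_herm_sq[of h]
  by (simp only: cnorm_smult mult_closed norm_of_real) (simp add: power2_eq_square power3_eq_cube)
 ultimately have "tu ^ 3 <= 0" by simp
 thus ?thesis using assms(5) by (metis order_antisym zero_le_power power_eq_0_iff)
qed

text \<open>With \<open>p\<close> and \<open>q\<close> twice the real and imaginary parts of
  \<open>z\<close>, up to sign, the element is half of \<open>p ** p +. q ** q\<close>.\<close>

lemma star_mult_add_mult_star_pos:
 assumes z: "z : carrier A"
 shows "pos (z ** star A z +. star A z ** z)"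
proof -
 define p where "p = z +. star A z"
 define d where "d = z -. star A z"
 define q where "q = \<i> *. d"
 have c: "p : carrier A" "d : carrier A" "q : carrier A" using z by (auto simp: p_def d_def q_def)
 have sp: "star A p = p" using z by (simp add: p_def star_add M.a_comm)
 have "star A d = \<ominus> d" using z by (simp add: d_def star_diff uminus_diff)
 hence sq: "star A q = q" using c by (simp add: q_def star_smult sm_uminus_left sm_minus_right)
 have qq: "q ** q = \<ominus> (d ** d)"
  using c by (simp add: q_def smult_mult_left smult_mult_right sm_assoc sm_minus_one)
 have "p ** p +. q ** q = (z ** star A z +. star A z ** z) +. (z ** star A z +. star A z ** z)"
  unfolding qq unfolding p_def d_def using z star_closed[OF z] by algebra
 hence "cr (1/2) *. (p ** p +. q ** q) = z ** star A z +. star A z ** z"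
  using z half_double[of "z ** star A z +. star A z ** z"] by (simp add: sm_add_right)
 moreover have "pos (cr (1/2) *. (p ** p +. q ** q))"
  by (intro pos_smult pos_add sq_pos c sp sq) simp
 ultimately show ?thesis by simp
qed

text \<open>Put \<open>h = g ** g\<close>. Adding \<open>h\<close> to the sum of both products shows
  that \<open>z ** star A z\<close> is positive, so its difference \<open>d\<close> from
  \<open>rs tu\<close> has norm at most \<open>tu\<close>. As \<open>star A z ** d\<close> equals
  \<open>rs tu +. h\<close> times \<open>star A z\<close>, the product
  \<open>star A z ** d ** d ** z\<close> is minus the element estimated in
  \<open>nm_sq_pos_le\<close>, and its norm is at most \<open>tu^3\<close>.\<close>

lemma neg_star_mult_zero:
 assumes z: "z : carrier A" and g: "g : carrier A" "star A g = g" and eq: "star A z ** z = \<ominus> (g ** g)"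
 shows "g = \<zero>"
proof -
 let ?k = "star A z ** z" let ?v = "z ** star A z"
 define h where "h = g ** g"
 have h: "pos h" unfolding h_def by (rule sq_pos[OF g])
 note hc = posD[OF h]
 define tu where "tu = (cnorm A z)\<^sup>2"
 have "pos ((?v +. ?k) +. h)" by (rule pos_add[OF star_mult_add_mult_star_pos[OF z] h])
 also have "(?v +. ?k) +. h = ?v" unfolding eq h_def[symmetric] using z star_closed[OF z] hc(1) by algebra
 finally have v: "pos ?v" .
 have nv: "cnorm A ?v = tu" using cnorm_cstar[of "star A z"] z by (simp add: tu_def)
 have "cnorm A ?k = tu" using cnorm_cstar[of z] z by (simp add: tu_def)
 hence nh: "cnorm A h = tu" unfolding eq h_def[symmetric] using hc by simp
 define d where "d = rs tu -. ?v"
 have d: "d : carrier A" "cnorm A d <= tu" using pos_norm[OF v, of tu] nv z by (auto simp: d_def)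
 have sz: "star A z : carrier A" using z by simp
 have zd: "star A z ** d = (rs tu +. h) ** star A z"
 proof -
  have "star A z ** d = star A z ** rs tu -. ?k ** star A z"
   unfolding d_def using z sz rs_closed[of tu] by algebra
  also have "... = (rs tu +. h) ** star A z"
   unfolding eq h_def[symmetric] rs_commute[OF sz] using sz rs_closed[of tu] hc(1) by algebra
  finally show ?thesis .
 qed
 have "star A z ** (d ** d) ** z = (star A z ** d) ** (d ** z)" using sz z d(1) by algebra
 also have "... = ((rs tu +. h) ** star A z) ** (d ** z)" by (simp only: zd)
 also have "... = (rs tu +. h) ** ((star A z ** d) ** z)"
  using sz z d(1) hc(1) rs_closed[of tu] by algebra
 also have "... = (rs tu +. h) ** (((rs tu +. h) ** star A z) ** z)" by (simp only: zd)
 also have "... = (rs tu +. h) ** (rs tu +. h) ** ?k"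
  using sz z hc(1) rs_closed[of tu] by algebra
 also have "... = \<ominus> ((rs tu +. h) ** (rs tu +. h) ** h)"
  unfolding eq h_def[symmetric] using hc(1) rs_closed[of tu] by algebra
 finally have "cnorm A ((rs tu +. h) ** (rs tu +. h) ** h) = cnorm A (star A z ** (d ** d) ** z)"
  using hc(1) by simp
 also have "... <= cnorm A (star A z ** (d ** d)) * cnorm A z" using sz z d by (intro cnorm_mult) auto
 also have "... <= (cnorm A z * (tu * tu)) * cnorm A z"
 proof (rule mult_right_mono)
  have "cnorm A (d ** d) <= cnorm A d * cnorm A d" by (rule cnorm_mult[OF d(1) d(1)])
  also have "... <= tu * tu" using d nm_nonneg[OF d(1)] by (intro mult_mono) (auto simp: tu_def)
  finally have "cnorm A z * cnorm A (d ** d) <= cnorm A z * (tu * tu)"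
   by (rule mult_left_mono) (rule nm_nonneg[OF z])
  thus "cnorm A (star A z ** (d ** d)) <= cnorm A z * (tu * tu)"
   using cnorm_mult[OF sz mult_closed[OF d(1) d(1)]] nm_star[OF z] by simp
 qed (rule nm_nonneg[OF z])
 also have "... = tu ^ 3" by (simp add: tu_def power2_eq_square power3_eq_cube algebra_simps)
 finally have "tu = 0"
  by (intro nm_sq_pos_le[OF h h_def g _ nh]) (auto simp: tu_def)
 hence "h = \<zero>" using nh cnorm_eq_zero[OF hc(1)] by simp
 thus ?thesis using pos_minus_sq[OF g] h_def by simp
qed

text \<open>Kaplansky's argument: with \<open>r = \<bar>x\<^sup>*x\<bar>\<close> and \<open>w = r - x\<^sup>*x\<close>, the element \<open>z = xw\<close> satisfies
  \<open>z\<^sup>*z = - wrw \<le> 0\<close>, while \<open>zz\<^sup>* \<ge> 0\<close>; comparing the two forces \<open>z = 0\<close>.\<close>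

lemma star_mult_pos:
 assumes x: "x : carrier A"
 shows "pos (star A x ** x)"
proof -
 define y where "y = star A x ** x"
 have y: "y : carrier A" "star A y = y" using x by (auto simp: y_def star_mult)
 obtain r where r: "pos r" "r ** r = y ** y"
  "!!z. z : carrier A ==> z ** (y ** y) = (y ** y) ** z ==> z ** r = r ** z"
  using pos_sqrt[OF sq_pos[OF y]] by blast
 note rc = posD[OF r(1)]
 have yr: "y ** r = r ** y" using r(3)[of y] y by (simp add: mult_assoc)
 obtain s where s: "pos s" "s ** s = r" "!!z. z : carrier A ==> z ** r = r ** z ==> z ** s = s ** z"
  using pos_sqrt[OF r(1)] by blast
 note sc = posD[OF s(1)]
 define w where "w = r -. y"
 have w: "w : carrier A" "star A w = w" using rc y by (auto simp: w_def star_diff)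
 have wr: "w ** r = r ** w" unfolding w_def using rc y yr by (simp add: mult_diff_left mult_diff_right)
 have ws: "w ** s = s ** w" using s(3)[OF w(1) wr] .
 have yw: "y ** w = \<ominus> (r ** w)"
 proof -
  have "y ** w = y ** r -. y ** y" unfolding w_def using y rc by algebra
  also have "... = r ** y -. r ** r" unfolding yr r(2) ..
  also have "... = \<ominus> (r ** w)" unfolding w_def using y(1) rc(1) by algebra
  finally show ?thesis .
 qed
 \<comment> \<open>The root \<open>s\<close> of \<open>r\<close> commutes with \<open>w\<close>, so
   \<open>g\<close> squares to \<open>w ** r ** w\<close>, which is minus the product of the adjoint
   of \<open>x ** w\<close> with \<open>x ** w\<close>.\<close>
 define g where "g = s ** w"
 have g: "g : carrier A" "star A g = g" using sc w ws by (auto simp: g_def star_mult)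
 have gg: "g ** g = w ** (r ** w)"
 proof -
  have "g ** g = (s ** w) ** s ** w" unfolding g_def using sc(1) w(1) by algebra
  also have "... = w ** (s ** s) ** w" unfolding ws[symmetric] using sc(1) w(1) by algebra
  also have "... = w ** (r ** w)" unfolding s(2) using rc(1) w(1) by algebra
  finally show ?thesis .
 qed
 have "star A (x ** w) ** (x ** w) = w ** (y ** w)"
  using x w by (simp add: star_mult y_def mult_assoc)
 also have "... = \<ominus> (g ** g)" unfolding yw gg using w(1) rc(1) by algebra
 finally have "g = \<zero>" by (intro neg_star_mult_zero[of "x ** w"] g) (use x w in auto)
 hence "s ** (s ** w) = \<zero>" using sc by (simp add: g_def)
 hence rw: "r ** w = \<zero>" using sc w s(2) by (simp add: mult_assoc[symmetric])
 have "w ** w = r ** w -. y ** w" by (subst (1) w_def) (use w y rc in \<open>simp add: mult_diff_left\<close>)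
 also have "... = \<zero>" unfolding yw rw by (simp add: a_minus_def)
 finally have "w = \<zero>" using pos_minus_sq[OF w] by simp
 hence "r = y" using diff_eq_zero[OF rc(1) y(1)] unfolding w_def by simp
 thus ?thesis using r(1) unfolding y_def by simp
qed

text \<open>With \<open>d = r -. b\<close> the product \<open>d ** (r +. b) ** d\<close> vanishes
  and is the sum of the positive elements \<open>d ** r ** d\<close> and \<open>d ** b ** d\<close>.
  So both are zero, and their difference is the cube of \<open>d\<close>.\<close>

lemma pos_sqrt_unique:
 assumes r: "pos r" and b: "pos b" and rb: "r ** b = b ** r" and eq: "r ** r = b ** b"
 shows "r = b"
proof -
 note c = posD[OF r] posD[OF b]
 define d where "d = r -. b"
 have d: "d : carrier A" "star A d = d" using c by (auto simp: d_def star_diff)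
 have conj: "pos (d ** a ** d)" if a: "pos a" for a
 proof -
  obtain s where s: "pos s" "s ** s = a" using pos_sqrt[OF a] by blast
  note sc = posD[OF s(1)]
  have "star A (s ** d) ** (s ** d) = d ** (s ** s) ** d" using sc d by (simp add: star_mult mult_assoc)
  thus ?thesis using star_mult_pos[of "s ** d"] sc d s(2) by simp
 qed
 have "d ** (r +. b) = r ** r +. r ** b -. b ** r -. b ** b"
  unfolding d_def using c(1,3) by algebra
 also have "... = \<zero>" unfolding eq rb using c(1,3) by algebra
 finally have "d ** (r +. b) ** d = \<zero>" using d by simp
 moreover have "d ** (r +. b) ** d = d ** r ** d +. d ** b ** d" using c(1,3) d(1) by algebra
 ultimately have sum: "d ** r ** d +. d ** b ** d = \<zero>" by simp
 have "d ** b ** d = \<ominus> (d ** r ** d)"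
  using M.minus_equality[of "d ** b ** d" "d ** r ** d"] sum c d M.a_comm[of "d ** r ** d" "d ** b ** d"] by simp
 hence "d ** r ** d = \<zero>" using pos_antisym[OF conj[OF r]] conj[OF b] by simp
 moreover from this have "d ** b ** d = \<zero>" using sum c d by simp
 moreover have "d ** (r -. b) ** d = d ** r ** d -. d ** b ** d" using c(1,3) d(1) by algebra
 ultimately have "d ** d ** d = \<zero>" unfolding d_def[symmetric] by (simp add: a_minus_def)
 hence "(d ** d) ** (d ** d) = \<zero>" using d by (simp add: mult_assoc)
 hence "d ** d = \<zero>" by (rule pos_minus_sq[rotated 2]) (use d in \<open>auto simp: star_mult\<close>)
 hence "d = \<zero>" using pos_minus_sq[OF d] by simp
 thus ?thesis using diff_eq_zero[OF c(1,3)] unfolding d_def by simp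
qed

lemma re_im_decomp:
 assumes x: "x : carrier A"
 defines "p \<equiv> (1/2) *. (x +. star A x)" and "q \<equiv> (- \<i> / 2) *. (x -. star A x)"
 shows "p : carrier A" "q : carrier A" "star A p = p" "star A q = q" "x = p +. \<i> *. q"
  "cnorm A p <= cnorm A x" "cnorm A q <= cnorm A x"
proof -
 have sx: "star A x : carrier A" using x by simp
 show c: "p : carrier A" "q : carrier A" using x by (auto simp: p_def q_def)
 show "star A p = p" using x by (simp add: p_def star_smult star_add M.a_comm)
 have "star A (x -. star A x) = \<ominus> (x -. star A x)" using x by (simp add: star_diff uminus_diff)
 moreover have "(\<i> / 2) *. (\<ominus> (x -. star A x)) = (- \<i> / 2) *. (x -. star A x)"
  using x sm_assoc[of "x -. star A x" "\<i> / 2" "-1"] by (simp add: sm_minus_one)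
 ultimately show "star A q = q" using x by (simp add: q_def star_smult)
 have "p +. \<i> *. q = (1/2) *. ((x +. star A x) +. (x -. star A x))"
  using x by (simp add: p_def q_def sm_assoc sm_add_right)
 also have "(x +. star A x) +. (x -. star A x) = x +. x" using x sx by algebra
 also have "(1/2) *. (x +. x) = x" unfolding sm_add_right[OF x x] by (rule half_double[OF x])
 finally show "x = p +. \<i> *. q" by simp
 show "cnorm A p <= cnorm A x" "cnorm A q <= cnorm A x"
  using cnorm_triangle[OF x sx] nm_diff[OF x sx] x
  by (simp_all add: p_def q_def cnorm_smult norm_divide)
qed

end

section \<open>Homomorphisms of C*-algebras\<close>

lemma star_homD:
 assumes "star_hom A B h"
 shows "x : carrier A ==> h x : carrier B"
  and "x : carrier A ==> y : carrier A ==> h (x +[A] y) = h x +[B] h y"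
  and "x : carrier A ==> h (c .[A] x) = c .[B] h x"
  and "x : carrier A ==> y : carrier A ==> h (x *[A] y) = h x *[B] h y"
  and "x : carrier A ==> h (star A x) = star B (h x)"
 using assms by (auto simp: star_hom_def)

lemma star_hom_comp:
 assumes "star_hom A B h" "star_hom B E k"
 shows "star_hom A E (%x. k (h x))"
 using assms by (auto simp: star_hom_def Pi_iff)

locale star_hom_loc = A: cstar_algebra A + B: cstar_algebra B
 for A :: "'a cstar" and B :: "'b cstar" +
 fixes h :: "'a => 'b"
 assumes hom: "star_hom A B h"
begin

lemmas hom_simps = star_homD[OF hom]
declare hom_simps(1) [simp]

lemma hom_minus: "x : carrier A ==> h (\<ominus>\<^bsub>A\<^esub> x) = \<ominus>\<^bsub>B\<^esub> h x"
 using hom_simps(3)[of x "-1"] by (simp add: A.sm_minus_one B.sm_minus_one)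

lemma hom_diff: "x : carrier A ==> y : carrier A ==> h (x -[A] y) = h x -[B] h y"
 by (simp add: a_minus_def hom_simps(2) hom_minus)

lemma hom_zero [simp]: "h 0[A] = 0[B]"
 using hom_simps(3)[of "0[A]" 0] by simp

end

locale unital_hom = A: unital_cstar_algebra A + B: unital_cstar_algebra B + star_hom_loc A B h
 for A :: "'a cstar" and B :: "'b cstar" and h :: "'a => 'b" +
 assumes hom_one [simp]: "h 1[A] = 1[B]"
begin

lemma hom_rs: "h (A.rs t) = B.rs t"
 by (simp add: A.rs_def B.rs_def hom_simps)

lemma hom_pos: "A.pos a ==> B.pos (h a)"
proof -
 assume a: "A.pos a"
 obtain s where s: "A.pos s" "s *[A] s = a" using A.pos_sqrt[OF a] by blast
 note sc = A.posD[OF s(1)]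
 have "h a = h s *[B] h s" using s(2) sc hom_simps(4)[of s s] by simp
 thus ?thesis using B.sq_pos[of "h s"] sc hom_simps(5)[of s] by simp
qed

lemma hom_contractive:
 assumes x: "x : carrier A"
 shows "cnorm B (h x) <= cnorm A x"
proof -
 let ?a = "star A x *[A] x"
 have a: "A.pos ?a" by (rule A.star_mult_pos[OF x])
 let ?t = "(cnorm A x)\<^sup>2"
 have "A.pos (A.rs ?t -[A] ?a)" using A.posD[OF a] A.cnorm_cstar[OF x] by (intro A.pos_norm_minus) auto
 hence "B.pos (B.rs ?t -[B] h ?a)" using hom_pos A.posD[OF a] by (fastforce simp: hom_diff hom_rs)
 hence "cnorm B (h ?a) <= ?t" by (intro B.pos_le_norm hom_pos a) auto
 also have "h ?a = star B (h x) *[B] h x" using x by (simp add: hom_simps)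
 finally have "(cnorm B (h x))\<^sup>2 <= ?t" using B.cnorm_cstar[of "h x"] x by simp
 thus ?thesis using x by (simp add: power_mono_iff)
qed

text \<open>Let \<open>b\<close> be the norm of \<open>h a\<close> minus \<open>a\<close>. Its image
  is positive, and so is the image of the positive root \<open>r\<close> of \<open>b ** b\<close>.
  Uniqueness of roots gives \<open>h r = h b\<close>, injectivity gives \<open>r = b\<close>, and
  positivity of \<open>b\<close> bounds the norm of \<open>a\<close>.\<close>

lemma hom_inj_isometric:
 assumes inj: "inj_on h (carrier A)" and x: "x : carrier A"
 shows "cnorm B (h x) = cnorm A x"
proof -
 define a where "a = star A x *[A] x"
 have a: "A.pos a" unfolding a_def by (rule A.star_mult_pos[OF x])
 note ac = A.posD[OF a]
 define bt where "bt = cnorm B (h a)"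
 have bt0: "bt >= 0" using ac by (simp add: bt_def)
 define b where "b = A.rs bt -[A] a"
 have b: "b : carrier A" "star A b = b" using ac by (auto simp: b_def A.star_diff)
 have hb: "h b = B.rs bt -[B] h a" using ac by (simp add: b_def hom_diff hom_rs)
 have phb: "B.pos (h b)" unfolding hb using B.posD[OF hom_pos[OF a]] by (intro B.pos_norm_minus) (auto simp: bt_def)
 obtain r where r: "A.pos r" "r *[A] r = b *[A] b"
  "!!z. z : carrier A ==> z *[A] (b *[A] b) = (b *[A] b) *[A] z ==> z *[A] r = r *[A] z"
  using A.pos_sqrt[OF A.sq_pos[OF b]] by blast
 note rc = A.posD[OF r(1)]
 have br: "b *[A] r = r *[A] b" using r(3)[of b] b by (simp add: A.mult_assoc)
 have "h r = h b"
  using hom_pos[OF r(1)] phb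
   hom_simps(4)[OF rc(1) b(1)] hom_simps(4)[OF b(1) rc(1)] br
   hom_simps(4)[OF rc(1) rc(1)] hom_simps(4)[OF b(1) b(1)] r(2)
  by - (rule B.pos_sqrt_unique, auto)
 hence "r = b" using inj rc b by (auto dest: inj_onD)
 hence "A.pos (A.rs bt -[A] a)" using r(1) b_def by simp
 hence "cnorm A a <= bt" using A.pos_le_norm[OF a _ bt0] by simp
 also have "bt = (cnorm B (h x))\<^sup>2"
  using B.cnorm_cstar[of "h x"] x by (simp add: bt_def a_def hom_simps)
 finally have "(cnorm A x)\<^sup>2 <= (cnorm B (h x))\<^sup>2" using A.cnorm_cstar[OF x] by (simp add: a_def)
 thus ?thesis using hom_contractive[OF x] x by (simp add: power_mono_iff)
qed

end

section \<open>Sublinear functionals\<close>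

text \<open>Based on a carrier set because one instance is the hermitian part of a C*-algebra; the
  other is the space of all functions \<open>nat => complex\<close> over the reals.\<close>

locale real_space =
 fixes V :: "'v set" and pl :: "'v => 'v => 'v" and sc :: "real => 'v => 'v" and z :: 'v
 assumes pl_closed [simp]: "x : V ==> y : V ==> pl x y : V"
  and sc_closed [simp]: "x : V ==> sc c x : V"
  and z_closed [simp]: "z : V"
  and pl_assoc: "x : V ==> y : V ==> w : V ==> pl (pl x y) w = pl x (pl y w)"
  and pl_comm: "x : V ==> y : V ==> pl x y = pl y x"
  and pl_z: "x : V ==> pl x z = x"
  and sc_pl: "x : V ==> y : V ==> sc c (pl x y) = pl (sc c x) (sc c y)"
  and sc_add: "x : V ==> sc (a + b) x = pl (sc a x) (sc b x)"
  and sc_sc: "x : V ==> sc a (sc b x) = sc (a * b) x"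
  and sc_1: "x : V ==> sc 1 x = x"
  and sc_0: "x : V ==> sc 0 x = z"
begin

definition sublin :: "('v => real) => bool" where
 "sublin p \<longleftrightarrow> (ALL x:V. ALL y:V. p (pl x y) <= p x + p y) & (ALL x:V. ALL t>0. p (sc t x) <= t * p x)"

lemma sublinD:
 assumes "sublin p"
 shows "x : V ==> y : V ==> p (pl x y) <= p x + p y"
  and "x : V ==> t > 0 ==> p (sc t x) <= t * p x"
 using assms by (auto simp: sublin_def)

lemma sublin_scale:
 assumes p: "sublin p" and x: "x : V" and t: "t > 0"
 shows "p (sc t x) = t * p x"
proof -
 have "p (sc (1/t) (sc t x)) <= (1/t) * p (sc t x)"
  by (rule sublinD(2)[OF p]) (use x t in auto)
 hence "p x <= (1/t) * p (sc t x)" using x t by (simp add: sc_sc sc_1)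
 hence "t * p x <= p (sc t x)" using t by (simp add: field_simps)
 thus ?thesis using sublinD(2)[OF p x t] by linarith
qed

lemma sublin_z: assumes p: "sublin p" shows "p z = 0"
proof -
 have "sc 2 z = z" using sc_sc[of z 2 0] sc_0[of z] by simp
 thus ?thesis using sublin_scale[OF p z_closed, of 2] by simp
qed

lemma pl_neg: "x : V ==> pl x (sc (-1) x) = z"
 using sc_add[of x 1 "-1"] by (simp add: sc_1 sc_0)

lemma pl_neg_cancel: "x : V ==> y : V ==> pl (pl x y) (sc (-1) x) = y"
proof -
 assume x: "x : V" and y: "y : V"
 have "pl (pl x y) (sc (-1) x) = pl (pl y x) (sc (-1) x)" using pl_comm[OF x y] by simp
 also have "... = pl y (pl x (sc (-1) x))" by (rule pl_assoc) (use x y in auto)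
 also have "... = y" using x y by (simp add: pl_neg pl_z)
 finally show ?thesis .
qed

lemma sublin_neg: assumes p: "sublin p" and x: "x : V" shows "- p (sc (-1) x) <= p x"
 using sublinD(1)[OF p x, of "sc (-1) x"] x sublin_z[OF p] by (simp add: pl_neg)

text \<open>The usual lowering of a sublinear functional in the direction \<open>v\<close>: the
  result stays below \<open>p\<close> and is at most \<open>- p v\<close> at the negative of
  \<open>v\<close>. The value 0 off \<open>V\<close> lets functionals be compared as
  functions.\<close>

definition drop_along :: "('v => real) => 'v => 'v => real" where
 "drop_along p v x = (if x : V then INF t\<in>{0..}. p (pl x (sc t v)) - t * p v else 0)"

lemma drop_along_bdd:
 assumes p: "sublin p" and v: "v : V" and x: "x : V"
 shows "bdd_below ((%t. p (pl x (sc t v)) - t * p v) ` {0..})"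
proof (rule bdd_belowI2)
 fix t :: real assume "t : {0..}"
 hence t: "t >= 0" by simp
 have "t * p v = p (sc t v)"
  using sublin_scale[OF p v, of t] t v sublin_z[OF p] sc_0[OF v] by (cases "t = 0") auto
 also have "... = p (pl (pl x (sc t v)) (sc (-1) x))" using x v by (simp add: pl_neg_cancel)
 also have "... <= p (pl x (sc t v)) + p (sc (-1) x)" by (rule sublinD(1)[OF p]) (use x v in auto)
 finally show "- p (sc (-1) x) <= p (pl x (sc t v)) - t * p v" by linarith
qed

lemma drop_along_le:
 assumes "sublin p" "v : V" "x : V" "t >= 0"
 shows "drop_along p v x <= p (pl x (sc t v)) - t * p v"
 using cINF_lower[OF drop_along_bdd[OF assms(1-3)], of t] assms by (simp add: drop_along_def)

lemma drop_along_le_self: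
 assumes "sublin p" "v : V" "x : V"
 shows "drop_along p v x <= p x"
 using drop_along_le[OF assms, of 0] assms by (simp add: sc_0 pl_z)

lemma drop_along_approx:
 assumes "sublin p" "v : V" "x : V" "e > 0"
 obtains t where "t >= 0" "p (pl x (sc t v)) - t * p v < drop_along p v x + e"
proof -
 have "Inf ((%t. p (pl x (sc t v)) - t * p v) ` {0..}) < drop_along p v x + e"
  using assms by (simp add: drop_along_def)
 then obtain y where "y : (%t. p (pl x (sc t v)) - t * p v) ` {0..}" "y < drop_along p v x + e"
  using cInf_lessD[of "(%t. p (pl x (sc t v)) - t * p v) ` {0..}"] by auto
 thus ?thesis using that by auto
qed

lemma drop_along_sublin:
 assumes p: "sublin p" and v: "v : V"
 shows "sublin (drop_along p v)"
 unfolding sublin_def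
proof (intro conjI ballI allI impI)
 fix x y assume x: "x : V" and y: "y : V"
 show "drop_along p v (pl x y) <= drop_along p v x + drop_along p v y"
 proof (rule field_le_epsilon)
  fix e :: real assume "e > 0"
  hence e: "e/2 > 0" by simp
  obtain s where s: "s >= 0" "p (pl x (sc s v)) - s * p v < drop_along p v x + e/2"
   by (rule drop_along_approx[OF p v x e])
  obtain t where t: "t >= 0" "p (pl y (sc t v)) - t * p v < drop_along p v y + e/2"
   by (rule drop_along_approx[OF p v y e])
  have "pl (pl x y) (sc (s + t) v) = pl x (pl y (pl (sc s v) (sc t v)))"
   using x y v by (simp add: sc_add pl_assoc)
  also have "pl y (pl (sc s v) (sc t v)) = pl (sc s v) (pl y (sc t v))"
   using y v by (metis pl_assoc pl_comm sc_closed)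
  also have "pl x (pl (sc s v) (pl y (sc t v))) = pl (pl x (sc s v)) (pl y (sc t v))"
   using x y v by (simp add: pl_assoc)
  finally have "p (pl (pl x y) (sc (s + t) v)) <= p (pl x (sc s v)) + p (pl y (sc t v))"
   using sublinD(1)[OF p, of "pl x (sc s v)" "pl y (sc t v)"] x y v by simp
  moreover have "drop_along p v (pl x y) <= p (pl (pl x y) (sc (s + t) v)) - (s + t) * p v"
   using s t x y by (intro drop_along_le[OF p v]) auto
  ultimately show "drop_along p v (pl x y) <= drop_along p v x + drop_along p v y + e"
   using s t by (simp add: algebra_simps)
 qed
next
 fix x and c :: real assume x: "x : V" and c: "c > 0"
 show "drop_along p v (sc c x) <= c * drop_along p v x"
 proof (rule field_le_epsilon)
  fix e :: real assume "e > 0"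
  hence e: "e/c > 0" using c by simp
  obtain s where s: "s >= 0" "p (pl x (sc s v)) - s * p v < drop_along p v x + e/c"
   by (rule drop_along_approx[OF p v x e])
  have "pl (sc c x) (sc (c * s) v) = sc c (pl x (sc s v))" using x v by (simp add: sc_pl sc_sc)
  hence "p (pl (sc c x) (sc (c * s) v)) = c * p (pl x (sc s v))"
   using sublin_scale[OF p, of "pl x (sc s v)" c] x v c by simp
  moreover have "drop_along p v (sc c x) <= p (pl (sc c x) (sc (c * s) v)) - (c * s) * p v"
   using s x c by (intro drop_along_le[OF p v]) auto
  moreover have "c * (p (pl x (sc s v)) - s * p v) <= c * (drop_along p v x + e/c)"
   using s c by (intro mult_left_mono) auto
  ultimately show "drop_along p v (sc c x) <= c * drop_along p v x + e"
   using c by (simp add: algebra_simps)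
 qed
qed

text \<open>A minimal sublinear functional is linear, since \<open>drop_along m v \<le> m\<close> must be an equality
  for every \<open>v\<close>.\<close>

theorem dominated_linear_functional:
 assumes p: "sublin p" and v0: "v0 : V"
 obtains l where "!!x y. x : V ==> y : V ==> l (pl x y) = l x + l y"
  "!!c x. x : V ==> l (sc c x) = c * l x" "!!x. x : V ==> l x <= p x" "l v0 = p v0"
proof -
 \<comment> \<open>A functional below \<open>p'\<close> is at most \<open>- p v0\<close> at the
   negative of \<open>v0\<close>; for a linear one this means at least \<open>p v0\<close> at
   \<open>v0\<close>.\<close>
 define p' where "p' = drop_along p v0"
 have p': "sublin p'" unfolding p'_def by (rule drop_along_sublin[OF p v0])
 \<comment> \<open>The functionals vanish off \<open>V\<close>, so that minimality can conclude
   equality of functions.\<close>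
 define S where "S = {q. sublin q & (ALL x:V. q x <= p' x) & (ALL x. x \<notin> V --> q x = 0)}"
 let ?P = "%a b. ALL x. (b x :: real) <= a (x :: 'v)"
 have p'S: "p' : S" using p' by (auto simp: S_def p'_def drop_along_def)
 have "EX m:S. ALL a:S. ?P m a --> a = m"
 proof (rule predicate_Zorn)
  show "partial_order_on S (relation_of ?P S)"
   by (rule partial_order_on_relation_ofI) (auto intro: order_trans intro!: ext antisym)
  fix C assume C: "C : Chains (relation_of ?P S)"
  hence CS: "C \<subseteq> S" and tot: "!!a b. a : C ==> b : C ==> ?P a b \<or> ?P b a"
   by (auto simp: Chains_def relation_of_def)
  show "EX u:S. ALL a:C. ?P a u"
  proof (cases "C = {}")
   case True thus ?thesis using p'S by auto
  next
   case False
   then obtain q0 where q0: "q0 : C" by auto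
   define u where "u x = (if x : V then INF q\<in>C. q x else 0)" for x
   have bdd: "bdd_below ((%q. q x) ` C)" if x: "x : V" for x
   proof (rule bdd_belowI2)
    fix q assume "q : C"
    hence q: "sublin q" "ALL x:V. q x <= p' x" using CS by (auto simp: S_def)
    have "q (sc (-1) x) <= p' (sc (-1) x)" using q(2) sc_closed[OF x] by blast
    thus "- p' (sc (-1) x) <= q x" using sublin_neg[OF q(1) x] by linarith
   qed
   have ule: "u x <= q x" if "x : V" "q : C" for x q
    using cINF_lower[OF bdd[OF that(1)] that(2)] that by (simp add: u_def)
   have uap: "EX q:C. q x < u x + e" if "x : V" "e > 0" for x e
   proof -
    have "Inf ((%q. q x) ` C) < u x + e" using that by (simp add: u_def)
    thus ?thesis using cInf_lessD[of "(%q. q x) ` C"] False by auto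
   qed
   have "sublin u"
    unfolding sublin_def
   proof (intro conjI ballI allI impI)
    fix x y assume x: "x : V" and y: "y : V"
    show "u (pl x y) <= u x + u y"
    proof (rule field_le_epsilon)
     fix e :: real assume "e > 0"
     hence e: "e/2 > 0" by simp
     obtain q1 where q1: "q1 : C" "q1 x < u x + e/2" using uap[OF x e] by auto
     obtain q2 where q2: "q2 : C" "q2 y < u y + e/2" using uap[OF y e] by auto
     \<comment> \<open>Comparability within the chain yields one member that is good at both points;
       this is where the infimum needs a chain.\<close>
     obtain q where q: "q : C" "q x <= q1 x" "q y <= q2 y"
      using tot[OF q1(1) q2(1)] q1(1) q2(1) by blast
     have "sublin q" using q CS by (auto simp: S_def)
     hence "q (pl x y) <= q x + q y" by (rule sublinD(1)) (use x y in auto)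
     moreover have "u (pl x y) <= q (pl x y)" by (rule ule) (use x y q in auto)
     ultimately show "u (pl x y) <= u x + u y + e" using q q1 q2 by linarith
    qed
   next
    fix x and t :: real assume x: "x : V" and t: "t > 0"
    show "u (sc t x) <= t * u x"
    proof (rule field_le_epsilon)
     fix e :: real assume "e > 0"
     hence e: "e/t > 0" using t by simp
     obtain q where q: "q : C" "q x < u x + e/t" using uap[OF x e] by auto
     have "sublin q" using q CS by (auto simp: S_def)
     hence "q (sc t x) <= t * q x" by (rule sublinD(2)) (use x t in auto)
     moreover have "u (sc t x) <= q (sc t x)" by (rule ule) (use x q in auto)
     moreover have "t * q x <= t * (u x + e/t)" using q t by (intro mult_left_mono) auto
     ultimately show "u (sc t x) <= t * u x + e" using t by (simp add: algebra_simps)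
    qed
   qed
   moreover have "ALL x:V. u x <= p' x"
    using ule[OF _ q0] q0 CS by (fastforce simp: S_def)
   ultimately have "u : S" by (auto simp: S_def u_def)
   moreover have "ALL a:C. ?P a u"
   proof (intro ballI allI)
    fix a x assume a: "a : C"
    show "u x <= a x" using ule[OF _ a, of x] a CS by (cases "x : V") (auto simp: S_def u_def)
   qed
   ultimately show ?thesis by blast
  qed
 qed
 then obtain m where m: "m : S" and min: "!!a. a : S ==> (!!x. a x <= m x) ==> a = m" by blast
 have ms: "sublin m" and mp: "!!x. x : V ==> m x <= p' x" and mo: "!!x. x \<notin> V ==> m x = 0"
  using m by (auto simp: S_def)
 have add: "m (pl x v) = m x + m v" if x: "x : V" and v: "v : V" for x v
 proof (rule antisym)
  show "m (pl x v) <= m x + m v" by (rule sublinD(1)[OF ms x v])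
  have le: "drop_along m v y <= m y" for y
   using drop_along_le_self[OF ms v, of y] mo[of y] by (cases "y : V") (auto simp: drop_along_def)
  have "ALL x:V. drop_along m v x <= p' x" using le mp order_trans by blast
  moreover have "ALL x. x \<notin> V --> drop_along m v x = 0" by (simp add: drop_along_def)
  ultimately have "drop_along m v : S" unfolding S_def using drop_along_sublin[OF ms v] by blast
  hence "drop_along m v = m" using min le by blast
  thus "m x + m v <= m (pl x v)" using drop_along_le[OF ms v x, of 1] v by (simp add: sc_1)
 qed
 have neg: "m (sc (-1) x) = - m x" if "x : V" for x
  using add[OF that, of "sc (-1) x"] that sublin_z[OF ms] by (simp add: pl_neg)
 have scale: "m (sc c x) = c * m x" if x: "x : V" for c x
 proof -
  consider "c = 0" | "c > 0" | "- c > 0" by linarith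
  thus ?thesis
  proof cases
   case 1 thus ?thesis using x sublin_z[OF ms] by (simp add: sc_0)
  next
   case 2 thus ?thesis using sublin_scale[OF ms x] by simp
  next
   case 3
   have "sc c x = sc (-1) (sc (-c) x)" using x by (simp add: sc_sc)
   thus ?thesis using neg[of "sc (-c) x"] sublin_scale[OF ms x 3] x by simp
  qed
 qed
 have le: "m x <= p x" if "x : V" for x
  using mp[OF that] drop_along_le_self[OF p v0 that] by (simp add: p'_def)
 have "p' (sc (-1) v0) <= p (pl (sc (-1) v0) (sc 1 v0)) - 1 * p v0"
  unfolding p'_def by (rule drop_along_le[OF p v0]) (use v0 in auto)
 also have "pl (sc (-1) v0) (sc 1 v0) = z" using v0 by (simp add: sc_1 pl_comm[of "sc (-1) v0" v0] pl_neg)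
 finally have "m v0 >= p v0" using mp[of "sc (-1) v0"] neg[OF v0] v0 sublin_z[OF p] by simp
 hence "m v0 = p v0" using le[OF v0] by linarith
 show ?thesis by (rule that[of m, OF add scale le `m v0 = p v0`])
qed

end

section \<open>Positive functionals\<close>

context unital_cstar_algebra
begin

text \<open>Positive functionals without normalisation at the unit. The constant 2 is what separate
  estimates of the real and imaginary parts give.\<close>

definition pos_functional :: "('a => complex) => bool" where
 "pos_functional f \<longleftrightarrow>
  (ALL x:carrier A. ALL y:carrier A. f (x +. y) = f x + f y) &
  (ALL c. ALL x:carrier A. f (c *. x) = c * f x) &
  (ALL x:carrier A. f (star A x) = cnj (f x)) &
  (ALL x:carrier A. 0 <= Re (f (star A x ** x))) &
  (ALL x:carrier A. cmod (f x) <= 2 * cnorm A x)"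

text \<open>Upper bounds of a hermitian element in the order given by \<open>pos\<close>. Their
  infimum, the largest spectral value, is the sublinear functional used for Hahn-Banach.\<close>

definition upper_bounds :: "'a => real set" where
 "upper_bounds a = {t. pos (rs t -. a)}"

lemma pos_rs_iff: "pos (rs t) ==> t >= 0"
proof (rule ccontr)
 assume t: "pos (rs t)" "\<not> t >= 0"
 hence "pos (\<ominus> (rs t))" using pos_rs[of "-t"] by (simp add: rs_minus)
 hence "rs t = \<zero>" using pos_antisym[OF t(1)] by simp
 hence "\<bar>t\<bar> = 0" using nm_rs[of t] by simp
 thus False using t by simp
qed

lemma rs_cancel: "a : carrier A ==> (rs t -. a) +. (rs s +. a) = rs (t + s)"
 unfolding rs_add using rs_closed[of t] rs_closed[of s] by algebra

lemma pos_plus_norm: "a : carrier A ==> star A a = a ==> pos (rs (cnorm A a) +. a)"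
 using pos_norm_minus[of "\<ominus> a" "cnorm A a"] by (simp add: star_minus a_minus_def)

lemma upper_bounds_bdd:
 assumes "a : carrier A" "star A a = a"
 shows "bdd_below (upper_bounds a)"
proof (rule bdd_belowI)
 fix t assume "t : upper_bounds a"
 hence "pos ((rs t -. a) +. (rs (cnorm A a) +. a))"
  by (intro pos_add[OF _ pos_plus_norm[OF assms]]) (simp add: upper_bounds_def)
 hence "t + cnorm A a >= 0" using rs_cancel[OF assms(1)] pos_rs_iff by simp
 thus "- cnorm A a <= t" by simp
qed

lemma upper_bounds_norm: "a : carrier A ==> star A a = a ==> cnorm A a : upper_bounds a"
 using pos_norm_minus[of a "cnorm A a"] by (simp add: upper_bounds_def)

text \<open>A linear functional below the infimum of the upper bounds is nonpositive on negatives of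
  positive elements, hence positive. Equality with the infimum at \<open>star A c ** c\<close> gives
  the squared norm, because an upper bound of a positive element bounds its norm.\<close>

lemma exists_pos_functional:
 assumes c: "c : carrier A"
 obtains f where "pos_functional f" "Re (f (star A c ** c)) = (cnorm A c)\<^sup>2"
proof -
 let ?V = "{a : carrier A. star A a = a}"
 interpret R: real_space ?V "add A" "%t. module.smult A (cr t)" \<zero>
  by unfold_locales
   (auto simp: star_add star_smult M.a_ac sm_add_right sm_add_left sm_assoc)
 define p where "p a = Inf (upper_bounds a)" for a
 have lower: "p a <= t" if "a : carrier A" "star A a = a" "pos (rs t -. a)" for a t
  unfolding p_def by (rule cInf_lower[OF _ upper_bounds_bdd]) (use that in \<open>auto simp: upper_bounds_def\<close>)
 have approx: "EX t. pos (rs t -. a) & t < p a + e" if "a : carrier A" "star A a = a" "e > 0" for a e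
  using cInf_lessD[of "upper_bounds a" "p a + e"] upper_bounds_norm[OF that(1,2)] that(3)
  by (auto simp: p_def upper_bounds_def)
 have sub: "R.sublin p"
  unfolding R.sublin_def
 proof (intro conjI ballI allI impI)
  fix x y assume x: "x : ?V" and y: "y : ?V"
  show "p (x +. y) <= p x + p y"
  proof (rule field_le_epsilon)
   fix e :: real assume "e > 0"
   hence e: "e/2 > 0" by simp
   obtain s where s: "pos (rs s -. x)" "s < p x + e/2" using approx[of x "e/2"] x e by auto
   obtain t where t: "pos (rs t -. y)" "t < p y + e/2" using approx[of y "e/2"] y e by auto
   have "pos ((rs s -. x) +. (rs t -. y))" by (rule pos_add[OF s(1) t(1)])
   also have "(rs s -. x) +. (rs t -. y) = rs (s + t) -. (x +. y)"
    using x y by (simp add: rs_add add_diff_add)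
   finally have "p (x +. y) <= s + t" using x y by (intro lower) (auto simp: star_add)
   thus "p (x +. y) <= p x + p y + e" using s t by linarith
  qed
 next
  fix x and c :: real assume x: "x : ?V" and c: "c > 0"
  show "p (cr c *. x) <= c * p x"
  proof (rule field_le_epsilon)
   fix e :: real assume "e > 0"
   hence e: "e/c > 0" using c by simp
   obtain s where s: "pos (rs s -. x)" "s < p x + e/c" using approx[of x "e/c"] x e by auto
   have "pos (cr c *. (rs s -. x))" using c by (intro pos_smult[OF s(1)]) simp
   also have "cr c *. (rs s -. x) = rs (c * s) -. cr c *. x"
    using x by (simp add: sm_diff_right sm_rs)
   finally have "p (cr c *. x) <= c * s" using x by (intro lower) (auto simp: star_smult)
   also have "c * s <= c * (p x + e/c)" using s c by (intro mult_left_mono) auto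
   finally show "p (cr c *. x) <= c * p x + e" using c by (simp add: algebra_simps)
  qed
 qed
 let ?cc = "star A c ** c"
 have cc: "pos ?cc" by (rule star_mult_pos[OF c])
 note ccD = posD[OF cc]
 obtain l where l: "!!x y. x : ?V ==> y : ?V ==> l (x +. y) = l x + l y"
  "!!c x. x : ?V ==> l (cr c *. x) = c * l x" "!!x. x : ?V ==> l x <= p x"
  "l ?cc = p ?cc"
  by (rule R.dominated_linear_functional[OF sub, of ?cc]) (use ccD in simp, rule that)
 have lneg: "l (\<ominus> x) = - l x" if "x : ?V" for x
  using l(2)[OF that, of "-1"] that by (simp add: sm_minus_one)
 have lpos: "l a >= 0" if a: "pos a" for a
 proof -
  note aD = posD[OF a]
  have "p (\<ominus> a) <= 0" using aD a by (intro lower) (auto simp: star_minus a_minus_def)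
  moreover have "l (\<ominus> a) <= p (\<ominus> a)" using aD by (intro l(3)) (auto simp: star_minus)
  ultimately show ?thesis using lneg[of a] aD by simp
 qed
 have lnorm: "\<bar>l a\<bar> <= cnorm A a" if a: "a : ?V" for a
 proof -
  have *: "l b <= cnorm A b" if b: "b : ?V" for b
   using l(3)[OF b] lower[of b "cnorm A b"] upper_bounds_norm[of b] b by (simp add: upper_bounds_def)
  show ?thesis using *[OF a] *[of "\<ominus> a"] lneg[OF a] a by (simp add: star_minus abs_le_iff)
 qed
 have lcc: "l ?cc = (cnorm A c)\<^sup>2"
 proof (rule antisym)
  show "l ?cc <= (cnorm A c)\<^sup>2" using lnorm[of ?cc] ccD cnorm_cstar[OF c] by simp
  have "(cnorm A c)\<^sup>2 <= t" if t: "t : upper_bounds ?cc" for t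
  proof -
   have tp: "pos (rs t -. ?cc)" using t by (simp add: upper_bounds_def)
   hence "pos ((rs t -. ?cc) +. (rs 0 +. ?cc))" using tp cc ccD by (simp add: pos_add)
   hence "t >= 0" using rs_cancel[OF ccD(1), of t 0] pos_rs_iff[of t] by simp
   thus ?thesis using pos_le_norm[OF cc tp] cnorm_cstar[OF c] by simp
  qed
  thus "(cnorm A c)\<^sup>2 <= l ?cc"
   unfolding l(4) p_def using upper_bounds_norm[OF ccD] by (intro cInf_greatest) auto
 qed
 \<comment> \<open>Complex-linear extension: \<open>l\<close> is applied to the hermitian real and
   imaginary parts separately.\<close>
 define re where "re x = (1/2 :: complex) *. (x +. star A x)" for x
 define im where "im x = (- \<i> / 2) *. (x -. star A x)" for x
 note ri = re_im_decomp[folded re_def im_def]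
 have V: "re x : ?V" "im x : ?V" if "x : carrier A" for x using ri(1-4)[OF that] by auto
 have re_add: "re (x +. y) = re x +. re y" "im (x +. y) = im x +. im y"
  if "x : carrier A" "y : carrier A" for x y
  using that by (simp_all add: re_def im_def star_add sm_add_right[symmetric] add_diff_add M.a_ac)
 have re_real: "re (cr t *. x) = cr t *. re x"
  "im (cr t *. x) = cr t *. im x" if "x : carrier A" for x t
  using that by (simp_all add: re_def im_def star_smult sm_add_right sm_diff_right sm_assoc mult.commute)
 have re_i: "re (\<i> *. x) = \<ominus> (im x)" "im (\<i> *. x) = re x" if x: "x : carrier A" for x
 proof -
  have s: "star A (\<i> *. x) = \<ominus> (\<i> *. star A x)" using x by (simp add: star_smult sm_uminus_left)
  have "re (\<i> *. x) = (1/2) *. (\<i> *. (x -. star A x))"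
   unfolding re_def s a_minus_def[symmetric] using x by (simp only: sm_diff_right star_closed)
  also have "... = \<ominus> (im x)"
   using x by (simp add: im_def sm_assoc sm_uminus_left)
  finally show "re (\<i> *. x) = \<ominus> (im x)" .
  have "im (\<i> *. x) = (- \<i> / 2) *. (\<i> *. (x +. star A x))"
   unfolding im_def s using x by (simp add: sm_add_right a_minus_def)
  thus "im (\<i> *. x) = re x" using x by (simp add: re_def sm_assoc)
 qed
 define f where "f x = Complex (l (re x)) (l (im x))" for x
 have f_add: "f (x +. y) = f x + f y" if "x : carrier A" "y : carrier A" for x y
  using that V by (simp add: f_def re_add l(1) complex_eq_iff)
 have f_real: "f (cr t *. x) = cr t * f x" if "x : carrier A" for t x
  using that V by (simp add: f_def re_real l(2) complex_eq_iff)
 have f_i: "f (\<i> *. x) = \<i> * f x" if "x : carrier A" for x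
  using that V by (simp add: f_def re_i lneg complex_eq_iff)
 have f_smult: "f (k *. x) = k * f x" if x: "x : carrier A" for k x
 proof -
  have "k = cr (Re k) + cr (Im k) * \<i>" by (simp add: complex_eq_iff)
  hence "k *. x = cr (Re k) *. x +. cr (Im k) *. (\<i> *. x)"
   using x by (metis sm_add_left sm_assoc)
  hence "f (k *. x) = cr (Re k) * f x + cr (Im k) * (\<i> * f x)"
   using x by (simp only: f_add f_real f_i sm_closed)
  also have "... = k * f x" by (simp add: complex_eq_iff algebra_simps)
  finally show ?thesis .
 qed
 have f_herm: "f a = cr (l a)" if a: "a : ?V" for a
 proof -
  have "re a = a" using a by (simp add: re_def sm_add_right)
  moreover have "im a = \<zero>" using a by (simp add: im_def)
  moreover have "l \<zero> = 0" using l(2)[of a 0] a by simp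
  ultimately show ?thesis by (simp add: f_def complex_eq_iff)
 qed
 have f_star: "f (star A x) = cnj (f x)" if x: "x : carrier A" for x
 proof -
  have "re (star A x) = re x" using x by (simp add: re_def M.a_comm)
  moreover have "im (star A x) = \<ominus> (im x)"
   using x by (simp add: im_def sm_minus_right[symmetric] uminus_diff)
  ultimately show ?thesis using V[OF x] lneg by (simp add: f_def complex_eq_iff)
 qed
 have "pos_functional f"
  unfolding pos_functional_def
 proof (intro conjI ballI allI)
  fix x assume x: "x : carrier A"
  have "pos (star A x ** x)" by (rule star_mult_pos[OF x])
  thus "0 <= Re (f (star A x ** x))" using f_herm[of "star A x ** x"] lpos posD by auto
  have "cmod (f x) <= \<bar>l (re x)\<bar> + \<bar>l (im x)\<bar>" using cmod_le[of "f x"] by (simp add: f_def)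
  also have "... <= cnorm A x + cnorm A x"
   using lnorm[OF V(1)[OF x]] lnorm[OF V(2)[OF x]] ri(6,7)[OF x] by linarith
  finally show "cmod (f x) <= 2 * cnorm A x" by simp
 qed (auto simp: f_add f_smult f_star)
 moreover have "Re (f ?cc) = (cnorm A c)\<^sup>2" using f_herm[of ?cc] ccD lcc by simp
 ultimately show ?thesis by (rule that)
qed

lemma pos_functionalD:
 assumes "pos_functional f"
 shows "x : carrier A ==> y : carrier A ==> f (x +. y) = f x + f y"
  and "x : carrier A ==> f (c *. x) = c * f x"
  and "x : carrier A ==> f (star A x) = cnj (f x)"
  and "x : carrier A ==> 0 <= Re (f (star A x ** x))"
  and "x : carrier A ==> cmod (f x) <= 2 * cnorm A x"
 using assms by (auto simp: pos_functional_def)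

lemma pos_functional_zero: "pos_functional f ==> f \<zero> = 0"
 using pos_functionalD(2)[of f \<zero> 0] by simp

lemma pos_functional_minus: "pos_functional f ==> x : carrier A ==> f (\<ominus> x) = - f x"
 using pos_functionalD(2)[of f x "-1"] by (simp add: sm_minus_one)

lemma pos_functional_diff: "pos_functional f ==> x : carrier A ==> y : carrier A ==> f (x -. y) = f x - f y"
 by (simp add: a_minus_def pos_functionalD(1) pos_functional_minus)

lemma pos_functional_self:
 assumes f: "pos_functional f" and x: "x : carrier A"
 shows "f (star A x ** x) = cr (Re (f (star A x ** x)))"
proof -
 have "cnj (f (star A x ** x)) = f (star A x ** x)"
  using pos_functionalD(3)[OF f, of "star A x ** x"] x by (simp add: star_mult)
 thus ?thesis by (simp add: complex_eq_iff)
qed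

text \<open>The parallelogram law with one nonnegative term dropped; it stands in for the triangle
  inequality of the seminorm and avoids square roots.\<close>

lemma parallelogram:
 assumes f: "pos_functional f" and a: "a : carrier A" and b: "b : carrier A"
 shows "Re (f (star A (a +. b) ** (a +. b))) <= 2 * Re (f (star A a ** a)) + 2 * Re (f (star A b ** b))"
proof -
 have "Re (f (star A (a +. b) ** (a +. b))) + Re (f (star A (a -. b) ** (a -. b)))
   = 2 * Re (f (star A a ** a)) + 2 * Re (f (star A b ** b))"
  using a b by (simp add: star_add star_diff mult_add_left mult_add_right mult_diff_left mult_diff_right
    pos_functionalD(1)[OF f] pos_functional_diff[OF f])
 moreover have "0 <= Re (f (star A (a -. b) ** (a -. b)))" using a b by (intro pos_functionalD(4)[OF f]) simp
 ultimately show ?thesis by linarith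
qed

text \<open>The functional \<open>\<Sum> 2\<^sup>-\<^sup>i f\<^sub>i\<close>, where \<open>f\<^sub>i\<close> attains \<open>\<parallel>c\<^sub>i\<parallel>\<^sup>2\<close> at \<open>c\<^sub>i\<^sup>*c\<^sub>i\<close> for a dense
  sequence \<open>c\<close>, is faithful.\<close>

lemma exists_faithful_functional:
 assumes sep: "separable_cstar A"
 obtains f where "pos_functional f" "!!x. x : carrier A ==> Re (f (star A x ** x)) = 0 ==> x = \<zero>"
proof -
 obtain S where S: "countable S" "S \<subseteq> carrier A" "!!x e. x : carrier A ==> e > 0 ==> EX s:S. cdist A x s < e"
  using sep unfolding separable_cstar_def by blast
 have "S ~= {}" using S(3)[of \<zero> 1] by auto
 then obtain c :: "nat => 'a" where c: "range c = S" using range_from_nat_into[OF _ S(1)] by blast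
 have cc: "c i : carrier A" for i using c S(2) by auto
 have "EX g. pos_functional g & Re (g (star A (c i) ** c i)) = (cnorm A (c i))\<^sup>2" for i
  by (rule exists_pos_functional[OF cc[of i]]) blast
 then obtain g where g: "!!i. pos_functional (g i)" "!!i. Re (g i (star A (c i) ** c i)) = (cnorm A (c i))\<^sup>2"
  by metis
 define h where "h x i = cr ((1/2) ^ Suc i) * g i x" for x i
 have hb: "cmod (h x i) <= (1/2) ^ Suc i * (2 * cnorm A x)" if "x : carrier A" for x i
  using pos_functionalD(5)[OF g(1) that, of i] unfolding h_def norm_mult norm_of_real
  by (intro mult_mono) auto
 have hs: "(%i. (1/2) ^ Suc i * (2 * r)) sums (2 * r)" for r :: real
  using sums_mult2[OF power_half_series, of "2 * r"] by simp
 have sm: "summable (h x)" if "x : carrier A" for x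
  by (rule summable_comparison_test'[OF sums_summable[OF hs[of "cnorm A x"]], of 0]) (use hb[OF that] in auto)
 define f where "f x = suminf (h x)" for x
 have self: "h (star A x ** x) i = cr ((1/2) ^ Suc i * Re (g i (star A x ** x)))"
  if "x : carrier A" for x i
  using pos_functional_self[OF g(1) that, of i] by (simp add: h_def)
 have Re_f: "summable (%i. (1/2) ^ Suc i * Re (g i (star A x ** x)))"
  "Re (f (star A x ** x)) = (\<Sum>i. (1/2) ^ Suc i * Re (g i (star A x ** x)))" if x: "x : carrier A" for x
 proof -
  have xx: "star A x ** x : carrier A" using x by simp
  show "summable (%i. (1/2) ^ Suc i * Re (g i (star A x ** x)))"
   using summable_Re[OF sm[OF xx]] by (simp add: self[OF x])
  show "Re (f (star A x ** x)) = (\<Sum>i. (1/2) ^ Suc i * Re (g i (star A x ** x)))"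
  proof -
   have "Re (f (star A x ** x)) = (\<Sum>i. Re (h (star A x ** x) i))"
    unfolding f_def by (rule Re_suminf[OF sm[OF xx]])
   thus ?thesis by (simp only: self[OF x] Re_complex_of_real)
  qed
 qed
 have f: "pos_functional f"
  unfolding pos_functional_def
 proof (intro conjI ballI allI)
  fix x assume x: "x : carrier A"
  fix y assume y: "y : carrier A"
  have "h (x +. y) = (%i. h x i + h y i)" using x y pos_functionalD(1)[OF g(1)] by (auto simp: h_def algebra_simps)
  thus "f (x +. y) = f x + f y" using suminf_add[OF sm[OF x] sm[OF y]] by (simp add: f_def)
 next
  fix k x assume x: "x : carrier A"
  have "h (k *. x) = (%i. k * h x i)" using x pos_functionalD(2)[OF g(1)] by (auto simp: h_def)
  thus "f (k *. x) = k * f x" using suminf_mult[OF sm[OF x], of k] by (simp add: f_def)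
 next
  fix x assume x: "x : carrier A"
  have "h (star A x) = (%i. cnj (h x i))" using x pos_functionalD(3)[OF g(1)] by (auto simp: h_def)
  moreover have "(%i. cnj (h x i)) sums cnj (suminf (h x))"
   using summable_sums[OF sm[OF x]] by (simp add: sums_cnj)
  ultimately show "f (star A x) = cnj (f x)" by (simp add: f_def sums_iff)
  show "0 <= Re (f (star A x ** x))"
   unfolding Re_f(2)[OF x] using pos_functionalD(4)[OF g(1) x] by (intro suminf_nonneg Re_f(1)[OF x]) simp
  have "norm (suminf (h x)) <= (\<Sum>i. (1/2) ^ Suc i * (2 * cnorm A x))"
   by (rule norm_suminf_le) (use hb[OF x] hs sums_summable in auto)
  thus "cmod (f x) <= 2 * cnorm A x" using hs[of "cnorm A x"] by (simp add: f_def sums_iff)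
 qed
 have faith: "x = \<zero>" if x: "x : carrier A" and f0: "Re (f (star A x ** x)) = 0" for x
 proof -
  have z: "Re (g i (star A x ** x)) = 0" for i
  proof -
   have "(\<Sum>i. (1/2) ^ Suc i * Re (g i (star A x ** x))) = 0" using f0 Re_f(2)[OF x] by simp
   hence "ALL i. (1/2) ^ Suc i * Re (g i (star A x ** x)) = 0"
    by (subst (asm) suminf_eq_zero_iff[OF Re_f(1)[OF x]]) (use pos_functionalD(4)[OF g(1) x] in auto)
   thus ?thesis by simp
  qed
  \<comment> \<open>Choose \<open>c i\<close> within \<open>e/4\<close> of \<open>x\<close>. As
    \<open>g i\<close> vanishes at \<open>star A x ** x\<close>, the parallelogram estimate bounds
    the norm of \<open>c i\<close> by twice the distance, so the norm of \<open>x\<close> is below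
    three times \<open>e/4\<close>.\<close>
  have "cnorm A x <= 0 + e" if e: "e > 0" for e
  proof -
   obtain i where i: "cnorm A (x -. c i) < e / 4" using S(3)[OF x, of "e/4"] e c unfolding cdist_def by auto
   have "c i = x +. (c i -. x)" using x cc[of i] by (simp add: M.a_comm[of x] diff_add_cancel)
   hence "(cnorm A (c i))\<^sup>2 <= 2 * Re (g i (star A x ** x)) + 2 * Re (g i (star A (c i -. x) ** (c i -. x)))"
    using parallelogram[OF g(1) x, of "c i -. x" i] g(2)[of i] x cc[of i] by simp
   also have "... <= 2 * cmod (g i (star A (c i -. x) ** (c i -. x)))"
    using z[of i] complex_Re_le_cmod by simp
   also have "... <= 2 * (2 * cnorm A (star A (c i -. x) ** (c i -. x)))"
    using pos_functionalD(5)[OF g(1), of "star A (c i -. x) ** (c i -. x)" i] x cc[of i] by simp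
   also have "... = (2 * cnorm A (c i -. x))\<^sup>2" using x cc[of i] by (simp add: cnorm_cstar power_mult_distrib)
   finally have "cnorm A (c i) <= 2 * cnorm A (c i -. x)"
    by (rule power2_le_imp_le) (use x cc[of i] in simp)
   thus ?thesis using e i nm_le_diff[OF x cc[of i]] nm_diff_commute[OF x cc[of i]] by linarith
  qed
  hence "cnorm A x <= 0" by (rule field_le_epsilon)
  thus ?thesis using cnorm_eq_zero[OF x] nm_nonneg[OF x] by linarith
 qed
 show ?thesis by (rule that[OF f faith])
qed

end

section \<open>The corona of a sequence of matrix algebras\<close>

lemma mat_prod_simps:
 "carrier (mat_prod n) = {Y. (ALL k. Y k : cmat (n k) (n k)) & bdd_above (range (%k. opn (Y k)))}"
 "monoid.mult (mat_prod n) = (%Y Z k. Y k * Z k)"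
 "one (mat_prod n) = (%k. 1\<^sub>m (n k))"
 "zero (mat_prod n) = (%k. 0\<^sub>m (n k) (n k))"
 "add (mat_prod n) = (%Y Z k. Y k + Z k)"
 "module.smult (mat_prod n) = (%c Y k. c *m Y k)"
 "star (mat_prod n) = (%Y k. adj (Y k))"
 "cnorm (mat_prod n) = (%Y. SUP k. opn (Y k))"
 by (simp_all add: mat_prod_def)

definition mprod :: "(nat => nat) => (nat => complex mat) set" where
 "mprod n = carrier (mat_prod n)"

lemma mprodI:
 assumes "!!k. Y k : cmat (n k) (n k)" "!!k. opn (Y k) <= B"
 shows "Y : mprod n"
 using assms by (auto simp: mprod_def mat_prod_simps(1) intro!: bdd_aboveI2)

lemma sup_opnorm_bdd: "Y : mprod n ==> bdd_above (range (%k. opn (Y k)))"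
 by (simp add: mprod_def mat_prod_simps(1))

lemma mpm [simp]: "Y : mprod n ==> Y k : cmat (n k) (n k)"
 by (simp add: mprod_def mat_prod_simps)

lemma mprod_dim [simp]: "Y : mprod n ==> dim_row (Y k) = n k" "Y : mprod n ==> dim_col (Y k) = n k"
 using mpm by blast+

lemma mprod_bound:
 assumes "Y : mprod n"
 obtains B where "!!k. opn (Y k) <= B" "B >= 0"
proof -
 obtain B where le: "ALL x:range (%k. opn (Y k)). x <= B"
  using sup_opnorm_bdd[OF assms] unfolding bdd_above_def ..
 have B: "opn (Y k) <= B" for k using le by (rule bspec) (rule rangeI)
 thus ?thesis using that[of B] order_trans[OF opnorm_nonneg[of "Y 0"] B[of 0]] by blast
qed

lemma mprod_add [simp]: "Y : mprod n ==> Z : mprod n ==> (%k. Y k + Z k) : mprod n"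
proof -
 assume Y: "Y : mprod n" and Z: "Z : mprod n"
 obtain B where B: "!!k. opn (Y k) <= B" using mprod_bound[OF Y] by blast
 obtain B' where B': "!!k. opn (Z k) <= B'" using mprod_bound[OF Z] by blast
 show ?thesis
 proof (rule mprodI)
  fix k show "opn (Y k + Z k) <= B + B'"
   using opnorm_add[OF mpm[OF Y] mpm[OF Z], of k] B[of k] B'[of k] by linarith
 qed (use Y Z in simp)
qed

lemma mprod_minus [simp]: "Y : mprod n ==> Z : mprod n ==> (%k. Y k - Z k) : mprod n"
proof -
 assume Y: "Y : mprod n" and Z: "Z : mprod n"
 obtain B where B: "!!k. opn (Y k) <= B" using mprod_bound[OF Y] by blast
 obtain B' where B': "!!k. opn (Z k) <= B'" using mprod_bound[OF Z] by blast
 show ?thesis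
 proof (rule mprodI)
  fix k show "opn (Y k - Z k) <= B + B'"
   using opnorm_minus[OF mpm[OF Y] mpm[OF Z], of k] B[of k] B'[of k] by linarith
  show "Y k - Z k : cmat (n k) (n k)" by (rule minus_carrier_mat) (use Z in simp)
 qed
qed

lemma mprod_mult [simp]: "Y : mprod n ==> Z : mprod n ==> (%k. Y k * Z k) : mprod n"
proof -
 assume Y: "Y : mprod n" and Z: "Z : mprod n"
 obtain B where B: "!!k. opn (Y k) <= B" "B >= 0" using mprod_bound[OF Y] by blast
 obtain B' where B': "!!k. opn (Z k) <= B'" using mprod_bound[OF Z] by blast
 show ?thesis
 proof (rule mprodI)
  fix k
  have "opn (Y k * Z k) <= opn (Y k) * opn (Z k)"
   by (rule opnorm_mult[OF mpm[OF Y] mpm[OF Z]])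
  also have "... <= B * B'" using B B' by (intro mult_mono) auto
  finally show "opn (Y k * Z k) <= B * B'" .
  show "Y k * Z k : cmat (n k) (n k)" by (rule mmc) (use Y Z in auto)
 qed
qed

lemma mprod_smult [simp]: "Y : mprod n ==> (%k. c *m Y k) : mprod n"
proof -
 assume Y: "Y : mprod n"
 obtain B where B: "!!k. opn (Y k) <= B" using mprod_bound[OF Y] by blast
 show ?thesis
  by (rule mprodI[of _ _ "cmod c * B"]) (use Y B in \<open>auto simp: opnorm_smult mult_left_mono\<close>)
qed

lemma mprod_adj [simp]: "Y : mprod n ==> (%k. adj (Y k)) : mprod n"
proof -
 assume Y: "Y : mprod n"
 obtain B where B: "!!k. opn (Y k) <= B" using mprod_bound[OF Y] by blast
 show ?thesis by (rule mprodI[of _ _ B]) (use Y B in \<open>auto\<close>)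
qed

lemma mprod_one [simp]: "(%k. 1\<^sub>m (n k)) : mprod n"
 by (rule mprodI[of _ _ 1]) (auto simp: opnorm_one_le)

lemma mprod_zero [simp]: "(%k. 0\<^sub>m (n k) (n k)) : mprod n"
 by (rule mprodI[of _ _ 0]) auto

lemma ring_mat_prod: "ring (mat_prod n)"
proof (rule ringI)
 show "abelian_group (mat_prod n)"
 proof (rule abelian_groupI)
  fix Y assume "Y : carrier (mat_prod n)"
  hence Y: "Y : mprod n" by (simp add: mprod_def)
  show "EX Z:carrier (mat_prod n). Z +[mat_prod n] Y = 0[mat_prod n]"
  proof (rule bexI)
   show "(%k. (-1) *m Y k) : carrier (mat_prod n)" using mprod_smult[OF Y] by (simp add: mprod_def)
   show "(%k. (-1) *m Y k) +[mat_prod n] Y = 0[mat_prod n]"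
    using Y by (intro ext eq_matI) (auto simp: mat_prod_simps)
  qed
 next
  fix X Y Z assume "X : carrier (mat_prod n)" "Y : carrier (mat_prod n)" "Z : carrier (mat_prod n)"
  hence c: "X : mprod n" "Y : mprod n" "Z : mprod n" by (auto simp: mprod_def)
  show "X +[mat_prod n] Y +[mat_prod n] Z = X +[mat_prod n] (Y +[mat_prod n] Z)"
   using c by (auto simp: mat_prod_simps assoc_add_mat[OF mpm mpm mpm])
 next
  fix X Y assume "X : carrier (mat_prod n)" "Y : carrier (mat_prod n)"
  hence c: "X : mprod n" "Y : mprod n" by (auto simp: mprod_def)
  show "X +[mat_prod n] Y : carrier (mat_prod n)"
   using mprod_add[OF c] by (simp add: mprod_def mat_prod_simps(5))
  show "X +[mat_prod n] Y = Y +[mat_prod n] X"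
   using c by (auto simp: mat_prod_simps comm_add_mat[OF mpm mpm])
 next
  fix X assume "X : carrier (mat_prod n)"
  hence c: "X : mprod n" by (auto simp: mprod_def)
  show "0[mat_prod n] +[mat_prod n] X = X"
   using c by (auto simp: mat_prod_simps left_add_zero_mat[OF mpm])
 next
  show "0[mat_prod n] : carrier (mat_prod n)"
   using mprod_zero[of n] by (simp add: mprod_def mat_prod_simps(4))
 qed
 show "monoid (mat_prod n)"
 proof (rule monoidI)
  fix X Y Z assume "X : carrier (mat_prod n)" "Y : carrier (mat_prod n)" "Z : carrier (mat_prod n)"
  hence c: "X : mprod n" "Y : mprod n" "Z : mprod n" by (auto simp: mprod_def)
  show "X *[mat_prod n] Y *[mat_prod n] Z = X *[mat_prod n] (Y *[mat_prod n] Z)"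
   using c by (auto simp: mat_prod_simps assoc_mult_mat[OF mpm mpm mpm])
 next
  fix X Y assume "X : carrier (mat_prod n)" "Y : carrier (mat_prod n)"
  hence c: "X : mprod n" "Y : mprod n" by (auto simp: mprod_def)
  show "X *[mat_prod n] Y : carrier (mat_prod n)"
   using mprod_mult[OF c] by (simp add: mprod_def mat_prod_simps(2))
 next
  fix X assume "X : carrier (mat_prod n)"
  hence c: "X : mprod n" by (auto simp: mprod_def)
  show "1[mat_prod n] *[mat_prod n] X = X" "X *[mat_prod n] 1[mat_prod n] = X"
   using c by (auto simp: mat_prod_simps left_mult_one_mat[OF mpm] right_mult_one_mat[OF mpm])
 next
  show "1[mat_prod n] : carrier (mat_prod n)"
   using mprod_one[of n] by (simp add: mprod_def mat_prod_simps(3))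
 qed
next
 fix X Y Z assume "X : carrier (mat_prod n)" "Y : carrier (mat_prod n)" "Z : carrier (mat_prod n)"
 hence c: "X : mprod n" "Y : mprod n" "Z : mprod n" by (auto simp: mprod_def)
 show "(X +[mat_prod n] Y) *[mat_prod n] Z = X *[mat_prod n] Z +[mat_prod n] Y *[mat_prod n] Z"
  using c by (auto simp: mat_prod_simps add_mult_distrib_mat[OF mpm mpm mpm])
 show "Z *[mat_prod n] (X +[mat_prod n] Y) = Z *[mat_prod n] X +[mat_prod n] Z *[mat_prod n] Y"
  using c by (auto simp: mat_prod_simps mult_add_distrib_mat[OF mpm mpm mpm])
qed

definition mnull :: "(nat => complex mat) => bool" where
 "mnull Y \<longleftrightarrow> (%k. opn (Y k)) ----> 0"

lemma mat_sum_iff: "Y : mat_sum n \<longleftrightarrow> Y : mprod n & mnull Y"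
 by (simp add: mat_sum_def mprod_def mnull_def)

lemma mnull_sandwich: "(!!k. opn (Y k) <= g k) ==> g ----> 0 ==> mnull Y"
 unfolding mnull_def by (rule tendsto_sandwich[OF _ _ tendsto_const]) auto

lemma mnull_add:
 assumes "!!k. Y k : cmat (p k) (r k)" "!!k. Z k : cmat (p k) (r k)" "mnull Y" "mnull Z"
 shows "mnull (%k. Y k + Z k)"
proof (rule mnull_sandwich)
 show "opn (Y k + Z k) <= opn (Y k) + opn (Z k)" for k
  by (rule opnorm_add[OF assms(1,2)])
 show "(%k. opn (Y k) + opn (Z k)) ----> 0"
  using tendsto_add[OF assms(3,4)[unfolded mnull_def]] by simp
qed

lemma mnull_smult: "mnull Y ==> mnull (%k. c *m Y k)"
 unfolding mnull_def opnorm_smult by (rule tendsto_mult_right_zero)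

lemma mnull_adj: "mnull Y ==> mnull (%k. adj (Y k))"
 by (simp add: mnull_def)

lemma mnull_mult_left:
 assumes "!!k. Y k : cmat (p k) (q k)" "!!k. Z k : cmat (q k) (r k)"
  and "!!k. opn (Y k) <= B" "mnull Z"
 shows "mnull (%k. Y k * Z k)"
proof (rule mnull_sandwich)
 show "opn (Y k * Z k) <= B * opn (Z k)" for k
  using opnorm_mult[OF assms(1,2), of k] mult_right_mono[OF assms(3)[of k] opnorm_nonneg[of "Z k"]] by linarith
 show "(%k. B * opn (Z k)) ----> 0"
  using tendsto_mult_right_zero[OF assms(4)[unfolded mnull_def]] .
qed

lemma mnull_mult_right:
 assumes "!!k. Y k : cmat (p k) (q k)" "!!k. Z k : cmat (q k) (r k)"
  and "!!k. opn (Z k) <= B" "mnull Y"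
 shows "mnull (%k. Y k * Z k)"
proof (rule mnull_sandwich)
 show "opn (Y k * Z k) <= opn (Y k) * B" for k
  using opnorm_mult[OF assms(1,2), of k] mult_left_mono[OF assms(3)[of k] opnorm_nonneg[of "Y k"]] by linarith
 show "(%k. opn (Y k) * B) ----> 0"
  using tendsto_mult_left_zero[OF assms(4)[unfolded mnull_def]] .
qed

lemma mprod_uminus_eq: "Y : mprod n ==> \<ominus>\<^bsub>mat_prod n\<^esub> Y = (%k. (-1) *m Y k)"
proof -
 assume Y: "Y : mprod n"
 interpret P: ring "mat_prod n" by (rule ring_mat_prod)
 have "(%k. (-1) *m Y k) +[mat_prod n] Y = 0[mat_prod n]"
  using Y by (intro ext eq_matI) (auto simp: mat_prod_simps)
 thus ?thesis using Y mprod_smult[OF Y, of "-1"]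
  by (intro P.minus_equality) (auto simp: mprod_def)
qed

lemma ideal_mat_sum: "ideal (mat_sum n) (mat_prod n)"
proof (rule idealI)
 interpret P: ring "mat_prod n" by (rule ring_mat_prod)
 show "ring (mat_prod n)" by (rule ring_mat_prod)
 show "subgroup (mat_sum n) (add_monoid (mat_prod n))"
 proof (rule group.subgroupI)
  show "Group.group (add_monoid (mat_prod n))" by (rule P.a_group)
  show "mat_sum n \<subseteq> carrier (add_monoid (mat_prod n))" by (auto simp: mat_sum_iff mprod_def)
  have "(%k. 0\<^sub>m (n k) (n k)) : mat_sum n" by (simp add: mat_sum_iff mnull_def)
  thus "mat_sum n ~= {}" by auto
  fix a b assume a: "a : mat_sum n" and b: "b : mat_sum n"
  show "a *[add_monoid (mat_prod n)] b : mat_sum n"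
   using a b mnull_add[of a n n b] by (auto simp: mat_sum_iff mat_prod_simps(5))
  have "inv\<^bsub>add_monoid (mat_prod n)\<^esub> a = (%k. (-1) *m a k)"
   using mprod_uminus_eq[of a n] a by (simp add: mat_sum_iff a_inv_def)
  thus "inv\<^bsub>add_monoid (mat_prod n)\<^esub> a : mat_sum n"
   using a mnull_smult[of a "-1"] by (simp add: mat_sum_iff)
 qed
 fix a x assume a: "a : mat_sum n" and "x : carrier (mat_prod n)"
 hence x: "x : mprod n" and a': "a : mprod n" "mnull a" by (auto simp: mprod_def mat_sum_iff)
 obtain B where B: "!!k. opn (x k) <= B" using mprod_bound[OF x] by blast
 show "x *[mat_prod n] a : mat_sum n"
  using mnull_mult_left[of x n n a n B] x a' B by (simp add: mat_sum_iff mat_prod_simps(2))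
 show "a *[mat_prod n] x : mat_sum n"
  using mnull_mult_right[of a n n x n B] x a' B by (simp add: mat_sum_iff mat_prod_simps(2))
qed

definition cls :: "(nat => nat) => (nat => complex mat) => (nat => complex mat) set" where
 "cls n Y = mat_sum n +>\<^bsub>mat_prod n\<^esub> Y"

lemma mem_cls_iff:
 assumes Y: "Y : mprod n"
 shows "Z : cls n Y \<longleftrightarrow> Z : mprod n & mnull (%k. Z k - Y k)"
proof
 assume "Z : cls n Y"
 then obtain w where w: "w : mat_sum n" "Z = (%k. w k + Y k)"
  by (auto simp: cls_def a_r_coset_def' mat_prod_simps(5))
 have "(%k. Z k - Y k) = w"
  using w Y by (intro ext eq_matI) (auto simp: mat_sum_iff)
 thus "Z : mprod n & mnull (%k. Z k - Y k)" using w Y by (auto simp: mat_sum_iff)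
next
 assume Z: "Z : mprod n & mnull (%k. Z k - Y k)"
 have "Z = (%k. (Z k - Y k) + Y k)" using Z Y by (intro ext eq_matI) auto
 thus "Z : cls n Y" using Z Y
  by (auto simp: cls_def a_r_coset_def' mat_prod_simps(5) mat_sum_iff intro!: bexI[of _ "%k. Z k - Y k"])
qed

lemma cls_self: "Y : mprod n ==> Y : cls n Y"
 by (simp add: mem_cls_iff mnull_def minus_r_inv_mat[OF mpm])

lemma cls_eq_iff:
 assumes Y: "Y : mprod n" and Z: "Z : mprod n"
 shows "cls n Y = cls n Z \<longleftrightarrow> mnull (%k. Y k - Z k)"
proof
 assume "cls n Y = cls n Z"
 moreover have "Y : cls n Y" by (rule cls_self[OF Y])
 ultimately show "mnull (%k. Y k - Z k)" using mem_cls_iff[OF Z] by blast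
next
 interpret I: ideal "mat_sum n" "mat_prod n" by (rule ideal_mat_sum)
 assume "mnull (%k. Y k - Z k)"
 hence "Y : mat_sum n +>\<^bsub>mat_prod n\<^esub> Z" using mem_cls_iff[OF Z] Y by (simp add: cls_def)
 from I.a_repr_independence[OF this Z[unfolded mprod_def] I.a_subgroup]
 show "cls n Y = cls n Z" unfolding cls_def by simp
qed

lemma carrier_corona: "X : carrier (cor n) \<longleftrightarrow> (EX Y:mprod n. X = cls n Y)"
 by (auto simp: mat_corona_def cstar_quotient_def FactRing_def A_RCOSETS_def' cls_def mprod_def)

lemma cls_carrier [simp]: "Y : mprod n ==> cls n Y : carrier (cor n)"
 by (auto simp: carrier_corona)

lemma corona_mult: "Y : mprod n ==> Z : mprod n ==>
 cls n Y *[cor n] cls n Z = cls n (%k. Y k * Z k)"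
 using ideal.rcoset_mult_add[OF ideal_mat_sum, of Y n Z]
 by (simp add: mat_corona_def cstar_quotient_def FactRing_def cls_def mprod_def mat_prod_simps(2))

lemma corona_add: "Y : mprod n ==> Z : mprod n ==>
 cls n Y +[cor n] cls n Z = cls n (%k. Y k + Z k)"
proof -
 interpret I: ideal "mat_sum n" "mat_prod n" by (rule ideal_mat_sum)
 assume "Y : mprod n" "Z : mprod n"
 thus ?thesis using I.a_rcos_sum[of Y Z]
  by (simp add: mat_corona_def cstar_quotient_def FactRing_def cls_def mprod_def mat_prod_simps(5))
qed

lemma corona_one: "1[cor n] = cls n (%k. 1\<^sub>m (n k))"
 by (simp add: mat_corona_def cstar_quotient_def FactRing_def cls_def mat_prod_simps(3))

lemma corona_zero: "0[cor n] = cls n (%k. 0\<^sub>m (n k) (n k))"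
proof -
 interpret I: ideal "mat_sum n" "mat_prod n" by (rule ideal_mat_sum)
 have "mat_sum n +>\<^bsub>mat_prod n\<^esub> 0[mat_prod n] = mat_sum n"
  using I.a_rcos_const[of "0[mat_prod n]"] I.zero_closed by simp
 thus ?thesis by (simp add: mat_corona_def cstar_quotient_def FactRing_def cls_def mat_prod_simps(4))
qed

text \<open>The quotient operations are unions over all representatives; such a union is a single
  coset once the coset does not depend on the representative.\<close>

lemma UN_cls:
 assumes Y: "Y : mprod n" and g: "!!Z. Z : mprod n ==> mnull (%k. Z k - Y k) ==> cls n (g Z) = cls n (g Y)"
 shows "(\<Union>Z\<in>cls n Y. cls n (g Z)) = cls n (g Y)"
proof -
 have "Y : cls n Y" by (rule cls_self[OF Y])
 moreover have "cls n (g Z) = cls n (g Y)" if "Z : cls n Y" for Z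
  using that g mem_cls_iff[OF Y] by blast
 ultimately show ?thesis by blast
qed

lemma corona_smult: "Y : mprod n ==> c .[cor n] cls n Y = cls n (%k. c *m Y k)"
proof -
 assume Y: "Y : mprod n"
 have "c .[cor n] cls n Y = (\<Union>Z\<in>cls n Y. cls n (%k. c *m Z k))"
  by (simp add: mat_corona_def cstar_quotient_def cls_def mat_prod_simps(6))
 also have "... = cls n (%k. c *m Y k)"
 proof (rule UN_cls[OF Y])
  fix Z assume Z: "Z : mprod n" "mnull (%k. Z k - Y k)"
  have "(%k. c *m Z k - c *m Y k) = (%k. c *m (Z k - Y k))"
   using Z(1) Y by (intro ext eq_matI) (auto simp: algebra_simps)
  thus "cls n (%k. c *m Z k) = cls n (%k. c *m Y k)"
   using mnull_smult[OF Z(2), of c] Z(1) Y by (simp add: cls_eq_iff)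
 qed
 finally show ?thesis .
qed

lemma corona_star: "Y : mprod n ==> star (cor n) (cls n Y) = cls n (%k. adj (Y k))"
proof -
 assume Y: "Y : mprod n"
 have "star (cor n) (cls n Y) = (\<Union>Z\<in>cls n Y. cls n (%k. adj (Z k)))"
  by (simp add: mat_corona_def cstar_quotient_def cls_def mat_prod_simps(7))
 also have "... = cls n (%k. adj (Y k))"
 proof (rule UN_cls[OF Y])
  fix Z assume Z: "Z : mprod n" "mnull (%k. Z k - Y k)"
  have "(%k. adj (Z k) - adj (Y k)) = (%k. adj (Z k - Y k))"
   using adj_minus[OF mpm[OF Z(1)] mpm[OF Y]] by simp
  thus "cls n (%k. adj (Z k)) = cls n (%k. adj (Y k))"
   using mnull_adj[OF Z(2)] Z(1) Y by (simp add: cls_eq_iff)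
 qed
 finally show ?thesis .
qed

lemma corona_norm_eq: "cnorm (cor n) X = (INF Z\<in>X. SUP k. opn (Z k))"
 by (simp add: mat_corona_def cstar_quotient_def mat_prod_simps(8))

lemma sup_opnorm_upper: "Y : mprod n ==> opn (Y k) <= (SUP k. opn (Y k))"
 by (rule cSUP_upper[OF _ sup_opnorm_bdd]) auto

lemma cls_bdd_below: "Y : mprod n ==> bdd_below ((%Z. SUP k. opn (Z k)) ` cls n Y)"
proof (rule bdd_belowI2)
 fix Z assume "Y : mprod n" "Z : cls n Y"
 hence "Z : mprod n" using mem_cls_iff by blast
 thus "0 <= (SUP k. opn (Z k))" using sup_opnorm_upper[of Z n 0] order_trans[OF opnorm_nonneg] by blast
qed

lemma mnull_eventually: "mnull Y ==> e > 0 ==> EV k. opn (Y k) < e"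
 unfolding mnull_def by (rule order_tendstoD(2))

text \<open>With \<open>corona_norm_leI\<close> this identifies the quotient norm as the limit
  superior of the coordinate norms. The pair of a strict and a weak estimate is used in place of the
  limit superior.\<close>

lemma corona_norm_lessD:
 assumes Y: "Y : mprod n" and r: "cnorm (cor n) (cls n Y) < r"
 shows "EV k. opn (Y k) < r"
proof -
 have "Y : cls n Y" by (rule cls_self[OF Y])
 hence ne: "(%Z. SUP k. opn (Z k)) ` cls n Y ~= {}" by blast
 obtain y where y: "y : (%Z. SUP k. opn (Z k)) ` cls n Y" "y < r"
  using cInf_lessD[OF ne r[unfolded corona_norm_eq]] by blast
 then obtain Z where Z: "Z : cls n Y" "(SUP k. opn (Z k)) < r" by blast
 have Zm: "Z : mprod n" and nl: "mnull (%k. Z k - Y k)" using Z mem_cls_iff[OF Y] by auto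
 have "EV k. opn (Z k - Y k) < r - (SUP k. opn (Z k))"
  by (rule mnull_eventually[OF nl]) (use Z in simp)
 thus ?thesis
 proof (rule eventually_mono)
  fix k assume k: "opn (Z k - Y k) < r - (SUP k. opn (Z k))"
  have "Y k = Z k - (Z k - Y k)" using Zm Y by (intro eq_matI) auto
  hence "opn (Y k) = opn (Z k - (Z k - Y k))" by (rule arg_cong)
  also have "... <= opn (Z k) + opn (Z k - Y k)"
   by (rule opnorm_minus[OF mpm[OF Zm] mpm[OF mprod_minus[OF Zm Y]]])
  finally have "opn (Y k) <= opn (Z k) + opn (Z k - Y k)" .
  thus "opn (Y k) < r" using k sup_opnorm_upper[OF Zm, of k] by linarith
 qed
qed

text \<open>Setting finitely many coordinates to zero does not change the coset, and the modified
  representative has all norms at most \<open>r\<close>.\<close>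

lemma corona_norm_leI:
 assumes Y: "Y : mprod n" and r: "r >= 0" and ev: "EV k. opn (Y k) <= r"
 shows "cnorm (cor n) (cls n Y) <= r"
proof -
 obtain N where N: "!!k. k >= N ==> opn (Y k) <= r" using ev by (auto simp: eventually_sequentially)
 define Z where "Z k = (if k >= N then Y k else 0\<^sub>m (n k) (n k))" for k
 have Zr: "opn (Z k) <= r" for k using N r by (simp add: Z_def)
 have Z: "Z : mprod n" by (rule mprodI[OF _ Zr]) (use Y in \<open>simp add: Z_def\<close>)
 have "EV k. opn (Z k - Y k) = 0"
  using eventually_ge_at_top[of N]
  by eventually_elim (simp add: Z_def minus_r_inv_mat[OF mpm[OF Y]])
 hence "mnull (%k. Z k - Y k)" unfolding mnull_def by (rule tendsto_eventually)
 hence "Z : cls n Y" using mem_cls_iff[OF Y] Z by simp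
 hence "cnorm (cor n) (cls n Y) <= (SUP k. opn (Z k))"
  unfolding corona_norm_eq by (rule cINF_lower[OF cls_bdd_below[OF Y]])
 also have "... <= r" by (rule cSUP_least) (auto simp: Zr)
 finally show ?thesis .
qed

lemma mat_diff_split:
 fixes A B C :: "complex mat"
 assumes "A : cmat m n" "B : cmat m n" "C : cmat m n"
 shows "A - C = (A - B) + (B - C)"
 using assms by (intro eq_matI) auto

lemma mat_diff_add:
 fixes A B :: "complex mat"
 assumes "A : cmat m n" "B : cmat m n"
 shows "A = (A - B) + B"
 using assms by (intro eq_matI) auto

lemma mat_diff_zero [simp]: "A : cmat m n ==> A - 0\<^sub>m m n = (A :: complex mat)"
 by (intro eq_matI) auto

lemma mat_diff_smult:
 fixes A B :: "complex mat"
 assumes "A : cmat m n" "B : cmat m n" "C : cmat m n"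
 shows "A - B = (A - C) + (-1) *m (B - C)"
 using assms by (intro eq_matI) auto

text \<open>The identity holds in each coordinate; eventual bounds with room \<open>e\<close> are
  squared for one inequality and rooted for the other.\<close>

lemma corona_norm_cstar:
 assumes Y: "Y : mprod n" and nn: "cnorm (cor n) (cls n Y) >= 0"
 shows "cnorm (cor n) (cls n (%k. adj (Y k) * Y k)) = (cnorm (cor n) (cls n Y))\<^sup>2"
  (is "?l = ?r\<^sup>2")
proof (rule antisym)
 have YY: "(%k. adj (Y k) * Y k) : mprod n" using Y by (intro mprod_mult mprod_adj)
 have eq: "opn (adj (Y k) * Y k) = (opn (Y k))\<^sup>2" for k by (rule opnorm_cstar)
 have "sqrt ?l <= ?r + e" if e: "e > 0" for e
 proof -
  have "EV k. opn (Y k) < ?r + e" by (rule corona_norm_lessD[OF Y]) (use e in simp)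
  hence "EV k. opn (adj (Y k) * Y k) <= (?r + e)\<^sup>2"
   by eventually_elim (simp add: eq power_mono)
  hence "?l <= (?r + e)\<^sup>2" by (intro corona_norm_leI[OF YY]) simp_all
  thus ?thesis using nn e by (intro real_le_lsqrt) auto
 qed
 hence "sqrt ?l <= ?r" by (rule field_le_epsilon)
 hence "(sqrt ?l)\<^sup>2 <= ?r\<^sup>2 \<or> ?l <= 0" using power_mono[of "sqrt ?l" ?r 2] by (cases "?l <= 0") auto
 moreover have "(sqrt ?l)\<^sup>2 = ?l \<or> ?l <= 0" by (cases "?l <= 0") auto
 moreover have "0 <= ?r\<^sup>2" by simp
 ultimately show "?l <= ?r\<^sup>2" by linarith
 show "?r\<^sup>2 <= ?l"
 proof (rule field_le_epsilon)
  fix e :: real assume e: "e > 0"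
  have ev: "EV k. opn (adj (Y k) * Y k) < ?l + e"
   by (rule corona_norm_lessD[OF YY]) (use e in simp)
  then obtain k where "opn (adj (Y k) * Y k) < ?l + e"
   using eventually_happens'[OF sequentially_bot ev] by blast
  hence le0: "0 <= ?l + e" using opnorm_nonneg[of "adj (Y k) * Y k"] by linarith
  have "EV k. opn (Y k) <= sqrt (?l + e)"
   using ev by eventually_elim (simp add: eq real_le_rsqrt)
  hence "?r <= sqrt (?l + e)" using le0 by (intro corona_norm_leI[OF Y]) auto
  hence "?r\<^sup>2 <= (sqrt (?l + e))\<^sup>2" using nn by (intro power_mono)
  thus "?r\<^sup>2 <= ?l + e" using le0 by simp
 qed
qed

lemma corona_norm_nonneg: assumes Y: "Y : mprod n" shows "0 <= cnorm (cor n) (cls n Y)"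
proof (rule field_le_epsilon)
 fix e :: real assume "e > 0"
 hence "EV k. opn (Y k) < cnorm (cor n) (cls n Y) + e"
  by (intro corona_norm_lessD[OF Y]) simp
 then obtain k where "opn (Y k) < cnorm (cor n) (cls n Y) + e"
  using eventually_happens'[OF sequentially_bot] by blast
 thus "0 <= cnorm (cor n) (cls n Y) + e" using opnorm_nonneg[of "Y k"] by linarith
qed

lemma corona_norm_add:
 assumes Y: "Y : mprod n" and Z: "Z : mprod n"
 shows "cnorm (cor n) (cls n (%k. Y k + Z k)) <= cnorm (cor n) (cls n Y) + cnorm (cor n) (cls n Z)"
  (is "_ <= ?y + ?z")
proof (rule field_le_epsilon)
 fix e :: real assume e: "e > 0"
 have "EV k. opn (Y k) < ?y + e/2" "EV k. opn (Z k) < ?z + e/2"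
  using e by (auto intro!: corona_norm_lessD Y Z)
 hence "EV k. opn (Y k + Z k) <= ?y + ?z + e"
 proof eventually_elim
  case (elim k)
  thus ?case using opnorm_add[OF mpm[OF Y] mpm[OF Z], of k] by linarith
 qed
 thus "cnorm (cor n) (cls n (%k. Y k + Z k)) <= ?y + ?z + e"
  using e corona_norm_nonneg[OF Y] corona_norm_nonneg[OF Z] by (intro corona_norm_leI mprod_add Y Z) auto
qed

lemma corona_norm_mult:
 assumes Y: "Y : mprod n" and Z: "Z : mprod n"
 shows "cnorm (cor n) (cls n (%k. Y k * Z k)) <= cnorm (cor n) (cls n Y) * cnorm (cor n) (cls n Z)"
  (is "?l <= ?y * ?z")
proof -
 note nn = corona_norm_nonneg[OF Y] corona_norm_nonneg[OF Z]
 have le: "?l <= (?y + e) * (?z + e)" if e: "e > 0" for e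
 proof -
  have "EV k. opn (Y k) < ?y + e" "EV k. opn (Z k) < ?z + e"
   using e by (auto intro!: corona_norm_lessD Y Z)
  hence "EV k. opn (Y k * Z k) <= (?y + e) * (?z + e)"
  proof eventually_elim
   case (elim k)
   have "opn (Y k * Z k) <= opn (Y k) * opn (Z k)"
    by (rule opnorm_mult[OF mpm[OF Y] mpm[OF Z]])
   also have "... <= (?y + e) * (?z + e)" using elim e nn by (intro mult_mono) auto
   finally show ?case .
  qed
  thus ?thesis using e nn by (intro corona_norm_leI mprod_mult Y Z) auto
 qed
 have "(%j. (?y + 1 / real (Suc j)) * (?z + 1 / real (Suc j))) ----> (?y + 0) * (?z + 0)"
  by (intro tendsto_intros LIMSEQ_Suc lim_1_over_n)
 moreover have "EX N. ALL j>=N. ?l <= (?y + 1 / real (Suc j)) * (?z + 1 / real (Suc j))"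
  using le by simp
 ultimately have "?l <= (?y + 0) * (?z + 0)" by (rule LIMSEQ_le_const)
 thus ?thesis by simp
qed

lemma corona_norm_smult:
 assumes Y: "Y : mprod n"
 shows "cnorm (cor n) (cls n (%k. c *m Y k)) = cmod c * cnorm (cor n) (cls n Y)"
proof -
 have le: "cnorm (cor n) (cls n (%k. c *m Y k)) <= cmod c * cnorm (cor n) (cls n Y)"
  if Y: "Y : mprod n" for c Y
 proof (cases "c = 0")
  case True
  thus ?thesis using Y by (intro corona_norm_leI) (auto simp: opnorm_smult)
 next
  case False
  show ?thesis
  proof (rule field_le_epsilon)
   fix e :: real assume "e > 0"
   hence "EV k. opn (Y k) < cnorm (cor n) (cls n Y) + e / cmod c"
    using False by (intro corona_norm_lessD[OF Y]) simp
   hence "EV k. opn (c *m Y k) <= cmod c * cnorm (cor n) (cls n Y) + e"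
   proof eventually_elim
    case (elim k)
    have "cmod c * opn (Y k) <= cmod c * (cnorm (cor n) (cls n Y) + e / cmod c)"
     using elim by (intro mult_left_mono) auto
    thus ?case using False by (simp add: opnorm_smult algebra_simps)
   qed
   thus "cnorm (cor n) (cls n (%k. c *m Y k)) <= cmod c * cnorm (cor n) (cls n Y) + e"
    using `e > 0` corona_norm_nonneg[OF Y] by (intro corona_norm_leI mprod_smult Y) auto
  qed
 qed
 show ?thesis
 proof (cases "c = 0")
  case True
  thus ?thesis using le[OF Y, of 0] corona_norm_nonneg[OF mprod_smult[OF Y, of 0]] by simp
 next
  case False
  have "(%k. inverse c *m (c *m Y k)) = Y" using False by (intro ext eq_matI) auto
  hence "cnorm (cor n) (cls n Y) <= cmod (inverse c) * cnorm (cor n) (cls n (%k. c *m Y k))"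
   using le[OF mprod_smult[OF Y, of c], of "inverse c"] by simp
  hence "cmod c * cnorm (cor n) (cls n Y) <= cmod c * (cmod (inverse c) * cnorm (cor n) (cls n (%k. c *m Y k)))"
   by (rule mult_left_mono) simp
  also have "... = cnorm (cor n) (cls n (%k. c *m Y k))"
   using False by (simp add: norm_inverse)
  finally show ?thesis using le[OF Y, of c] by linarith
 qed
qed

lemma corona_norm_zero_iff:
 assumes Y: "Y : mprod n"
 shows "cnorm (cor n) (cls n Y) = 0 \<longleftrightarrow> mnull Y"
proof
 assume z: "cnorm (cor n) (cls n Y) = 0"
 show "mnull Y" unfolding mnull_def
 proof (rule order_tendstoI)
  fix a :: real assume "a < 0"
  thus "EV k. a < opn (Y k)" by (intro always_eventually allI) (rule less_le_trans[OF _ opnorm_nonneg])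
 next
  fix a :: real assume "0 < a"
  thus "EV k. opn (Y k) < a" using z by (intro corona_norm_lessD[OF Y]) simp
 qed
next
 assume nl: "mnull Y"
 have "cnorm (cor n) (cls n Y) <= 0 + e" if "e > 0" for e
  using mnull_eventually[OF nl that] that by (intro corona_norm_leI[OF Y]) (auto elim: eventually_mono)
 hence "cnorm (cor n) (cls n Y) <= 0" by (rule field_le_epsilon)
 thus "cnorm (cor n) (cls n Y) = 0" using corona_norm_nonneg[OF Y] by linarith
qed

lemma corona_abelian_group: "abelian_group (cor n)"
proof (rule abelian_groupI)
 fix X Y assume "X : carrier (cor n)" "Y : carrier (cor n)"
 then obtain x y where r: "x : mprod n" "X = cls n x" "y : mprod n" "Y = cls n y" by (auto simp: carrier_corona)
 show "X +[cor n] Y : carrier (cor n)" using r by (simp add: corona_add)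
 show "X +[cor n] Y = Y +[cor n] X"
  using r by (simp add: corona_add comm_add_mat[OF mpm mpm])
next
 fix X Y Z assume "X : carrier (cor n)" "Y : carrier (cor n)" "Z : carrier (cor n)"
 then obtain x y z where r: "x : mprod n" "X = cls n x" "y : mprod n" "Y = cls n y" "z : mprod n" "Z = cls n z"
  by (auto simp: carrier_corona)
 show "X +[cor n] Y +[cor n] Z = X +[cor n] (Y +[cor n] Z)"
  using r by (simp add: corona_add assoc_add_mat[OF mpm mpm mpm])
next
 show "0[cor n] : carrier (cor n)" by (simp add: corona_zero)
next
 fix X assume "X : carrier (cor n)"
 then obtain x where r: "x : mprod n" "X = cls n x" by (auto simp: carrier_corona)
 show "0[cor n] +[cor n] X = X"
  using r by (simp add: corona_zero corona_add left_add_zero_mat[OF mpm])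
 have "(%k. (-1) *m x k + x k) = (%k. 0\<^sub>m (n k) (n k))" using r by (intro ext eq_matI) auto
 hence "cls n (%k. (-1) *m x k) +[cor n] X = 0[cor n]"
  using r mprod_smult[OF r(1), of "-1"] by (simp add: corona_zero corona_add)
 thus "EX Y:carrier (cor n). Y +[cor n] X = 0[cor n]"
  using mprod_smult[OF r(1), of "-1"] by (intro bexI[of _ "cls n (%k. (-1) *m x k)"]) auto
qed

lemma corona_minus:
 assumes Y: "Y : mprod n" and Z: "Z : mprod n"
 shows "cls n Y -[cor n] cls n Z = cls n (%k. Y k - Z k)"
proof -
 interpret G: abelian_group "cor n" by (rule corona_abelian_group)
 have "(%k. (-1) *m Z k + Z k) = (%k. 0\<^sub>m (n k) (n k))" using Z by (intro ext eq_matI) auto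
 hence "cls n (%k. (-1) *m Z k) +[cor n] cls n Z = 0[cor n]"
  using Z mprod_smult[OF Z, of "-1"] by (simp add: corona_zero corona_add)
 hence "\<ominus>\<^bsub>cor n\<^esub> cls n Z = cls n (%k. (-1) *m Z k)"
  using Z mprod_smult[OF Z, of "-1"] by (intro G.minus_equality) auto
 moreover have "(%k. Y k + (-1) *m Z k) = (%k. Y k - Z k)" using Y Z by (intro ext eq_matI) auto
 ultimately show ?thesis using Y mprod_smult[OF Z, of "-1"] by (simp add: a_minus_def corona_add)
qed

lemma corona_dist:
 assumes "Y : mprod n" "Z : mprod n"
 shows "cdist (cor n) (cls n Y) (cls n Z) = cnorm (cor n) (cls n (%k. Y k - Z k))"
 using corona_minus[OF assms] by (simp add: cdist_def)

text \<open>A fast Cauchy sequence of classes converges to the class of a diagonal sequence of lifts; the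
  completeness of the individual matrix algebras plays no role.\<close>

lemma corona_diagonal:
 assumes Y: "!!j. Y j : mprod n"
  and fast: "!!j. cnorm (cor n) (cls n (%k. Y (Suc j) k - Y j k)) < (1/2) ^ j"
 obtains W where "W : mprod n" "!!j. cnorm (cor n) (cls n (%k. W k - Y j k)) <= 2 * (1/2) ^ j"
proof -
 have "EX K. ALL k>=K. opn (Y (Suc j) k - Y j k) < (1/2) ^ j" for j
  using corona_norm_lessD[OF mprod_minus[OF Y Y] fast, of j] by (simp add: eventually_sequentially)
 then obtain K where K: "!!j k. k >= K j ==> opn (Y (Suc j) k - Y j k) < (1/2) ^ j" by metis
 \<comment> \<open>The last stage up to \<open>k\<close> whose threshold, together with those of all
   earlier stages, has been passed by \<open>k\<close>. The inserted 0 keeps the set nonempty, and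
   stage 0 requires no estimate.\<close>
 define J where "J k = Max (insert 0 {j. j <= k & (ALL i<=j. K i <= k)})" for k
 have fin: "finite (insert 0 {j. j <= k & (ALL i<=j. K i <= k)})" for k by simp
 have J: "J k = 0 \<or> (ALL i<=J k. K i <= k)" for k
  using Max_in[OF fin[of k]] unfolding J_def by blast
 have Jge: "j <= J k" if "j <= k" "ALL i<=j. K i <= k" for j k
  unfolding J_def by (rule Max_ge[OF fin]) (use that in auto)
 have tele: "opn (Y m k - Y j k) <= 2 * (1/2) ^ j - 2 * (1/2) ^ m"
  if jm: "j <= m" and Ks: "!!i. j <= i ==> i < m ==> K i <= k" for m j k
  using jm Ks
 proof (induction m rule: dec_induct)
  case base
  show ?case by (simp add: minus_r_inv_mat[OF mpm[OF Y]])
 next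
  case (step m)
  have "opn (Y (Suc m) k - Y j k) = opn ((Y (Suc m) k - Y m k) + (Y m k - Y j k))"
   by (rule arg_cong[OF mat_diff_split]) (rule mpm[OF Y])+
  also have "... <= opn (Y (Suc m) k - Y m k) + opn (Y m k - Y j k)"
   by (rule opnorm_add) (rule minus_carrier_mat, rule mpm[OF Y])+
  finally have "opn (Y (Suc m) k - Y j k) <= opn (Y (Suc m) k - Y m k) + opn (Y m k - Y j k)" .
  moreover have "opn (Y (Suc m) k - Y m k) < (1/2) ^ m" using step by (intro K) auto
  moreover have "opn (Y m k - Y j k) <= 2 * (1/2) ^ j - 2 * (1/2) ^ m" using step by auto
  ultimately show ?case by simp
 qed
 define W where "W k = Y (J k) k" for k
 have W0: "opn (W k - Y 0 k) <= 2" for k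
 proof -
  have "opn (Y (J k) k - Y 0 k) <= 2 * (1/2) ^ 0 - 2 * (1/2) ^ (J k)"
   by (rule tele) (use J[of k] in auto)
  also have "... <= 2" by simp
  finally show ?thesis by (simp add: W_def)
 qed
 obtain B where B: "!!k. opn (Y 0 k) <= B" using mprod_bound[OF Y[of 0]] by blast
 have W: "W : mprod n"
 proof (rule mprodI)
  fix k
  show "W k : cmat (n k) (n k)" using Y by (simp add: W_def)
  have "opn (W k) = opn ((W k - Y 0 k) + Y 0 k)"
   unfolding W_def by (rule arg_cong[OF mat_diff_add]) (rule mpm[OF Y])+
  also have "... <= opn (W k - Y 0 k) + opn (Y 0 k)"
   unfolding W_def by (rule opnorm_add) (rule minus_carrier_mat, rule mpm[OF Y], rule mpm[OF Y])
  also have "... <= 2 + B" using W0 B by (intro add_mono)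
  finally show "opn (W k) <= 2 + B" .
 qed
 have "cnorm (cor n) (cls n (%k. W k - Y j k)) <= 2 * (1/2) ^ j" for j
 proof (rule corona_norm_leI)
  have "EV k. k >= j + (SUM i<=j. K i)" by (rule eventually_ge_at_top)
  thus "EV k. opn (W k - Y j k) <= 2 * (1/2) ^ j"
  proof eventually_elim
   case (elim k)
   have Ki: "K i <= k" if "i <= j" for i
   proof -
    have "K i <= (SUM i<=j. K i)" by (rule member_le_sum) (use that in auto)
    thus ?thesis using elim by linarith
   qed
   have jJ: "j <= J k" by (rule Jge) (use Ki elim in auto)
   have "opn (Y (J k) k - Y j k) <= 2 * (1/2) ^ j - 2 * (1/2) ^ (J k)"
    by (rule tele[OF jJ]) (use J[of k] in auto)
   also have "... <= 2 * (1/2) ^ j" by simp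
   finally show ?case by (simp add: W_def)
  qed
 qed (use W Y in auto)
 thus ?thesis using that W by blast
qed

lemma corona_complete:
 assumes X: "!!m. X m : carrier (cor n)" and Cau: "cCauchy (cor n) X"
 shows "EX x:carrier (cor n). ctendsto (cor n) X x"
proof -
 have "EX Y. Y : mprod n & X m = cls n Y" for m using X[of m] by (auto simp: carrier_corona)
 then obtain Y where Y: "!!m. Y m : mprod n" and XY: "!!m. X m = cls n (Y m)" by metis
 have d: "cdist (cor n) (X i) (X j) = cnorm (cor n) (cls n (%k. Y i k - Y j k))" for i j
  by (simp add: XY corona_dist Y)
 have "EX M. ALL i>=M. ALL j>=M. cdist (cor n) (X i) (X j) < (1/2) ^ l" for l :: nat
  using Cau[unfolded cCauchy_def, rule_format, of "(1/2) ^ l"] by simp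
 then obtain M where M: "!!l i j. i >= M l ==> j >= M l ==> cdist (cor n) (X i) (X j) < (1/2) ^ l" by metis
 \<comment> \<open>Partial sums turn the thresholds \<open>M\<close> into a nondecreasing sequence
   that still dominates each of them.\<close>
 define s where "s l = (SUM i<=l. M i)" for l
 have sM: "M l <= s l" for l unfolding s_def by (rule member_le_sum) auto
 have smono: "s l <= s (Suc l)" for l by (simp add: s_def)
 obtain W where W: "W : mprod n" "!!j. cnorm (cor n) (cls n (%k. W k - Y (s j) k)) <= 2 * (1/2) ^ j"
 proof (rule corona_diagonal[of "%j. Y (s j)" n])
  show "cnorm (cor n) (cls n (%k. Y (s (Suc j)) k - Y (s j) k)) < (1/2) ^ j" for j
   unfolding d[symmetric] using sM[of j] smono[of j] by (intro M) auto
 qed (use Y in auto)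
 have le: "cdist (cor n) (X m) (cls n W) <= 3 * (1/2) ^ j" if m: "m >= s j" for m j
 proof -
  have eq: "cdist (cor n) (X m) (cls n W) = cnorm (cor n) (cls n (%k. Y m k - W k))"
   by (simp add: XY corona_dist Y W)
  have "(%k. Y m k - W k) = (%k. (Y m k - Y (s j) k) + (-1) *m (W k - Y (s j) k))"
   by (rule ext, rule mat_diff_smult) (rule mpm[OF Y] mpm[OF W(1)])+
  hence "cdist (cor n) (X m) (cls n W) <= cnorm (cor n) (cls n (%k. Y m k - Y (s j) k))
    + cnorm (cor n) (cls n (%k. (-1) *m (W k - Y (s j) k)))"
   unfolding eq using corona_norm_add[OF mprod_minus[OF Y[of m] Y[of "s j"]] mprod_smult[OF mprod_minus[OF W(1) Y[of "s j"]], of "-1"]]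
   by simp
  also have "... <= (1/2) ^ j + 2 * (1/2) ^ j"
  proof (rule add_mono)
   have "cdist (cor n) (X m) (X (s j)) < (1/2) ^ j" using m sM[of j] by (intro M) auto
   thus "cnorm (cor n) (cls n (%k. Y m k - Y (s j) k)) <= (1/2) ^ j" unfolding d by simp
   show "cnorm (cor n) (cls n (%k. (-1) *m (W k - Y (s j) k))) <= 2 * (1/2) ^ j"
    using corona_norm_smult[OF mprod_minus[OF W(1) Y[of "s j"]], of "-1"] W(2)[of j] by simp
  qed
  finally show ?thesis by simp
 qed
 have "(%m. cdist (cor n) (X m) (cls n W)) ----> 0"
 proof (rule order_tendstoI)
  fix a :: real assume a: "a < 0"
  have "0 <= cdist (cor n) (X m) (cls n W)" for m
   by (simp add: XY corona_dist Y W corona_norm_nonneg)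
  thus "EV m. a < cdist (cor n) (X m) (cls n W)"
   using a by (intro always_eventually allI) (rule less_le_trans)
 next
  fix a :: real assume "0 < a"
  hence "0 < a / 3" by simp
  then obtain j where "(1/2) ^ j < a / 3" using real_arch_pow_inv[of "a/3" "1/2"] by auto
  hence "ALL m>=s j. cdist (cor n) (X m) (cls n W) < a" using le[of j] by fastforce
  thus "EV m. cdist (cor n) (X m) (cls n W) < a"
   unfolding eventually_sequentially by blast
 qed
 thus ?thesis using W(1) unfolding ctendsto_def by (intro bexI[of _ "cls n W"]) auto
qed

theorem unital_cstar_corona:
 assumes n: "!!k. n k > 0"
 shows "unital_cstar_algebra (cor n)"
proof -
 have md: "Module.module (class_ring :: complex ring) (cor n)"
 proof (rule moduleI)
  show "cring (class_ring :: complex ring)" ..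
  show "abelian_group (cor n)" by (rule corona_abelian_group)
  fix a b :: complex and X Y assume "X : carrier (cor n)" "Y : carrier (cor n)"
  then obtain x y where r: "x : mprod n" "X = cls n x" "y : mprod n" "Y = cls n y" by (auto simp: carrier_corona)
  have "(%k. a *m (x k + y k)) = (%k. a *m x k + a *m y k)"
   using add_smult_distrib_left_mat[OF mpm[OF r(1)] mpm[OF r(3)]] by simp
  thus "a .[cor n] (X +[cor n] Y) = a .[cor n] X +[cor n] a .[cor n] Y"
   using r by (simp add: corona_add corona_smult)
 next
  fix a b :: complex and X assume "X : carrier (cor n)"
  then obtain x where r: "x : mprod n" "X = cls n x" by (auto simp: carrier_corona)
  show "a .[cor n] X : carrier (cor n)" using r by (simp add: corona_smult)
  have "(%k. (a + b) *m x k) = (%k. a *m x k + b *m x k)"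
   using add_smult_distrib_right_mat[OF mpm[OF r(1)]] by simp
  thus "(a +[class_ring] b) .[cor n] X = a .[cor n] X +[cor n] b .[cor n] X"
   using r by (simp add: corona_add corona_smult)
  have "(%k. (a * b) *m x k) = (%k. a *m (b *m x k))" by (intro ext eq_matI) auto
  thus "(a *[class_ring] b) .[cor n] X = a .[cor n] (b .[cor n] X)"
   using r by (simp add: corona_smult)
  have "(%k. 1 *m x k) = x" by (intro ext eq_matI) auto
  thus "1[class_ring] .[cor n] X = X" using r by (simp add: corona_smult)
 qed
 have "cstar_algebra_axioms (cor n)"
 proof (rule cstar_algebra_axioms.intro, goal_cases)
  case (1 X Y)
  then obtain x y where r: "x : mprod n" "X = cls n x" "y : mprod n" "Y = cls n y" by (auto simp: carrier_corona)
  show ?case using r by (simp add: corona_mult)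
 next
  case (2 X Y Z)
  then obtain x y z where r: "x : mprod n" "X = cls n x" "y : mprod n" "Y = cls n y" "z : mprod n" "Z = cls n z"
   by (auto simp: carrier_corona)
  show ?case using r by (simp add: corona_mult assoc_mult_mat[OF mpm mpm mpm])
 next
  case (3 X Y Z)
  then obtain x y z where r: "x : mprod n" "X = cls n x" "y : mprod n" "Y = cls n y" "z : mprod n" "Z = cls n z"
   by (auto simp: carrier_corona)
  show ?case using r by (simp add: corona_mult corona_add add_mult_distrib_mat[OF mpm mpm mpm])
 next
  case (4 X Y Z)
  then obtain x y z where r: "x : mprod n" "X = cls n x" "y : mprod n" "Y = cls n y" "z : mprod n" "Z = cls n z"
   by (auto simp: carrier_corona)
  show ?case using r by (simp add: corona_mult corona_add mult_add_distrib_mat[OF mpm mpm mpm])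
 next
  case (5 X Y c)
  then obtain x y where r: "x : mprod n" "X = cls n x" "y : mprod n" "Y = cls n y" by (auto simp: carrier_corona)
  show ?case using r by (simp add: corona_mult corona_smult mult_smult_assoc_mat[OF mpm mpm])
 next
  case (6 X Y c)
  then obtain x y where r: "x : mprod n" "X = cls n x" "y : mprod n" "Y = cls n y" by (auto simp: carrier_corona)
  show ?case using r by (simp add: corona_mult corona_smult mult_smult_distrib[OF mpm mpm])
 next
  case (7 X)
  then obtain x where r: "x : mprod n" "X = cls n x" by (auto simp: carrier_corona)
  show ?case using r by (simp add: corona_star)
 next
  case (8 X)
  then obtain x where r: "x : mprod n" "X = cls n x" by (auto simp: carrier_corona)
  show ?case using r by (simp add: corona_star)
 next
  case (9 X Y)
  then obtain x y where r: "x : mprod n" "X = cls n x" "y : mprod n" "Y = cls n y" by (auto simp: carrier_corona)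
  show ?case using r by (simp add: corona_star corona_add adj_add[OF mpm mpm])
 next
  case (10 X c)
  then obtain x where r: "x : mprod n" "X = cls n x" by (auto simp: carrier_corona)
  show ?case using r by (simp add: corona_star corona_smult adj_smult)
 next
  case (11 X Y)
  then obtain x y where r: "x : mprod n" "X = cls n x" "y : mprod n" "Y = cls n y" by (auto simp: carrier_corona)
  show ?case using r by (simp add: corona_star corona_mult adj_mult[OF mpm mpm])
 next
  case (12 X)
  then obtain x where r: "x : mprod n" "X = cls n x" by (auto simp: carrier_corona)
  have "mnull (%k. x k - 0\<^sub>m (n k) (n k))"
   using 12 r by (simp add: corona_norm_zero_iff mnull_def)
  thus ?case using r by (simp add: corona_zero cls_eq_iff)
 next
  case (13 X Y)
  then obtain x y where r: "x : mprod n" "X = cls n x" "y : mprod n" "Y = cls n y" by (auto simp: carrier_corona)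
  show ?case using r by (simp add: corona_add corona_norm_add)
 next
  case (14 X c)
  then obtain x where r: "x : mprod n" "X = cls n x" by (auto simp: carrier_corona)
  show ?case using r by (simp add: corona_smult corona_norm_smult)
 next
  case (15 X Y)
  then obtain x y where r: "x : mprod n" "X = cls n x" "y : mprod n" "Y = cls n y" by (auto simp: carrier_corona)
  show ?case using r by (simp add: corona_mult corona_norm_mult)
 next
  case (16 X)
  then obtain x where r: "x : mprod n" "X = cls n x" by (auto simp: carrier_corona)
  show ?case using r by (simp add: corona_star corona_mult corona_norm_cstar corona_norm_nonneg)
 next
  case (17 X)
  thus ?case by (rule corona_complete)
 qed
 hence "cstar_algebra (cor n)" using md by (intro cstar_algebra.intro)
 moreover have "unital_cstar_algebra_axioms (cor n)"
 proof (rule unital_cstar_algebra_axioms.intro, goal_cases)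
  case 1 show ?case by (simp add: corona_one)
 next
  case (2 X)
  then obtain x where r: "x : mprod n" "X = cls n x" by (auto simp: carrier_corona)
  show ?case using r by (simp add: corona_one corona_mult left_mult_one_mat[OF mpm])
 next
  case (3 X)
  then obtain x where r: "x : mprod n" "X = cls n x" by (auto simp: carrier_corona)
  show ?case using r by (simp add: corona_one corona_mult right_mult_one_mat[OF mpm])
 next
  case 4
  have "opn (1\<^sub>m (n k) - 0\<^sub>m (n k) (n k)) = 1" for k
   using n by simp
  hence "\<not> mnull (%k. 1\<^sub>m (n k) - 0\<^sub>m (n k) (n k))"
   by (simp add: mnull_def tendsto_const_iff)
  thus ?case by (simp add: corona_one corona_zero cls_eq_iff)
 qed
 ultimately show ?thesis by (intro unital_cstar_algebra.intro)
qed

section \<open>Block matrices and direct sums of representations\<close>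

lemma conjugate_append: "conjugate (v @\<^sub>v w) = conjugate v @\<^sub>v conjugate (w :: complex vec)"
 by (rule eq_vecI) auto

lemma cip_append:
 fixes v w :: "complex vec"
 assumes "v : cvec m" "v' : cvec m" "w : cvec l" "w' : cvec l"
 shows "(v @\<^sub>v w) *c (v' @\<^sub>v w') = v *c v' + w *c w'"
 unfolding conjugate_append by (rule scalar_prod_append) (use assms in auto)

lemma l2norm_append:
 "(nrm (v @\<^sub>v w))\<^sup>2 = (nrm v)\<^sup>2 + (nrm w)\<^sup>2"
proof -
 have "(v @\<^sub>v w) *c (v @\<^sub>v w) = v *c v + w *c w"
  by (rule cip_append) (rule carrier_vecI, rule refl)+
 thus ?thesis unfolding l2norm_Re by (simp only: plus_complex.sel)
qed

lemma vec_split: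
 fixes v :: "complex vec"
 assumes "v : cvec (m + l)"
 obtains a b where "a : cvec m" "b : cvec l" "v = a @\<^sub>v b"
 using that[OF vec_first_carrier vec_last_carrier vec_first_last_append[OF assms, symmetric]] .

definition dsum :: "complex mat => complex mat => complex mat" where
 "dsum A B = four_block_mat A (0\<^sub>m (dim_row A) (dim_col B)) (0\<^sub>m (dim_row B) (dim_col A)) B"

lemma dsum_carrier [simp]:
 "A : cmat m m' ==> B : cmat l l' ==> dsum A B : cmat (m + l) (m' + l')"
 by (auto simp: dsum_def)

lemma dsum_eq:
 "A : cmat m m' ==> B : cmat l l' ==> dsum A B = four_block_mat A (0\<^sub>m m l') (0\<^sub>m l m') B"
 by (auto simp: dsum_def)

lemma dsum_mult_vec:
 assumes A: "A : cmat m m'" and B: "B : cmat l l'"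
  and a: "a : cvec m'" and b: "b : cvec l'"
 shows "dsum A B *v (a @\<^sub>v b) = (A *v a) @\<^sub>v (B *v b)"
proof -
 have "0\<^sub>m m l' *v b = 0\<^sub>v m" "0\<^sub>m l m' *v a = 0\<^sub>v l" using a b by (auto intro!: eq_vecI)
 thus ?thesis
  unfolding dsum_eq[OF A B] four_block_mat_mult_vec[OF A zero_carrier_mat zero_carrier_mat B a b]
  using A B a b by simp
qed

lemma dsum_add:
 assumes "A : cmat m m'" "B : cmat l l'" "C : cmat m m'" "D : cmat l l'"
 shows "dsum (A + C) (B + D) = dsum A B + dsum C D"
 using assms by (intro eq_matI) (auto simp: dsum_def)

lemma dsum_smult:
 assumes "A : cmat m m'" "B : cmat l l'"
 shows "dsum (c *m A) (c *m B) = c *m dsum A B"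
 using assms by (intro eq_matI) (auto simp: dsum_def)

lemma dsum_mult:
 assumes "A : cmat m m" "B : cmat l l" "C : cmat m m" "D : cmat l l"
 shows "dsum (A * C) (B * D) = dsum A B * dsum C D"
proof -
 have "dsum A B * dsum C D = four_block_mat (A * C + 0\<^sub>m m l * 0\<^sub>m l m) (A * 0\<^sub>m m l + 0\<^sub>m m l * D)
   (0\<^sub>m l m * C + B * 0\<^sub>m l m) (0\<^sub>m l m * 0\<^sub>m m l + B * D)"
  unfolding dsum_eq[OF assms(1,2)] dsum_eq[OF assms(3,4)]
  by (rule mult_four_block_mat) (use assms in auto)
 also have "... = four_block_mat (A * C) (0\<^sub>m m l) (0\<^sub>m l m) (B * D)"
  using assms by simp
 also have "... = dsum (A * C) (B * D)" by (rule dsum_eq[symmetric]) (use assms in auto)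
 finally show ?thesis ..
qed

lemma dsum_adj:
 assumes "A : cmat m m'" "B : cmat l l'"
 shows "dsum (adj A) (adj B) = adj (dsum A B)"
 using assms by (intro eq_matI) (auto simp: dsum_def adj_index)

lemma dsum_one: "dsum (1\<^sub>m m) (1\<^sub>m l) = 1\<^sub>m (m + l)"
 by (intro eq_matI) (auto simp: dsum_def)

lemma opnorm_dsum:
 assumes A: "A : cmat m m'" and B: "B : cmat l l'"
  and r: "opn A <= r" "opn B <= r"
 shows "opn (dsum A B) <= r"
proof (rule opnorm_le)
 show r0: "0 <= r" using r(1) order_trans[OF opnorm_nonneg] by blast
 fix v :: "complex vec" assume "v : cvec (dim_col (dsum A B))"
 hence "v : cvec (m' + l')" using dsum_carrier[OF A B] by auto
 then obtain a b where ab: "a : cvec m'" "b : cvec l'" "v = a @\<^sub>v b" by (rule vec_split)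
 have a: "nrm (A *v a) <= r * nrm a"
  using opnorm_vec[OF A ab(1)] mult_right_mono[OF r(1) l2norm_nonneg[of a]] by linarith
 have b: "nrm (B *v b) <= r * nrm b"
  using opnorm_vec[OF B ab(2)] mult_right_mono[OF r(2) l2norm_nonneg[of b]] by linarith
 have "(nrm (dsum A B *v v))\<^sup>2 = (nrm (A *v a))\<^sup>2 + (nrm (B *v b))\<^sup>2"
  unfolding ab(3) dsum_mult_vec[OF A B ab(1,2)] by (rule l2norm_append)
 also have "... <= (r * nrm a)\<^sup>2 + (r * nrm b)\<^sup>2"
  by (intro add_mono power_mono a b) auto
 also have "... = (r * nrm v)\<^sup>2"
  unfolding ab(3) power_mult_distrib l2norm_append by (simp add: algebra_simps)
 finally show "nrm (dsum A B *v v) <= r * nrm v"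
  by (rule power2_le_imp_le) (use r0 in simp)
qed

text \<open>Representations of \<open>\<Prod>\<^sub>k M\<^sub>n\<^sub>k\<close> on \<open>\<complex>\<^sup>m\<close> that only see the coordinates \<open>k \<ge> N\<close>.\<close>

definition rep :: "(nat => nat) => nat => nat => ((nat => complex mat) => complex mat) => bool" where
 "rep n N m F \<longleftrightarrow> m > 0 &
  (ALL Y:mprod n. F Y : cmat m m) &
  (ALL Y:mprod n. ALL Z:mprod n. F (%k. Y k + Z k) = F Y + F Z) &
  (ALL c. ALL Y:mprod n. F (%k. c *m Y k) = c *m F Y) &
  (ALL Y:mprod n. ALL Z:mprod n. F (%k. Y k * Z k) = F Y * F Z) &
  (ALL Y:mprod n. F (%k. adj (Y k)) = adj (F Y)) &
  F (%k. 1\<^sub>m (n k)) = 1\<^sub>m m &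
  (ALL Y:mprod n. ALL r. (ALL k>=N. opn (Y k) <= r) --> opn (F Y) <= r)"

lemma repD:
 assumes "rep n N m F"
 shows "m > 0"
  and "Y : mprod n ==> F Y : cmat m m"
  and "Y : mprod n ==> Z : mprod n ==> F (%k. Y k + Z k) = F Y + F Z"
  and "Y : mprod n ==> F (%k. c *m Y k) = c *m F Y"
  and "Y : mprod n ==> Z : mprod n ==> F (%k. Y k * Z k) = F Y * F Z"
  and "Y : mprod n ==> F (%k. adj (Y k)) = adj (F Y)"
  and "F (%k. 1\<^sub>m (n k)) = 1\<^sub>m m"
  and "Y : mprod n ==> (!!k. k >= N ==> opn (Y k) <= r) ==> opn (F Y) <= r"
 using assms by (auto simp: rep_def)

lemma rep_coord: "n k > 0 ==> k >= N ==> rep n N (n k) (%Y. Y k)"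
 by (simp add: rep_def)

lemma rep_dsum:
 assumes F: "rep n N m F" and G: "rep n N l G"
 shows "rep n N (m + l) (%Y. dsum (F Y) (G Y))"
 unfolding rep_def
proof (intro conjI ballI allI impI)
 show "m + l > 0" using repD(1)[OF F] by simp
 show "dsum (F (%k. 1\<^sub>m (n k))) (G (%k. 1\<^sub>m (n k))) = 1\<^sub>m (m + l)"
  by (simp add: repD(7)[OF F] repD(7)[OF G] dsum_one)
 fix Y assume Y: "Y : mprod n"
 note FY = repD(2)[OF F Y] and GY = repD(2)[OF G Y]
 show "dsum (F Y) (G Y) : cmat (m + l) (m + l)" by (rule dsum_carrier[OF FY GY])
 show "dsum (F (%k. c *m Y k)) (G (%k. c *m Y k)) = c *m dsum (F Y) (G Y)" for c
  unfolding repD(4)[OF F Y] repD(4)[OF G Y] by (rule dsum_smult[OF FY GY])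
 show "dsum (F (%k. adj (Y k))) (G (%k. adj (Y k))) = adj (dsum (F Y) (G Y))"
  unfolding repD(6)[OF F Y] repD(6)[OF G Y] by (rule dsum_adj[OF FY GY])
 show "opn (dsum (F Y) (G Y)) <= r" if "ALL k>=N. opn (Y k) <= r" for r
  by (rule opnorm_dsum[OF FY GY]) (use that in \<open>auto intro!: repD(8)[OF F Y] repD(8)[OF G Y]\<close>)
 fix Z assume Z: "Z : mprod n"
 note FZ = repD(2)[OF F Z] and GZ = repD(2)[OF G Z]
 show "dsum (F (%k. Y k + Z k)) (G (%k. Y k + Z k)) = dsum (F Y) (G Y) + dsum (F Z) (G Z)"
  unfolding repD(3)[OF F Y Z] repD(3)[OF G Y Z] by (rule dsum_add[OF FY GY FZ GZ])
 show "dsum (F (%k. Y k * Z k)) (G (%k. Y k * Z k)) = dsum (F Y) (G Y) * dsum (F Z) (G Z)"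
  unfolding repD(5)[OF F Y Z] repD(5)[OF G Y Z] by (rule dsum_mult[OF FY GY FZ GZ])
qed

text \<open>Positivity at \<open>v\<close> minus \<open>1/t\<close> times \<open>w = M *v v\<close>,
  together with the norm bound, shows that the squared norm of \<open>w\<close> is at most
  \<open>t\<close> times the form at \<open>v\<close>. Expanding the squared norm of
  \<open>t v - w\<close> then gives the claim without diagonalising \<open>M\<close>.\<close>

lemma psd_bound:
 assumes M: "M : cmat m m" and h: "adj M = M"
  and psd: "!!v. v : cvec m ==> 0 <= Re ((M *v v) *c v)"
  and t: "opn M <= t" "t > 0"
 shows "opn (cr t *m 1\<^sub>m m - M) <= t"
proof (rule opnorm_le)
 show "0 <= t" using t by simp
 fix v :: "complex vec" assume "v : cvec (dim_col (cr t *m 1\<^sub>m m - M))"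
 hence v: "v : cvec m" using M by simp
 define w where "w = M *v v"
 have w: "w : cvec m" using mvc[OF M v] by (simp add: w_def)
 define u where "u = M *v w"
 have u: "u : cvec m" using mvc[OF M w] by (simp add: u_def)
 define al where "al = cr (1 / t)"
 have uv: "u *c v = w *c w" unfolding u_def using cip_adj[OF M w v] h by (simp add: w_def)
 have "0 <= Re ((M *v (v - al *s w)) *c (v - al *s w))"
  by (rule psd) (use v w in simp)
 also have "M *v (v - al *s w) = w - al *s u"
  using M v w by (simp add: mult_mat_vec_minus[of _ m m] mult_mat_vec_smult[of _ m m] w_def u_def)
 also have "Re ((w - al *s u) *c (v - al *s w))
   = Re (w *c v) - 2 / t * Re (w *c w) + (1/t) * (1/t) * Re (u *c w)"
  using u v w by (simp add: cip_simps[of _ m] uv al_def algebra_simps)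
 finally have h0: "0 <= Re (w *c v) - 2 / t * Re (w *c w) + (1/t) * (1/t) * Re (u *c w)" .
 have "Re (u *c w) <= cmod (u *c w)" by (rule complex_Re_le_cmod)
 also have "... <= opn M * nrm w * nrm w"
  unfolding u_def by (rule opnorm_sesq[OF M w w])
 also have "... <= t * nrm w * nrm w" using t by (intro mult_right_mono) auto
 finally have "Re (u *c w) <= t * Re (w *c w)" by (simp add: l2norm_Re[symmetric] power2_eq_square mult.assoc)
 hence "(1/t) * (1/t) * Re (u *c w) <= (1/t) * (1/t) * (t * Re (w *c w))"
  using t by (intro mult_left_mono) auto
 also have "... = Re (w *c w) / t" using t by simp
 finally have "Re (w *c w) / t <= Re (w *c v)" using h0 by simp
 hence key: "Re (w *c w) <= t * Re (w *c v)" using t by (simp add: pos_divide_le_eq mult.commute)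
 have "(cr t *m 1\<^sub>m m - M) *v v = cr t *s v - w"
  using M v by (simp add: minus_mult_distrib_mat_vec[of _ m m] smult_mat_mult_vec[of _ m m] w_def)
 hence "(nrm ((cr t *m 1\<^sub>m m - M) *v v))\<^sup>2
   = t * t * Re (v *c v) - 2 * t * Re (w *c v) + Re (w *c w)"
  using v w cip_commute[OF v w] by (simp add: l2norm_Re cip_simps[of _ m] algebra_simps)
 also have "... <= t * t * Re (v *c v)"
 proof -
  have "0 <= t * Re (w *c v)" using psd[OF v] t by (simp add: w_def)
  thus ?thesis using key by linarith
 qed
 also have "... = (t * nrm v)\<^sup>2" by (simp add: l2norm_Re[symmetric] power2_eq_square mult_ac)
 finally show "nrm ((cr t *m 1\<^sub>m m - M) *v v) <= t * nrm v"
  by (rule power2_le_imp_le) (use t in simp)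
qed

section \<open>Finite sums\<close>

definition vsum :: "nat => (nat => complex vec) => nat => complex vec" where
 "vsum m u r = vec m (%i. SUM j<r. u j $ i)"

lemma vsum_carrier [simp]: "vsum m u r : cvec m"
 by (simp add: vsum_def)

lemma vsum_Suc: "u r : cvec m ==> vsum m u (Suc r) = vsum m u r + u r"
 by (auto simp: vsum_def)

lemma vsum_0 [simp]: "vsum m u 0 = 0\<^sub>v m"
 by (auto simp: vsum_def)

lemma cip_vsum_left:
 assumes "!!j. j < r ==> u j : cvec m" "w : cvec m"
 shows "vsum m u r *c w = (SUM j<r. u j *c w)"
 using assms(1) by (induction r) (auto simp: vsum_Suc cip_add_left[of _ m] assms(2))

lemma cip_vsum_right:
 assumes "!!j. j < r ==> u j : cvec m" "w : cvec m"
 shows "w *c vsum m u r = (SUM j<r. w *c u j)"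
 using assms(1) by (induction r) (auto simp: vsum_Suc cip_add_right[of _ m] assms(2))

lemma mult_mat_vsum:
 fixes M :: "complex mat"
 assumes "M : cmat l m" "!!j. j < r ==> u j : cvec m"
 shows "M *v vsum m u r = vsum l (%j. M *v u j) r"
 using assms(2)
proof (induction r)
 case 0
 have "M *v 0\<^sub>v m = 0\<^sub>v l" using assms(1) by auto
 then show ?case by simp
next
 case (Suc r)
 thus ?case using assms(1)
  by (simp add: vsum_Suc mult_add_distrib_mat_vec[of M l m] mvc[OF assms(1)])
qed

primrec csum :: "'a cstar => (nat => 'a) => nat => 'a" where
 "csum A g 0 = 0[A]"
| "csum A g (Suc r) = csum A g r +[A] g r"

context cstar_algebra
begin

lemma csum_closed [simp]: "(!!j. j < r ==> g j : carrier A) ==> csum A g r : carrier A"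
 by (induction r) auto

lemma csum_mult_left: "(!!j. j < r ==> g j : carrier A) ==> x : carrier A ==>
 x ** csum A g r = csum A (%j. x ** g j) r"
 by (induction r) (auto simp: mult_add_right)

lemma csum_add: "(!!j. j < r ==> g j : carrier A) ==> (!!j. j < r ==> h j : carrier A) ==>
 csum A (%j. g j +. h j) r = csum A g r +. csum A h r"
 by (induction r) (auto simp: M.a_ac)

lemma csum_smult: "(!!j. j < r ==> g j : carrier A) ==> csum A (%j. c *. g j) r = c *. csum A g r"
 by (induction r) (auto simp: sm_add_right)

lemma csum_cong: "(!!j. j < r ==> g j = h j) ==> csum A g r = csum A h r"
 by (induction r) auto

end

lemma (in unital_cstar_algebra) pos_functional_csum:
 "pos_functional f ==> (!!j. j < r ==> g j : carrier A) ==> f (csum A g r) = (SUM j<r. f (g j))"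
 by (induction r) (auto simp: pos_functional_zero pos_functionalD(1))

context unital_cstar_algebra
begin

lemma functional_conj_pos:
 assumes f: "pos_functional f" and b: "pos b" and y: "y : carrier A"
 shows "0 <= Re (f (star A y ** (b ** y)))"
proof -
 obtain g where g: "pos g" "g ** g = b" using pos_sqrt[OF b] by blast
 note gc = posD[OF g(1)]
 have "star A (g ** y) ** (g ** y) = star A y ** (b ** y)"
  using g(2)[symmetric] gc y by (simp add: star_mult mult_assoc)
 thus ?thesis using pos_functionalD(4)[OF f, of "g ** y"] gc y by simp
qed

text \<open>The difference of the two sides is \<open>f\<close> at the positive element
  \<open>rs t -. star A b ** b\<close> conjugated by \<open>y\<close>. This is boundedness of left
  multiplication on the GNS space.\<close>

lemma functional_mult_bound:
 assumes f: "pos_functional f" and b: "b : carrier A" and y: "y : carrier A"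
 shows "Re (f (star A (b ** y) ** (b ** y))) <= (cnorm A b)\<^sup>2 * Re (f (star A y ** y))"
proof -
 let ?t = "(cnorm A b)\<^sup>2"
 have bb: "star A b ** b : carrier A" "star A (star A b ** b) = star A b ** b" "cnorm A (star A b ** b) <= ?t"
  using b by (simp_all add: star_mult cnorm_cstar)
 have "0 <= Re (f (star A y ** ((rs ?t -. star A b ** b) ** y)))"
  by (rule functional_conj_pos[OF f pos_norm_minus[OF bb] y])
 also have "star A y ** ((rs ?t -. star A b ** b) ** y)
   = cr ?t *. (star A y ** y) -. star A (b ** y) ** (b ** y)"
  using b y by (simp add: mult_diff_left mult_diff_right rs_mult smult_mult_right star_mult mult_assoc)
 also have "Re (f ...) = ?t * Re (f (star A y ** y)) - Re (f (star A (b ** y) ** (b ** y)))"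
  using b y by (simp add: pos_functional_diff[OF f] pos_functionalD(2)[OF f])
 finally show ?thesis by simp
qed

end

section \<open>Approximating vector functionals by coordinate representations\<close>

text \<open>One half of the gluing situation; it is instantiated for \<open>A\<close> and for
  \<open>B\<close> with the same \<open>C\<close>, \<open>f\<close> and sizes
  \<open>n\<close>.\<close>

locale gram_side = A: unital_cstar_algebra A + C: unital_cstar_algebra C
 for A :: "'a cstar" and C :: "'c cstar" +
 fixes n :: "nat => nat" and q :: "'a => (nat => complex mat) set" and s :: "'a => 'c" and f :: "'c => complex"
 assumes n_pos: "!!k. n k > 0"
  and q: "unital_embedding A (cor n) q"
  and s: "unital_embedding A C s"
  and f: "C.pos_functional f"
begin

sublocale Q: unital_cstar_algebra "cor n"
 by (rule unital_cstar_corona[OF n_pos])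

sublocale q: unital_hom A "cor n" q
 by unfold_locales (use q in \<open>auto simp: unital_embedding_def embedding_def\<close>)

sublocale s: unital_hom A C s
 by unfold_locales (use s in \<open>auto simp: unital_embedding_def embedding_def\<close>)

lemma q_inj: "inj_on q (carrier A)"
 using q by (simp add: unital_embedding_def embedding_def)

definition lift :: "(nat => complex mat) => 'a => bool" where
 "lift y a \<longleftrightarrow> y : mprod n & a : carrier A & cls n y = q a"

lemma liftD: "lift y a ==> y : mprod n" "lift y a ==> a : carrier A" "lift y a ==> q a = cls n y"
 by (auto simp: lift_def)

lemma ex_lift: "a : carrier A ==> EX y. lift y a"
 using carrier_corona[of "q a" n] by (auto simp: lift_def)

lemma lift_add: "lift y a ==> lift z b ==> lift (%k. y k + z k) (a +[A] b)"
 by (simp add: lift_def q.hom_simps(2) corona_add[symmetric])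

lemma lift_smult: "lift y a ==> lift (%k. c *m y k) (c .[A] a)"
 by (simp add: lift_def q.hom_simps(3) corona_smult[symmetric])

lemma lift_mult: "lift y a ==> lift z b ==> lift (%k. y k * z k) (a *[A] b)"
 by (simp add: lift_def q.hom_simps(4) corona_mult[symmetric])

lemma lift_adj: "lift y a ==> lift (%k. adj (y k)) (star A a)"
 by (simp add: lift_def q.hom_simps(5) corona_star[symmetric])

lemma lift_one: "lift (%k. 1\<^sub>m (n k)) 1[A]"
 by (simp add: lift_def corona_one[symmetric])

lemma lift_zero: "lift (%k. 0\<^sub>m (n k) (n k)) 0[A]"
 by (simp add: lift_def corona_zero[symmetric])

text \<open>Positive coordinates from \<open>N\<close> on bound the coordinates of
  \<open>t - y\<close>, hence the corona norm of the image of \<open>A.rs t\<close> minus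
  \<open>a\<close>. The injective \<open>q\<close> is isometric, so the bound holds in
  \<open>A\<close>, where it is the definition of positivity.\<close>

lemma lift_psd:
 assumes l: "lift y a" and h: "!!k. adj (y k) = y k"
  and psd: "!!k v. k >= N ==> v : cvec (n k) ==> 0 <= Re ((y k *v v) *c v)"
 shows "A.pos a"
proof -
 note y = liftD[OF l]
 obtain B where B: "!!k. opn (y k) <= B" "B >= 0" using mprod_bound[OF y(1)] by blast
 define t where "t = B + 1"
 have t: "t > 0" using B(2) by (simp add: t_def)
 have "star (cor n) (q a) = q a" using y h by (simp add: corona_star)
 hence "q (star A a) = q a" using y by (simp add: q.hom_simps(5))
 hence sa: "star A a = a" by (rule inj_onD[OF q_inj _ A.star_closed[OF y(2)] y(2)])
 have rs: "Q.rs t = cls n (%k. cr t *m 1\<^sub>m (n k))"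
  by (simp add: Q.rs_def corona_one corona_smult)
 have mem: "(%k. cr t *m 1\<^sub>m (n k)) : mprod n" by (rule mprod_smult[OF mprod_one])
 have "ALL k>=N. opn (cr t *m 1\<^sub>m (n k) - y k) <= t"
 proof (intro allI impI)
  fix k assume k: "k >= N"
  have "opn (y k) <= t" using B(1)[of k] by (simp add: t_def)
  thus "opn (cr t *m 1\<^sub>m (n k) - y k) <= t"
   by (intro psd_bound[OF mpm[OF y(1)] h]) (use psd[OF k] t in auto)
 qed
 hence "cnorm (cor n) (cls n (%k. cr t *m 1\<^sub>m (n k) - y k)) <= t"
  using t mprod_minus[OF mem y(1)] by (intro corona_norm_leI) (auto simp: eventually_sequentially)
 hence "cnorm (cor n) (q (A.rs t -[A] a)) <= t"
  using y corona_minus[OF mem y(1)] by (simp add: q.hom_diff q.hom_rs rs)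
 hence "cnorm A (A.rs t -[A] a) <= t"
  using q.hom_inj_isometric[OF q_inj, of "A.rs t -[A] a"] y by simp
 thus ?thesis using A.posI y(2) sa by blast
qed

lemma lift_psd_functional:
 assumes "lift y a" "!!k. adj (y k) = y k"
  and "!!k v. k >= N ==> v : cvec (n k) ==> 0 <= Re ((y k *v v) *c v)" "x : carrier C"
 shows "0 <= Re (f (star C x *[C] (s a *[C] x)))"
 by (rule C.functional_conj_pos[OF f s.hom_pos[OF lift_psd[OF assms(1-3)]] assms(4)])

text \<open>Matrix coefficient of \<open>a\<close> between the vectors of \<open>x\<close> and
  \<open>y\<close> in the GNS space of \<open>f\<close>, written without that space.\<close>

definition gm :: "'a => 'c => 'c => complex" where
 "gm a x y = f (star C y *[C] (s a *[C] x))"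

lemma gm_add: "a : carrier A ==> b : carrier A ==> x : carrier C ==> y : carrier C ==>
 gm (a +[A] b) x y = gm a x y + gm b x y"
 by (simp add: gm_def s.hom_simps(2) C.mult_add_left C.mult_add_right C.pos_functionalD(1)[OF f])

lemma gm_smult: "a : carrier A ==> x : carrier C ==> y : carrier C ==> gm (c .[A] a) x y = c * gm a x y"
 by (simp add: gm_def s.hom_simps(3) C.smult_mult_left C.smult_mult_right C.pos_functionalD(2)[OF f])

lemma gm_star: "a : carrier A ==> x : carrier C ==> y : carrier C ==> gm (star A a) x y = cnj (gm a y x)"
proof -
 assume c: "a : carrier A" "x : carrier C" "y : carrier C"
 have "star C (star C x *[C] (s a *[C] y)) = star C y *[C] (s (star A a) *[C] x)"
  using c by (simp add: C.star_mult C.mult_assoc s.hom_simps(5))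
 thus ?thesis using C.pos_functionalD(3)[OF f, of "star C x *[C] (s a *[C] y)"] c
  by (simp add: gm_def)
qed

lemma gm_zero: "x : carrier C ==> y : carrier C ==> gm 0[A] x y = 0"
 by (simp add: gm_def C.pos_functional_zero[OF f])

lemma lift_combination:
 fixes p :: nat and c :: "nat => complex"
 assumes ls: "!!i. i < p ==> lift (ys i) (as i)" and x: "x : carrier C"
 shows "EX y a. lift y a & gm a x x = (SUM i<p. c i * gm (as i) x x) &
  (ALL k. ALL v:cvec (n k). (y k *v v) *c v = (SUM i<p. c i * ((ys i k *v v) *c v)))"
 using ls
proof (induction p)
 case 0
 have "0\<^sub>m (n k) (n k) *v v = 0\<^sub>v (n k)" if "v : cvec (n k)" for k and v :: "complex vec"
  using that by (intro eq_vecI) auto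
 thus ?case using lift_zero gm_zero[OF x x] by (intro exI[of _ "%k. 0\<^sub>m (n k) (n k)"] exI[of _ "0[A]"]) auto
next
 case (Suc p)
 then obtain y a where IH: "lift y a" "gm a x x = (SUM i<p. c i * gm (as i) x x)"
  "!!k v. v : cvec (n k) ==> (y k *v v) *c v = (SUM i<p. c i * ((ys i k *v v) *c v))"
  by auto
 have lp: "lift (ys p) (as p)" using Suc by simp
 note m1 = mpm[OF liftD(1)[OF IH(1)]] and m2 = mpm[OF liftD(1)[OF lp]]
 show ?case
 proof (intro exI conjI allI ballI)
  show "lift (%k. y k + c p *m ys p k) (a +[A] c p .[A] as p)"
   by (rule lift_add[OF IH(1) lift_smult[OF lp]])
  show "gm (a +[A] c p .[A] as p) x x = (SUM i<Suc p. c i * gm (as i) x x)"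
   using liftD(2)[OF IH(1)] liftD(2)[OF lp] x by (simp add: gm_add gm_smult IH(2))
  fix k and v :: "complex vec" assume v: "v : cvec (n k)"
  have "(y k + c p *m ys p k) *v v = y k *v v + c p *s (ys p k *v v)"
   using m1[of k] m2[of k] v by (simp add: add_mult_distrib_mat_vec[of _ "n k" "n k"] smult_mat_mult_vec[of _ "n k" "n k"])
  thus "((y k + c p *m ys p k) *v v) *c v = (SUM i<Suc p. c i * ((ys i k *v v) *c v))"
   using mvc[OF m1 v] mvc[OF m2 v] v IH(3)[OF v]
   by (simp add: cip_add_left[of _ "n k"] cip_smult_left[of _ "n k"])
 qed
qed

text \<open>The negative real part of the combined lift is positive semidefinite from
  \<open>N\<close> on, so it lifts a positive element of \<open>A\<close>, and \<open>f\<close>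
  inherits the sign. This inequality is what refutes a separating functional in
  \<open>gram_one\<close>.\<close>

lemma gm_dominated:
 fixes p :: nat and c :: "nat => complex"
 assumes ls: "!!i. i < p ==> lift (ys i) (as i)" and x: "x : carrier C"
  and neg: "!!k (v :: complex vec). k >= N ==> v : cvec (n k) ==> Re (SUM i<p. c i * ((ys i k *v v) *c v)) <= 0"
 shows "Re (SUM i<p. c i * gm (as i) x x) <= 0"
proof -
 obtain y a where ya: "lift y a" "gm a x x = (SUM i<p. c i * gm (as i) x x)"
  "!!k v. v : cvec (n k) ==> (y k *v v) *c v = (SUM i<p. c i * ((ys i k *v v) *c v))"
  using lift_combination[of p ys as x c, OF ls x] by blast
 note y = mpm[OF liftD(1)[OF ya(1)]]
 define h where "h k = (-1/2) *m (y k + adj (y k))" for k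
 define b where "b = (-1/2) .[A] (a +[A] star A a)"
 have lh: "lift h b" unfolding h_def b_def by (intro lift_smult lift_add lift_adj ya(1))
 have hh: "adj (h k) = h k" for k
  using y[of k] by (simp add: h_def adj_smult adj_add[of _ "n k" "n k"] comm_add_mat[of _ "n k" "n k"])
 have hv: "Re ((h k *v v) *c v) = - Re ((y k *v v) *c v)" if v: "v : cvec (n k)" for k and v :: "complex vec"
 proof -
  have "h k *v v = (-1/2) *s (y k *v v + adj (y k) *v v)"
   unfolding h_def using y[of k] v
   by (simp add: add_mult_distrib_mat_vec[of _ "n k" "n k"] smult_mat_mult_vec[of _ "n k" "n k"])
  moreover have "y k *v v : cvec (n k)" "adj (y k) *v v : cvec (n k)"
   by (rule mvc[OF y v], rule mvc[OF adj_carrier[OF y] v])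
  moreover from this have "(adj (y k) *v v) *c v = cnj ((y k *v v) *c v)"
   using cip_adj'[OF y v v] cip_commute[of "y k *v v" "n k" v] v by simp
  ultimately show ?thesis using v by (simp add: cip_smult_left[of _ "n k"] cip_add_left[of _ "n k"])
 qed
 have "0 <= Re (f (star C x *[C] (s b *[C] x)))"
 proof (rule lift_psd_functional[OF lh hh _ x])
  fix k and v :: "complex vec" assume k: "N <= k" and v: "v : cvec (n k)"
  show "0 <= Re ((h k *v v) *c v)" unfolding hv[OF v] ya(3)[OF v] using neg[OF k v] by simp
 qed
 also have "f (star C x *[C] (s b *[C] x)) = gm b x x" by (simp add: gm_def)
 also have "... = (-1/2) * (gm a x x + cnj (gm a x x))"
  unfolding b_def using liftD(2)[OF ya(1)] x by (simp add: gm_smult gm_add gm_star)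
 also have "Re ... = - Re (gm a x x)" by simp
 finally show ?thesis using ya(2) by simp
qed

text \<open>The value vectors attained by representations form a convex cone: direct sums add them,
  rescaling the vector scales them. If the cone stayed at distance \<open>e\<close> from the true
  values, Hahn-Banach would give a functional that is nonpositive on the cone and positive at the
  true values, against \<open>gm_dominated\<close>.\<close>

lemma gram_one:
 fixes p :: nat and e :: real
 assumes ls: "!!i. i < p ==> lift (ys i) (as i)" and x: "x : carrier C" and e: "e > 0"
 shows "EX m F v. rep n N m F & v : cvec m & (ALL i<p. cmod ((F (ys i) *v v) *c v - gm (as i) x x) < e)"
proof (rule ccontr)
 assume no: "\<not> ?thesis"
 define g :: "nat => complex" where "g i = gm (as i) x x" for i
 \<comment> \<open>Entries from index \<open>p\<close> on are left free, and the distance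
   \<open>D\<close> below ignores them; so finitely many constraints live in one function
   space.\<close>
 define W :: "(nat => complex) set" where "W = {w. EX m F v. rep n N m F & v : cvec m & (ALL i<p. w i = (F (ys i) *v v) *c v)}"
 have yc: "ys i : mprod n" if "i < p" for i using liftD(1)[OF ls[OF that]] .
 interpret R: real_space "UNIV :: (nat => complex) set" "%u v i. u i + v i" "%t v i. cr t * v i" "%i. 0"
  by unfold_locales (auto simp: algebra_simps)
 have W_ne: "(%i. 0) : W"
 proof -
  have "(ys i N *v 0\<^sub>v (n N)) *c 0\<^sub>v (n N) = 0" if "i < p" for i
   using mvc[OF mpm[OF yc[OF that]], of "0\<^sub>v (n N)" N] by simp
  thus ?thesis unfolding W_def
   using rep_coord[of n N N] n_pos[of N] by (intro CollectI exI[of _ "n N"] exI[of _ "%Y. Y N"] exI[of _ "0\<^sub>v (n N)"]) auto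
 qed
 have W_add: "(%i. w i + w' i) : W" if w: "w : W" and w': "w' : W" for w w' :: "nat => complex"
 proof -
  obtain m F v where 1: "rep n N m F" "v : cvec m" "!!i. i < p ==> w i = (F (ys i) *v v) *c v"
   using w unfolding W_def by blast
  obtain l G u where 2: "rep n N l G" "u : cvec l" "!!i. i < p ==> w' i = (G (ys i) *v u) *c u"
   using w' unfolding W_def by blast
  have "w i + w' i = (dsum (F (ys i)) (G (ys i)) *v (v @\<^sub>v u)) *c (v @\<^sub>v u)" if i: "i < p" for i
  proof -
   note Fc = repD(2)[OF 1(1) yc[OF i]] and Gc = repD(2)[OF 2(1) yc[OF i]]
   show ?thesis unfolding dsum_mult_vec[OF Fc Gc 1(2) 2(2)]
    by (subst cip_append[OF mvc[OF Fc 1(2)] 1(2) mvc[OF Gc 2(2)] 2(2)])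
     (simp add: 1(3)[OF i] 2(3)[OF i])
  qed
  thus ?thesis unfolding W_def using rep_dsum[OF 1(1) 2(1)] 1(2) 2(2)
   by (intro CollectI exI[of _ "m + l"] exI[of _ "%Y. dsum (F Y) (G Y)"] exI[of _ "v @\<^sub>v u"]) auto
 qed
 have W_scale: "(%i. cr t * w i) : W" if w: "w : W" and t: "t > 0" for w :: "nat => complex" and t
 proof -
  obtain m F v where 1: "rep n N m F" "v : cvec m" "!!i. i < p ==> w i = (F (ys i) *v v) *c v"
   using w unfolding W_def by blast
  let ?r = "cr (sqrt t)"
  have rr: "?r * ?r = cr t" using t by (simp flip: of_real_mult)
  have "cr t * w i = (F (ys i) *v (?r *s v)) *c (?r *s v)" if i: "i < p" for i
  proof -
   note Fc = repD(2)[OF 1(1) yc[OF i]]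
   show ?thesis unfolding mult_mat_vec_smult[OF Fc 1(2)]
    using mvc[OF Fc 1(2)] 1(2) rr
    by (simp add: cip_smult_left[of _ m] cip_smult_right[of _ m] 1(3)[OF i] mult.assoc[symmetric])
  qed
  thus ?thesis unfolding W_def using 1(1,2)
   by (intro CollectI exI[of _ m] exI[of _ F] exI[of _ "?r *s v"]) auto
 qed
 define D :: "(nat => complex) => (nat => complex) => real" where "D v w = (SUM i<p. cmod (v i - w i))" for v w
 have D0: "0 <= D v w" for v w by (simp add: D_def sum_nonneg)
 define P :: "(nat => complex) => real" where "P v = (INF w\<in>W. D v w)" for v
 have bdd: "bdd_below ((%w. D v w) ` W)" for v by (rule bdd_belowI2[of _ 0]) (rule D0)
 have P_le: "P v <= D v w" if "w : W" for v w unfolding P_def by (rule cINF_lower[OF bdd that])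
 have P_ap: "EX w:W. D v w < P v + dl" if "dl > 0" for v dl
 proof -
  have "Inf ((%w. D v w) ` W) < P v + dl" using that by (simp add: P_def)
  thus ?thesis using cInf_lessD[of "(%w. D v w) ` W" "P v + dl"] W_ne by blast
 qed
 have sub: "R.sublin P"
  unfolding R.sublin_def
 proof (intro conjI ballI allI impI)
  fix u v :: "nat => complex"
  show "P (%i. u i + v i) <= P u + P v"
  proof (rule field_le_epsilon)
   fix dl :: real assume "dl > 0"
   hence d: "dl/2 > 0" by simp
   obtain w where w: "w : W" "D u w < P u + dl/2" using P_ap[OF d] by blast
   obtain w' where w': "w' : W" "D v w' < P v + dl/2" using P_ap[OF d] by blast
   have "P (%i. u i + v i) <= D (%i. u i + v i) (%i. w i + w' i)" by (rule P_le[OF W_add[OF w(1) w'(1)]])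
   also have "... <= D u w + D v w'"
    unfolding D_def sum.distrib[symmetric]
   proof (rule sum_mono)
    fix i
    have "u i + v i - (w i + w' i) = (u i - w i) + (v i - w' i)" by simp
    thus "cmod (u i + v i - (w i + w' i)) <= cmod (u i - w i) + cmod (v i - w' i)"
     using norm_triangle_ineq[of "u i - w i" "v i - w' i"] by (simp only:)
   qed
   finally show "P (%i. u i + v i) <= P u + P v + dl" using w w' by linarith
  qed
 next
  fix v :: "nat => complex" and t :: real assume t: "t > 0"
  show "P (%i. cr t * v i) <= t * P v"
  proof (rule field_le_epsilon)
   fix dl :: real assume "dl > 0"
   hence d: "dl/t > 0" using t by simp
   obtain w where w: "w : W" "D v w < P v + dl/t" using P_ap[OF d] by blast
   have "P (%i. cr t * v i) <= D (%i. cr t * v i) (%i. cr t * w i)"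
    by (rule P_le[OF W_scale[OF w(1) t]])
   also have "... = t * D v w"
    using t by (simp add: D_def sum_distrib_left norm_mult flip: right_diff_distrib)
   also have "... <= t * (P v + dl/t)" using w t by (intro mult_left_mono) auto
   finally show "P (%i. cr t * v i) <= t * P v + dl" using t by (simp add: algebra_simps)
  qed
 qed
 have Pg: "P g >= e"
 proof (unfold P_def, rule cINF_greatest)
  show "W ~= {}" using W_ne by blast
  fix w assume "w : W"
  then obtain m F v where 1: "rep n N m F" "v : cvec m" "!!i. i < p ==> w i = (F (ys i) *v v) *c v"
   unfolding W_def by blast
  obtain i where i: "i < p" "\<not> cmod ((F (ys i) *v v) *c v - gm (as i) x x) < e" using no 1(1,2) by blast
  have "e <= cmod (g i - w i)" using i 1(3)[OF i(1)] by (simp add: g_def norm_minus_commute)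
  also have "... <= D g w" unfolding D_def by (rule member_le_sum) (use i in auto)
  finally show "e <= D g w" .
 qed
 obtain l where l: "!!u v. l (%i. u i + v i) = l u + l v"
  "!!t v. l (%i. cr t * v i) = t * l v" "!!v. l v <= P v" "l g = P g"
  by (rule R.dominated_linear_functional[OF sub, of g]) (use that in auto)
 \<comment> \<open>Complex coefficients for which \<open>l\<close> is the real part of a
   complex-linear form; they are determined by the values of \<open>l\<close> at 1 and at the
   imaginary unit in each slot.\<close>
 define c :: "nat => complex" where "c i = cr (l (%j. if j = i then 1 else 0)) - \<i> * cr (l (%j. if j = i then \<i> else 0))" for i
 have l_trunc: "l (%j. if j < r then v j else 0) = Re (SUM i<r. c i * v i)" for r v
 proof (induction r)
  case 0
  show ?case using l(2)[of 0 "%j. 0"] by simp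
 next
  case (Suc r)
  have e: "(%j. if j < Suc r then v j else 0)
   = (%j. (if j < r then v j else 0) + (cr (Re (v r)) * (if j = r then 1 else 0)
     + cr (Im (v r)) * (if j = r then \<i> else 0)))"
   by (rule ext) (auto simp: complex_eq_iff dest: less_antisym)
  have "l (%j. if j < Suc r then v j else 0) = l (%j. if j < r then v j else 0)
    + (Re (v r) * l (%j. if j = r then 1 else 0) + Im (v r) * l (%j. if j = r then \<i> else 0))"
   unfolding e by (simp only: l(1) l(2))
  also have "... = Re (SUM i<Suc r. c i * v i)" unfolding Suc.IH by (simp add: c_def algebra_simps)
  finally show ?case .
 qed
 \<comment> \<open>A vector supported on the free entries has distance 0 from the cone, and so has
   its negative; therefore \<open>l\<close> vanishes on it.\<close>
 have l_ext: "l v = Re (SUM i<p. c i * v i)" for v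
 proof -
  define u :: "nat => complex" where "u j = (if j < p then 0 else v j)" for j
  have u0: "D u (%i. 0) = 0" "D (%j. cr (-1) * u j) (%i. 0) = 0" by (simp_all add: D_def u_def)
  have "l u <= 0" using l(3)[of u] P_le[OF W_ne, of u] u0 by linarith
  moreover have "- l u <= 0"
   using l(3)[of "%j. cr (-1) * u j"] P_le[OF W_ne, of "%j. cr (-1) * u j"] u0 l(2)[of "-1" u]
   by linarith
  moreover have "v = (%j. (if j < p then v j else 0) + u j)" by (auto simp: u_def)
  hence "l v = l (%j. if j < p then v j else 0) + l u" using l(1)[of "%j. if j < p then v j else 0" u] by simp
  ultimately show ?thesis by (simp add: l_trunc)
 qed
 have "Re (SUM i<p. c i * gm (as i) x x) <= 0"
 proof (rule gm_dominated[OF ls x])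
  fix k and v :: "complex vec" assume k: "N <= k" and v: "v : cvec (n k)"
  have "(%i. (ys i k *v v) *c v) : W" unfolding W_def
   using rep_coord[OF n_pos k] v by (intro CollectI exI[of _ "n k"] exI[of _ "%Y. Y k"] exI[of _ v]) auto
  hence "l (%i. (ys i k *v v) *c v) <= D (%i. (ys i k *v v) *c v) (%i. (ys i k *v v) *c v)"
   using l(3) P_le order_trans by blast
  thus "Re (SUM i<p. c i * ((ys i k *v v) *c v)) <= 0" by (simp add: l_ext D_def)
 qed
 moreover have "l g = Re (SUM i<p. c i * gm (as i) x x)" unfolding l_ext by (simp add: g_def)
 ultimately show False using Pg l(4) e by linarith
qed

end

section \<open>Approximating Gram matrices\<close>

text \<open>Near-minimality is tested with \<open>c\<close> equal to
  \<open>f (star A y ** u)\<close> divided by \<open>g + 1\<close>. The added 1 keeps the quotient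
  meaningful when \<open>y\<close> has seminorm 0.\<close>

lemma (in unital_cstar_algebra) near_minimal_orthogonal:
 assumes f: "pos_functional f" and u: "u : carrier A" and y: "y : carrier A"
  and min: "!!c. Re (f (star A u ** u)) <= Re (f (star A (u -. c *. y) ** (u -. c *. y))) + dl\<^sup>2"
 shows "(cmod (f (star A y ** u)))\<^sup>2 <= dl\<^sup>2 * (Re (f (star A y ** y)) + 1)"
proof -
 define g where "g = Re (f (star A y ** y))"
 define b where "b = f (star A y ** u)"
 have g0: "0 <= g" unfolding g_def by (rule pos_functionalD(4)[OF f y])
 define t where "t = 1 / (g + 1)"
 define c where "c = cr t * b"
 have fb: "f (star A u ** y) = cnj b"
  using pos_functionalD(3)[OF f, of "star A y ** u"] u y by (simp add: b_def star_mult)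
 have gg: "f (star A y ** y) = cr g" unfolding g_def by (rule pos_functional_self[OF f y])
 have "star A (u -. c *. y) ** (u -. c *. y)
   = (star A u ** u -. cnj c *. (star A y ** u)) -. (c *. (star A u ** y) -. (c * cnj c) *. (star A y ** y))"
  using u y by (simp add: star_diff star_smult mult_diff_left mult_diff_right smult_mult_left
    smult_mult_right sm_diff_right sm_assoc mult.commute)
 hence "Re (f (star A (u -. c *. y) ** (u -. c *. y)))
   = Re (f (star A u ** u)) - 2 * Re (c * cnj b) + Re (c * cnj c) * g"
  using u y by (simp add: pos_functional_diff[OF f] pos_functionalD(2)[OF f] fb gg b_def[symmetric])
 moreover have "Re (c * cnj b) = t * (cmod b)\<^sup>2" "Re (c * cnj c) = t * t * (cmod b)\<^sup>2"
  unfolding c_def cmod_power2 by (simp_all add: power2_eq_square algebra_simps)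
 ultimately have "2 * (t * (cmod b)\<^sup>2) - t * t * (cmod b)\<^sup>2 * g <= dl\<^sup>2" using min[of c] by simp
 moreover have "t * t * (cmod b)\<^sup>2 * g <= t * (cmod b)\<^sup>2"
 proof -
  have "t * g <= 1" "0 <= t" using g0 by (auto simp: t_def)
  hence "(t * g) * (t * (cmod b)\<^sup>2) <= 1 * (t * (cmod b)\<^sup>2)" by (intro mult_right_mono) auto
  thus ?thesis by (simp add: mult_ac)
 qed
 ultimately have "t * (cmod b)\<^sup>2 <= dl\<^sup>2" by linarith
 thus ?thesis using g0 by (simp add: t_def b_def[symmetric] g_def[symmetric] pos_divide_le_eq)
qed

lemma (in cstar_algebra) csum_delta:
 assumes "!!j. j < r ==> g j : carrier A" "i < r"
 shows "csum A (%j. if j = i then g j else \<zero>) r = g i"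
 using assms
proof (induction r)
 case (Suc r)
 have z: "csum A (%j. if j = i then g j else \<zero>) r' = \<zero>" if "r' <= i" for r'
  using that by (induction r') auto
 show ?case using Suc z[of r] by (cases "i = r") (auto simp: less_Suc_eq)
qed simp

lemma rep_sesq:
 fixes r :: nat
 assumes F: "rep n N m F" and y: "y : mprod n" and t: "!!j. j < r ==> t j : mprod n"
  and t': "!!j. j < r ==> t' j : mprod n" and xi: "!!j. j < r ==> xj j : cvec m"
 shows "(F y *v vsum m (%j. F (t j) *v xj j) r) *c vsum m (%j. F (t' j) *v xj j) r
  = (SUM j<r. SUM j'<r. (F (%k. adj (t' j' k) * (y k * t j k)) *v xj j) *c xj j')"
proof -
 note Fy = repD(2)[OF F y]
 have u: "F (t j) *v xj j : cvec m" "F (t' j) *v xj j : cvec m" if "j < r" for j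
  by (rule mvc[OF repD(2)[OF F t[OF that]] xi[OF that]],
    rule mvc[OF repD(2)[OF F t'[OF that]] xi[OF that]])
 have e: "(F y *v (F (t j) *v xj j)) *c (F (t' j') *v xj j')
   = (F (%k. adj (t' j' k) * (y k * t j k)) *v xj j) *c xj j'" if j: "j < r" and j': "j' < r" for j j'
 proof -
  note 1 = repD(2)[OF F t[OF j]] and 2 = repD(2)[OF F t'[OF j']]
  have m1: "(%k. y k * t j k) : mprod n" by (rule mprod_mult[OF y t[OF j]])
  have "F (%k. adj (t' j' k) * (y k * t j k)) = adj (F (t' j')) * (F y * F (t j))"
   using repD(5)[OF F mprod_adj[OF t'[OF j']] m1] repD(5)[OF F y t[OF j]] repD(6)[OF F t'[OF j']] by simp
  also have "... *v xj j = adj (F (t' j')) *v (F y *v (F (t j) *v xj j))"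
   using Fy 1 adj_carrier[OF 2] xi[OF j]
   by (simp add: assoc_mult_mat_vec[of _ m m _ m] mvc[OF 1 xi[OF j]] mmc[OF Fy 1])
  also have "... *c xj j' = (F y *v (F (t j) *v xj j)) *c (F (t' j') *v xj j')"
   by (rule cip_adj'[OF 2 mvc[OF Fy u(1)[OF j]] xi[OF j']])
  finally show ?thesis ..
 qed
 have "F y *v vsum m (%j. F (t j) *v xj j) r = vsum m (%j. F y *v (F (t j) *v xj j)) r"
  by (rule mult_mat_vsum[OF Fy u(1)])
 also have "... *c vsum m (%j. F (t' j) *v xj j) r
   = (SUM j<r. (F y *v (F (t j) *v xj j)) *c vsum m (%j. F (t' j) *v xj j) r)"
  by (rule cip_vsum_left) (simp_all add: mvc[OF Fy u(1)])
 also have "... = (SUM j<r. SUM j'<r. (F y *v (F (t j) *v xj j)) *c (F (t' j') *v xj j'))"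
  by (intro sum.cong refl cip_vsum_right) (simp_all add: mvc[OF Fy u(1)] u(2))
 also have "... = (SUM j<r. SUM j'<r. (F (%k. adj (t' j' k) * (y k * t j k)) *v xj j) *c xj j')"
  by (intro sum.cong refl) (simp add: e)
 finally show ?thesis .
qed

context gram_side
begin

lemma gram_one_set:
 assumes P: "finite P" "!!y a. (y, a) : P ==> lift y a" and x: "x : carrier C" and e: "(e::real) > 0"
 shows "EX m F v. rep n N m F & v : cvec m & (ALL (y, a):P. cmod ((F y *v v) *c v - gm a x x) < e)"
proof -
 obtain h where h: "bij_betw h {0..<card P} P" using ex_bij_betw_nat_finite[OF P(1)] by blast
 have hP: "h i : P" if "i < card P" for i using bij_betwE[OF h] that by simp
 have "lift (fst (h i)) (snd (h i))" if "i < card P" for i using P(2)[of "fst (h i)" "snd (h i)"] hP[OF that] by simp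
 from gram_one[where N = N and p = "card P" and ys = "%i. fst (h i)" and as = "%i. snd (h i)", OF this x e] obtain m F v where 1: "rep n N m F" "v : cvec m"
  "!!i. i < card P ==> cmod ((F (fst (h i)) *v v) *c v - gm (snd (h i)) x x) < e"
  by blast
 have "cmod ((F y *v v) *c v - gm a x x) < e" if ya: "(y, a) : P" for y a
 proof -
  obtain i where "i < card P" "h i = (y, a)" using h ya unfolding bij_betw_def by force
  thus ?thesis using 1(3)[of i] by simp
 qed
 thus ?thesis using 1(1,2) by blast
qed

lemma gm_left_add: "a : carrier A ==> x : carrier C ==> x' : carrier C ==> y : carrier C ==>
 gm a (x +[C] x') y = gm a x y + gm a x' y"
 by (simp add: gm_def C.mult_add_right C.pos_functionalD(1)[OF f])

lemma gm_right_add: "a : carrier A ==> x : carrier C ==> y : carrier C ==> y' : carrier C ==>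
 gm a x (y +[C] y') = gm a x y + gm a x y'"
 by (simp add: gm_def C.star_add C.mult_add_left C.pos_functionalD(1)[OF f])

lemma gm_zero_vec [simp]: "a : carrier A ==> x : carrier C ==> gm a 0[C] x = 0"
 "a : carrier A ==> x : carrier C ==> gm a x 0[C] = 0"
 by (simp_all add: gm_def C.pos_functional_zero[OF f])

lemma gm_csum_left: "a : carrier A ==> (!!j. j < r ==> g j : carrier C) ==> y : carrier C ==>
 gm a (csum C g r) y = (SUM j<r. gm a (g j) y)"
 by (induction r) (auto simp: gm_left_add)

lemma gm_csum_right: "a : carrier A ==> (!!j. j < r ==> g j : carrier C) ==> x : carrier C ==>
 gm a x (csum C g r) = (SUM j<r. gm a x (g j))"
 by (induction r) (auto simp: gm_right_add)

lemma gm_move: "a : carrier A ==> b : carrier A ==> b' : carrier A ==> x : carrier C ==> y : carrier C ==>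
 gm a (s b *[C] x) (s b' *[C] y) = gm (star A b' *[A] (a *[A] b)) x y"
 by (simp add: gm_def s.hom_simps(4,5) C.star_mult C.mult_assoc)

lemma gm_as_functional: "a : carrier A ==> x : carrier C ==> y : carrier C ==>
 gm a x y = f (star C (s (star A a) *[C] y) *[C] x)"
 by (simp add: gm_def s.hom_simps(5) C.star_mult C.mult_assoc)

lemma gm_comb:
 assumes "a : carrier A" "!!j. b j : carrier A" "!!j. b' j : carrier A" "!!j. j < r ==> xs j : carrier C"
 shows "gm a (csum C (%j. s (b j) *[C] xs j) r) (csum C (%j. s (b' j) *[C] xs j) r)
  = (SUM j<r. SUM j'<r. gm (star A (b' j') *[A] (a *[A] b j)) (xs j) (xs j'))"
proof -
 have 1: "s (b j) *[C] xs j : carrier C" "s (b' j) *[C] xs j : carrier C" if "j < r" for j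
  using assms(2-4) that by auto
 show ?thesis using assms 1 by (simp add: gm_csum_left gm_csum_right gm_move) (rule sum.swap)
qed

text \<open>Projection of \<open>x\<close> to the left \<open>A\<close>-span of the
  \<open>xs\<close> in the seminorm of \<open>f\<close>. The least distance need not be attained, so
  \<open>a\<close> minimises only up to \<open>dl\<close> squared, and \<open>u\<close> is only
  almost orthogonal to that span.\<close>

lemma near_projection:
 fixes r :: nat
 assumes xs: "!!j. j < r ==> xs j : carrier C" and x: "x : carrier C" and d: "dl > 0" "dl <= 1"
 obtains a u where "!!j. a j : carrier A" "u : carrier C"
  "x = csum C (%j. s (a j) *[C] xs j) r +[C] u"
  "!!b. (!!j. b j : carrier A) ==> (cmod (f (star C (csum C (%j. s (b j) *[C] xs j) r) *[C] u)))\<^sup>2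
   <= dl\<^sup>2 * (Re (f (star C (csum C (%j. s (b j) *[C] xs j) r) *[C] csum C (%j. s (b j) *[C] xs j) r)) + 1)"
  "Re (f (star C (csum C (%j. s (a j) *[C] xs j) r) *[C] csum C (%j. s (a j) *[C] xs j) r))
   <= 4 * Re (f (star C x *[C] x)) + 2"
proof -
 define Y where "Y b = csum C (%j. s (b j) *[C] xs j) r" for b
 define g where "g z = Re (f (star C z *[C] z))" for z
 have g0: "0 <= g z" if "z : carrier C" for z unfolding g_def by (rule C.pos_functionalD(4)[OF f that])
 have Yc [simp]: "Y b : carrier C" if "!!j. b j : carrier A" for b
  unfolding Y_def using that xs by (intro C.csum_closed) auto
 have Y_add: "Y (%j. b j +[A] c .[A] b' j) = Y b +[C] c .[C] Y b'"
  if bb: "!!j. b j : carrier A" "!!j. b' j : carrier A" for b b' c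
 proof -
  have "Y (%j. b j +[A] c .[A] b' j) = csum C (%j. s (b j) *[C] xs j +[C] c .[C] (s (b' j) *[C] xs j)) r"
   unfolding Y_def by (rule C.csum_cong)
    (simp add: bb xs s.hom_simps(2,3) C.mult_add_left C.smult_mult_left)
  also have "... = csum C (%j. s (b j) *[C] xs j) r +[C] csum C (%j. c .[C] (s (b' j) *[C] xs j)) r"
   by (rule C.csum_add) (simp_all add: bb xs)
  also have "csum C (%j. c .[C] (s (b' j) *[C] xs j)) r = c .[C] csum C (%j. s (b' j) *[C] xs j) r"
   by (rule C.csum_smult) (simp add: bb xs)
  finally show ?thesis unfolding Y_def .
 qed
 define T :: "(nat => 'a) set" where "T = {b. ALL j. b j : carrier A}"
 define E where "E b = g (x -[C] Y b)" for b
 have T0: "(%j. 0[A]) : T" by (simp add: T_def)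
 have bdd: "bdd_below (E ` T)" by (rule bdd_belowI2[of _ 0]) (auto simp: T_def E_def x intro!: g0)
 obtain a where a: "a : T" "E a < Inf (E ` T) + dl\<^sup>2"
  using cInf_lessD[of "E ` T" "Inf (E ` T) + dl\<^sup>2"] T0 d by auto
 have min: "E a <= E b + dl\<^sup>2" if "b : T" for b
  using a(2) cInf_lower[OF imageI[OF that] bdd] by linarith
 have ac: "a j : carrier A" for j using a(1) by (simp add: T_def)
 have Ya: "Y a : carrier C" using ac by simp
 define u where "u = x -[C] Y a"
 have u: "u : carrier C" using x Ya by (simp add: u_def)
 have xu: "x = Y a +[C] u" using x Ya C.diff_add_cancel[OF x Ya] C.M.a_comm[of "Y a" u] u by (simp add: u_def)
 have orth: "(cmod (f (star C (Y b) *[C] u)))\<^sup>2 <= dl\<^sup>2 * (Re (f (star C (Y b) *[C] Y b)) + 1)"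
  if b: "!!j. b j : carrier A" for b
 proof (rule C.near_minimal_orthogonal[OF f u Yc[OF b]])
  fix c
  have "(%j. a j +[A] c .[A] b j) : T" using ac b by (simp add: T_def)
  from min[OF this] have "g u <= g (x -[C] (Y a +[C] c .[C] Y b)) + dl\<^sup>2"
   unfolding E_def u_def[symmetric] Y_add[of a b, OF ac b] .
  also have "x -[C] (Y a +[C] c .[C] Y b) = u -[C] c .[C] Y b"
   using x Ya Yc[OF b] unfolding u_def by (simp add: a_minus_def C.M.minus_add C.M.a_assoc)
  finally show "Re (f (star C u *[C] u))
   <= Re (f (star C (u -[C] c .[C] Y b) *[C] (u -[C] c .[C] Y b))) + dl\<^sup>2"
   unfolding g_def .
 qed
 have "E (%j. 0[A]) = g x"
 proof -
  have "Y (%j. 0[A]) = 0[C]"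
   using Y_add[of "%j. 0[A]" "%j. 0[A]" "-1"] Yc[of "%j. 0[A]"]
   by (simp add: C.sm_minus_one C.M.r_neg)
  thus ?thesis using x by (simp add: E_def a_minus_def)
 qed
 hence gu: "g u <= g x + dl\<^sup>2" using min[OF T0] by (simp add: E_def u_def)
 have "dl\<^sup>2 <= 1" using d power_mono[of dl 1 2] by simp
 have mu: "g (\<ominus>\<^bsub>C\<^esub> u) = g u" using u by (simp add: g_def C.star_minus C.mult_minus_left C.mult_minus_right)
 have "Y a = x +[C] (\<ominus>\<^bsub>C\<^esub> u)" using x Ya C.rs_minus_rs_minus u
  by (subst xu) (simp add: C.M.a_assoc C.M.r_neg)
 hence "g (Y a) <= 2 * g x + 2 * g (\<ominus>\<^bsub>C\<^esub> u)"
  unfolding g_def using C.parallelogram[OF f x, of "\<ominus>\<^bsub>C\<^esub> u"] u by simp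
 hence "g (Y a) <= 4 * g x + 2" using gu `dl\<^sup>2 <= 1` mu by linarith
 thus ?thesis using that[of a u] ac u xu orth unfolding Y_def g_def by blast
qed

text \<open>The last vector is split into an \<open>A\<close>-combination of the others and an
  almost orthogonal remainder \<open>u\<close>. The combination is modelled in the space from the
  induction hypothesis, the remainder by \<open>gram_one\<close> in a new orthogonal summand. Cross
  terms vanish in the model and are small for \<open>f\<close>.\<close>

lemma gram_step:
 fixes r :: nat
 assumes IH: "!!P e. finite P ==> (!!y a. (y, a) : P ==> lift y a) ==> (e::real) > 0 ==>
   EX m F xj. rep n N m F & (ALL i<r. xj i : cvec m) &
    (ALL (y, a):P. ALL i<r. ALL l<r. cmod ((F y *v xj i) *c xj l - gm a (xs i) (xs l)) < e)"
  and xs: "!!i. i <= r ==> xs i : carrier C"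
  and P: "finite P" "!!y a. (y, a) : P ==> lift y a" and e: "(e::real) > 0"
 shows "EX m F xj. rep n N m F & (ALL i<Suc r. xj i : cvec m) &
    (ALL (y, a):P. ALL i<Suc r. ALL l<Suc r. cmod ((F y *v xj i) *c xj l - gm a (xs i) (xs l)) < e)"
proof -
 define g where "g z = Re (f (star C z *[C] z))" for z
 have g0: "0 <= g z" if "z : carrier C" for z unfolding g_def by (rule C.pos_functionalD(4)[OF f that])
 have xr: "xs r : carrier C" and xs': "!!j. j < r ==> xs j : carrier C" using xs by auto
 \<comment> \<open>Bounds the squared seminorm of every combination \<open>Y i\<close>, the last one
   by the final estimate of \<open>near_projection\<close>.\<close>
 define M where "M = (SUM j<r. g (xs j)) + (4 * g (xs r) + 2)"
 have M0: "0 <= M" unfolding M_def using g0 xs xs' by (intro add_nonneg_nonneg sum_nonneg) auto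
 define K where "K = (SUM p:P. (cnorm A (snd p))\<^sup>2) * M + 1"
 have sP: "0 <= (SUM p:P. (cnorm A (snd p))\<^sup>2)" by (rule sum_nonneg) simp
 have K1: "1 <= K" using sP M0 by (simp add: K_def)
 have Kb: "(cnorm A a)\<^sup>2 * M + 1 <= K" if "(y, a) : P" for y a
 proof -
  have "(cnorm A a)\<^sup>2 <= (SUM p:P. (cnorm A (snd p))\<^sup>2)"
   using member_le_sum[of "(y, a)" P "%p. (cnorm A (snd p))\<^sup>2"] that P(1) by simp
  thus ?thesis using M0 by (simp add: K_def mult_right_mono)
 qed
 \<comment> \<open>A cross term is at most \<open>dl * K\<close>, which this choice keeps within
   \<open>e/8\<close>.\<close>
 define dl where "dl = min 1 (e / (8 * K))"
 have d: "dl > 0" "dl <= 1" "dl * K <= e / 8"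
 proof -
  show "dl > 0" "dl <= 1" using e K1 by (auto simp: dl_def)
  have "dl * K <= e / (8 * K) * K" using K1 by (intro mult_right_mono) (auto simp: dl_def)
  thus "dl * K <= e / 8" using K1 by simp
 qed
 obtain a u where au: "!!j. a j : carrier A" "u : carrier C"
  "xs r = csum C (%j. s (a j) *[C] xs j) r +[C] u"
  "!!b. (!!j. b j : carrier A) ==> (cmod (f (star C (csum C (%j. s (b j) *[C] xs j) r) *[C] u)))\<^sup>2
   <= dl\<^sup>2 * (g (csum C (%j. s (b j) *[C] xs j) r) + 1)"
  "g (csum C (%j. s (a j) *[C] xs j) r) <= 4 * g (xs r) + 2"
  unfolding g_def by (rule near_projection[OF xs' xr d(1,2)]) (assumption | blast)+
 \<comment> \<open>Coefficients for all \<open>r + 1\<close> vectors in one notation: the earlier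
   vectors are their own projections and have remainder 0.\<close>
 define b where "b i j = (if i = r then a j else if j = i then 1[A] else 0[A])" for i j
 define U where "U i = (if i = r then u else 0[C])" for i
 define Y where "Y i = csum C (%j. s (b i j) *[C] xs j) r" for i
 have bc: "b i j : carrier A" for i j using au(1) A.one_closed by (simp add: b_def)
 have Uc: "U i : carrier C" for i using au(2) by (simp add: U_def)
 have Yc: "Y i : carrier C" for i unfolding Y_def using bc xs' by (intro C.csum_closed) auto
 have xY: "xs i = Y i +[C] U i" if i: "i <= r" for i
 proof (cases "i = r")
  case True thus ?thesis using au(3) by (simp add: Y_def U_def b_def)
 next
  case False
  hence "Y i = csum C (%j. if j = i then xs j else 0[C]) r"
   unfolding Y_def b_def by (intro C.csum_cong) (auto simp: xs' s.hom_one C.one_mult)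
  also have "... = xs i" by (rule C.csum_delta) (use xs' False i in auto)
  finally show ?thesis using False xs[OF i] by (simp add: U_def)
 qed
 have gY: "g (Y i) <= M" if i: "i <= r" for i
 proof (cases "i = r")
  case True
  have "0 <= (SUM j<r. g (xs j))" by (rule sum_nonneg) (use g0 xs' in auto)
  thus ?thesis using au(5) True by (simp add: Y_def b_def M_def)
 next
  case False
  hence "Y i = xs i" using xY[OF i] Yc[of i] by (simp add: U_def)
  moreover have "g (xs i) <= (SUM j<r. g (xs j))" by (rule member_le_sum) (use False i g0 xs' in auto)
  ultimately show ?thesis using g0[OF xr] by (simp add: M_def)
 qed
 have cross: "cmod (gm c (U i) (Y l)) <= e / 8"
  if c: "c : carrier A" "(cnorm A c)\<^sup>2 * M + 1 <= K" and l: "l <= r" for c i l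
 proof (cases "i = r")
  case True
  have z: "s (star A c) *[C] Y l = csum C (%j. s (star A c *[A] b l j) *[C] xs j) r"
   unfolding Y_def using c bc xs' by (subst C.csum_mult_left)
    (auto intro!: C.csum_cong simp: s.hom_simps(4) C.mult_assoc)
  have "cmod (gm c (U i) (Y l)) = cmod (f (star C (s (star A c) *[C] Y l) *[C] u))"
   using c Yc Uc True by (simp add: gm_as_functional) (simp add: U_def)
  hence "(cmod (gm c (U i) (Y l)))\<^sup>2 <= dl\<^sup>2 * (g (s (star A c) *[C] Y l) + 1)"
   unfolding z using au(4)[of "%j. star A c *[A] b l j"] c bc by simp
  also have "g (s (star A c) *[C] Y l) <= (cnorm A c)\<^sup>2 * M"
  proof -
   have "cnorm C (s (star A c)) <= cnorm A c" using s.hom_contractive[of "star A c"] c by simp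
   hence "(cnorm C (s (star A c)))\<^sup>2 <= (cnorm A c)\<^sup>2" by (rule power_mono) (use c in simp)
   hence "(cnorm C (s (star A c)))\<^sup>2 * g (Y l) <= (cnorm A c)\<^sup>2 * M"
    using gY[OF l] g0[OF Yc] by (intro mult_mono) auto
   thus ?thesis using C.functional_mult_bound[OF f, of "s (star A c)" "Y l"] c Yc[of l] by (simp add: g_def)
  qed
  also have "dl\<^sup>2 * ((cnorm A c)\<^sup>2 * M + 1) <= dl\<^sup>2 * (K * K)"
  proof (rule mult_left_mono)
   have "K * 1 <= K * K" using K1 by (intro mult_left_mono) auto
   thus "(cnorm A c)\<^sup>2 * M + 1 <= K * K" using c(2) by simp
  qed simp
  also have "... = (dl * K)\<^sup>2" by (simp add: power2_eq_square)
  finally have "cmod (gm c (U i) (Y l)) <= dl * K" by (rule power2_le_imp_le) (use d K1 in auto)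
  thus ?thesis using d(3) by linarith
 qed (use c Yc e in \<open>simp add: U_def\<close>)
 obtain t0 where t0: "!!j. lift (t0 j) (a j)" using ex_lift[OF au(1)] by metis
 define t where "t i j = (if i = r then t0 j else if j = i then (%k. 1\<^sub>m (n k)) else (%k. 0\<^sub>m (n k) (n k)))" for i j
 have t: "lift (t i j) (b i j)" for i j using t0 lift_one lift_zero by (simp add: t_def b_def)
 \<comment> \<open>Moving coefficients across the form, as in \<open>rep_sesq\<close> and
   \<open>gm_move\<close>, reduces the Gram data of the combinations to that of the
   \<open>xs\<close> for finitely many further elements of \<open>A\<close>, to which the induction
   hypothesis is applied.\<close>
 define T where "T y i j l j' = (%k. adj (t l j' k) * (y k * t i j k))" for y i j l j'
 define B where "B c i j l j' = star A (b l j') *[A] (c *[A] b i j)" for c i j l j'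
 define P' where "P' = (%((y, c), i, j, l, j'). (T y i j l j', B c i j l j')) ` (P \<times> {..r} \<times> {..<r} \<times> {..r} \<times> {..<r})"
 have P'f: "finite P'" unfolding P'_def using P(1) by (intro finite_imageI finite_cartesian_product) auto
 have P'l: "lift y c" if "(y, c) : P'" for y c
 proof -
  obtain y0 c0 i j l j' where "(y0, c0) : P" "y = T y0 i j l j'" "c = B c0 i j l j'"
   using `(y, c) : P'` unfolding P'_def by auto
  thus ?thesis unfolding T_def B_def by (simp only:) (intro lift_mult lift_adj t P(2))
 qed
 \<comment> \<open>Each of \<open>r * r\<close> terms contributes at most \<open>e'\<close>, in
   total at most \<open>e/4\<close>. With \<open>e/4\<close> for the remainder and twice
   \<open>e/8\<close> for the cross terms the error stays below \<open>e\<close>.\<close>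
 define e' where "e' = e / (4 * (real r * real r + 1))"
 have rr: "0 < real r * real r + 1" by (intro add_nonneg_pos) auto
 have e': "e' > 0" using e rr by (simp add: e'_def)
 obtain m F xj where F: "rep n N m F" "!!i. i < r ==> xj i : cvec m"
  "!!y c i l. (y, c) : P' ==> i < r ==> l < r ==> cmod ((F y *v xj i) *c xj l - gm c (xs i) (xs l)) < e'"
  using IH[OF P'f P'l e'] by fast
 obtain m' G v where G: "rep n N m' G" "v : cvec m'"
  "!!y c. (y, c) : P ==> cmod ((G y *v v) *c v - gm c u u) < e / 4"
  using gram_one_set[OF P au(2), of "e/4" N] e by fastforce
 define et where "et i = vsum m (%j. F (t i j) *v xj j) r" for i
 define w where "w i = (if i = r then v else 0\<^sub>v m')" for i
 have wc: "w i : cvec m'" and ec: "et i : cvec m" for i using G(2) by (auto simp: w_def et_def)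
 have main: "cmod ((dsum (F y) (G y) *v (et i @\<^sub>v w i)) *c (et l @\<^sub>v w l) - gm c (xs i) (xs l)) < e"
  if yc: "(y, c) : P" and i: "i <= r" and l: "l <= r" for y c i l
 proof -
  note ly = P(2)[OF yc]
  note cc = liftD(2)[OF ly] and ym = liftD(1)[OF ly]
  note Fy = repD(2)[OF F(1) ym] and Gy = repD(2)[OF G(1) ym]
  have dec: "(dsum (F y) (G y) *v (et i @\<^sub>v w i)) *c (et l @\<^sub>v w l) = (F y *v et i) *c et l + (G y *v w i) *c w l"
   unfolding dsum_mult_vec[OF Fy Gy ec wc]
   by (rule cip_append[OF mvc[OF Fy ec] ec mvc[OF Gy wc] wc])
  have gdec: "gm c (xs i) (xs l) = (gm c (Y i) (Y l) + gm c (U i) (U l)) + (gm c (U i) (Y l) + cnj (gm (star A c) (U l) (Y i)))"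
   unfolding xY[OF i] xY[OF l] using cc Yc Uc by (simp add: gm_left_add gm_right_add gm_star)
  have "(F y *v et i) *c et l - gm c (Y i) (Y l)
   = (SUM j<r. SUM j'<r. (F (T y i j l j') *v xj j) *c xj j' - gm (B c i j l j') (xs j) (xs j'))"
   unfolding et_def Y_def T_def B_def
   by (subst rep_sesq[OF F(1) ym liftD(1)[OF t] liftD(1)[OF t] F(2)], assumption,
     subst gm_comb[OF cc bc bc xs'], assumption) (simp add: sum_subtractf)
  also have "cmod ... <= (SUM j<r. SUM j'<r. e')"
  proof (intro order_trans[OF norm_sum] sum_mono)
   fix j j' assume j: "j : {..<r}" "j' : {..<r}"
   have "(T y i j l j', B c i j l j') : P'"
    unfolding P'_def using yc i l j by (intro image_eqI[of _ _ "((y, c), i, j, l, j')"]) auto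
   from F(3)[OF this, of j j'] j
   show "cmod ((F (T y i j l j') *v xj j) *c xj j' - gm (B c i j l j') (xs j) (xs j')) <= e'" by simp
  qed
  also have "... = (real r * real r) * e'" by simp
  also have "... <= (real r * real r + 1) * e'" using e' by (intro mult_right_mono) auto
  also have "... = e / 4" unfolding e'_def using rr by (simp add: field_simps)
  finally have n1: "cmod ((F y *v et i) *c et l - gm c (Y i) (Y l)) <= e / 4" .
  have n2: "cmod ((G y *v w i) *c w l - gm c (U i) (U l)) <= e / 4"
  proof (cases "i = r & l = r")
   case True thus ?thesis using G(3)[OF yc] by (simp add: w_def U_def)
  next
   case False
   have "G y *v 0\<^sub>v m' = 0\<^sub>v m'" using Gy by auto
   hence "(G y *v w i) *c w l = 0" using False mvc[OF Gy wc[of i]] wc[of l] by (auto simp: w_def)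
   moreover have "gm c (U i) (U l) = 0" using False cc au(2) by (auto simp: U_def)
   ultimately show ?thesis using e by simp
  qed
  have n3: "cmod (gm c (U i) (Y l)) <= e / 8" by (rule cross[OF cc Kb[OF yc] l])
  have n4: "cmod (gm (star A c) (U l) (Y i)) <= e / 8" by (rule cross[OF _ _ i]) (use cc Kb[OF yc] in auto)
  have "(dsum (F y) (G y) *v (et i @\<^sub>v w i)) *c (et l @\<^sub>v w l) - gm c (xs i) (xs l)
   = ((F y *v et i) *c et l - gm c (Y i) (Y l)) + ((G y *v w i) *c w l - gm c (U i) (U l))
    + (- gm c (U i) (Y l) + - cnj (gm (star A c) (U l) (Y i)))"
   unfolding dec gdec by (simp add: algebra_simps)
  also have "cmod ... <= (e/4 + e/4) + (e/8 + e/8)"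
   by (intro order_trans[OF norm_triangle_ineq] add_mono n1 n2) (use n3 n4 in simp_all)
  finally show ?thesis using e by simp
 qed
 show ?thesis
  by (rule exI[of _ "m + m'"], rule exI[of _ "%Y. dsum (F Y) (G Y)"], rule exI[of _ "%i. et i @\<^sub>v w i"])
   (use rep_dsum[OF F(1) G(1)] ec wc main in auto)
qed

lemma gram_many:
 fixes r :: nat
 assumes "!!i. i < r ==> xs i : carrier C"
  and "finite P" "!!y a. (y, a) : P ==> lift y a" and "(e::real) > 0"
 shows "EX m F xj. rep n N m F & (ALL i<r. xj i : cvec m) &
    (ALL (y, a):P. ALL i<r. ALL l<r. cmod ((F y *v xj i) *c xj l - gm a (xs i) (xs l)) < e)"
 using assms
proof (induction r arbitrary: P e)
 case 0
 show ?case using rep_coord[of n N N] n_pos[of N] by (intro exI[of _ "n N"] exI[of _ "%Y. Y N"]) auto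
next
 case (Suc r)
 show ?case by (rule gram_step[OF Suc.IH]) (use Suc.prems in auto)
qed

end

lemma rep_mono: "rep n N m F ==> M <= N ==> rep n M m F"
 unfolding rep_def by (meson order_trans)

context gram_side
begin

text \<open>Stage \<open>tu\<close> treats the first \<open>tu\<close> pairs and vectors of two
  enumerations with error below \<open>1 / (tu + 1)\<close>, by representations that see only
  coordinates from \<open>tu\<close> on.\<close>

lemma gram_seq:
 assumes P: "countable P" "!!y a. (y, a) : P ==> lift y a" and X: "countable X" "X \<subseteq> carrier C"
 shows "EX m F xj. (ALL tu. rep n tu (m tu) (F tu)) & (ALL tu. ALL x:X. xj tu x : cvec (m tu)) &
  (ALL (y, a):P. ALL x:X. ALL x':X. (%tu. (F tu y *v xj tu x) *c xj tu x') ----> gm a x x')"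
proof -
 define P\<^sub>f where "P\<^sub>f tu = {p : P. to_nat_on P p < tu}" for tu
 have Pf: "finite (P\<^sub>f tu)" for tu
 proof (rule finite_imageD)
  show "finite (to_nat_on P ` P\<^sub>f tu)" by (rule finite_subset[of _ "{..<tu}"]) (auto simp: P\<^sub>f_def)
  show "inj_on (to_nat_on P) (P\<^sub>f tu)"
   using inj_on_to_nat_on[OF P(1)] by (rule inj_on_subset) (auto simp: P\<^sub>f_def)
 qed
 define xs where "xs i = (if from_nat_into X i : X then from_nat_into X i else 0[C])" for i
 have xs: "xs i : carrier C" for i using X(2) by (auto simp: xs_def)
 have xs_X: "xs (to_nat_on X x) = x" if "x : X" for x using X(1) that by (simp add: xs_def)
 have ex: "EX m F xj. rep n tu m F & (ALL i<tu. xj i : cvec m) &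
    (ALL (y, a):P\<^sub>f tu. ALL i<tu. ALL l<tu. cmod ((F y *v xj i) *c xj l - gm a (xs i) (xs l)) < 1 / (real tu + 1))" for tu
  by (rule gram_many[OF xs Pf]) (auto simp: P\<^sub>f_def P(2))
 then obtain m F zt where 1: "!!tu. rep n tu (m tu) (F tu)" "!!tu i. i < tu ==> zt tu i : cvec (m tu)"
  "!!tu y a i l. (y, a) : P\<^sub>f tu ==> i < tu ==> l < tu ==>
   cmod ((F tu y *v zt tu i) *c zt tu l - gm a (xs i) (xs l)) < 1 / (real tu + 1)"
  by (metis (no_types, lifting) case_prodD)
 \<comment> \<open>Vectors not yet enumerated are modelled by zero; for each \<open>x\<close> this
   concerns finitely many stages.\<close>
 define xj where "xj tu x = (if to_nat_on X x < tu then zt tu (to_nat_on X x) else 0\<^sub>v (m tu))" for tu x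
 have "(%tu. (F tu y *v xj tu x) *c xj tu x') ----> gm a x x'" if ya: "(y, a) : P" and x: "x : X" "x' : X" for y a x x'
 proof (rule LIM_zero_cancel, rule tendsto_0_le[where K = 1])
  show "(%tu. 1 / (real tu + 1)) ----> 0" using LIMSEQ_inverse_real_of_nat by (simp add: inverse_eq_divide add.commute)
  show "EV tu. norm ((F tu y *v xj tu x) *c xj tu x' - gm a x x') <= norm (1 / (real tu + 1)) * 1"
  proof (rule eventually_sequentiallyI)
   fix tu assume t: "to_nat_on P (y, a) + to_nat_on X x + to_nat_on X x' + 1 <= tu"
   hence "(y, a) : P\<^sub>f tu" "to_nat_on X x < tu" "to_nat_on X x' < tu" using ya by (auto simp: P\<^sub>f_def)
   from 1(3)[OF this] show "norm ((F tu y *v xj tu x) *c xj tu x' - gm a x x') <= norm (1 / (real tu + 1)) * 1"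
    using t xs_X[OF x(1)] xs_X[OF x(2)] by (simp add: xj_def)
  qed
 qed
 moreover have "xj tu x : cvec (m tu)" for tu x using 1(2) by (simp add: xj_def)
 ultimately show ?thesis using 1(1) by (intro exI[of _ m] exI[of _ F] exI[of _ xj]) auto
qed

text \<open>In the squared norm of the difference all inner products have the same limit, with
  weights \<open>1 - 2 + 1\<close>. To control the first of them the tested pairs are enlarged by
  the products of the form \<open>adj y * y\<close>; the unit pair yields the plain Gram
  matrix.\<close>

lemma gram_rep:
 assumes P: "countable P" "!!y a. (y, a) : P ==> lift y a" and X: "countable X" "X \<subseteq> carrier C"
 obtains m F xj where "!!tu. rep n tu (m tu) (F tu)" "!!tu x. x : X ==> xj tu x : cvec (m tu)"
  "!!x x'. x : X ==> x' : X ==> (%tu. xj tu x *c xj tu x') ----> f (star C x' *[C] x)"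
  "!!y a x. (y, a) : P ==> x : X ==> s a *[C] x : X ==>
   (%tu. nrm (F tu y *v xj tu x - xj tu (s a *[C] x))) ----> 0"
proof -
 define P' where "P' = insert (%k. 1\<^sub>m (n k), 1[A]) P \<union>
   (%p. (%k. adj (fst p k) * fst p k, star A (snd p) *[A] snd p)) ` P"
 have c: "countable P'" unfolding P'_def using P(1) by simp
 have l: "lift y a" if "(y, a) : P'" for y a
 proof -
  have "lift (%k. adj (fst p k) * fst p k) (star A (snd p) *[A] snd p)" if "p : P" for p
   using P(2)[of "fst p" "snd p"] that by (intro lift_mult lift_adj) auto
  moreover have "(y, a) = (%k. 1\<^sub>m (n k), 1[A]) \<or> (y, a) : P \<or>
    (EX p:P. (y, a) = (%k. adj (fst p k) * fst p k, star A (snd p) *[A] snd p))"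
   using that unfolding P'_def by (auto simp only: Un_iff insert_iff image_iff)
  ultimately show ?thesis using P(2) lift_one by (elim disjE bexE) (simp_all only: prod.inject)
 qed
 have ex: "EX m F xj. (ALL tu. rep n tu (m tu) (F tu)) & (ALL tu. ALL x:X. xj tu x : cvec (m tu)) &
  (ALL (y, a):P'. ALL x:X. ALL x':X. (%tu. (F tu y *v xj tu x) *c xj tu x') ----> gm a x x')"
  by (rule gram_seq[OF c _ X]) (rule l)
 from ex obtain m F xj where raw: "ALL tu. rep n tu (m tu) (F tu)" "ALL tu. ALL x:X. xj tu x : cvec (m tu)"
  "ALL (y, a):P'. ALL x:X. ALL x':X. (%tu. (F tu y *v xj tu x) *c xj tu x') ----> gm a x x'"
  by (elim exE conjE) (rule that)
 have 1: "!!tu. rep n tu (m tu) (F tu)" "!!tu x. x : X ==> xj tu x : cvec (m tu)"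
  "!!y a x x'. (y, a) : P' ==> x : X ==> x' : X ==> (%tu. (F tu y *v xj tu x) *c xj tu x') ----> gm a x x'"
  using raw by (simp, simp, fast)
 have Xc: "x : carrier C" if "x : X" for x using X(2) that by blast
 have gram: "(%tu. xj tu x *c xj tu x') ----> f (star C x' *[C] x)" if x: "x : X" "x' : X" for x x'
 proof -
  have "(%k. 1\<^sub>m (n k), 1[A]) : P'" by (simp add: P'_def)
  from 1(3)[OF this x] show ?thesis using repD(7)[OF 1(1)] 1(2)[OF x(1)] Xc[OF x(1)]
   by (simp add: gm_def C.one_mult)
 qed
 have "(%tu. nrm (F tu y *v xj tu x - xj tu (s a *[C] x))) ----> 0"
  if ya: "(y, a) : P" and x: "x : X" "s a *[C] x : X" for y a x
 proof -
  define z where "z = s a *[C] x"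
  note zX = x(2)[folded z_def]
  note ly = P(2)[OF ya]
  have p1: "(y, a) : P'" "(%k. adj (y k) * y k, star A a *[A] a) : P'"
   using ya by (auto simp: P'_def intro!: image_eqI[of _ _ "(y, a)"])
  note ac = liftD(2)[OF ly] and ym = liftD(1)[OF ly]
  have g1: "gm (star A a *[A] a) x x = f (star C z *[C] z)"
   using ac Xc[OF x(1)] by (simp add: gm_def z_def s.hom_simps(4,5) C.star_mult C.mult_assoc)
  have g2: "gm a x z = f (star C z *[C] z)" by (simp add: gm_def z_def)
  have sq: "(nrm (F tu y *v xj tu x - xj tu z))\<^sup>2
   = Re ((F tu (%k. adj (y k) * y k) *v xj tu x) *c xj tu x) - 2 * Re ((F tu y *v xj tu x) *c xj tu z) + Re (xj tu z *c xj tu z)" for tu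
  proof -
   note Fy = repD(2)[OF 1(1)[of tu] ym] and xi = 1(2)[OF x(1), of tu] and ze = 1(2)[OF zX, of tu]
   have w: "F tu y *v xj tu x : cvec (m tu)" by (rule mvc[OF Fy xi])
   have "F tu (%k. adj (y k) * y k) = adj (F tu y) * F tu y"
    using repD(5)[OF 1(1) mprod_adj[OF ym] ym] repD(6)[OF 1(1) ym] by simp
   also have "... *v xj tu x = adj (F tu y) *v (F tu y *v xj tu x)"
    by (rule assoc_mult_mat_vec[OF adj_carrier[OF Fy] Fy xi])
   also have "... *c xj tu x = (F tu y *v xj tu x) *c (F tu y *v xj tu x)"
    by (rule cip_adj'[OF Fy w xi])
   finally show ?thesis using w ze cip_commute[OF w ze] by (simp add: l2norm_Re cip_simps[of _ "m tu"])
  qed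
  have "(%tu. (nrm (F tu y *v xj tu x - xj tu z))\<^sup>2)
   ----> Re (f (star C z *[C] z)) - 2 * Re (f (star C z *[C] z)) + Re (f (star C z *[C] z))"
   unfolding sq
   by (intro tendsto_add tendsto_diff tendsto_mult tendsto_const tendsto_Re gram[OF zX zX]
     1(3)[OF p1(1) x(1) zX, unfolded g2] 1(3)[OF p1(2) x(1) x(1), unfolded g1])
  hence "(%tu. sqrt ((nrm (F tu y *v xj tu x - xj tu z))\<^sup>2)) ----> sqrt 0"
   by (intro tendsto_real_sqrt) simp
  thus ?thesis by (simp add: z_def)
 qed
 thus ?thesis using that[of m F xj] 1(1,2) gram by blast
qed

end

section \<open>Finite rank operators and almost orthonormal systems\<close>

text \<open>Sums the vectors \<open>b p\<close> weighted by inner products with \<open>a p\<close>;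
  for orthonormal systems it is the partial isometry carrying \<open>a\<close> to
  \<open>b\<close>.\<close>

definition rank_sum :: "nat => nat => (nat => complex vec) => (nat => complex vec) => nat => complex mat" where
 "rank_sum l m b a r = mat l m (%(i, k). SUM p<r. b p $ i * cnj (a p $ k))"

lemma rank_sum_carrier [simp]: "rank_sum l m b a r : cmat l m"
 by (simp add: rank_sum_def)

lemma rank_sum_vec:
 assumes b: "!!p. p < r ==> b p : cvec l" and a: "!!p. p < r ==> a p : cvec m"
  and v: "v : cvec m"
 shows "rank_sum l m b a r *v v = vsum l (%p. (v *c a p) *s b p) r"
proof (rule eq_vecI)
 show "dim_vec (rank_sum l m b a r *v v) = dim_vec (vsum l (%p. (v *c a p) *s b p) r)"
  by (simp add: rank_sum_def vsum_def)
 fix i assume "i < dim_vec (vsum l (%p. (v *c a p) *s b p) r)"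
 hence i: "i < l" by (simp add: vsum_def)
 have "(rank_sum l m b a r *v v) $ i = (SUM k<m. (SUM p<r. b p $ i * cnj (a p $ k)) * v $ k)"
  using i v by (simp add: rank_sum_def scalar_prod_def atLeast0LessThan)
 also have "... = (SUM p<r. SUM k<m. b p $ i * cnj (a p $ k) * v $ k)"
  by (simp add: sum_distrib_right sum.swap[of _ "{..<m}"])
 also have "... = (SUM p<r. (v *c a p) * b p $ i)"
  by (intro sum.cong refl) (simp add: cip_sum[OF a] sum_distrib_left mult_ac)
 also have "... = vsum l (%p. (v *c a p) *s b p) r $ i"
  using i b by (simp add: vsum_def carrier_vecD[OF b])
 finally show "(rank_sum l m b a r *v v) $ i = vsum l (%p. (v *c a p) *s b p) r $ i" .
qed

lemma vsum_norm_le: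
 assumes "!!p. p < r ==> u p : cvec m"
 shows "nrm (vsum m u r) <= (SUM p<r. nrm (u p))"
 using assms
proof (induction r)
 case (Suc r)
 have "nrm (vsum m u (Suc r)) <= nrm (vsum m u r) + nrm (u r)"
  using Suc.prems[of r] by (simp add: vsum_Suc l2norm_triangle[of _ m])
 thus ?case using Suc by force
qed simp

lemma L2_set_mult_ineq_sq:
 fixes f g :: "'i => real"
 assumes "!!i. 0 <= f i * g i"
 shows "(SUM i:I. f i * g i)\<^sup>2 <= (SUM i:I. (f i)\<^sup>2) * (SUM i:I. (g i)\<^sup>2)"
proof -
 have "(SUM i:I. f i * g i) <= L2_set f I * L2_set g I"
  using L2_set_mult_ineq[of f g I] assms by (simp flip: abs_mult)
 hence "(SUM i:I. f i * g i)\<^sup>2 <= (L2_set f I * L2_set g I)\<^sup>2"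
  by (rule power_mono) (simp add: sum_nonneg assms)
 thus ?thesis by (simp add: power_mult_distrib L2_set_def sum_nonneg)
qed

text \<open>Deviations of the Gram matrix from the identity contribute at most \<open>ep\<close>
  times the square of the sum of all \<open>cmod (c p)\<close>, and Cauchy-Schwarz replaces that
  square at the cost of the factor \<open>r\<close>.\<close>

lemma almost_orthonormal_norm:
 fixes c :: "nat => complex"
 assumes b: "!!p. p < r ==> b p : cvec l"
  and g: "!!p q. p < r ==> q < r ==> cmod (b p *c b q - (if p = q then 1 else 0)) <= ep"
 shows "(nrm (vsum l (%p. c p *s b p) r))\<^sup>2 <= (1 + real r * ep) * (SUM p<r. (cmod (c p))\<^sup>2)"
proof -
 have bs: "!!p. p < r ==> c p *s b p : cvec l" using b by simp
 have "vsum l (%p. c p *s b p) r *c vsum l (%p. c p *s b p) r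
   = (SUM p<r. SUM q<r. (c p *s b p) *c (c q *s b q))"
  using bs by (simp add: cip_vsum_left[OF bs] cip_vsum_right[OF bs]) (rule sum.swap)
 also have "... = (SUM p<r. SUM q<r. c p * cnj (c q) * (b p *c b q))"
  using b by (intro sum.cong refl) (simp add: cip_smult_left[of _ l] cip_smult_right[of _ l])
 also have "... = (SUM p<r. SUM q<r. c p * cnj (c q) * (if p = q then 1 else 0))
   + (SUM p<r. SUM q<r. c p * cnj (c q) * (b p *c b q - (if p = q then 1 else 0)))"
  by (simp add: sum.distrib[symmetric] algebra_simps)
 also have "(SUM p<r. SUM q<r. c p * cnj (c q) * (if p = q then 1 else 0)) = (SUM p<r. c p * cnj (c p))"
  by (intro sum.cong refl) (simp add: if_distrib cong: if_cong)
 also have "... = cr (SUM p<r. (cmod (c p))\<^sup>2)"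
  unfolding of_real_sum by (intro sum.cong refl) (simp only: of_real_power complex_norm_square[symmetric])
 finally have "(nrm (vsum l (%p. c p *s b p) r))\<^sup>2 = (SUM p<r. (cmod (c p))\<^sup>2)
   + Re (SUM p<r. SUM q<r. c p * cnj (c q) * (b p *c b q - (if p = q then 1 else 0)))"
  by (simp add: l2norm_Re)
 also have "Re (SUM p<r. SUM q<r. c p * cnj (c q) * (b p *c b q - (if p = q then 1 else 0)))
   <= (SUM p<r. SUM q<r. cmod (c p) * cmod (c q) * ep)"
 proof (intro order_trans[OF complex_Re_le_cmod] order_trans[OF norm_sum] sum_mono)
  fix p q assume "p : {..<r}" "q : {..<r}"
  thus "cmod (c p * cnj (c q) * (b p *c b q - (if p = q then 1 else 0))) <= cmod (c p) * cmod (c q) * ep"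
   using g[of p q] unfolding norm_mult complex_mod_cnj by (intro mult_left_mono) auto
 qed
 also have "... = (SUM p<r. cmod (c p))\<^sup>2 * ep"
  by (simp add: power2_eq_square sum_distrib_left sum_distrib_right mult_ac)
 also have "... <= (real r * (SUM p<r. (cmod (c p))\<^sup>2)) * ep"
 proof (cases "r = 0")
  case False
  hence "0 <= ep" using g[of 0 0] norm_ge_zero order_trans by blast
  moreover have "(SUM p<r. cmod (c p))\<^sup>2 <= real r * (SUM p<r. (cmod (c p))\<^sup>2)"
   using L2_set_mult_ineq_sq[of "%p. cmod (c p)" "%p. 1" "{..<r}"] by (simp add: mult.commute)
  ultimately show ?thesis by (intro mult_right_mono)
 qed simp
 finally show ?thesis by (simp add: algebra_simps)
qed

text \<open>Pairing \<open>v\<close> with the sum of its coefficients times the \<open>a p\<close>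
  gives exactly \<open>S\<close>. Cauchy-Schwarz and \<open>almost_orthonormal_norm\<close> bound
  \<open>S * S\<close> by a multiple of \<open>S\<close>, and \<open>S\<close> cancels.\<close>

lemma almost_bessel:
 assumes a: "!!p. p < r ==> a p : cvec m"
  and ga: "!!p q. p < r ==> q < r ==> cmod (a p *c a q - (if p = q then 1 else 0)) <= ep"
  and e: "0 <= ep" and v: "v : cvec m"
 shows "(SUM p<r. (cmod (v *c a p))\<^sup>2) <= (1 + real r * ep) * (nrm v)\<^sup>2"
proof -
 let ?k = "1 + real r * ep"
 have k0: "0 <= ?k" using e by simp
 define c where "c p = v *c a p" for p
 define S where "S = (SUM p<r. (cmod (c p))\<^sup>2)"
 have S0: "0 <= S" by (simp add: S_def sum_nonneg)
 let ?w = "vsum m (%p. c p *s a p) r"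
 have "v *c ?w = (SUM p<r. v *c (c p *s a p))" by (rule cip_vsum_right) (use a v in auto)
 also have "... = (SUM p<r. c p * cnj (c p))"
  by (intro sum.cong refl) (use a v in \<open>simp add: cip_smult_right[of _ m] c_def mult.commute\<close>)
 also have "... = cr S"
  unfolding S_def of_real_sum by (intro sum.cong refl) (simp only: of_real_power complex_norm_square[symmetric])
 finally have "S <= nrm v * nrm ?w"
  using cip_Cauchy_Schwarz[OF v, of ?w] S0 by simp
 hence "S\<^sup>2 <= (nrm v * nrm ?w)\<^sup>2" by (rule power_mono[OF _ S0])
 also have "... <= (nrm v)\<^sup>2 * (?k * S)"
  unfolding power_mult_distrib S_def by (intro mult_left_mono almost_orthonormal_norm a ga) auto
 finally have S2: "S * S <= (?k * (nrm v)\<^sup>2) * S" by (simp add: power2_eq_square mult_ac)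
 show ?thesis
 proof (cases "S = 0")
  case True thus ?thesis using k0 by (simp add: S_def c_def)
 next
  case False
  hence "S > 0" using S0 by simp
  from mult_right_le_imp_le[OF S2 this] show ?thesis by (simp add: S_def c_def)
 qed
qed

text \<open>One factor \<open>1 + r * ep\<close> of the squared norm comes from expanding in the
  \<open>b p\<close>, the other from Bessel's inequality for the \<open>a p\<close>.\<close>

lemma rank_sum_opnorm:
 assumes b: "!!p. p < r ==> b p : cvec l" and a: "!!p. p < r ==> a p : cvec m"
  and gb: "!!p q. p < r ==> q < r ==> cmod (b p *c b q - (if p = q then 1 else 0)) <= ep"
  and ga: "!!p q. p < r ==> q < r ==> cmod (a p *c a q - (if p = q then 1 else 0)) <= ep"
  and e: "0 <= ep"
 shows "opn (rank_sum l m b a r) <= 1 + real r * ep"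
proof (rule opnorm_le)
 let ?k = "1 + real r * ep"
 show k0: "0 <= ?k" using e by simp
 fix v :: "complex vec" assume "v : cvec (dim_col (rank_sum l m b a r))"
 hence v: "v : cvec m" by (simp add: rank_sum_def)
 have "rank_sum l m b a r *v v = vsum l (%p. (v *c a p) *s b p) r"
  by (rule rank_sum_vec[OF b a v])
 hence "(nrm (rank_sum l m b a r *v v))\<^sup>2 <= ?k * (SUM p<r. (cmod (v *c a p))\<^sup>2)"
  by (simp only:) (rule almost_orthonormal_norm[OF b gb])
 also have "... <= ?k * (?k * (nrm v)\<^sup>2)"
  by (rule mult_left_mono[OF almost_bessel[OF a ga e v] k0])
 also have "... = (?k * nrm v)\<^sup>2" by (simp add: power2_eq_square)
 finally show "nrm (rank_sum l m b a r *v v) <= ?k * nrm v"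
  by (rule power2_le_imp_le) (use k0 in simp)
qed

lemma l2norm_diff_tendsto:
 assumes u: "!!k. u k : cvec (m k)" and v: "!!k. v k : cvec (m k)" and w: "!!k. w k : cvec (m k)"
  and l: "(%k. nrm (u k - w k)) ----> 0" "(%k. nrm (v k - w k)) ----> 0"
 shows "(%k::nat. nrm (u k - v k)) ----> 0"
proof (rule tendsto_sandwich[OF _ _ tendsto_const])
 show "(%k. nrm (u k - w k) + nrm (v k - w k)) ----> 0" using tendsto_add[OF l] by simp
 have "nrm (u k - v k) <= nrm (u k - w k) + nrm (v k - w k)" for k
  using l2norm_triangle3[OF u w v] l2norm_minus_commute[OF w v] by metis
 thus "EV k. nrm (u k - v k) <= nrm (u k - w k) + nrm (v k - w k)" by simp
qed simp

text \<open>The hypothesis \<open>xx\<close> is Parseval's identity in the limit: it makes the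
  expanded square of the distance converge to \<open>P - 2 P + P\<close> for one and the same sum
  \<open>P\<close>.\<close>

lemma gram_expand:
 fixes b :: "nat => nat => complex vec"
 assumes b: "!!tu p. p < r ==> b tu p : cvec (l tu)" and x: "!!tu. x tu : cvec (l tu)"
  and gb: "!!p q. p < r ==> q < r ==> (%tu. b tu p *c b tu q) ----> (if p = q then 1 else 0)"
  and gx: "!!p. p < r ==> (%tu. x tu *c b tu p) ----> c p"
  and xx: "(%tu. x tu *c x tu) ----> (SUM p<r. c p * cnj (c p))"
  and co: "!!p. p < r ==> (%tu. gq tu p) ----> c p"
 shows "(%tu. nrm (vsum (l tu) (%p. gq tu p *s b tu p) r - x tu)) ----> 0"
proof -
 let ?v = "%tu. vsum (l tu) (%p. gq tu p *s b tu p) r"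
 have bs: "gq tu p *s b tu p : cvec (l tu)" if "p < r" for tu p using b[OF that] by simp
 have vv: "?v tu *c ?v tu = (SUM p<r. SUM q<r. gq tu p * cnj (gq tu q) * (b tu p *c b tu q))" for tu
 proof -
  have "?v tu *c ?v tu = (SUM p<r. SUM q<r. (gq tu p *s b tu p) *c (gq tu q *s b tu q))"
  proof -
   have "?v tu *c ?v tu = (SUM p<r. (gq tu p *s b tu p) *c ?v tu)" by (rule cip_vsum_left[OF bs]) auto
   also have "... = (SUM p<r. SUM q<r. (gq tu p *s b tu p) *c (gq tu q *s b tu q))"
    by (intro sum.cong refl cip_vsum_right bs) auto
   finally show ?thesis .
  qed
  also have "... = (SUM p<r. SUM q<r. gq tu p * cnj (gq tu q) * (b tu p *c b tu q))"
   using b by (intro sum.cong refl) (simp add: cip_smult_left[of _ "l tu"] cip_smult_right[of _ "l tu"])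
  finally show ?thesis .
 qed
 have xv: "x tu *c ?v tu = (SUM p<r. cnj (gq tu p) * (x tu *c b tu p))" for tu
 proof -
  have "x tu *c ?v tu = (SUM p<r. x tu *c (gq tu p *s b tu p))" by (rule cip_vsum_right[OF bs x])
  also have "... = (SUM p<r. cnj (gq tu p) * (x tu *c b tu p))"
   using b x by (intro sum.cong refl) (simp add: cip_smult_right[of _ "l tu"])
  finally show ?thesis .
 qed
 have sq: "(nrm (?v tu - x tu))\<^sup>2 = Re (?v tu *c ?v tu) - 2 * Re (x tu *c ?v tu) + Re (x tu *c x tu)" for tu
  using cip_commute[of "x tu" "l tu" "?v tu"] x[of tu] by (simp add: l2norm_Re cip_simps[of _ "l tu"])
 have 1: "(%tu. ?v tu *c ?v tu) ----> (SUM p<r. SUM q<r. c p * cnj (c q) * (if p = q then 1 else 0))"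
  unfolding vv by (intro tendsto_sum tendsto_mult tendsto_cnj co gb) auto
 have "(SUM p<r. SUM q<r. c p * cnj (c q) * (if p = q then 1 else 0)) = (SUM p<r. c p * cnj (c p))"
  by (intro sum.cong refl) (simp add: if_distrib cong: if_cong)
 note 1 = 1[unfolded this]
 have 2: "(%tu. x tu *c ?v tu) ----> (SUM p<r. cnj (c p) * c p)"
  unfolding xv by (intro tendsto_sum tendsto_mult tendsto_cnj co gx) auto
 have "(SUM p<r. cnj (c p) * c p) = (SUM p<r. c p * cnj (c p))" by (simp add: mult.commute)
 note 2 = 2[unfolded this]
 have "(%tu. (nrm (?v tu - x tu))\<^sup>2) ---->
  Re (SUM p<r. c p * cnj (c p)) - 2 * Re (SUM p<r. c p * cnj (c p)) + Re (SUM p<r. c p * cnj (c p))"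
  unfolding sq by (intro tendsto_add tendsto_diff tendsto_mult tendsto_const tendsto_Re 1 2 xx)
 hence "(%tu. sqrt ((nrm (?v tu - x tu))\<^sup>2)) ----> sqrt 0" by (intro tendsto_real_sqrt) simp
 thus ?thesis by simp
qed

text \<open>If \<open>adj Y\<close> acts on the \<open>a p\<close> and \<open>Z\<close> on the
  \<open>b p\<close> by matrices adjoint to each other, both compositions reduce to the same double
  sum. What remains are the errors of the two matrix actions.\<close>

lemma rank_sum_intertwine:
 assumes b: "!!p. p < r ==> b p : cvec l" and a: "!!p. p < r ==> a p : cvec m"
  and Y: "Y : cmat m m" and Z: "Z : cmat l l"
  and AB: "!!p q. p < r ==> q < r ==> cnj (al p q) = bt q p"
 shows "opn (rank_sum l m b a r * Y - Z * rank_sum l m b a r)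
  <= (SUM p<r. nrm (adj Y *v a p - vsum m (%q. al p q *s a q) r) * nrm (b p)
    + nrm (a p) * nrm (Z *v b p - vsum l (%q. bt p q *s b q) r))"
  (is "_ <= (SUM p<r. ?e p)")
proof (rule opnorm_le)
 show "0 <= (SUM p<r. ?e p)" by (intro sum_nonneg add_nonneg_nonneg mult_nonneg_nonneg) auto
 let ?t = "rank_sum l m b a r"
 fix v :: "complex vec" assume "v : cvec (dim_col (?t * Y - Z * ?t))"
 hence v: "v : cvec m" by (simp add: rank_sum_def)
 define x where "x p = adj Y *v a p - vsum m (%q. al p q *s a q) r" for p
 define z where "z p = Z *v b p - vsum l (%q. bt p q *s b q) r" for p
 have Ya: "adj Y *v a p : cvec m" if "p < r" for p
  by (rule mvc[OF adj_carrier[OF Y] a[OF that]])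
 have Zb: "Z *v b p : cvec l" if "p < r" for p by (rule mvc[OF Z b[OF that]])
 have xc: "x p : cvec m" if "p < r" for p using Ya[OF that] by (simp add: x_def)
 have zc: "z p : cvec l" if "p < r" for p using Zb[OF that] by (simp add: z_def)
 have Yv: "Y *v v : cvec m" by (rule mvc[OF Y v])
 have 1: "(?t * Y - Z * ?t) *v v = ?t *v (Y *v v) - Z *v (?t *v v)"
 proof -
  have "(?t * Y - Z * ?t) *v v = (?t * Y) *v v - (Z * ?t) *v v"
   by (rule minus_mult_distrib_mat_vec[OF mmc[OF rank_sum_carrier Y] mmc[OF Z rank_sum_carrier] v])
  thus ?thesis
   by (simp only: assoc_mult_mat_vec[OF rank_sum_carrier Y v] assoc_mult_mat_vec[OF Z rank_sum_carrier v])
 qed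
 have tv: "?t *v u = vsum l (%p. (u *c a p) *s b p) r" if "u : cvec m" for u
  by (rule rank_sum_vec[OF b a that])
 have bs: "(v *c a p) *s b p : cvec l" if "p < r" for p using b[OF that] by simp
 have Zt: "Z *v (?t *v v) = vsum l (%p. (v *c a p) *s (Z *v b p)) r"
 proof -
  have "Z *v (?t *v v) = vsum l (%p. Z *v ((v *c a p) *s b p)) r"
   unfolding tv[OF v] by (rule mult_mat_vsum[OF Z bs])
  also have "... = vsum l (%p. (v *c a p) *s (Z *v b p)) r"
   unfolding vsum_def by (intro eq_vecI) (simp_all add: mult_mat_vec_smult[OF Z b])
  finally show ?thesis .
 qed
 have ca: "v *c (adj Y *v a p) = v *c x p + (SUM q<r. cnj (al p q) * (v *c a q))" if p: "p < r" for p
 proof -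
  have "v *c vsum m (%q. al p q *s a q) r = (SUM q<r. v *c (al p q *s a q))"
   by (rule cip_vsum_right) (use a v in auto)
  also have "... = (SUM q<r. cnj (al p q) * (v *c a q))"
   using a v by (intro sum.cong refl) (simp add: cip_smult_right[of _ m])
  finally show ?thesis using v Ya[OF p] by (simp add: x_def cip_minus_right[of _ m])
 qed
 have "(?t * Y - Z * ?t) *v v = vsum l (%p. (v *c x p) *s b p - (v *c a p) *s z p) r" (is "_ = ?R")
 proof (rule eq_vecI)
  show "dim_vec ((?t * Y - Z * ?t) *v v) = dim_vec ?R" using Z by (simp add: vsum_def)
  fix i assume "i < dim_vec ?R"
  hence i: "i < l" by (simp add: vsum_def)
  have "((?t * Y - Z * ?t) *v v) $ i
   = (SUM p<r. (v *c (adj Y *v a p)) * b p $ i) - (SUM p<r. (v *c a p) * (Z *v b p) $ i)"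
  proof -
   have "(Y *v v) *c a p = v *c (adj Y *v a p)" if "p < r" for p
    by (rule cip_adj[OF Y v a[OF that]])
   hence "(?t *v (Y *v v)) $ i = (SUM p<r. (v *c (adj Y *v a p)) * b p $ i)"
    unfolding tv[OF Yv] using i by (simp add: vsum_def carrier_vecD[OF b])
   moreover have "(Z *v (?t *v v)) $ i = (SUM p<r. (v *c a p) * (Z *v b p) $ i)"
    unfolding Zt using i by (simp add: vsum_def carrier_matD(1)[OF Z])
   moreover have "Z *v (?t *v v) : cvec l" unfolding Zt by simp
   ultimately show ?thesis unfolding 1 using i carrier_matD(1)[OF Z] by simp
  qed
  also have "(SUM p<r. (v *c (adj Y *v a p)) * b p $ i)
   = (SUM p<r. (v *c x p) * b p $ i) + (SUM p<r. SUM q<r. cnj (al p q) * (v *c a q) * b p $ i)"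
   unfolding sum.distrib[symmetric] by (intro sum.cong refl) (simp add: ca algebra_simps sum_distrib_left)
  also have "(SUM p<r. SUM q<r. cnj (al p q) * (v *c a q) * b p $ i) = (SUM p<r. SUM q<r. (v *c a p) * (bt p q * b q $ i))"
   by (subst sum.swap) (intro sum.cong refl, simp add: AB mult_ac)
  also have "(SUM p<r. (v *c a p) * (Z *v b p) $ i)
   = (SUM p<r. (v *c a p) * z p $ i) + (SUM p<r. SUM q<r. (v *c a p) * (bt p q * b q $ i))"
  proof -
   have "(Z *v b p) $ i = z p $ i + (SUM q<r. bt p q * b q $ i)" if p: "p < r" for p
    using i carrier_vecD[OF Zb[OF p]] by (simp add: z_def vsum_def carrier_vecD[OF b])
   thus ?thesis unfolding sum.distrib[symmetric] by (intro sum.cong refl) (simp add: algebra_simps sum_distrib_left)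
  qed
  finally show "((?t * Y - Z * ?t) *v v) $ i = ?R $ i"
   using i by (simp add: vsum_def sum_subtractf carrier_vecD[OF b] carrier_vecD[OF zc])
 qed
 hence "nrm ((?t * Y - Z * ?t) *v v) <= (SUM p<r. nrm ((v *c x p) *s b p - (v *c a p) *s z p))"
  using vsum_norm_le[of r "%p. (v *c x p) *s b p - (v *c a p) *s z p" l] b zc by simp
 also have "... <= (SUM p<r. ?e p * nrm v)"
 proof (rule sum_mono)
  fix p assume "p : {..<r}"
  hence p: "p < r" by simp
  have "nrm ((v *c x p) *s b p - (v *c a p) *s z p)
   <= cmod (v *c x p) * nrm (b p) + cmod (v *c a p) * nrm (z p)"
   using l2norm_triangle_minus[of "(v *c x p) *s b p" l "(v *c a p) *s z p"] b[OF p] zc[OF p] by (simp add: l2norm_smult)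
  also have "... <= (nrm v * nrm (x p)) * nrm (b p) + (nrm v * nrm (a p)) * nrm (z p)"
   by (intro add_mono mult_right_mono cip_Cauchy_Schwarz[OF v xc[OF p]] cip_Cauchy_Schwarz[OF v a[OF p]]) auto
  finally show "nrm ((v *c x p) *s b p - (v *c a p) *s z p) <= ?e p * nrm v"
   unfolding x_def[symmetric] z_def[symmetric] by (simp add: algebra_simps)
 qed
 finally show "nrm ((?t * Y - Z * ?t) *v v) <= (SUM p<r. ?e p) * nrm v"
  by (simp only: sum_distrib_right)
qed

section \<open>Orthonormal systems for a faithful functional\<close>

definition lin_subspace :: "'a cstar => 'a set => bool" where
 "lin_subspace A W \<longleftrightarrow> W \<subseteq> carrier A & 0[A] : W & (ALL x:W. ALL y:W. x +[A] y : W) & (ALL c. ALL x:W. c .[A] x : W)"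

lemma lin_subspaceD:
 assumes "lin_subspace A W"
 shows "W \<subseteq> carrier A" "0[A] : W" "x : W ==> y : W ==> x +[A] y : W" "x : W ==> c .[A] x : W" "x : W ==> x : carrier A"
 using assms by (auto simp: lin_subspace_def)

lemma lin_subspace_csum: "lin_subspace A W ==> (!!j. j < r ==> g j : W) ==> csum A g r : W"
 by (induction r) (auto dest: lin_subspaceD)

text \<open>Linear span expressed by subspaces instead of linear combinations: a property passes
  from \<open>S\<close> to \<open>E\<close> once it is seen to define a subspace.\<close>

definition spans :: "'a cstar => 'a set => 'a set => bool" where
 "spans A S E \<longleftrightarrow> (ALL W. lin_subspace A W --> S \<subseteq> W --> E \<subseteq> W)"

lemma spansD: "spans A S E ==> lin_subspace A W ==> S \<subseteq> W ==> x : E ==> x : W"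
 by (auto simp: spans_def)

lemma fin_dim_spans:
 fixes A :: "'a cstar"
 assumes A: "cstar_algebra A" and F: "cstar_subalgebra F A"
  and fd: "vectorspace.fin_dim (class_ring :: complex ring) (A\<lparr>carrier := F\<rparr>)"
 obtains S where "finite S" "S \<subseteq> F" "spans A S F"
proof -
 interpret A: cstar_algebra A by (rule A)
 have sub: "Module.submodule F (class_ring :: complex ring) A" using F by (simp add: cstar_subalgebra_def)
 interpret V: vectorspace "class_ring :: complex ring" "A\<lparr>carrier := F\<rparr>"
  by (intro vectorspace.intro submodule.submodule_is_module[OF sub A.module_axioms] class_field)
 obtain S where S: "finite S" "S \<subseteq> F" "V.span S = F" using fd unfolding V.fin_dim_def by auto
 have "F \<subseteq> W" if W: "lin_subspace A W" "S \<subseteq> W" for W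
 proof
  fix x assume "x : F"
  hence "x : V.span S" using S(3) by simp
  then obtain a T where T: "finite T" "T \<subseteq> S" "x = V.lincomb a T" unfolding V.span_def by blast
  have "V.lincomb a T : W" using T(1,2)
  proof (induction T rule: finite_induct)
   case empty
   show ?case using lin_subspaceD(2)[OF W(1)] by (simp add: V.lincomb_def)
  next
   case (insert v T)
   have mem: "(%v. a v .[A] v) : T \<rightarrow> F" "a v .[A] v : F"
    using insert S(2) V.smult_closed by (auto simp: class_ring_simps)
   have "V.lincomb a (insert v T) = (a v .[A] v) +[A] V.lincomb a T"
    unfolding V.lincomb_def using V.M.finsum_insert[OF insert(1,2), of "%v. a v .[A] v"] mem by simp
   thus ?case using insert lin_subspaceD(3,4)[OF W(1)] W(2) by auto
  qed
  thus "x : W" using T(3) by simp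
 qed
 thus ?thesis using that S(1,2) by (auto simp: spans_def)
qed

definition lin_hull :: "'a cstar => 'a set => 'a set" where
 "lin_hull A T = {x : carrier A. ALL W. lin_subspace A W --> T \<subseteq> W --> x : W}"

context cstar_algebra
begin

lemma lin_hull_subspace: "lin_subspace A (lin_hull A T)"
 unfolding lin_subspace_def lin_hull_def by (auto simp: lin_subspace_def)

lemma lin_hull_superset: "T \<subseteq> carrier A ==> T \<subseteq> lin_hull A T"
 by (auto simp: lin_hull_def)

lemma lin_hull_minimal: "lin_subspace A W ==> T \<subseteq> W ==> lin_hull A T \<subseteq> W"
 by (auto simp: lin_hull_def)

end

context unital_cstar_algebra
begin

definition expansion :: "('a => complex) => (nat => 'a) => nat => 'a => 'a" where
 "expansion f u r x = csum A (%p. f (star A (u p) ** x) *. u p) r"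

lemma expansion_closed: "(!!p. p < r ==> u p : carrier A) ==> expansion f u r x : carrier A"
 unfolding expansion_def by (intro csum_closed) auto

lemma expansion_functional:
 assumes f: "pos_functional f" and u: "!!p. p < r ==> u p : carrier A" and y: "y : carrier A"
 shows "f (y ** expansion f u r x) = (SUM p<r. f (star A (u p) ** x) * f (y ** u p))"
proof -
 have "y ** expansion f u r x = csum A (%p. f (star A (u p) ** x) *. (y ** u p)) r"
  unfolding expansion_def using u y by (subst csum_mult_left) (auto intro!: csum_cong simp: smult_mult_right)
 thus ?thesis using u y by (simp add: pos_functional_csum[OF f] pos_functionalD(2)[OF f])
qed

text \<open>Being equal to one's own expansion is a linear condition, so it passes from a spanning
  set to the whole span.\<close>

lemma expansion_subspace:
 assumes f: "pos_functional f" and u: "!!p. p < r ==> u p : carrier A"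
 shows "lin_subspace A {x : carrier A. x = expansion f u r x}"
proof -
 have z: "expansion f u r \<zero> = \<zero>"
 proof -
  have "expansion f u r \<zero> = csum A (%p. \<zero>) r"
   unfolding expansion_def by (rule csum_cong) (simp add: u pos_functional_zero[OF f])
  also have "... = \<zero>" by (induction r) auto
  finally show ?thesis .
 qed
 have a: "expansion f u r (x +. y) = expansion f u r x +. expansion f u r y" if x: "x : carrier A" "y : carrier A" for x y
 proof -
  have "expansion f u r (x +. y) = csum A (%p. f (star A (u p) ** x) *. u p +. f (star A (u p) ** y) *. u p) r"
   unfolding expansion_def by (rule csum_cong)
    (simp add: u x mult_add_right pos_functionalD(1)[OF f] sm_add_left)
  also have "... = expansion f u r x +. expansion f u r y"
   unfolding expansion_def by (rule csum_add) (simp_all add: u)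
  finally show ?thesis .
 qed
 have s: "expansion f u r (c *. x) = c *. expansion f u r x" if x: "x : carrier A" for c x
 proof -
  have "expansion f u r (c *. x) = csum A (%p. c *. (f (star A (u p) ** x) *. u p)) r"
   unfolding expansion_def by (rule csum_cong)
    (simp add: u x smult_mult_right pos_functionalD(2)[OF f] sm_assoc)
  also have "... = c *. expansion f u r x"
   unfolding expansion_def by (rule csum_smult) (simp add: u)
  finally show ?thesis .
 qed
 show ?thesis unfolding lin_subspace_def using z a s by auto
qed

lemma expansion_parseval:
 assumes f: "pos_functional f" and u: "!!p. p < r ==> u p : carrier A" and x: "x : carrier A" "x = expansion f u r x"
 shows "f (star A x ** x) = (SUM p<r. f (star A (u p) ** x) * cnj (f (star A (u p) ** x)))"
proof -
 have "f (star A x ** x) = f (star A x ** expansion f u r x)" using x(2) by simp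
 also have "... = (SUM p<r. f (star A (u p) ** x) * f (star A x ** u p))"
  by (rule expansion_functional[OF f u]) (use x in auto)
 also have "... = (SUM p<r. f (star A (u p) ** x) * cnj (f (star A (u p) ** x)))"
 proof (rule sum.cong[OF refl])
  fix p assume "p : {..<r}"
  thus "f (star A (u p) ** x) * f (star A x ** u p) = f (star A (u p) ** x) * cnj (f (star A (u p) ** x))"
   using pos_functionalD(3)[OF f, of "star A (u p) ** x"] u x(1) by (simp add: star_mult)
 qed
 finally show ?thesis .
qed

text \<open>Faithfulness of \<open>f\<close> makes the procedure exact: a remainder of seminorm 0 is
  zero and adds no basis vector, so \<open>r\<close> may be smaller than \<open>k\<close> and the
  expansions are equalities in the algebra.\<close>

lemma gram_schmidt:
 fixes k :: nat
 assumes f: "pos_functional f" and faith: "!!x. x : carrier A ==> Re (f (star A x ** x)) = 0 ==> x = \<zero>"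
  and V: "lin_subspace A V" and z: "!!i. i < k ==> z i : V"
 shows "EX u r. (ALL p<r. u p : V) & (ALL p<r. ALL q<r. f (star A (u q) ** u p) = (if p = q then 1 else 0)) &
  (ALL i<k. z i = expansion f u r (z i))"
 using z
proof (induction k)
 case 0
 show ?case by (intro exI[of _ "%_. \<zero>"] exI[of _ 0]) auto
next
 case (Suc k)
 then obtain u r where IH: "!!p. p < r ==> u p : V" "!!p q. p < r ==> q < r ==> f (star A (u q) ** u p) = (if p = q then 1 else 0)"
  "!!i. i < k ==> z i = expansion f u r (z i)" by force
 have zV: "z k : V" using Suc.prems by simp
 note zc = lin_subspaceD(5)[OF V zV] and uc = lin_subspaceD(5)[OF V IH(1)]
 define e where "e = expansion f u r (z k)"
 have eV: "e : V" unfolding e_def expansion_def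
  by (intro lin_subspace_csum[OF V] lin_subspaceD(4)[OF V] IH(1))
 note ec = lin_subspaceD(5)[OF V eV]
 define w where "w = z k -. e"
 have wc: "w : carrier A" using zc ec by (simp add: w_def)
 have "w = z k +. (-1) *. e" using ec by (simp add: w_def a_minus_def sm_minus_one)
 hence wV: "w : V" using lin_subspaceD(3,4)[OF V] zV eV by simp
 have orth: "f (star A (u q) ** w) = 0" if q: "q < r" for q
 proof -
  have "f (star A (u q) ** e) = (SUM p<r. f (star A (u p) ** z k) * f (star A (u q) ** u p))"
   unfolding e_def by (rule expansion_functional[OF f uc]) (use uc[OF q] in auto)
  also have "... = (SUM p<r. if p = q then f (star A (u p) ** z k) else 0)"
   by (intro sum.cong refl) (simp add: IH(2) q)
  also have "... = f (star A (u q) ** z k)" using q by simp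
  finally show ?thesis using uc[OF q] zc ec by (simp add: w_def mult_diff_right pos_functional_diff[OF f])
 qed
 show ?case
 proof (cases "w = \<zero>")
  case True
  hence "z k = e" unfolding w_def by (rule diff_eq_zero[OF zc ec])
  thus ?thesis using IH unfolding e_def by (intro exI[of _ u] exI[of _ r]) (auto simp: less_Suc_eq)
 next
  case False
  define g where "g = Re (f (star A w ** w))"
  have g: "g > 0" using faith[OF wc] False pos_functionalD(4)[OF f wc] by (auto simp: g_def order_less_le)
  have fg: "f (star A w ** w) = cr g" unfolding g_def by (rule pos_functional_self[OF f wc])
  define c where "c = cr (1 / sqrt g)"
  have cg: "c * c * cr g = 1" "cnj c = c" "c * cr g = cr (sqrt g)"
   "cr (sqrt g) * c = 1"
   using g by (simp_all add: c_def field_simps flip: of_real_mult)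
  define u' where "u' = u(r := c *. w)"
  have u'r: "u' r = c *. w" and u'p: "!!p. p < r ==> u' p = u p" by (auto simp: u'_def)
  have u'V: "u' p : V" if "p < Suc r" for p
   using that IH(1) lin_subspaceD(4)[OF V wV] by (auto simp: u'_def less_Suc_eq)
  have u'c: "u' p : carrier A" if "p < Suc r" for p by (rule lin_subspaceD(5)[OF V u'V[OF that]])
  have wu: "f (star A w ** u q) = 0" if "q < r" for q
   using pos_functionalD(3)[OF f, of "star A (u q) ** w"] orth[OF that] uc[OF that] wc by (simp add: star_mult)
  have on: "f (star A (u' q) ** u' p) = (if p = q then 1 else 0)" if pq: "p < Suc r" "q < Suc r" for p q
  proof -
   consider "p < r" "q < r" | "p = r" "q < r" | "p < r" "q = r" | "p = r" "q = r" using pq by (auto simp: less_Suc_eq)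
   thus ?thesis
   proof cases
    case 1 thus ?thesis using IH(2) u'p by simp
   next
    case 2 thus ?thesis using uc[of q] wc orth[of q]
     by (simp add: u'r u'p smult_mult_right pos_functionalD(2)[OF f])
   next
    case 3 thus ?thesis using uc[of p] wc wu[of p]
     by (simp add: u'r u'p star_smult smult_mult_left pos_functionalD(2)[OF f])
   next
    case 4 thus ?thesis using wc cg
     by (simp add: u'r star_smult smult_mult_left smult_mult_right pos_functionalD(2)[OF f] fg mult.assoc)
   qed
  qed
  have ex': "expansion f u' (Suc r) x = expansion f u r x +. (c * f (star A w ** x)) *. (c *. w)"
   if x: "x : carrier A" for x
  proof -
   have "csum A (%p. f (star A (u' p) ** x) *. u' p) r = csum A (%p. f (star A (u p) ** x) *. u p) r"
    by (rule csum_cong) (simp add: u'p)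
   thus ?thesis using x wc cg(2)
    by (simp add: expansion_def u'r star_smult smult_mult_left pos_functionalD(2)[OF f])
  qed
  have wex: "f (star A w ** expansion f u r x) = 0" for x
  proof -
   have "f (star A w ** expansion f u r x) = (SUM p<r. f (star A (u p) ** x) * f (star A w ** u p))"
    by (rule expansion_functional[OF f uc]) (use wc in auto)
   also have "... = 0" by (rule sum.neutral) (simp add: wu)
   finally show ?thesis .
  qed
  have "z i = expansion f u' (Suc r) (z i)" if i: "i < Suc k" for i
  proof (cases "i = k")
   case False
   hence zi: "z i = expansion f u r (z i)" "z i : carrier A"
    using i IH(3)[of i] lin_subspaceD(5)[OF V Suc.prems[OF i]] by auto
   have "f (star A w ** z i) = 0" using wex[of "z i"] zi(1) by simp
   hence "expansion f u' (Suc r) (z i) = expansion f u r (z i)"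
    using ex'[OF zi(2)] wc expansion_closed[of r u f "z i"] uc by simp
   thus ?thesis using zi(1) by simp
  next
   case True
   have ze: "z k = e +. w" using M.a_comm[OF ec wc] diff_add_cancel[OF zc ec] by (simp add: w_def)
   have "f (star A w ** z k) = f (star A w ** e) + f (star A w ** w)"
    unfolding ze using ec wc by (simp add: mult_add_right pos_functionalD(1)[OF f])
   also have "... = cr g" unfolding e_def wex fg by simp
   finally have "expansion f u' (Suc r) (z k) = e +. w"
    unfolding ex'[OF zc] e_def[symmetric] using wc cg by (simp add: sm_assoc)
   thus ?thesis using ze True by simp
  qed
  thus ?thesis using on u'V by (intro exI[of _ u'] exI[of _ "Suc r"]) auto
 qed
qed

end

section \<open>Almost intertwining contractions\<close>

lemma smult_minus_mat:
 fixes X Y :: "complex mat"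
 assumes "X : cmat l m" "Y : cmat l m"
 shows "c *m (X - Y) = c *m X - c *m Y"
 using assms by (intro eq_matI) (auto simp: algebra_simps)

locale glue = A: gram_side A C n q1 sA f + B: gram_side B C n q2 sB f + D: unital_cstar_algebra D
 for A :: "'a cstar" and B :: "'b cstar" and C :: "'c cstar" and D :: "'d cstar"
  and n q1 q2 sA sB f +
 fixes iA :: "'d => 'a" and iB :: "'d => 'b"
 assumes faith: "!!x. x : carrier C ==> Re (f (star C x *[C] x)) = 0 ==> x = 0[C]"
  and iA: "unital_embedding D A iA" and iB: "unital_embedding D B iB"
  and s_eq: "!!d. d : carrier D ==> sA (iA d) = sB (iB d)"
  and q_eq: "!!d. d : carrier D ==> q1 (iA d) = q2 (iB d)"
begin

sublocale iA: unital_hom D A iA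
 by unfold_locales (use iA in \<open>auto simp: unital_embedding_def embedding_def\<close>)

sublocale iB: unital_hom D B iB
 by unfold_locales (use iB in \<open>auto simp: unital_embedding_def embedding_def\<close>)

definition sd :: "'d => 'c" where "sd d = sA (iA d)"

lemma sd_simps:
 "d : carrier D ==> sd d : carrier C"
 "d : carrier D ==> d' : carrier D ==> sd (d +[D] d') = sd d +[C] sd d'"
 "d : carrier D ==> sd (c .[D] d) = c .[C] sd d"
 "d : carrier D ==> d' : carrier D ==> sd (d *[D] d') = sd d *[C] sd d'"
 "d : carrier D ==> sd (star D d) = star C (sd d)"
 "sd 1[D] = 1[C]" "sd 0[D] = 0[C]"
 by (simp_all add: sd_def iA.hom_simps A.s.hom_simps)

lemma sd_B: "d : carrier D ==> sB (iB d) = sd d"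
 by (simp add: sd_def s_eq)

definition lift_both :: "(nat => complex mat) => 'd => bool" where
 "lift_both y d \<longleftrightarrow> d : carrier D & A.lift y (iA d) & B.lift y (iB d)"

text \<open>Agreement of \<open>q1\<close> and \<open>q2\<close> on \<open>D\<close> lets one matrix
  sequence lift \<open>d\<close> on both sides; therefore one operator can be tested against both
  models with the same \<open>y\<close>.\<close>

lemma ex_lift_both: "d : carrier D ==> EX y. lift_both y d"
 using A.ex_lift[of "iA d"] q_eq[of d] by (auto simp: lift_both_def A.lift_def B.lift_def)

lemma lift_both_adj: "lift_both y d ==> lift_both (%k. adj (y k)) (star D d)"
 using A.lift_adj[of y "iA d"] B.lift_adj[of y "iB d"]
 by (auto simp: lift_both_def iA.hom_simps(5) iB.hom_simps(5))

text \<open>The hull of \<open>E \<cdot> Z\<close> for a finite-dimensional unital *-subalgebra \<open>E\<close> of \<open>D\<close>.\<close>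

lemma invariant_hull:
 assumes E: "lin_subspace D E" "1[D] : E" "!!d d'. d : E ==> d' : E ==> d *[D] d' : E"
  and S: "finite S" "S \<subseteq> E" "spans D S E" and Z: "finite Z" "Z \<subseteq> carrier C"
 obtains V T where "lin_subspace C V" "finite T" "T \<subseteq> V" "spans C T V" "Z \<subseteq> V"
  "!!d x. d : E ==> x : V ==> sd d *[C] x : V"
proof -
 note Ec = lin_subspaceD(5)[OF E(1)]
 have Zc: "z : carrier C" if "z : Z" for z using Z(2) that by blast
 define T where "T = (%(s, z). sd s *[C] z) ` (S \<times> Z)"
 have Tc: "T \<subseteq> carrier C"
 proof
  fix x assume "x : T"
  then obtain s z where "s : S" "z : Z" "x = sd s *[C] z" by (auto simp: T_def)
  thus "x : carrier C" using sd_simps(1)[OF Ec] Zc S(2) by auto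
 qed
 define V where "V = lin_hull C T"
 have V: "lin_subspace C V" unfolding V_def by (rule A.C.lin_hull_subspace)
 note VD = lin_subspaceD[OF V]
 have TV: "T \<subseteq> V" unfolding V_def by (rule A.C.lin_hull_superset[OF Tc])
 have sp: "spans C T V" unfolding spans_def V_def by (intro allI impI A.C.lin_hull_minimal)
 have Vd: "sd d *[C] z : V" if d: "d : E" and z: "z : Z" for d z
 proof -
  have "lin_subspace D {d : carrier D. sd d *[C] z : V}"
   unfolding lin_subspace_def using VD Zc[OF z]
   by (auto simp: sd_simps A.C.mult_add_left A.C.smult_mult_left)
  moreover have "S \<subseteq> {d : carrier D. sd d *[C] z : V}" using z TV S(2) Ec by (auto simp: T_def)
  ultimately have "d : {d : carrier D. sd d *[C] z : V}" by (rule spansD[OF S(3) _ _ d])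
  thus ?thesis by simp
 qed
 have "sd d *[C] x : V" if d: "d : E" and x: "x : V" for d x
 proof -
  have "lin_subspace C {x : carrier C. sd d *[C] x : V}"
   unfolding lin_subspace_def using VD sd_simps(1)[OF Ec[OF d]]
   by (auto simp: A.C.mult_add_right A.C.smult_mult_right)
  moreover have "T \<subseteq> {x : carrier C. sd d *[C] x : V}"
  proof
   fix x assume "x : T"
   then obtain s z where sz: "s : S" "z : Z" "x = sd s *[C] z" by (auto simp: T_def)
   have sE: "s : E" using S(2) sz(1) by blast
   have "sd d *[C] x = sd (d *[D] s) *[C] z"
    using Ec[OF d] Ec[OF sE] Zc[OF sz(2)] by (simp add: sz(3) sd_simps A.C.mult_assoc)
   also have "... : V" by (rule Vd[OF E(3)[OF d sE] sz(2)])
   finally show "x : {x : carrier C. sd d *[C] x : V}" using `x : T` Tc by blast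
  qed
  ultimately have "x : {x : carrier C. sd d *[C] x : V}" by (rule spansD[OF sp _ _ x])
  thus ?thesis by simp
 qed
 moreover have "Z \<subseteq> V"
 proof
  fix z assume z: "z : Z"
  show "z : V" using Vd[OF E(2) z] Zc[OF z] by (simp add: sd_simps)
 qed
 moreover have "finite T" using S(1) Z(1) by (simp add: T_def)
 ultimately show ?thesis by (intro that[OF V _ TV sp])
qed

text \<open>Data of one finite stage. \<open>F\<close> with the vectors \<open>xj\<close> serves
  \<open>A\<close>, \<open>G\<close> with the vectors \<open>zt\<close> serves \<open>B\<close>;
  both represent the same product of matrix algebras, so \<open>t\<close> can be compared with a
  common lift of an element of \<open>D\<close>.\<close>

definition approx_glue where
 "approx_glue N Z PA PB PD e m F m' G t xj zt \<longleftrightarrow> rep n N m F & rep n N m' G & t : cmat m' m & opn t <= 1 &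
  (ALL x:Z. xj x : cvec m & zt x : cvec m') &
  (ALL x:Z. ALL x':Z. cmod (xj x *c xj x' - f (star C x' *[C] x)) < e & cmod (zt x *c zt x' - f (star C x' *[C] x)) < e) &
  (ALL (y, a):PA. ALL x:Z. sA a *[C] x : Z --> nrm (F y *v xj x - xj (sA a *[C] x)) < e) &
  (ALL (y, a):PB. ALL x:Z. sB a *[C] x : Z --> nrm (G y *v zt x - zt (sB a *[C] x)) < e) &
  (ALL x:Z. nrm (t *v xj x - zt x) < e) &
  (ALL (y, d):PD. opn (t * F y - G y * t) < e)"

text \<open>The hull of \<open>Z\<close> under \<open>E\<close> is invariant and has a finite
  orthonormal basis \<open>u\<close>. Both models contain almost orthonormal copies of
  \<open>u\<close>, on which \<open>E\<close> acts by the same matrices up to small errors, so the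
  finite rank operator from one copy to the other almost intertwines.\<close>

lemma glue_step:
 fixes e :: real
 assumes E: "lin_subspace D E" "1[D] : E" "!!d d'. d : E ==> d' : E ==> d *[D] d' : E" "!!d. d : E ==> star D d : E"
  and S: "finite S" "S \<subseteq> E" "spans D S E" and Z: "finite Z" "Z \<subseteq> carrier C"
  and PA: "finite PA" "!!y a. (y, a) : PA ==> A.lift y a"
  and PB: "finite PB" "!!y a. (y, a) : PB ==> B.lift y a"
  and PD: "finite PD" "!!y d. (y, d) : PD ==> lift_both y d & d : E"
  and e: "e > 0"
 shows "EX m F m' G t xj zt. approx_glue N Z PA PB PD e m F m' G t xj zt"
proof -
 obtain V T where V: "lin_subspace C V" "finite T" "T \<subseteq> V" "spans C T V" "Z \<subseteq> V"
  "!!d x. d : E ==> x : V ==> sd d *[C] x : V"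
  by (rule invariant_hull[OF E(1,2) _ S Z]) (rule E(3), assumption, assumption, rule that)
 note Vc = lin_subspaceD(5)[OF V(1)]
 obtain h where h: "bij_betw h {0..<card T} T" using ex_bij_betw_nat_finite[OF V(2)] by blast
 have hT: "h ` {0..<card T} = T" using h by (simp add: bij_betw_def)
 have hV: "h i : V" if "i < card T" for i using hT V(3) that by auto
 obtain u r where u: "!!p. p < r ==> u p : V" "!!p q. p < r ==> q < r ==> f (star C (u q) *[C] u p) = (if p = q then 1 else 0)"
  "!!i. i < card T ==> h i = A.C.expansion f u r (h i)"
  using A.C.gram_schmidt[OF A.f faith V(1), of "card T" h] hV by blast
 have uc: "u p : carrier C" if "p < r" for p by (rule Vc[OF u(1)[OF that]])
 have Vex: "x = A.C.expansion f u r x" if "x : V" for x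
 proof -
  have "T \<subseteq> {x : carrier C. x = A.C.expansion f u r x}"
  proof
   fix x assume x: "x : T"
   then obtain i where "i < card T" "x = h i" using hT by force
   thus "x : {x : carrier C. x = A.C.expansion f u r x}" using u(3) x V(3) Vc by auto
  qed
  from spansD[OF V(4) A.C.expansion_subspace[OF A.f uc] this that] show ?thesis by simp
 qed
 \<comment> \<open>Besides \<open>Z\<close> and the basis, the models must contain the images of the
   basis under the tested elements and their adjoints, as the intertwining estimate compares these
   images with their expansions.\<close>
 define X where "X = Z \<union> u ` {..<r} \<union> (%((y, d), p). sd d *[C] u p) ` (PD \<times> {..<r})
   \<union> (%((y, d), p). sd (star D d) *[C] u p) ` (PD \<times> {..<r})"
 have Xfin: "finite X" unfolding X_def using Z(1) PD(1) by simp
 have PDE: "d : E" "lift_both y d" if "(y, d) : PD" for y d using PD(2)[OF that] by auto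
 have XV: "X \<subseteq> V" unfolding X_def using V(5) V(6)[OF PDE(1) u(1)] V(6)[OF E(4)[OF PDE(1)] u(1)] u(1) by auto
 have Xc: "X \<subseteq> carrier C" using XV Vc by blast
 have ZX: "Z \<subseteq> X" and uX: "!!p. p < r ==> u p : X" by (auto simp: X_def)
 have dX: "sd d *[C] u p : X" "sd (star D d) *[C] u p : X" if "(y, d) : PD" "p < r" for y d p
  unfolding X_def using that by (force, force)
 \<comment> \<open>Adjoint lifts are added on the side of \<open>A\<close> only: in
   \<open>rank_sum_intertwine\<close> the adjoint acts on the source vectors and the element itself
   on the target vectors.\<close>
 define PA' where "PA' = PA \<union> (%(y, d). (y, iA d)) ` PD \<union> (%(y, d). (%k. adj (y k), iA (star D d))) ` PD"
 define PB' where "PB' = PB \<union> (%(y, d). (y, iB d)) ` PD"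
 have lA: "A.lift y a" if "(y, a) : PA'" for y a
  using that PA(2) PDE(2) lift_both_adj[OF PDE(2)] unfolding PA'_def by (auto simp: lift_both_def)
 have lB: "B.lift y a" if "(y, a) : PB'" for y a
  using that PB(2) PDE(2) unfolding PB'_def by (auto simp: lift_both_def)
 have cA: "countable PA'" and cB: "countable PB'" unfolding PA'_def PB'_def using PA(1) PB(1) PD(1)
  by (auto intro: countable_finite)
 note cX = countable_finite[OF Xfin]
 obtain m F xj where F: "!!tu. rep n tu (m tu) (F tu)" "!!tu x. x : X ==> xj tu x : cvec (m tu)"
  "!!x x'. x : X ==> x' : X ==> (%tu. xj tu x *c xj tu x') ----> f (star C x' *[C] x)"
  "!!y a x. (y, a) : PA' ==> x : X ==> sA a *[C] x : X ==>
   (%tu. nrm (F tu y *v xj tu x - xj tu (sA a *[C] x))) ----> 0"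
  by (rule A.gram_rep[OF cA _ cX Xc]) (use lA in blast)+
 obtain m' G zt where G: "!!tu. rep n tu (m' tu) (G tu)" "!!tu x. x : X ==> zt tu x : cvec (m' tu)"
  "!!x x'. x : X ==> x' : X ==> (%tu. zt tu x *c zt tu x') ----> f (star C x' *[C] x)"
  "!!y a x. (y, a) : PB' ==> x : X ==> sB a *[C] x : X ==>
   (%tu. nrm (G tu y *v zt tu x - zt tu (sB a *[C] x))) ----> 0"
  by (rule B.gram_rep[OF cB _ cX Xc]) (use lB in blast)+
 define a where "a tu p = xj tu (u p)" for tu p
 define b where "b tu p = zt tu (u p)" for tu p
 have ac: "a tu p : cvec (m tu)" and bc: "b tu p : cvec (m' tu)" if "p < r" for tu p
  unfolding a_def b_def using F(2) G(2) uX[OF that] by auto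
 have ga: "(%tu. a tu p *c a tu q) ----> (if p = q then 1 else 0)"
  and gb: "(%tu. b tu p *c b tu q) ----> (if p = q then 1 else 0)" if "p < r" "q < r" for p q
  using F(3)[OF uX[OF that(1)] uX[OF that(2)]] G(3)[OF uX[OF that(1)] uX[OF that(2)]] u(2)[OF that]
  by (simp_all add: a_def b_def)
 define c where "c x p = f (star C (u p) *[C] x)" for x p
 have pars: "f (star C x *[C] x) = (SUM p<r. c x p * cnj (c x p))" if "x : X" for x
  unfolding c_def using that XV Xc by (intro A.C.expansion_parseval[OF A.f uc] Vex) auto
 have expA: "(%tu. nrm (vsum (m tu) (%p. gq tu p *s a tu p) r - xj tu x)) ----> 0"
  if x: "x : X" and g: "!!p. p < r ==> (%tu. gq tu p) ----> c x p" for x gq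
  by (rule gram_expand[OF ac F(2)[OF x] ga _ _ g])
   (use F(3)[OF x x] F(3)[OF x uX] in \<open>simp_all add: pars[OF x] a_def c_def\<close>)
 have expB: "(%tu. nrm (vsum (m' tu) (%p. gq tu p *s b tu p) r - zt tu x)) ----> 0"
  if x: "x : X" and g: "!!p. p < r ==> (%tu. gq tu p) ----> c x p" for x gq
  by (rule gram_expand[OF bc G(2)[OF x] gb _ _ g])
   (use G(3)[OF x x] G(3)[OF x uX] in \<open>simp_all add: pars[OF x] b_def c_def\<close>)
 define ep where "ep tu = (SUM p<r. SUM q<r. cmod (a tu p *c a tu q - (if p = q then 1 else 0))
   + cmod (b tu p *c b tu q - (if p = q then 1 else 0)))" for tu
 have eps0: "ep ----> 0"
 proof -
  have "ep ----> (SUM p<r. SUM q<r. cmod ((if p = q then 1 else 0) - (if p = q then 1 else 0))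
   + cmod ((if p = q then 1 else 0) - (if p = q then 1 else (0::complex))))"
   unfolding ep_def by (intro tendsto_sum tendsto_add tendsto_norm tendsto_diff ga gb tendsto_const) auto
  thus ?thesis by simp
 qed
 have eps_ge: "0 <= ep tu" for tu unfolding ep_def by (intro sum_nonneg add_nonneg_nonneg) auto
 have eps: "cmod (a tu p *c a tu q - (if p = q then 1 else 0)) <= ep tu"
  "cmod (b tu p *c b tu q - (if p = q then 1 else 0)) <= ep tu" if pq: "p < r" "q < r" for tu p q
 proof -
  let ?g = "%p q. cmod (a tu p *c a tu q - (if p = q then 1 else 0)) + cmod (b tu p *c b tu q - (if p = q then 1 else 0))"
  have "?g p q <= (SUM q<r. ?g p q)" by (rule member_le_sum) (use pq in auto)
  also have "... <= ep tu" unfolding ep_def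
   by (rule member_le_sum[of p "{..<r}" "%p. SUM q<r. ?g p q"]) (use pq in \<open>auto intro!: sum_nonneg add_nonneg_nonneg\<close>)
  finally show "cmod (a tu p *c a tu q - (if p = q then 1 else 0)) <= ep tu"
   "cmod (b tu p *c b tu q - (if p = q then 1 else 0)) <= ep tu"
   by (auto intro: order_trans[rotated])
 qed
 \<comment> \<open>Normalises the bound \<open>1 + r * ep\<close> of \<open>rank_sum_opnorm\<close>
   to 1. It tends to 1, so the limits below are not affected.\<close>
 define kk where "kk tu = 1 / (1 + real r * ep tu)" for tu
 have kpos: "0 < 1 + real r * ep tu" for tu using eps_ge[of tu] by (simp add: add_pos_nonneg)
 have kap: "0 <= kk tu" "kk tu <= 1" for tu using kpos[of tu] eps_ge[of tu] by (auto simp: kk_def)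
 have kap1: "kk ----> 1"
 proof -
  have "kk ----> 1 / (1 + real r * 0)" unfolding kk_def by (intro tendsto_intros eps0) auto
  thus ?thesis by simp
 qed
 define t0 where "t0 tu = rank_sum (m' tu) (m tu) (b tu) (a tu) r" for tu
 have t0c: "t0 tu : cmat (m' tu) (m tu)" for tu by (simp add: t0_def)
 define t where "t tu = cr (kk tu) *m t0 tu" for tu
 have tc: "t tu : cmat (m' tu) (m tu)" for tu using t0c by (simp add: t_def)
 have t1: "opn (t tu) <= 1" for tu
 proof -
  have "opn (t0 tu) <= 1 + real r * ep tu"
   unfolding t0_def by (rule rank_sum_opnorm[OF bc ac eps(2,1) eps_ge])
  hence "opn (t tu) <= kk tu * (1 + real r * ep tu)"
   unfolding t_def opnorm_smult using kap(1) by (simp add: mult_left_mono)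
  thus ?thesis using kpos[of tu] by (simp add: kk_def)
 qed
 have txj: "(%tu. nrm (t tu *v xj tu x - zt tu x)) ----> 0" if x: "x : X" for x
 proof -
  define gq where "gq tu p = cr (kk tu) * (xj tu x *c a tu p)" for tu p
  have "t tu *v xj tu x = vsum (m' tu) (%p. gq tu p *s b tu p) r" for tu
  proof -
   have "t tu *v xj tu x = cr (kk tu) *s (t0 tu *v xj tu x)"
    unfolding t_def by (rule smult_mat_mult_vec[OF t0c F(2)[OF x]])
   also have "t0 tu *v xj tu x = vsum (m' tu) (%p. (xj tu x *c a tu p) *s b tu p) r"
    unfolding t0_def by (rule rank_sum_vec[OF bc ac F(2)[OF x]])
   also have "cr (kk tu) *s ... = vsum (m' tu) (%p. gq tu p *s b tu p) r"
    by (rule eq_vecI) (auto simp: vsum_def gq_def sum_distrib_left carrier_vecD[OF bc] mult_ac intro!: sum.cong)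
   finally show ?thesis .
  qed
  moreover have "(%tu. gq tu p) ----> c x p" if "p < r" for p
  proof -
   have "(%tu. gq tu p) ----> cr 1 * c x p"
    unfolding gq_def a_def c_def by (intro tendsto_mult tendsto_of_real kap1 F(3)[OF x uX[OF that]])
   thus ?thesis by simp
  qed
  ultimately show ?thesis using expB[OF x, of gq] by simp
 qed
 have nrm: "(%tu. nrm (a tu p)) ----> 1" "(%tu. nrm (b tu p)) ----> 1" if "p < r" for p
  unfolding vec_l2norm_def
  using tendsto_real_sqrt[OF tendsto_Re[OF ga[OF that that]]] tendsto_real_sqrt[OF tendsto_Re[OF gb[OF that that]]] by simp_all
 have comm: "(%tu. opn (t tu * F tu y - G tu y * t tu)) ----> 0" if yd: "(y, d) : PD" for y d
 proof -
  have dD: "d : carrier D" and yA: "A.lift y (iA d)" using PDE(2)[OF yd] by (auto simp: lift_both_def)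
  note ym = A.liftD(1)[OF yA]
  \<comment> \<open>Matrix entries of \<open>star D d\<close> and of \<open>d\<close> in the basis
    \<open>u\<close>; as \<open>f\<close> is hermitian, the two matrices are adjoint to each
    other.\<close>
  define al where "al p q = c (sd (star D d) *[C] u p) q" for p q
  define bt where "bt p q = c (sd d *[C] u p) q" for p q
  have AB: "cnj (al p q) = bt q p" if "p < r" "q < r" for p q
  proof -
   have "star C (star C (u q) *[C] (sd (star D d) *[C] u p)) = star C (u p) *[C] (sd d *[C] u q)"
    using uc[OF that(1)] uc[OF that(2)] sd_simps(1)[OF dD] dD
    by (simp add: A.C.star_mult sd_simps(5) A.C.mult_assoc A.C.star_star)
   thus ?thesis using A.C.pos_functionalD(3)[OF A.f, of "star C (u q) *[C] (sd (star D d) *[C] u p)"]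
     uc[OF that(1)] uc[OF that(2)] sd_simps(1)[of "star D d"] dD by (simp add: al_def bt_def c_def)
  qed
  define e1 where "e1 tu p = nrm (adj (F tu y) *v a tu p - vsum (m tu) (%q. al p q *s a tu q) r)" for tu p
  define e2 where "e2 tu p = nrm (G tu y *v b tu p - vsum (m' tu) (%q. bt p q *s b tu q) r)" for tu p
  have e1l: "(%tu. e1 tu p) ----> 0" if p: "p < r" for p
   unfolding e1_def
  proof (rule l2norm_diff_tendsto)
   let ?x = "sd (star D d) *[C] u p"
   have xX: "?x : X" by (rule dX(2)[OF yd p])
   have P: "(%k. adj (y k), iA (star D d)) : PA'" using yd by (force simp: PA'_def)
   show "(%tu. nrm (adj (F tu y) *v a tu p - xj tu ?x)) ----> 0"
    using F(4)[OF P uX[OF p]] xX by (simp add: a_def sd_def repD(6)[OF F(1) ym])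
   show "(%tu. nrm (vsum (m tu) (%q. al p q *s a tu q) r - xj tu ?x)) ----> 0"
    by (rule expA[OF xX]) (simp add: al_def)
   show "adj (F tu y) *v a tu p : cvec (m tu)" for tu
    by (rule mvc[OF adj_carrier[OF repD(2)[OF F(1) ym]] ac[OF p]])
  qed (use F(2)[OF dX(2)[OF yd p]] in auto)
  have e2l: "(%tu. e2 tu p) ----> 0" if p: "p < r" for p
   unfolding e2_def
  proof (rule l2norm_diff_tendsto)
   let ?x = "sd d *[C] u p"
   have xX: "?x : X" by (rule dX(1)[OF yd p])
   have P: "(y, iB d) : PB'" using yd by (force simp: PB'_def)
   show "(%tu. nrm (G tu y *v b tu p - zt tu ?x)) ----> 0"
    using G(4)[OF P uX[OF p]] xX by (simp add: b_def sd_B[OF dD])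
   show "(%tu. nrm (vsum (m' tu) (%q. bt p q *s b tu q) r - zt tu ?x)) ----> 0"
    by (rule expB[OF xX]) (simp add: bt_def)
   show "G tu y *v b tu p : cvec (m' tu)" for tu
    by (rule mvc[OF repD(2)[OF G(1) ym] bc[OF p]])
  qed (use G(2)[OF dX(1)[OF yd p]] in auto)
  show ?thesis
  proof (rule tendsto_sandwich[OF _ _ tendsto_const])
   have "(%tu. SUM p<r. e1 tu p * nrm (b tu p) + nrm (a tu p) * e2 tu p) ----> (SUM p<r. 0 * 1 + 1 * 0)"
    by (intro tendsto_sum tendsto_add tendsto_mult e1l e2l nrm) auto
   thus "(%tu. SUM p<r. e1 tu p * nrm (b tu p) + nrm (a tu p) * e2 tu p) ----> 0" by simp
   show "EV tu. 0 <= opn (t tu * F tu y - G tu y * t tu)" by simp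
   have "opn (t tu * F tu y - G tu y * t tu) <= (SUM p<r. e1 tu p * nrm (b tu p) + nrm (a tu p) * e2 tu p)" for tu
   proof -
    note Fy = repD(2)[OF F(1)[of tu] ym] and Gy = repD(2)[OF G(1)[of tu] ym]
    have "t tu * F tu y - G tu y * t tu = cr (kk tu) *m (t0 tu * F tu y - G tu y * t0 tu)"
     unfolding t_def mult_smult_assoc_mat[OF t0c Fy] mult_smult_distrib[OF Gy t0c]
     by (rule smult_minus_mat[OF mmc[OF t0c Fy] mmc[OF Gy t0c], symmetric])
    hence "opn (t tu * F tu y - G tu y * t tu) = kk tu * opn (t0 tu * F tu y - G tu y * t0 tu)"
     using kap(1)[of tu] by (simp add: opnorm_smult)
    also have "... <= 1 * opn (t0 tu * F tu y - G tu y * t0 tu)" by (intro mult_right_mono kap) auto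
    also have "... <= (SUM p<r. e1 tu p * nrm (b tu p) + nrm (a tu p) * e2 tu p)"
     unfolding t0_def e1_def e2_def mult_1 by (rule rank_sum_intertwine[OF bc ac Fy Gy AB])
    finally show ?thesis .
   qed
   thus "EV tu. opn (t tu * F tu y - G tu y * t tu)
     <= (SUM p<r. e1 tu p * nrm (b tu p) + nrm (a tu p) * e2 tu p)" by simp
  qed
 qed
 have lim0: "EV tu. h tu < e" if "h ----> 0" for h :: "nat => real"
  using order_tendstoD(2)[OF that e] .
 have limc: "EV tu. cmod (h tu - l) < e" if "h ----> l" for h l
  using tendstoD[OF that e] by (simp add: dist_norm)
 have "EV tu. approx_glue N Z PA PB PD e (m tu) (F tu) (m' tu) (G tu) (t tu) (xj tu) (zt tu)"
  unfolding approx_glue_def case_prod_beta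
 proof (intro eventually_conj eventually_ball_finite Z(1) PA(1) PB(1) PD(1) ballI)
  show "EV tu. rep n N (m tu) (F tu)" "EV tu. rep n N (m' tu) (G tu)"
   using eventually_ge_at_top[of N] by (eventually_elim, metis rep_mono F(1) G(1))+
  fix x assume "x : Z"
  hence x: "x : X" using ZX by auto
  show "EV tu. xj tu x : cvec (m tu)" "EV tu. zt tu x : cvec (m' tu)"
   using F(2)[OF x] G(2)[OF x] by simp_all
  show "EV tu. nrm (t tu *v xj tu x - zt tu x) < e" by (rule lim0[OF txj[OF x]])
  show "EV tu. sA (snd p) *[C] x : Z -->
    nrm (F tu (fst p) *v xj tu x - xj tu (sA (snd p) *[C] x)) < e" if "p : PA" for p
   using lim0[OF F(4)[of "fst p" "snd p", OF _ x]] that ZX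
   by (cases "sA (snd p) *[C] x : Z") (auto simp: PA'_def)
  show "EV tu. sB (snd p) *[C] x : Z -->
    nrm (G tu (fst p) *v zt tu x - zt tu (sB (snd p) *[C] x)) < e" if "p : PB" for p
   using lim0[OF G(4)[of "fst p" "snd p", OF _ x]] that ZX
   by (cases "sB (snd p) *[C] x : Z") (auto simp: PB'_def)
  fix x' assume "x' : Z"
  hence x': "x' : X" using ZX by auto
  show "EV tu. cmod (xj tu x *c xj tu x' - f (star C x' *[C] x)) < e"
   "EV tu. cmod (zt tu x *c zt tu x' - f (star C x' *[C] x)) < e"
   using limc[OF F(3)[OF x x']] limc[OF G(3)[OF x x']] by blast+
 next
  fix p assume "p : PD"
  thus "EV tu. opn (t tu * F tu (fst p) - G tu (fst p) * t tu) < e"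
   using lim0[OF comm[of "fst p" "snd p"]] by simp
 qed (use tc t1 in auto)
 thus ?thesis using eventually_happens'[OF sequentially_bot] by blast
qed

end

section \<open>Homomorphisms between coronas and their action on vector sequences\<close>

lemma rep_mprod:
 assumes R: "!!j. rep n j (M j) (R j)" and Y: "Y : mprod n"
 shows "(%j. R j Y) : mprod M"
proof -
 obtain B where B: "!!k. opn (Y k) <= B" "B >= 0" using mprod_bound[OF Y] by blast
 show ?thesis
  by (rule mprodI[OF repD(2)[OF R Y] repD(8)[OF R Y B(1)]])
qed

text \<open>The representation at stage \<open>j\<close> sees only coordinates from \<open>j\<close>
  on, where a null sequence is already small.\<close>

lemma rep_mnull:
 assumes R: "!!j. rep n j (M j) (R j)" and Y: "Y : mprod n" and nl: "mnull Y"
 shows "mnull (%j. R j Y)"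
 unfolding mnull_def
proof (rule LIMSEQ_I)
 fix r :: real assume r: "0 < r"
 hence r2: "r / 2 > 0" by simp
 obtain N where N: "!!k. k >= N ==> opn (Y k) < r / 2"
  using mnull_eventually[OF nl r2] by (auto simp: eventually_sequentially)
 have "opn (R j Y) <= r / 2" if "j >= N" for j
  by (rule repD(8)[OF R Y]) (meson N that less_imp_le order_trans)
 thus "EX no. ALL j>=no. norm (opn (R j Y) - 0) < r" using r by (intro exI[of _ N]) force
qed

text \<open>\<open>tt\<close> is computed on a chosen representative; \<open>rep_mnull\<close>,
  applied to the difference of two representatives, shows that the choice does not matter.\<close>

lemma rep_seq_hom:
 assumes R: "!!j. rep n j (M j) (R j)"
 obtains tt where "star_hom (cor n) (cor M) tt" "tt 1[cor n] = 1[cor M]"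
  "!!Y. Y : mprod n ==> tt (cls n Y) = cls M (%j. R j Y)"
proof -
 define rp where "rp X = (SOME Y. Y : mprod n & X = cls n Y)" for X
 define tt where "tt X = cls M (%j. R j (rp X))" for X
 have th: "tt (cls n Y) = cls M (%j. R j Y)" if Y: "Y : mprod n" for Y
 proof -
  have "rp (cls n Y) : mprod n & cls n Y = cls n (rp (cls n Y))"
   unfolding rp_def by (rule someI[of _ Y]) (simp add: Y)
  hence r: "rp (cls n Y) : mprod n" "mnull (%k. rp (cls n Y) k - Y k)" using Y cls_eq_iff by metis+
  note m1 = mprod_minus[OF r(1) Y]
  have "R j (%k. rp (cls n Y) k - Y k) = R j (rp (cls n Y)) - R j Y" for j
  proof -
   have e: "(%k. rp (cls n Y) k - Y k) = (%k. rp (cls n Y) k + (-1) *m Y k)"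
    by (rule ext, rule eq_matI) (use r(1) Y in auto)
   show ?thesis unfolding e repD(3)[OF R r(1) mprod_smult[OF Y]] repD(4)[OF R Y]
    by (rule eq_matI) (use repD(2)[OF R r(1)] repD(2)[OF R Y] in auto)
  qed
  hence "mnull (%j. R j (rp (cls n Y)) - R j Y)" using rep_mnull[OF R m1 r(2)] by simp
  thus ?thesis unfolding tt_def using cls_eq_iff[OF rep_mprod[OF R r(1)] rep_mprod[OF R Y]] by simp
 qed
 have "star_hom (cor n) (cor M) tt"
  unfolding star_hom_def
 proof (intro conjI ballI allI)
  show "tt : carrier (cor n) \<rightarrow> carrier (cor M)"
   by (auto simp: carrier_corona th intro!: bexI[OF _ rep_mprod[OF R]])
  fix X assume "X : carrier (cor n)"
  then obtain x where x: "x : mprod n" "X = cls n x" by (auto simp: carrier_corona)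
  show "tt (c .[cor n] X) = c .[cor M] tt X" for c
   using x rep_mprod[OF R x(1)] by (simp add: corona_smult th repD(4)[OF R])
  show "tt (star (cor n) X) = star (cor M) (tt X)"
   using x rep_mprod[OF R x(1)] by (simp add: corona_star th repD(6)[OF R])
  fix Z assume "Z : carrier (cor n)"
  then obtain z where z: "z : mprod n" "Z = cls n z" by (auto simp: carrier_corona)
  show "tt (X +[cor n] Z) = tt X +[cor M] tt Z"
   using x z rep_mprod[OF R x(1)] rep_mprod[OF R z(1)] by (simp add: corona_add th repD(3)[OF R])
  show "tt (X *[cor n] Z) = tt X *[cor M] tt Z"
   using x z rep_mprod[OF R x(1)] rep_mprod[OF R z(1)] by (simp add: corona_mult th repD(5)[OF R])
 qed
 moreover have "tt 1[cor n] = 1[cor M]"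
  by (simp add: corona_one th repD(7)[OF R])
 ultimately show ?thesis using that th by blast
qed

definition bvec :: "(nat => nat) => (nat => complex vec) set" where
 "bvec M = {v. (ALL j. v j : cvec (M j)) & (EX B. ALL j. nrm (v j) <= B)}"

text \<open>An element of the corona has no action on vectors, but a lift moves a bounded sequence
  \<open>v\<close> to \<open>w\<close> up to a null sequence. By \<open>acts_any\<close> one lift
  may be replaced by any other.\<close>

definition acts :: "(nat => nat) => (nat => complex mat) set => (nat => complex vec) => (nat => complex vec) => bool" where
 "acts M X v w \<longleftrightarrow> v : bvec M & w : bvec M &
  (EX Y:mprod M. X = cls M Y & (%j. nrm (Y j *v v j - w j)) ----> 0)"

lemma bvecD: "v : bvec M ==> v j : cvec (M j)"
 by (simp add: bvec_def)

lemma bvec_bound: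
 assumes "v : bvec M"
 obtains B where "!!j. nrm (v j) <= B" "B >= 0"
proof -
 obtain B where B: "!!j. nrm (v j) <= B" using assms by (auto simp: bvec_def)
 have "0 <= B" using B[of 0] l2norm_nonneg order_trans by blast
 thus ?thesis using that[OF B] by simp
qed

lemma bvec_add:
 assumes v: "v : bvec M" and w: "w : bvec M"
 shows "(%j. v j + w j) : bvec M"
proof -
 obtain B where B: "!!j. nrm (v j) <= B" using v by (auto simp: bvec_def)
 obtain B' where B': "!!j. nrm (w j) <= B'" using w by (auto simp: bvec_def)
 have "nrm (v j + w j) <= B + B'" for j
  using l2norm_triangle[OF bvecD[OF v] bvecD[OF w], of j] B[of j] B'[of j] by linarith
 moreover have "v j + w j : cvec (M j)" for j using bvecD[OF v, of j] bvecD[OF w, of j] by simp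
 ultimately show ?thesis unfolding bvec_def by blast
qed

lemma null_sandwich: "(!!j. (0::real) <= f j) ==> (!!j. f j <= g j) ==> g ----> 0 ==> f ----> 0"
 by (rule tendsto_sandwich[OF _ _ tendsto_const]) auto

lemma acts_any:
 assumes a: "acts M (cls M Y) v w" and Y: "Y : mprod M"
 shows "(%j. nrm (Y j *v v j - w j)) ----> 0"
proof -
 obtain Z where Z: "Z : mprod M" "cls M Y = cls M Z" "(%j. nrm (Z j *v v j - w j)) ----> 0"
  and v: "v : bvec M" and w: "w : bvec M" using a unfolding acts_def by blast
 have nl: "mnull (%j. Y j - Z j)" using cls_eq_iff[OF Y Z(1)] Z(2) by simp
 obtain B where B: "!!j. nrm (v j) <= B" "B >= 0" using bvec_bound[OF v] by blast
 show ?thesis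
 proof (rule null_sandwich)
  fix j
  note Yj = mpm[OF Y, of j] and Zj = mpm[OF Z(1), of j] and vj = bvecD[OF v, of j] and wj = bvecD[OF w, of j]
  have "Y j *v v j - Z j *v v j = (Y j - Z j) *v v j"
   by (rule minus_mult_distrib_mat_vec[OF Yj Zj vj, symmetric])
  hence "nrm (Y j *v v j - w j) <= nrm ((Y j - Z j) *v v j) + nrm (Z j *v v j - w j)"
   using l2norm_triangle3[OF mvc[OF Yj vj] mvc[OF Zj vj] wj] by simp
  also have "nrm ((Y j - Z j) *v v j) <= opn (Y j - Z j) * nrm (v j)"
   by (rule opnorm_vec[OF minus_carrier_mat[OF Zj] vj])
  also have "... <= opn (Y j - Z j) * B" by (intro mult_left_mono B) auto
  finally show "nrm (Y j *v v j - w j) <= opn (Y j - Z j) * B + nrm (Z j *v v j - w j)" by simp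
 next
  have "(%j. opn (Y j - Z j) * B + nrm (Z j *v v j - w j)) ----> 0 * B + 0"
   using nl Z(3) unfolding mnull_def by (intro tendsto_intros)
  thus "(%j. opn (Y j - Z j) * B + nrm (Z j *v v j - w j)) ----> 0" by simp
 qed simp
qed

lemma actsI: "Y : mprod M ==> v : bvec M ==> w : bvec M ==> (%j. nrm (Y j *v v j - w j)) ----> 0 ==>
 acts M (cls M Y) v w"
 by (auto simp: acts_def)

lemma acts_bvec: "acts M X v w ==> v : bvec M" "acts M X v w ==> w : bvec M"
 by (auto simp: acts_def)

lemma acts_sim:
 assumes a: "acts M X v w" and w': "w' : bvec M" "(%j. nrm (w j - w' j)) ----> 0"
 shows "acts M X v w'"
proof -
 obtain Y where Y: "Y : mprod M" "X = cls M Y" "(%j. nrm (Y j *v v j - w j)) ----> 0"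
  using a unfolding acts_def by blast
 have "(%j. nrm (Y j *v v j - w' j)) ----> 0"
 proof (rule null_sandwich)
  show "nrm (Y j *v v j - w' j) <= nrm (Y j *v v j - w j) + nrm (w j - w' j)" for j
   by (rule l2norm_triangle3[OF mvc[OF mpm[OF Y(1)] bvecD[OF acts_bvec(1)[OF a]]]
      bvecD[OF acts_bvec(2)[OF a]] bvecD[OF w'(1)]])
  show "(%j. nrm (Y j *v v j - w j) + nrm (w j - w' j)) ----> 0"
   using tendsto_add[OF Y(3) w'(2)] by simp
 qed simp
 thus ?thesis unfolding Y(2) by (rule actsI[OF Y(1) acts_bvec(1)[OF a] w'(1)])
qed

lemma acts_mult:
 assumes a: "acts M X v w" and b: "acts M X' w u"
 shows "acts M (X' *[cor M] X) v u"
proof -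
 obtain Y where Y: "Y : mprod M" "X = cls M Y" "(%j. nrm (Y j *v v j - w j)) ----> 0"
  using a unfolding acts_def by blast
 obtain Z where Z: "Z : mprod M" "X' = cls M Z" "(%j. nrm (Z j *v w j - u j)) ----> 0"
  using b unfolding acts_def by blast
 obtain B where B: "!!j. opn (Z j) <= B" "B >= 0" using mprod_bound[OF Z(1)] by blast
 have "(%j. nrm ((Z j * Y j) *v v j - u j)) ----> 0"
 proof (rule null_sandwich)
  fix j
  note Yj = mpm[OF Y(1), of j] and Zj = mpm[OF Z(1), of j]
  note vj = bvecD[OF acts_bvec(1)[OF a], of j] and wj = bvecD[OF acts_bvec(2)[OF a], of j] and uj = bvecD[OF acts_bvec(2)[OF b], of j]
  note Yv = mvc[OF Yj vj]
  have "nrm ((Z j * Y j) *v v j - u j) <= nrm (Z j *v (Y j *v v j) - Z j *v w j) + nrm (Z j *v w j - u j)"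
   unfolding assoc_mult_mat_vec[OF Zj Yj vj]
   by (rule l2norm_triangle3[OF mvc[OF Zj Yv] mvc[OF Zj wj] uj])
  also have "Z j *v (Y j *v v j) - Z j *v w j = Z j *v (Y j *v v j - w j)"
   by (rule mult_mat_vec_minus[OF Zj Yv wj, symmetric])
  also have "nrm (Z j *v (Y j *v v j - w j)) <= opn (Z j) * nrm (Y j *v v j - w j)"
   by (rule opnorm_vec[OF Zj minus_carrier_vec[OF Yv wj]])
  also have "... <= B * nrm (Y j *v v j - w j)" by (intro mult_right_mono B) auto
  finally show "nrm ((Z j * Y j) *v v j - u j) <= B * nrm (Y j *v v j - w j) + nrm (Z j *v w j - u j)" by simp
 next
  have "(%j. B * nrm (Y j *v v j - w j) + nrm (Z j *v w j - u j)) ----> B * 0 + 0"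
   by (intro tendsto_intros Y(3) Z(3))
  thus "(%j. B * nrm (Y j *v v j - w j) + nrm (Z j *v w j - u j)) ----> 0" by simp
 qed simp
 thus ?thesis unfolding Y(2) Z(2) corona_mult[OF Z(1) Y(1)]
  by (rule actsI[OF mprod_mult[OF Z(1) Y(1)] acts_bvec(1)[OF a] acts_bvec(2)[OF b]])
qed

lemma acts_add:
 assumes a: "acts M X v w" and b: "acts M X' v u"
 shows "acts M (X +[cor M] X') v (%j. w j + u j)"
proof -
 obtain Y where Y: "Y : mprod M" "X = cls M Y" "(%j. nrm (Y j *v v j - w j)) ----> 0"
  using a unfolding acts_def by blast
 obtain Z where Z: "Z : mprod M" "X' = cls M Z" "(%j. nrm (Z j *v v j - u j)) ----> 0"
  using b unfolding acts_def by blast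
 have "(%j. nrm ((Y j + Z j) *v v j - (w j + u j))) ----> 0"
 proof (rule null_sandwich)
  fix j
  note Yj = mpm[OF Y(1), of j] and Zj = mpm[OF Z(1), of j]
  note vj = bvecD[OF acts_bvec(1)[OF a], of j] and wj = bvecD[OF acts_bvec(2)[OF a], of j] and uj = bvecD[OF acts_bvec(2)[OF b], of j]
  note Yv = mvc[OF Yj vj] and Zv = mvc[OF Zj vj]
  have aux: "(p + q) - (x + y) = (p - x) + (q - y)"
   if "p : cvec l" "q : cvec l" "x : cvec l" "y : cvec l"
   for p q x y :: "complex vec" and l
   using that by (intro eq_vecI) auto
  have "(Y j + Z j) *v v j - (w j + u j) = (Y j *v v j - w j) + (Z j *v v j - u j)"
   unfolding add_mult_distrib_mat_vec[OF Yj Zj vj] by (rule aux[OF Yv Zv wj uj])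
  thus "nrm ((Y j + Z j) *v v j - (w j + u j)) <= nrm (Y j *v v j - w j) + nrm (Z j *v v j - u j)"
   using l2norm_triangle[OF minus_carrier_vec[OF Yv wj] minus_carrier_vec[OF Zv uj]] by simp
  show "(%j. nrm (Y j *v v j - w j) + nrm (Z j *v v j - u j)) ----> 0"
   using tendsto_add[OF Y(3) Z(3)] by simp
 qed simp
 thus ?thesis unfolding Y(2) Z(2) corona_add[OF Y(1) Z(1)]
  by (rule actsI[OF mprod_add[OF Y(1) Z(1)] acts_bvec(1)[OF a] bvec_add[OF acts_bvec(2)[OF a] acts_bvec(2)[OF b]]])
qed

text \<open>Read backwards, the limits of the vector norms bound the norm of \<open>X\<close> from
  below. Injectivity of the glued homomorphism rests on this.\<close>

lemma acts_norm:
 assumes a: "acts M X v w" and v: "(%j. (nrm (v j))\<^sup>2) ----> al" and w: "(%j. (nrm (w j))\<^sup>2) ----> bt"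
  and r: "cnorm (cor M) X < r"
 shows "bt <= r\<^sup>2 * al"
proof -
 obtain Y where Y: "Y : mprod M" "X = cls M Y" "(%j. nrm (Y j *v v j - w j)) ----> 0"
  using a unfolding acts_def by blast
 have vl: "(%j. nrm (v j)) ----> sqrt al" and wl: "(%j. nrm (w j)) ----> sqrt bt"
  using tendsto_real_sqrt[OF v] tendsto_real_sqrt[OF w] by simp_all
 have ab: "0 <= al" "0 <= bt" using LIMSEQ_le_const[OF v] LIMSEQ_le_const[OF w] by auto
 have ev: "EV j. opn (Y j) < r" by (rule corona_norm_lessD[OF Y(1) r[unfolded Y(2)]])
 have "EV j. nrm (w j) <= r * nrm (v j) + nrm (Y j *v v j - w j)"
  using ev
 proof (rule eventually_mono)
  fix j assume j: "opn (Y j) < r"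
  note Yj = mpm[OF Y(1), of j] and vj = bvecD[OF acts_bvec(1)[OF a], of j] and wj = bvecD[OF acts_bvec(2)[OF a], of j]
  note Yv = mvc[OF Yj vj]
  have "nrm (w j) <= nrm (Y j *v v j) + nrm (Y j *v v j - w j)"
   using l2norm_diff_le[OF Yv wj] by linarith
  moreover have "nrm (Y j *v v j) <= opn (Y j) * nrm (v j)" by (rule opnorm_vec[OF Yj vj])
  moreover have "... <= r * nrm (v j)" using j by (intro mult_right_mono) auto
  ultimately show "nrm (w j) <= r * nrm (v j) + nrm (Y j *v v j - w j)" by linarith
 qed
 hence "sqrt bt <= r * sqrt al + 0"
  by (rule tendsto_le[OF sequentially_bot tendsto_add[OF tendsto_mult[OF tendsto_const vl] Y(3)] wl])
 hence "(sqrt bt)\<^sup>2 <= (r * sqrt al)\<^sup>2" using ab by (intro power_mono) auto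
 thus ?thesis using ab by (simp add: power_mult_distrib)
qed

section \<open>Off-diagonal block matrices\<close>

definition offdiag :: "complex mat => complex mat => complex mat" where
 "offdiag P R = four_block_mat (0\<^sub>m (dim_row P) (dim_col R)) P R (0\<^sub>m (dim_row R) (dim_col P))"

lemma offdiag_carrier [simp]:
 "P : cmat m l ==> R : cmat l m ==> offdiag P R : cmat (m + l) (m + l)"
 by (auto simp: offdiag_def)

lemma offdiag_eq:
 "P : cmat m l ==> R : cmat l m ==> offdiag P R = four_block_mat (0\<^sub>m m m) P R (0\<^sub>m l l)"
 by (auto simp: offdiag_def)

lemma offdiag_vec:
 assumes P: "P : cmat m l" and R: "R : cmat l m" and a: "a : cvec m" and b: "b : cvec l"
 shows "offdiag P R *v (a @\<^sub>v b) = (P *v b) @\<^sub>v (R *v a)"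
proof -
 have "0\<^sub>m m m *v a = 0\<^sub>v m" "0\<^sub>m l l *v b = 0\<^sub>v l" using a b by (auto intro!: eq_vecI)
 thus ?thesis
  unfolding offdiag_eq[OF P R] four_block_mat_mult_vec[OF zero_carrier_mat P R zero_carrier_mat a b]
  using P R a b by simp
qed

lemma offdiag_dsum:
 assumes P: "P : cmat m l" and R: "R : cmat l m" and X: "X : cmat m m" and Y: "Y : cmat l l"
 shows "offdiag P R * dsum X Y = offdiag (P * Y) (R * X)" "dsum X Y * offdiag P R = offdiag (X * P) (Y * R)"
proof -
 have "offdiag P R * dsum X Y = four_block_mat (0\<^sub>m m m * X + P * 0\<^sub>m l m) (0\<^sub>m m m * 0\<^sub>m m l + P * Y)
   (R * X + 0\<^sub>m l l * 0\<^sub>m l m) (R * 0\<^sub>m m l + 0\<^sub>m l l * Y)"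
  unfolding offdiag_eq[OF P R] dsum_eq[OF X Y] by (rule mult_four_block_mat) (use assms in auto)
 also have "... = four_block_mat (0\<^sub>m m m) (P * Y) (R * X) (0\<^sub>m l l)" using assms by simp
 also have "... = offdiag (P * Y) (R * X)" by (rule offdiag_eq[symmetric]) (use assms in auto)
 finally show "offdiag P R * dsum X Y = offdiag (P * Y) (R * X)" .
 have "dsum X Y * offdiag P R = four_block_mat (X * 0\<^sub>m m m + 0\<^sub>m m l * R) (X * P + 0\<^sub>m m l * 0\<^sub>m l l)
   (0\<^sub>m l m * 0\<^sub>m m m + Y * R) (0\<^sub>m l m * P + Y * 0\<^sub>m l l)"
  unfolding offdiag_eq[OF P R] dsum_eq[OF X Y] by (rule mult_four_block_mat) (use assms in auto)
 also have "... = four_block_mat (0\<^sub>m m m) (X * P) (Y * R) (0\<^sub>m l l)" using assms by simp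
 also have "... = offdiag (X * P) (Y * R)" by (rule offdiag_eq[symmetric]) (use assms in auto)
 finally show "dsum X Y * offdiag P R = offdiag (X * P) (Y * R)" .
qed

lemma offdiag_minus:
 assumes "P : cmat m l" "R : cmat l m" "P' : cmat m l" "R' : cmat l m"
 shows "offdiag P R - offdiag P' R' = offdiag (P - P') (R - R')"
 using assms by (intro eq_matI) (auto simp: offdiag_def)

lemma offdiag_adj:
 assumes "P : cmat m l" "R : cmat l m"
 shows "adj (offdiag P R) = offdiag (adj R) (adj P)"
 using assms by (intro eq_matI) (auto simp: offdiag_def adj_index)

lemma offdiag_uminus:
 assumes "P : cmat m l" "R : cmat l m"
 shows "offdiag ((-1) *m P) ((-1) *m R) = (-1) *m offdiag P R"
 using assms by (intro eq_matI) (auto simp: offdiag_def)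

lemma opnorm_offdiag:
 assumes P: "P : cmat m l" and R: "R : cmat l m" and r: "opn P <= r" "opn R <= r"
 shows "opn (offdiag P R) <= r"
proof (rule opnorm_le)
 show r0: "0 <= r" using r(1) order_trans[OF opnorm_nonneg] by blast
 fix v :: "complex vec" assume "v : cvec (dim_col (offdiag P R))"
 hence "v : cvec (m + l)" using offdiag_carrier[OF P R] by auto
 then obtain a b where ab: "a : cvec m" "b : cvec l" "v = a @\<^sub>v b" by (rule vec_split)
 have b: "nrm (P *v b) <= r * nrm b"
  using opnorm_vec[OF P ab(2)] mult_right_mono[OF r(1) l2norm_nonneg[of b]] by linarith
 have a: "nrm (R *v a) <= r * nrm a"
  using opnorm_vec[OF R ab(1)] mult_right_mono[OF r(2) l2norm_nonneg[of a]] by linarith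
 have "(nrm (offdiag P R *v v))\<^sup>2 = (nrm (P *v b))\<^sup>2 + (nrm (R *v a))\<^sup>2"
  unfolding ab(3) offdiag_vec[OF P R ab(1,2)] by (rule l2norm_append)
 also have "... <= (r * nrm b)\<^sup>2 + (r * nrm a)\<^sup>2"
  by (intro add_mono power_mono a b) auto
 also have "... = (r * nrm v)\<^sup>2"
  unfolding ab(3) power_mult_distrib l2norm_append by (simp add: algebra_simps)
 finally show "nrm (offdiag P R *v v) <= r * nrm v"
  by (rule power2_le_imp_le) (use r0 in simp)
qed

section \<open>Separable subalgebras and change of the carrier type\<close>

definition norm_closure :: "'a cstar => 'a set => 'a set" where
 "norm_closure A K = {x : carrier A. ALL e>0. EX k:K. cnorm A (x -[A] k) < e}"

context cstar_algebra
begin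

lemma norm_closure_superset: "K \<subseteq> carrier A ==> K \<subseteq> norm_closure A K"
 unfolding norm_closure_def
proof safe
 fix x e :: 'a and r :: real assume "K \<subseteq> carrier A" "x : K" "r > 0"
 thus "EX k:K. cnorm A (x -. k) < r" by (intro bexI[of _ x]) auto
qed auto

lemma norm_closure_idem:
 assumes K: "K \<subseteq> carrier A" and x: "x : carrier A" and y: "!!e. e > 0 ==> EX y:norm_closure A K. cnorm A (x -. y) < e"
 shows "x : norm_closure A K"
 unfolding norm_closure_def
proof (intro CollectI conjI x allI impI)
 fix e :: real assume "e > 0"
 hence e2: "e / 2 > 0" by simp
 obtain y where y: "y : carrier A" "ALL e>0. EX k:K. cnorm A (y -. k) < e" "cnorm A (x -. y) < e / 2"
  using y[OF e2] by (auto simp: norm_closure_def)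
 obtain k where k: "k : K" "cnorm A (y -. k) < e / 2" using y(2) e2 by blast
 have "cnorm A (x -. k) <= cnorm A (x -. y) + cnorm A (y -. k)" by (rule nm_triangle3) (use x y k K in auto)
 thus "EX k:K. cnorm A (x -. k) < e" using y(3) k by (intro bexI[of _ k]) auto
qed

lemma norm_closure_add:
 assumes K: "K \<subseteq> carrier A" "!!x y. x : K ==> y : K ==> x +. y : K"
  and x: "x : norm_closure A K" and y: "y : norm_closure A K"
 shows "x +. y : norm_closure A K"
 unfolding norm_closure_def
proof (intro CollectI conjI allI impI)
 show "x +. y : carrier A" using x y by (simp add: norm_closure_def)
 fix e :: real assume "e > 0"
 hence e2: "e / 2 > 0" by simp
 obtain k where k: "k : K" "cnorm A (x -. k) < e / 2" using x e2 unfolding norm_closure_def by blast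
 obtain l where l: "l : K" "cnorm A (y -. l) < e / 2" using y e2 unfolding norm_closure_def by blast
 have c: "x : carrier A" "y : carrier A" "k : carrier A" "l : carrier A" using x y k l K(1) by (auto simp: norm_closure_def)
 have "cnorm A ((x +. y) -. (k +. l)) <= cnorm A (x -. k) + cnorm A (y -. l)"
  using c cnorm_triangle[of "x -. k" "y -. l"] by (simp add: add_diff_add)
 thus "EX m:K. cnorm A (x +. y -. m) < e" using k l K(2) by (intro bexI[of _ "k +. l"]) auto
qed

lemma norm_closure_mult:
 assumes K: "K \<subseteq> carrier A" "!!x y. x : K ==> y : K ==> x ** y : K"
  and x: "x : norm_closure A K" and y: "y : norm_closure A K"
 shows "x ** y : norm_closure A K"
 unfolding norm_closure_def
proof (intro CollectI conjI allI impI)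
 have c: "x : carrier A" "y : carrier A" using x y by (auto simp: norm_closure_def)
 show "x ** y : carrier A" using c by (rule mult_closed)
 fix e :: real assume e: "e > 0"
 define a where "a = min 1 (e / (2 * (cnorm A y + 1)))"
 define b where "b = e / (2 * (cnorm A x + 1))"
 have n: "0 <= cnorm A x" "0 <= cnorm A y" using c by auto
 have ab: "a > 0" "a <= 1" "b > 0" "a * (cnorm A y + 1) <= e / 2" "(cnorm A x + 1) * b = e / 2"
 proof -
  show "a > 0" "a <= 1" "b > 0" using n e by (auto simp: a_def b_def)
  have "a * (cnorm A y + 1) <= e / (2 * (cnorm A y + 1)) * (cnorm A y + 1)"
   by (rule mult_right_mono) (use n in \<open>auto simp: a_def\<close>)
  also have "... = e / 2"
  proof -
   have "cnorm A y + 1 ~= 0" using n by linarith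
   thus ?thesis by (simp add: field_simps)
  qed
  finally show "a * (cnorm A y + 1) <= e / 2" .
  have "cnorm A x + 1 ~= 0" using n by linarith
  thus "(cnorm A x + 1) * b = e / 2" by (simp add: b_def field_simps)
 qed
 obtain k where k: "k : K" "cnorm A (x -. k) < a" using x ab(1) unfolding norm_closure_def by blast
 obtain l where l: "l : K" "cnorm A (y -. l) < b" using y ab(3) unfolding norm_closure_def by blast
 have kl: "k : carrier A" "l : carrier A" using k l K(1) by auto
 have nk: "cnorm A k <= cnorm A x + 1"
  using nm_le_diff[OF kl(1) c(1)] nm_diff_commute[OF kl(1) c(1)] k(2) ab(2) by linarith
 have "(x ** y) -. (k ** l) = ((x -. k) ** y) +. (k ** (y -. l))"
  using c kl by (simp add: mult_diff_left mult_diff_right diff_diff_add)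
 hence "cnorm A ((x ** y) -. (k ** l)) <= cnorm A ((x -. k) ** y) + cnorm A (k ** (y -. l))"
  using c kl cnorm_triangle[of "(x -. k) ** y" "k ** (y -. l)"] by simp
 also have "... <= cnorm A (x -. k) * cnorm A y + cnorm A k * cnorm A (y -. l)"
  by (intro add_mono cnorm_mult) (use c kl in auto)
 also have "... <= a * cnorm A y + (cnorm A x + 1) * cnorm A (y -. l)"
  by (intro add_mono mult_right_mono nk) (use k c kl in auto)
 also have "... < a * (cnorm A y + 1) + (cnorm A x + 1) * b"
  using ab(1) l(2) n by (intro add_strict_mono mult_strict_left_mono) auto
 also have "... <= e" using ab(4,5) by linarith
 finally show "EX m:K. cnorm A (x ** y -. m) < e" using k l K(2) by (intro bexI[of _ "k ** l"]) auto
qed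

end

section \<open>Countably many words in dense sequences of \<open>A\<close> and \<open>B\<close>, and
  their closure\<close>

datatype gexpr = GA nat | GB nat | GAdd gexpr gexpr | GMul gexpr gexpr

instance gexpr :: countable by countable_datatype

primrec geval :: "'a cstar => (nat => 'a) => (nat => 'a) => gexpr => 'a" where
 "geval A a b (GA i) = a i"
| "geval A a b (GB i) = b i"
| "geval A a b (GAdd x y) = geval A a b x +[A] geval A a b y"
| "geval A a b (GMul x y) = geval A a b x *[A] geval A a b y"

definition dense_seq :: "'a cstar => (nat => 'a) => bool" where
 "dense_seq A a \<longleftrightarrow> (ALL i. a i : carrier A) & (ALL x:carrier A. ALL e>0. EX i. cnorm A (x -[A] a i) < e)"

lemma (in cstar_algebra) separable_dense_seq:
 assumes "separable_cstar A"
 obtains a where "dense_seq A a"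
proof -
 obtain S where S: "countable S" "S \<subseteq> carrier A" "!!x e. x : carrier A ==> e > 0 ==> EX s:S. cdist A x s < e"
  using assms unfolding separable_cstar_def by blast
 have "S ~= {}" using S(3)[of \<zero> 1] by auto
 then obtain a :: "nat => 'a" where a: "range a = S" using range_from_nat_into[OF _ S(1)] by blast
 have "dense_seq A a"
  unfolding dense_seq_def
 proof (intro conjI allI ballI impI)
  show "a i : carrier A" for i using a S(2) by auto
  fix x e assume "x : carrier A" "(e::real) > 0"
  then obtain s where "s : S" "cdist A x s < e" using S(3) by blast
  thus "EX i. cnorm A (x -. a i) < e" using a unfolding cdist_def by auto
 qed
 thus ?thesis by (rule that)
qed

locale word_gen = hA: unital_hom A G hA + hB: unital_hom B G hB
 for A :: "'a cstar" and B :: "'b cstar" and G :: "'g cstar" and hA hB +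
 fixes a b
 assumes a: "dense_seq A a" and b: "dense_seq B b"
begin

text \<open>Scalars and adjoints are not built into the words; in the norm closure they are
  recovered from the density of the two sequences.\<close>

definition words :: "'g set" where
 "words = range (geval G (%i. hA (a i)) (%i. hB (b i)))"

lemma ab_closed: "a i : carrier A" "b i : carrier B"
 using a b by (auto simp: dense_seq_def)

lemma geval_closed: "geval G (%i. hA (a i)) (%i. hB (b i)) x : carrier G"
 by (induction x) (auto simp: ab_closed)

lemma words_carrier: "words \<subseteq> carrier G"
 using geval_closed by (auto simp: words_def)

lemma words_add:
 assumes "x : words" "y : words"
 shows "x +[G] y : words"
proof -
 obtain u v where "x = geval G (%i. hA (a i)) (%i. hB (b i)) u" "y = geval G (%i. hA (a i)) (%i. hB (b i)) v"
  using assms unfolding words_def by blast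
 hence "x +[G] y = geval G (%i. hA (a i)) (%i. hB (b i)) (GAdd u v)" by simp
 thus ?thesis unfolding words_def by (rule range_eqI)
qed

lemma words_mult:
 assumes "x : words" "y : words"
 shows "x *[G] y : words"
proof -
 obtain u v where "x = geval G (%i. hA (a i)) (%i. hB (b i)) u" "y = geval G (%i. hA (a i)) (%i. hB (b i)) v"
  using assms unfolding words_def by blast
 hence "x *[G] y = geval G (%i. hA (a i)) (%i. hB (b i)) (GMul u v)" by simp
 thus ?thesis unfolding words_def by (rule range_eqI)
qed

lemma words_A: "hA (a i) : words"
 unfolding words_def by (rule range_eqI[of _ _ "GA i"]) simp

lemma words_B: "hB (b i) : words"
 unfolding words_def by (rule range_eqI[of _ _ "GB i"]) simp

lemma words_countable: "countable words"
 by (simp add: words_def)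

definition W :: "'g set" where "W = norm_closure G words"

lemma W_closed: "x : W ==> x : carrier G"
 by (simp add: W_def norm_closure_def)

lemma words_W: "x : words ==> x : W"
 unfolding W_def using hA.B.norm_closure_superset[OF words_carrier] by blast

lemma W_idem: "x : carrier G ==> (!!e. e > 0 ==> EX y:W. cnorm G (x -[G] y) < e) ==> x : W"
 unfolding W_def by (rule hA.B.norm_closure_idem[OF words_carrier])

lemma W_add: "x : W ==> y : W ==> x +[G] y : W"
 unfolding W_def by (rule hA.B.norm_closure_add[OF words_carrier words_add])

lemma W_mult: "x : W ==> y : W ==> x *[G] y : W"
 unfolding W_def by (rule hA.B.norm_closure_mult[OF words_carrier words_mult])

lemma A_in_W: assumes x: "x : carrier A" shows "hA x : W"
proof (rule W_idem)
 fix e :: real assume "e > 0"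
 then obtain i where i: "cnorm A (x -[A] a i) < e" using a x unfolding dense_seq_def by blast
 have "cnorm G (hA x -[G] hA (a i)) <= cnorm A (x -[A] a i)"
  using hA.hom_contractive[of "x -[A] a i"] x ab_closed by (simp add: hA.hom_diff)
 thus "EX y:W. cnorm G (hA x -[G] y) < e" using i words_W[OF words_A] by (intro bexI[of _ "hA (a i)"]) auto
qed (use x in simp)

lemma B_in_W: assumes x: "x : carrier B" shows "hB x : W"
proof (rule W_idem)
 fix e :: real assume "e > 0"
 then obtain i where i: "cnorm B (x -[B] b i) < e" using b x unfolding dense_seq_def by blast
 have "cnorm G (hB x -[G] hB (b i)) <= cnorm B (x -[B] b i)"
  using hB.hom_contractive[of "x -[B] b i"] x ab_closed by (simp add: hB.hom_diff)
 thus "EX y:W. cnorm G (hB x -[G] y) < e" using i words_W[OF words_B] by (intro bexI[of _ "hB (b i)"]) auto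
qed (use x in simp)

text \<open>A scalar multiple is the product with the image of a multiple of the unit of
  \<open>A\<close>, which lies in the closure.\<close>

lemma W_smult: assumes x: "x : W" shows "c .[G] x : W"
proof -
 have "hA (c .[A] 1[A]) *[G] x : W" by (intro W_mult A_in_W x) simp
 thus ?thesis using W_closed[OF x] by (simp add: hA.hom_simps(3) hA.B.smult_mult_left)
qed

lemma W_star: assumes x: "x : W" shows "star G x : W"
proof (rule W_idem)
 have w: "star G (geval G (%i. hA (a i)) (%i. hB (b i)) y) : W" for y
 proof (induction y)
  case (GA i) show ?case using A_in_W[of "star A (a i)"] ab_closed by (simp add: hA.hom_simps(5))
 next
  case (GB i) show ?case using B_in_W[of "star B (b i)"] ab_closed by (simp add: hB.hom_simps(5))
 next
  case (GAdd y z) thus ?case using W_add geval_closed by (simp add: hA.B.star_add)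
 next
  case (GMul y z) thus ?case using W_mult geval_closed by (simp add: hA.B.star_mult)
 qed
 fix e :: real assume "e > 0"
 then obtain y where y: "y : words" "cnorm G (x -[G] y) < e" using x unfolding W_def norm_closure_def by blast
 have yc: "y : carrier G" using y(1) words_carrier by blast
 have "star G x -[G] star G y = star G (x -[G] y)" using W_closed[OF x] yc by (simp add: hA.B.star_diff)
 hence "cnorm G (star G x -[G] star G y) < e" using y(2) W_closed[OF x] yc by simp
 moreover have "star G y : W" using y(1) w unfolding words_def by blast
 ultimately show "EX y:W. cnorm G (star G x -[G] y) < e" by blast
qed (use W_closed[OF x] in simp)

lemma W_subalgebra: "cstar_subalgebra W G"
 unfolding cstar_subalgebra_def
proof (intro conjI ballI allI impI)
 show "Module.submodule W (class_ring :: complex ring) G"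
 proof (rule hA.B.submoduleI)
  show "W \<subseteq> carrier G" using W_closed by blast
  show "0[G] : W" using A_in_W[of "0[A]"] by simp
  show "\<ominus>\<^bsub>G\<^esub> x : W" if "x : W" for x using W_smult[OF that, of "-1"] W_closed[OF that] by (simp add: hA.B.sm_minus_one)
 qed (auto intro: W_add W_smult)
 fix X :: "nat => 'g" and x assume x: "x : carrier G" and X: "ALL m. X m : W" and l: "ctendsto G X x"
 show "x : W"
 proof (rule W_idem[OF x])
  fix e :: real assume e: "e > 0"
  obtain m where "cnorm G (X m -[G] x) < e"
   using order_tendstoD(2)[OF l[unfolded ctendsto_def cdist_def] e] by (auto simp: eventually_sequentially)
  thus "EX y:W. cnorm G (x -[G] y) < e"
   using X hA.B.nm_diff_commute[OF x, of "X m"] W_closed[of "X m"] by (intro bexI[of _ "X m"]) auto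
 qed
qed (auto intro: W_mult W_star)

end

text \<open>All operations are carried over along an injection \<open>ph\<close> of the subalgebra
  alone, so a type that is too small for \<open>G\<close> can still hold the copy.\<close>

lemma transport_subalgebra:
 fixes G :: "'g cstar" and ph :: "'g => 'e"
 assumes G: "cstar_algebra G" and W: "cstar_subalgebra W G" and inj: "inj_on ph W"
 obtains E :: "'e cstar" where "cstar_algebra E" "star_hom E G (inv_into W ph)"
  "star_hom (G\<lparr>carrier := W\<rparr>) E ph"
proof -
 interpret G: cstar_algebra G by (rule G)
 have sub: "Module.submodule W (class_ring :: complex ring) G" using W by (simp add: cstar_subalgebra_def)
 note sE = G.submoduleE[OF sub]
 have Wc [simp]: "x : W ==> x : carrier G" for x using sE(1) by blast
 have Wadd [simp]: "x : W ==> y : W ==> x +[G] y : W" for x y using sE(5) by blast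
 have Wsm [simp]: "x : W ==> c .[G] x : W" for x c using sE(4)[of c x] by simp
 have Wmul [simp]: "x : W ==> y : W ==> x *[G] y : W" for x y using W by (simp add: cstar_subalgebra_def)
 have Wst [simp]: "x : W ==> star G x : W" for x using W by (simp add: cstar_subalgebra_def)
 have Wz [simp]: "0[G] : W"
 proof -
  obtain x where "x : W" using sE(2) by blast
  thus ?thesis using Wsm[of x 0] by simp
 qed
 have closed: "x : W" if "x : carrier G" "!!m. X m : W" "ctendsto G X x" for X x
 proof -
  have "ALL X. ALL x:carrier G. (ALL m. X m : W) --> ctendsto G X x --> x : W"
   using W unfolding cstar_subalgebra_def by (elim conjE)
  from this[rule_format, OF that] show ?thesis .
 qed
 define ps where "ps = inv_into W ph"
 have psi [simp]: "ps (ph x) = x" if "x : W" for x using inj that by (simp add: ps_def)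
 \<comment> \<open>The field \<open>one\<close> is filled arbitrarily, as the subalgebra may lack a
   unit and the copy is only claimed to be a \<open>cstar_algebra\<close>.\<close>
 define E :: "'e cstar" where "E = \<lparr>carrier = ph ` W, monoid.mult = (%x y. ph (ps x *[G] ps y)), one = ph 0[G],
  zero = ph 0[G], add = (%x y. ph (ps x +[G] ps y)), module.smult = (%c x. ph (c .[G] ps x)),
  star = (%x. ph (star G (ps x))), cnorm = (%x. cnorm G (ps x))\<rparr>"
 have Es [simp]: "carrier E = ph ` W" "monoid.mult E = (%x y. ph (ps x *[G] ps y))" "zero E = ph 0[G]"
  "add E = (%x y. ph (ps x +[G] ps y))" "module.smult E = (%c x. ph (c .[G] ps x))"
  "star E = (%x. ph (star G (ps x)))" "cnorm E = (%x. cnorm G (ps x))"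
  by (simp_all add: E_def)
 have ag: "abelian_group E"
 proof (rule abelian_groupI)
  fix x assume "x : carrier E"
  then obtain w where w: "w : W" "x = ph w" by auto
  have "\<ominus>\<^bsub>G\<^esub> w : W" using Wsm[OF w(1), of "-1"] w(1) by (simp add: G.sm_minus_one)
  thus "EX y:carrier E. y +[E] x = 0[E]" using w by (intro bexI[of _ "ph (\<ominus>\<^bsub>G\<^esub> w)"]) (auto simp: G.M.l_neg)
 qed (auto simp: G.M.a_ac)
 have cr: "cring (class_ring :: complex ring)" ..
 have md: "Module.module (class_ring :: complex ring) E"
  by (rule moduleI[OF cr ag])
   (auto simp: G.sm_add_left G.sm_add_right G.sm_assoc)
 interpret E: abelian_group E by (rule ag)
 have minus: "ph x -[E] ph y = ph (x -[G] y)" if "x : W" "y : W" for x y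
 proof -
  have my: "\<ominus>\<^bsub>G\<^esub> y : W" using Wsm[OF that(2), of "-1"] that(2) by (simp add: G.sm_minus_one)
  have "\<ominus>\<^bsub>E\<^esub> ph y = ph (\<ominus>\<^bsub>G\<^esub> y)"
   by (rule E.minus_equality) (use my that in \<open>auto simp: G.M.l_neg\<close>)
  thus ?thesis using that my by (simp add: a_minus_def)
 qed
 have Wm: "x -[G] y : W" if "x : W" "y : W" for x y
  using Wadd[OF that(1) Wsm[OF that(2), of "-1"]] that by (simp add: a_minus_def G.sm_minus_one)
 have dist: "cdist E (ph x) (ph y) = cdist G x y" if "x : W" "y : W" for x y
  using that by (simp add: cdist_def minus Wm)
 have carE: thesis if "x : carrier E" "!!w. w : W ==> x = ph w ==> thesis" for x thesis
  using that by auto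
 note imageI [simp]
 have ax: "cstar_algebra_axioms E"
 proof (rule cstar_algebra_axioms.intro, goal_cases)
  case (12 x)
  then obtain w where w: "w : W" "x = ph w" by auto
  thus ?case using 12 G.cnorm_eq_zero[of w] by simp
 next
  case (17 X)
  have "ALL m. EX w. w : W & X m = ph w" using 17(1) by auto
  then obtain Y where Y: "!!m. Y m : W" "!!m. X m = ph (Y m)" by metis
  have "cCauchy G Y" using 17(2) unfolding cCauchy_def Y(2) dist[OF Y(1) Y(1)] .
  then obtain y where y: "y : carrier G" "ctendsto G Y y" using G.complete[of Y] Y(1) by auto
  have yW: "y : W" by (rule closed[OF y(1) Y(1) y(2)])
  have "ctendsto E X (ph y)" using y(2) unfolding ctendsto_def Y(2) dist[OF Y(1) yW] .
  thus ?case using yW by auto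
 next
  case (1 x y)
  then obtain u v where e: "u : W" "x = ph u" "v : W" "y = ph v" by (elim carE) blast
  show ?case using e(1,3) unfolding e(2,4) Es by (simp)
 next
  case (2 x y z)
  then obtain u v w where e: "u : W" "x = ph u" "v : W" "y = ph v" "w : W" "z = ph w" by (elim carE) blast
  show ?case using e(1,3,5) unfolding e(2,4,6) Es by (simp add: G.mult_assoc)
 next
  case (3 x y z)
  then obtain u v w where e: "u : W" "x = ph u" "v : W" "y = ph v" "w : W" "z = ph w" by (elim carE) blast
  show ?case using e(1,3,5) unfolding e(2,4,6) Es by (simp add: G.mult_add_left)
 next
  case (4 x y z)
  then obtain u v w where e: "u : W" "x = ph u" "v : W" "y = ph v" "w : W" "z = ph w" by (elim carE) blast
  show ?case using e(1,3,5) unfolding e(2,4,6) Es by (simp add: G.mult_add_right)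
 next
  case (5 x y c)
  then obtain u v where e: "u : W" "x = ph u" "v : W" "y = ph v" by (elim carE) blast
  show ?case using e(1,3) unfolding e(2,4) Es by (simp add: G.smult_mult_left)
 next
  case (6 x y c)
  then obtain u v where e: "u : W" "x = ph u" "v : W" "y = ph v" by (elim carE) blast
  show ?case using e(1,3) unfolding e(2,4) Es by (simp add: G.smult_mult_right)
 next
  case (7 x)
  then obtain u where e: "u : W" "x = ph u" by (elim carE) blast
  show ?case using e(1) unfolding e(2) Es by (simp)
 next
  case (8 x)
  then obtain u where e: "u : W" "x = ph u" by (elim carE) blast
  show ?case using e(1) unfolding e(2) Es by (simp)
 next
  case (9 x y)
  then obtain u v where e: "u : W" "x = ph u" "v : W" "y = ph v" by (elim carE) blast
  show ?case using e(1,3) unfolding e(2,4) Es by (simp add: G.star_add)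
 next
  case (10 x c)
  then obtain u where e: "u : W" "x = ph u" by (elim carE) blast
  show ?case using e(1) unfolding e(2) Es by (simp add: G.star_smult)
 next
  case (11 x y)
  then obtain u v where e: "u : W" "x = ph u" "v : W" "y = ph v" by (elim carE) blast
  show ?case using e(1,3) unfolding e(2,4) Es by (simp add: G.star_mult)
 next
  case (13 x y)
  then obtain u v where e: "u : W" "x = ph u" "v : W" "y = ph v" by (elim carE) blast
  show ?case using e(1,3) unfolding e(2,4) Es by (simp add: G.cnorm_triangle)
 next
  case (14 x c)
  then obtain u where e: "u : W" "x = ph u" by (elim carE) blast
  show ?case using e(1) unfolding e(2) Es by (simp add: G.cnorm_smult)
 next
  case (15 x y)
  then obtain u v where e: "u : W" "x = ph u" "v : W" "y = ph v" by (elim carE) blast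
  show ?case using e(1,3) unfolding e(2,4) Es by (simp add: G.cnorm_mult)
 next
  case (16 x)
  then obtain u where e: "u : W" "x = ph u" by (elim carE) blast
  show ?case using e(1) unfolding e(2) Es by (simp add: G.cnorm_cstar)
 qed
 show ?thesis
 proof (rule that)
  show "cstar_algebra E" by (rule cstar_algebra.intro[OF md ax])
  show "star_hom E G (inv_into W ph)" unfolding star_hom_def ps_def[symmetric] by auto
  show "star_hom (G\<lparr>carrier := W\<rparr>) E ph" unfolding star_hom_def by auto
 qed
qed

lemma (in cstar_algebra) subalgebra_lin_subspace: "cstar_subalgebra F A ==> lin_subspace A F"
proof -
 assume F: "cstar_subalgebra F A"
 hence sub: "Module.submodule F (class_ring :: complex ring) A" by (simp add: cstar_subalgebra_def)
 note sE = submoduleE[OF sub]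
 obtain x where "x : F" using sE(2) by blast
 hence "\<zero> : F" using sE(4)[of 0 x] sE(1) by auto
 thus ?thesis unfolding lin_subspace_def using sE(1,4,5) by auto
qed

section \<open>Adjoining the unit to the subalgebras of an AF filtration\<close>

context unital_cstar_algebra
begin

text \<open>The members of an AF filtration need not contain the unit, but
  \<open>invariant_hull\<close> relies on it to keep the given vectors inside the hull. Adding
  scalars preserves the algebra structure and finite spanning sets.\<close>

definition unitization :: "'a set => 'a set" where
 "unitization F = {d +. c *. \<one> | d c. d : F}"

lemma unitizationI: "d : F ==> d +. c *. \<one> : unitization F"
 by (auto simp: unitization_def)

lemma unitizationE:
 assumes "x : unitization F"
 obtains d c where "d : F" "x = d +. c *. \<one>"
 using assms by (auto simp: unitization_def)

lemma unitization_props: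
 assumes F: "cstar_subalgebra F A"
 shows "lin_subspace A (unitization F)" "\<one> : unitization F" "F \<subseteq> unitization F"
  "!!x y. x : unitization F ==> y : unitization F ==> x ** y : unitization F"
  "!!x. x : unitization F ==> star A x : unitization F"
proof -
 note Fs = subalgebra_lin_subspace[OF F]
 note FD = lin_subspaceD[OF Fs]
 have Fm: "x ** y : F" if "x : F" "y : F" for x y using F that by (simp add: cstar_subalgebra_def)
 have Fst: "star A x : F" if "x : F" for x using F that by (simp add: cstar_subalgebra_def)
 have sub: "F \<subseteq> unitization F"
 proof
  fix x assume x: "x : F"
  thus "x : unitization F" using unitizationI[OF x, of 0] FD(5)[OF x] by simp
 qed
 show "F \<subseteq> unitization F" by (rule sub)
 show "\<one> : unitization F" using unitizationI[OF FD(2), of 1] by simp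
 show "lin_subspace A (unitization F)"
  unfolding lin_subspace_def
 proof (intro conjI ballI allI)
  show "unitization F \<subseteq> carrier A" using FD(5) by (auto simp: unitization_def)
  show "\<zero> : unitization F" using FD(2) sub by blast
  fix x assume "x : unitization F"
  then obtain d c where x: "d : F" "x = d +. c *. \<one>" by (rule unitizationE)
  have "k *. x = k *. d +. (k * c) *. \<one>" for k using FD(5)[OF x(1)] x(2) by (simp add: sm_add_right sm_assoc)
  thus "k *. x : unitization F" for k using unitizationI[OF FD(4)[OF x(1)]] by simp
  fix y assume "y : unitization F"
  then obtain d' c' where y: "d' : F" "y = d' +. c' *. \<one>" by (rule unitizationE)
  have "x +. y = (d +. d') +. (c + c') *. \<one>"
   using FD(5)[OF x(1)] FD(5)[OF y(1)] x(2) y(2) by (simp add: sm_add_left M.a_ac)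
  thus "x +. y : unitization F" using unitizationI[OF FD(3)[OF x(1) y(1)]] by simp
 qed
 show "x ** y : unitization F" if xy: "x : unitization F" "y : unitization F" for x y
 proof -
  obtain d c where x: "d : F" "x = d +. c *. \<one>" using xy(1) by (rule unitizationE)
  obtain d' c' where y: "d' : F" "y = d' +. c' *. \<one>" using xy(2) by (rule unitizationE)
  note dc = FD(5)[OF x(1)] FD(5)[OF y(1)]
  have "x ** y = (d ** d' +. (c' *. d +. c *. d')) +. (c * c') *. \<one>"
   using dc x(2) y(2) by (simp add: mult_add_left mult_add_right smult_mult_left smult_mult_right sm_assoc M.a_ac sm_add_right mult.commute)
  thus ?thesis using unitizationI[OF FD(3)[OF Fm[OF x(1) y(1)] FD(3)[OF FD(4)[OF x(1)] FD(4)[OF y(1)]]]] by simp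
 qed
 show "star A x : unitization F" if xx: "x : unitization F" for x
 proof -
  obtain d c where x: "d : F" "x = d +. c *. \<one>" using xx by (rule unitizationE)
  have "star A x = star A d +. cnj c *. \<one>" using FD(5)[OF x(1)] x(2) by (simp add: star_add star_smult)
  thus ?thesis using unitizationI[OF Fst[OF x(1)]] by simp
 qed
qed

lemma unitization_spans:
 assumes F: "cstar_subalgebra F A" and S: "S \<subseteq> F" "spans A S F"
 shows "insert \<one> S \<subseteq> unitization F" "spans A (insert \<one> S) (unitization F)"
proof -
 show "insert \<one> S \<subseteq> unitization F" using unitization_props(2,3)[OF F] S(1) by blast
 show "spans A (insert \<one> S) (unitization F)"
  unfolding spans_def
 proof (intro allI impI subsetI)
  fix W x assume W: "lin_subspace A W" "insert \<one> S \<subseteq> W" and x: "x : unitization F"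
  obtain d c where d: "d : F" "x = d +. c *. \<one>" using x by (rule unitizationE)
  have "d : W" by (rule spansD[OF S(2) W(1) _ d(1)]) (use W(2) in blast)
  thus "x : W" using d(2) W lin_subspaceD(3,4)[OF W(1)] by simp
 qed
qed

end

text \<open>The closed linear span of \<open>S\<close> is the whole algebra. In this form a closed
  linear condition can be checked on \<open>S\<close> alone.\<close>

definition approximable :: "'a cstar => 'a set => bool" where
 "approximable A S \<longleftrightarrow> (ALL W. lin_subspace A W --> S \<subseteq> W -->
  (ALL x:carrier A. (ALL e>0. EX y:W. cnorm A (x -[A] y) < e) --> x : W) --> W = carrier A)"

section \<open>Sequences of models along the AF filtration\<close>

context glue
begin

text \<open>Stage \<open>j\<close> uses the first \<open>j\<close> data, representations that see
  coordinates from \<open>j\<close> on, the spanning sets of the filtration up to \<open>j\<close>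
  and error \<open>1 / (j + 1)\<close>. Any fixed datum is covered by all late stages, which turns
  the finite estimates into limits.\<close>

lemma glue_sequences:
 assumes AF: "AF_algebra D" and la: "!!i::nat. A.lift (ya i) (aa i)" and lb: "!!i::nat. B.lift (yb i) (bb i)"
  and xs: "!!i::nat. xs i : carrier C"
 shows "EX m F m' G t xj zt S. (ALL j. rep n j (m j) (F j) & rep n j (m' j) (G j) & t j : cmat (m' j) (m j) & opn (t j) <= 1) &
  (ALL j x. xj j x : cvec (m j) & zt j x : cvec (m' j)) &
  (ALL x:range xs. ALL x':range xs. (%j. xj j x *c xj j x') ----> f (star C x' *[C] x) &
    (%j. zt j x *c zt j x') ----> f (star C x' *[C] x)) &
  (ALL i. ALL x:range xs. sA (aa i) *[C] x : range xs -->
    (%j. nrm (F j (ya i) *v xj j x - xj j (sA (aa i) *[C] x))) ----> 0) &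
  (ALL i. ALL x:range xs. sB (bb i) *[C] x : range xs -->
    (%j. nrm (G j (yb i) *v zt j x - zt j (sB (bb i) *[C] x))) ----> 0) &
  (ALL x:range xs. (%j. nrm (t j *v xj j x - zt j x)) ----> 0) &
  S \<subseteq> carrier D & approximable D S &
  (ALL d:S. EX y. lift_both y d & (%j. opn (t j * F j y - G j y * t j)) ----> 0 &
   (%j. opn (t j * F j (%k. adj (y k)) - G j (%k. adj (y k)) * t j)) ----> 0)"
proof -
 obtain Fd :: "nat => 'd set" where Fd: "incseq Fd" "!!k. cstar_subalgebra (Fd k) D"
  "!!k. vectorspace.fin_dim (class_ring :: complex ring) (D\<lparr>carrier := Fd k\<rparr>)"
  "!!x e. x : carrier D ==> e > 0 ==> EX y:(UN k. Fd k). cdist D x y < e"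
  using AF unfolding AF_algebra_def by blast
 have "EX S. finite S & S \<subseteq> Fd k & spans D S (Fd k)" for k
  by (rule fin_dim_spans[OF D.cstar_algebra_axioms Fd(2,3)]) blast
 then obtain Sk where Sk: "!!k. finite (Sk k)" "!!k. Sk k \<subseteq> Fd k" "!!k. spans D (Sk k) (Fd k)" by metis
 define E where "E k = D.unitization (Fd k)" for k
 note E = D.unitization_props[OF Fd(2), folded E_def] and ES = D.unitization_spans[OF Fd(2) Sk(2,3), folded E_def]
 have FdD: "Fd k \<subseteq> carrier D" for k using lin_subspaceD(1)[OF D.subalgebra_lin_subspace[OF Fd(2)]] .
 define S where "S = (UN k. Sk k)"
 have SD: "S \<subseteq> carrier D" unfolding S_def using Sk(2) FdD by blast
 have app: "approximable D S"
  unfolding approximable_def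
 proof (intro allI impI)
  fix W assume W: "lin_subspace D W" "S \<subseteq> W"
   and cl: "ALL x:carrier D. (ALL e>0. EX y:W. cnorm D (x -[D] y) < e) --> x : W"
  have FW: "Fd k \<subseteq> W" for k
  proof
   fix x assume x: "x : Fd k"
   show "x : W" by (rule spansD[OF Sk(3) W(1) _ x]) (use W(2) in \<open>auto simp: S_def\<close>)
  qed
  have "x : W" if x: "x : carrier D" for x
  proof -
   have "EX y:W. cnorm D (x -[D] y) < e" if e: "e > 0" for e
   proof -
    obtain y where "y : (UN k. Fd k)" "cdist D x y < e" using Fd(4)[OF x e] by blast
    thus ?thesis using FW unfolding cdist_def by blast
   qed
   thus ?thesis using cl x by simp
  qed
  thus "W = carrier D" using lin_subspaceD(1)[OF W(1)] by blast
 qed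
 define yl where "yl d = (SOME y. lift_both y d)" for d
 have yl: "lift_both (yl d) d" if "d : carrier D" for d
  unfolding yl_def using someI_ex[OF ex_lift_both[OF that]] .
 define PD where "PD j = (UN k<=j. (%d. (yl d, d)) ` Sk k \<union> (%d. (%k. adj (yl d k), star D d)) ` Sk k)" for j
 have PDf: "finite (PD j)" for j unfolding PD_def using Sk(1) by auto
 have PDl: "lift_both y d & d : E j" if yd: "(y, d) : PD j" for y d j
 proof -
  obtain k d0 where k: "k <= j" "d0 : Sk k" "(y, d) = (yl d0, d0) \<or> (y, d) = (%k. adj (yl d0 k), star D d0)"
   using yd unfolding PD_def by blast
  have d0: "d0 : Fd j" using k(1,2) Sk(2) Fd(1) unfolding incseq_def by blast
  have "lift_both (yl d0) d0" using yl d0 FdD by blast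
  moreover have "d0 : E j" using E(3)[of j] d0 by blast
  ultimately show ?thesis using k(3) lift_both_adj E(5) by auto
 qed
 define Z where "Z j = xs ` {..<j}" for j
 define PA where "PA j = (%i. (ya i, aa i)) ` {..<j}" for j
 define PB where "PB j = (%i. (yb i, bb i)) ` {..<j}" for j
 have Zf: "finite (Z j)" "Z j \<subseteq> carrier C" and PAf: "finite (PA j)" and PBf: "finite (PB j)" for j
  using xs by (auto simp: Z_def PA_def PB_def)
 have PAl: "A.lift y a" if "(y, a) : PA j" for y a j using that la by (auto simp: PA_def)
 have PBl: "B.lift y a" if "(y, a) : PB j" for y a j using that lb by (auto simp: PB_def)
 define e where "e j = 1 / (real j + 1)" for j
 have e: "e j > 0" for j by (simp add: e_def)
 have "e = (%j. inverse (real (Suc j)))" by (rule ext) (simp add: e_def inverse_eq_divide add.commute)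
 hence e0: "e ----> 0" using LIMSEQ_inverse_real_of_nat by simp
 have "ALL j. EX m F m' G t xj zt. approx_glue j (Z j) (PA j) (PB j) (PD j) (e j) m F m' G t xj zt"
  by (rule allI, rule glue_step[OF E(1,2) E(4) E(5) _ ES(1) ES(2) Zf PAf PAl PBf PBl PDf PDl e]) (use Sk(1) in auto)
 then obtain m F m' G t xj0 zt0 where
  "ALL j. approx_glue j (Z j) (PA j) (PB j) (PD j) (e j) (m j) (F j) (m' j) (G j) (t j) (xj0 j) (zt0 j)"
  unfolding choice_iff by (elim exE) (rule that)
 note g = spec[OF this, unfolded approx_glue_def]
 define xj where "xj j x = (if x : Z j then xj0 j x else 0\<^sub>v (m j))" for j x
 define zt where "zt j x = (if x : Z j then zt0 j x else 0\<^sub>v (m' j))" for j x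
 have g1: "ALL x:Z j. xj0 j x : cvec (m j) & zt0 j x : cvec (m' j)" for j
  using g[of j] by (elim conjE)
 have g2: "ALL x:Z j. ALL x':Z j. cmod (xj0 j x *c xj0 j x' - f (star C x' *[C] x)) < e j & cmod (zt0 j x *c zt0 j x' - f (star C x' *[C] x)) < e j" for j
  using g[of j] by (elim conjE)
 have g5: "ALL x:Z j. nrm (t j *v xj0 j x - zt0 j x) < e j" for j
  using g[of j] by (elim conjE)
 have zev: "EV j. x : Z j" if xr: "x : range xs" for x
 proof -
  obtain i where "x = xs i" using xr by blast
  thus ?thesis unfolding eventually_sequentially Z_def by (intro exI[of _ "Suc i"]) auto
 qed
 have pev: "EV j. (ya i, aa i) : PA j" "EV j. (yb i, bb i) : PB j" for i
  unfolding eventually_sequentially PA_def PB_def by (auto intro!: exI[of _ "Suc i"])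
 have dev: "EV j. (yl d, d) : PD j & (%k. adj (yl d k), star D d) : PD j" if dS: "d : S" for d
 proof -
  obtain k where "d : Sk k" using dS by (auto simp: S_def)
  thus ?thesis unfolding eventually_sequentially PD_def by (intro exI[of _ k]) blast
 qed
 have lim_r: "h ----> 0" if "!!j. 0 <= h j" "EV j. h j < e j" for h :: "nat => real"
  by (rule tendsto_sandwich[OF _ _ tendsto_const e0])
   (use that in \<open>auto elim: eventually_mono\<close>)
 have lim_c: "h ----> l" if "EV j. cmod (h j - l) < e j" for h :: "nat => complex" and l
  using lim_r[of "%j. cmod (h j - l)"] that by (simp add: LIM_zero_iff tendsto_norm_zero_iff)
 have 1: "xj j x : cvec (m j) & zt j x : cvec (m' j)" for j x
  using g1[of j] by (simp add: xj_def zt_def)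
 have 2: "(%j. xj j x *c xj j x') ----> f (star C x' *[C] x) & (%j. zt j x *c zt j x') ----> f (star C x' *[C] x)"
  if x: "x : range xs" "x' : range xs" for x x'
 proof (intro conjI lim_c)
  show "EV j. cmod (xj j x *c xj j x' - f (star C x' *[C] x)) < e j"
   using zev[OF x(1)] zev[OF x(2)] by eventually_elim (use g2 in \<open>simp add: xj_def\<close>)
  show "EV j. cmod (zt j x *c zt j x' - f (star C x' *[C] x)) < e j"
   using zev[OF x(1)] zev[OF x(2)] by eventually_elim (use g2 in \<open>simp add: zt_def\<close>)
 qed
 have 3: "(%j. nrm (F j (ya i) *v xj j x - xj j (sA (aa i) *[C] x))) ----> 0"
  if x: "x : range xs" "sA (aa i) *[C] x : range xs" for i x
 proof (rule lim_r)
  show "EV j. nrm (F j (ya i) *v xj j x - xj j (sA (aa i) *[C] x)) < e j"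
   using zev[OF x(1)] zev[OF x(2)] pev(1)[of i]
  proof eventually_elim
   case (elim j)
   have "ALL (y, a):PA j. ALL x:Z j. sA a *[C] x : Z j --> nrm (F j y *v xj0 j x - xj0 j (sA a *[C] x)) < e j"
    using g[of j] by (elim conjE)
   from bspec[OF this elim(3)] show ?case using elim by (simp add: xj_def)
  qed
 qed simp
 have 4: "(%j. nrm (G j (yb i) *v zt j x - zt j (sB (bb i) *[C] x))) ----> 0"
  if x: "x : range xs" "sB (bb i) *[C] x : range xs" for i x
 proof (rule lim_r)
  show "EV j. nrm (G j (yb i) *v zt j x - zt j (sB (bb i) *[C] x)) < e j"
   using zev[OF x(1)] zev[OF x(2)] pev(2)[of i]
  proof eventually_elim
   case (elim j)
   have "ALL (y, a):PB j. ALL x:Z j. sB a *[C] x : Z j --> nrm (G j y *v zt0 j x - zt0 j (sB a *[C] x)) < e j"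
    using g[of j] by (elim conjE)
   from bspec[OF this elim(3)] show ?case using elim by (simp add: zt_def)
  qed
 qed simp
 have 5: "(%j. nrm (t j *v xj j x - zt j x)) ----> 0" if x: "x : range xs" for x
 proof (rule lim_r)
  show "EV j. nrm (t j *v xj j x - zt j x) < e j"
   using zev[OF x] by eventually_elim (use g5 in \<open>simp add: xj_def zt_def\<close>)
 qed simp
 have 6: "(%j. opn (t j * F j y - G j y * t j)) ----> 0" if ev: "EV j. (y, d) : PD j" for y d
 proof (rule lim_r)
  show "EV j. opn (t j * F j y - G j y * t j) < e j"
   using ev
  proof eventually_elim
   case (elim j)
   have "ALL (y, d):PD j. opn (t j * F j y - G j y * t j) < e j" using g[of j] by (elim conjE)
   from bspec[OF this elim] show ?case by simp
  qed
 qed simp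
 have 7: "EX y. lift_both y d & (%j. opn (t j * F j y - G j y * t j)) ----> 0 &
   (%j. opn (t j * F j (%k. adj (y k)) - G j (%k. adj (y k)) * t j)) ----> 0" if d: "d : S" for d
 proof (intro exI conjI)
  show "lift_both (yl d) d" using yl d SD by blast
  show "(%j. opn (t j * F j (yl d) - G j (yl d) * t j)) ----> 0"
   by (rule 6[of _ d], rule eventually_mono[OF dev[OF d]]) simp
  show "(%j. opn (t j * F j (%k. adj (yl d k)) - G j (%k. adj (yl d k)) * t j)) ----> 0"
   by (rule 6[of _ "star D d"], rule eventually_mono[OF dev[OF d]]) simp
 qed
 have 0: "rep n j (m j) (F j) & rep n j (m' j) (G j) & t j : cmat (m' j) (m j) & opn (t j) <= 1" for j
  using g[of j] by (elim conjE) (intro conjI)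
 show ?thesis
 proof (intro exI conjI allI)
  show "rep n j (m j) (F j)" "rep n j (m' j) (G j)" "t j : cmat (m' j) (m j)" "opn (t j) <= 1" for j
   using 0[of j] by simp_all
  show "xj j x : cvec (m j)" "zt j x : cvec (m' j)" for j x using 1[of j x] by simp_all
  show "ALL x:range xs. ALL x':range xs. (%j. xj j x *c xj j x') ----> f (star C x' *[C] x) &
    (%j. zt j x *c zt j x') ----> f (star C x' *[C] x)" by (intro ballI 2)
  show "ALL x:range xs. sA (aa i) *[C] x : range xs -->
    (%j. nrm (F j (ya i) *v xj j x - xj j (sA (aa i) *[C] x))) ----> 0" for i by (intro ballI impI 3)
  show "ALL x:range xs. sB (bb i) *[C] x : range xs -->
    (%j. nrm (G j (yb i) *v zt j x - zt j (sB (bb i) *[C] x))) ----> 0" for i by (intro ballI impI 4)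
  show "ALL x:range xs. (%j. nrm (t j *v xj j x - zt j x)) ----> 0" by (intro ballI 5)
  show "S \<subseteq> carrier D" "approximable D S" by (rule SD, rule app)
  show "ALL d:S. EX y. lift_both y d & (%j. opn (t j * F j y - G j y * t j)) ----> 0 &
   (%j. opn (t j * F j (%k. adj (y k)) - G j (%k. adj (y k)) * t j)) ----> 0"
   by (intro ballI 7)
 qed
qed

end

section \<open>Tools for the gluing: the symmetry, annihilated vectors and the size of separable
  carriers\<close>

lemma ex_inj_nat_set_real: "EX g :: nat set => real. inj g"
 using nat_sets_eqpoll_reals by (auto simp: eqpoll_def bij_betw_def)

text \<open>As \<open>w\<close> anticommutes with \<open>S\<close>, it commutes with
  \<open>S ** S\<close> and with the root \<open>r\<close>. In the square of
  \<open>S +. r ** w\<close> the mixed terms cancel, and \<open>S ** S +. r ** r\<close> remains,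
  which is the unit.\<close>

lemma (in unital_cstar_algebra) glue_unitary:
 assumes S: "S : carrier A" "star A S = S" "cnorm A S <= 1"
  and w: "w : carrier A" "star A w = w" "w ** w = \<one>" "w ** S = \<ominus> (S ** w)"
 obtains r where "r : carrier A" "star A r = r" "r ** r = \<one> -. S ** S"
  "star A (S +. r ** w) = S +. r ** w" "(S +. r ** w) ** (S +. r ** w) = \<one>"
  "!!z. z : carrier A ==> z ** S = S ** z ==> z ** w = w ** z ==> z ** (S +. r ** w) = (S +. r ** w) ** z"
proof -
 have SS: "S ** S : carrier A" "star A (S ** S) = S ** S" using S by (simp_all add: star_mult)
 have "cnorm A (S ** S) <= 1" using nm_herm_sq[OF S(1,2)] power_mono[OF S(3), of 2] S(1) by simp
 from sqrt_rs_minus[OF SS this] obtain r where r: "r : carrier A" "star A r = r" "r ** r = rs 1 -. S ** S"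
  "!!z. z : carrier A ==> z ** (S ** S) = (S ** S) ** z ==> z ** r = r ** z"
  by metis
 have Sr: "S ** r = r ** S" by (rule r(4)[OF S(1)]) (simp add: mult_assoc S(1))
 have "w ** (S ** S) = (S ** S) ** w"
 proof -
  have "w ** (S ** S) = \<ominus> (S ** w) ** S" using w(4) S(1) w(1) by (simp add: mult_assoc[symmetric])
  also have "... = \<ominus> (S ** (w ** S))" using S(1) w(1) by (simp add: mult_minus_left mult_assoc)
  also have "... = (S ** S) ** w" unfolding w(4) using S(1) w(1) by (simp add: mult_minus_right mult_assoc)
  finally show ?thesis .
 qed
 hence wr: "w ** r = r ** w" by (rule r(4)[OF w(1)])
 have "star A (S +. r ** w) = S +. r ** w" using S r(1,2) w wr by (simp add: star_add star_mult)
 moreover have "(S +. r ** w) ** (S +. r ** w) = \<one>"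
 proof -
  have 1: "S ** (r ** w) = r ** (S ** w)" using S(1) r(1) w(1) Sr by (simp add: mult_assoc[symmetric])
  have 2: "(r ** w) ** S = \<ominus> (r ** (S ** w))" using S(1) r(1) w(1) w(4) by (simp add: mult_assoc mult_minus_right)
  have 3: "(r ** w) ** (r ** w) = r ** r"
  proof -
   have "(r ** w) ** (r ** w) = r ** ((w ** r) ** w)" using r(1) w(1) by (simp add: mult_assoc)
   also have "... = (r ** r) ** (w ** w)" unfolding wr using r(1) w(1) by (simp add: mult_assoc)
   finally show ?thesis using r(1) w(3) by simp
  qed
  have "(S +. r ** w) ** (S +. r ** w) = (S ** S +. (r ** w) ** S) +. (S ** (r ** w) +. (r ** w) ** (r ** w))"
   using S(1) r(1) w(1) by (simp add: mult_add_left mult_add_right)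
  also have "... = (S ** S +. \<ominus> (r ** (S ** w))) +. (r ** (S ** w) +. (\<one> -. S ** S))"
   unfolding 1 2 3 using r(3) by simp
  also have "... = \<one>"
  proof -
   have aux: "(x +. \<ominus> y) +. (y +. (\<one> -. x)) = \<one>" if "x : carrier A" "y : carrier A" for x y
    using that by algebra
   show ?thesis by (rule aux) (use S(1) r(1) w(1) in auto)
  qed
  finally show ?thesis .
 qed
 moreover have "z ** (S +. r ** w) = (S +. r ** w) ** z" if z: "z : carrier A" "z ** S = S ** z" "z ** w = w ** z" for z
 proof -
  have "z ** (S ** S) = (S ** S) ** z"
  proof -
   have "z ** (S ** S) = (S ** z) ** S" using z(1,2) S(1) by (simp add: mult_assoc[symmetric])
   also have "... = S ** (S ** z)" using z(1,2) S(1) by (simp add: mult_assoc)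
   finally show ?thesis using z(1) S(1) by (simp add: mult_assoc)
  qed
  hence zr: "z ** r = r ** z" by (rule r(4)[OF z(1)])
  have "z ** (r ** w) = (r ** z) ** w" using z(1) r(1) w(1) zr by (simp add: mult_assoc[symmetric])
  also have "... = (r ** w) ** z" using z r(1) w(1) by (simp add: mult_assoc)
  finally show ?thesis using z(1,2) S(1) r(1) w(1) by (simp add: mult_add_left mult_add_right)
 qed
 ultimately show ?thesis using that[of r] r(1-3) by simp
qed

lemma bvec_mult: "Y : mprod M ==> v : bvec M ==> (%j. Y j *v v j) : bvec M"
proof -
 assume Y: "Y : mprod M" and v: "v : bvec M"
 obtain B where B: "!!j. opn (Y j) <= B" "B >= 0" using mprod_bound[OF Y] by blast
 obtain b where b: "!!j. nrm (v j) <= b" "b >= 0" using bvec_bound[OF v] by blast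
 have "nrm (Y j *v v j) <= B * b" for j
  using opnorm_vec[OF mpm[OF Y] bvecD[OF v], of j] mult_mono[OF B(1)[of j] b(1)[of j] B(2) l2norm_nonneg] by linarith
 moreover have "Y j *v v j : cvec (M j)" for j by (rule mvc[OF mpm[OF Y] bvecD[OF v]])
 ultimately show ?thesis unfolding bvec_def by blast
qed

lemma bvec_zero: "(%j. 0\<^sub>v (M j)) : bvec M"
 by (auto simp: bvec_def intro!: exI[of _ 0])

lemma acts_self:
 assumes Y: "Y : mprod M" and v: "v : bvec M"
 shows "acts M (cls M Y) v (%j. Y j *v v j)"
proof (rule actsI[OF Y v bvec_mult[OF Y v]])
 have "Y j *v v j - Y j *v v j = 0\<^sub>v (M j)" for j
  using mvc[OF mpm[OF Y] bvecD[OF v], of j] by auto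
 thus "(%j. nrm (Y j *v v j - Y j *v v j)) ----> 0" by simp
qed

lemma acts_inverse:
 assumes a: "acts M X v w" and X': "X' : carrier (cor M)" and inv: "X' *[cor M] X = 1[cor M]"
 shows "acts M X' w v"
proof -
 obtain Y where Y: "Y : mprod M" "X' = cls M Y" using X' by (auto simp: carrier_corona)
 note w = acts_bvec(2)[OF a] and v = acts_bvec(1)[OF a]
 have b: "acts M X' w (%j. Y j *v w j)" unfolding Y(2) by (rule acts_self[OF Y(1) w])
 have "acts M (cls M (%k. 1\<^sub>m (M k))) v (%j. Y j *v w j)"
  using acts_mult[OF a b] unfolding inv corona_one .
 from acts_any[OF this mprod_one] have "(%j. nrm (v j - Y j *v w j)) ----> 0"
  using bvecD[OF v] by (simp add: one_mult_mat_vec)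
 hence "(%j. nrm (Y j *v w j - v j)) ----> 0"
  using l2norm_minus_commute[OF bvecD[OF v] bvecD[OF bvec_mult[OF Y(1) w]]] by simp
 thus ?thesis by (rule acts_sim[OF b v])
qed

text \<open>Up to a null matrix, the squared norm of \<open>Y j *v v j\<close> is the defect between
  the squared norms of \<open>v j\<close> and \<open>S j *v v j\<close>. So \<open>Y\<close>
  annihilates vectors whose norm \<open>S\<close> asymptotically preserves.\<close>

lemma acts_zero:
 assumes Y: "Y : mprod M" and S: "S : mprod M" and v: "v : bvec M"
  and eq: "cls M (%k. adj (Y k) * Y k) = cls M (%k. 1\<^sub>m (M k) - adj (S k) * S k)"
  and lim: "(%j. (nrm (v j))\<^sup>2 - (nrm (S j *v v j))\<^sup>2) ----> 0"
 shows "acts M (cls M Y) v (%j. 0\<^sub>v (M j))"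
proof (rule actsI[OF Y v bvec_zero])
 define Nn where "Nn k = adj (Y k) * Y k - (1\<^sub>m (M k) - adj (S k) * S k)" for k
 have "mnull Nn" unfolding Nn_def
  using eq cls_eq_iff[OF mprod_mult[OF mprod_adj[OF Y] Y] mprod_minus[OF mprod_one mprod_mult[OF mprod_adj[OF S] S]]] by simp
 hence nl: "(%k. opn (Nn k)) ----> 0" by (simp add: mnull_def)
 obtain b where b: "!!j. nrm (v j) <= b" "b >= 0" using bvec_bound[OF v] by blast
 have key: "(nrm (Y j *v v j))\<^sup>2 <= ((nrm (v j))\<^sup>2 - (nrm (S j *v v j))\<^sup>2) + opn (Nn j) * b * b" for j
 proof -
  note Yj = mpm[OF Y, of j] and Sj = mpm[OF S, of j] and vj = bvecD[OF v, of j]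
  note aY = adj_carrier[OF Yj] and aS = adj_carrier[OF Sj]
  have sq: "(nrm (X *v v j))\<^sup>2 = Re (((adj X * X) *v v j) *c v j)" if X: "X : cmat (M j) (M j)" for X
  proof -
   have "(adj X * X) *v v j = adj X *v (X *v v j)"
    by (rule assoc_mult_mat_vec[OF adj_carrier[OF X] X vj])
   thus ?thesis using cip_adj'[OF X mvc[OF X vj] vj] by (simp add: l2norm_Re)
  qed
  have Nc: "Nn j : cmat (M j) (M j)" unfolding Nn_def using Yj Sj aY aS by auto
  have SS: "adj (S j) * S j : cmat (M j) (M j)" using Sj aS by auto
  have "adj (Y j) * Y j = Nn j + (1\<^sub>m (M j) - adj (S j) * S j)"
   unfolding Nn_def by (rule eq_matI) (use Yj aY Sj aS in auto)
  hence "(adj (Y j) * Y j) *v v j = Nn j *v v j + (v j - (adj (S j) * S j) *v v j)"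
   using vj by (simp add: add_mult_distrib_mat_vec[OF Nc minus_carrier_mat[OF SS] vj]
     minus_mult_distrib_mat_vec[OF one_carrier_mat SS vj])
  hence "(nrm (Y j *v v j))\<^sup>2 = Re ((Nn j *v v j) *c v j) + ((nrm (v j))\<^sup>2 - (nrm (S j *v v j))\<^sup>2)"
   unfolding sq[OF Yj] sq[OF Sj]
   using mvc[OF Nc vj] mvc[OF SS vj] vj
   by (simp add: cip_add_left[of _ "M j"] cip_minus_left[of _ "M j"] l2norm_Re)
  moreover have "Re ((Nn j *v v j) *c v j) <= opn (Nn j) * nrm (v j) * nrm (v j)"
   by (rule order_trans[OF complex_Re_le_cmod opnorm_sesq[OF Nc vj vj]])
  moreover have "... <= opn (Nn j) * b * b"
   using b by (intro mult_mono mult_left_mono mult_nonneg_nonneg) auto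
  ultimately show ?thesis by linarith
 qed
 have "(%j. ((nrm (v j))\<^sup>2 - (nrm (S j *v v j))\<^sup>2) + opn (Nn j) * b * b) ----> 0 + 0 * b * b"
  by (intro tendsto_intros lim nl)
 hence "(%j. (nrm (Y j *v v j))\<^sup>2) ----> 0"
  by (intro null_sandwich[OF _ key]) simp_all
 hence "(%j. sqrt ((nrm (Y j *v v j))\<^sup>2)) ----> sqrt 0" by (intro tendsto_real_sqrt)
 moreover have "Y j *v v j - 0\<^sub>v (M j) = Y j *v v j" for j
  using mvc[OF mpm[OF Y] bvecD[OF v], of j] by auto
 ultimately show "(%j. nrm (Y j *v v j - 0\<^sub>v (M j))) ----> 0" by simp
qed

text \<open>A point is encoded by the set of pairs of a word index and a precision within which that
  word approximates it. Points with equal sets are within \<open>2 / (j + 1)\<close> of each other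
  for every \<open>j\<close>, and sets of naturals inject into the reals.\<close>

lemma (in word_gen) ex_inj_W: "EX ph :: 'g => real. inj_on ph W"
proof -
 have ne: "words ~= {}" using words_A by blast
 obtain k :: "nat => 'g" where k: "range k = words" using range_from_nat_into[OF ne words_countable] by blast
 define ph0 where "ph0 x = {p. cnorm G (x -[G] k (fst (prod_decode p))) < 1 / (real (snd (prod_decode p)) + 1)}" for x
 have "inj_on ph0 W"
 proof (rule inj_onI)
  fix x y assume x: "x : W" and y: "y : W" and eq: "ph0 x = ph0 y"
  note xc = W_closed[OF x] and yc = W_closed[OF y]
  have b: "cnorm G (x -[G] y) <= 2 / (real j + 1)" for j
  proof -
   have pos: "0 < 1 / (real j + 1)" by simp
   obtain z where z: "z : words" "cnorm G (x -[G] z) < 1 / (real j + 1)"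
    using x pos unfolding W_def norm_closure_def by blast
   obtain i where i: "z = k i" using z(1) k by blast
   have "prod_encode (i, j) : ph0 x" using z(2) i by (simp add: ph0_def)
   hence "prod_encode (i, j) : ph0 y" using eq by simp
   hence "cnorm G (y -[G] z) < 1 / (real j + 1)" using i by (simp add: ph0_def)
   moreover have zc: "z : carrier G" using z(1) words_carrier by blast
   ultimately have "cnorm G (x -[G] y) <= 1 / (real j + 1) + 1 / (real j + 1)"
    using hA.B.nm_triangle3[OF xc zc yc] hA.B.nm_diff_commute[OF zc yc] z(2) by linarith
   thus ?thesis by simp
  qed
  have "(%j. inverse (real (Suc j))) ----> 0" by (rule LIMSEQ_inverse_real_of_nat)
  from tendsto_mult[OF tendsto_const[of 2] this] have "(%j. 2 / (real j + 1)) ----> 0"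
   by (simp add: divide_inverse add.commute)
  hence "cnorm G (x -[G] y) <= 0" by (rule LIMSEQ_le_const) (use b in blast)
  moreover have "0 <= cnorm G (x -[G] y)" by (rule hA.B.nm_nonneg) (use xc yc in simp)
  ultimately have "cnorm G (x -[G] y) = 0" by linarith
  hence "x -[G] y = 0[G]" by (intro hA.B.cnorm_eq_zero) (use xc yc in auto)
  thus "x = y" by (rule hA.B.diff_eq_zero[OF xc yc])
 qed
 moreover obtain g :: "nat set => real" where "inj g" using ex_inj_nat_set_real by blast
 ultimately have "inj_on (g \<circ> ph0) W" by (intro comp_inj_on) (auto intro: inj_on_subset)
 thus ?thesis by blast
qed

text \<open>The universal property only quantifies over algebras on \<open>'e\<close>; a target of any other type
  is replaced by a copy of the separable subalgebra generated by the images of \<open>A\<close> and \<open>B\<close>.\<close>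

lemma universal_extension:
 fixes A :: "'a cstar" and B :: "'b cstar" and C :: "'c cstar" and D :: "'d cstar" and Q :: "'q cstar"
 assumes fp: "amalgamated_free_product TYPE('e) A B D iA iB C sA sB" and univ: "EX g :: real => 'e. inj g"
  and pA: "unital_hom A Q pA" and pB: "unital_hom B Q pB" and a: "dense_seq A a" and b: "dense_seq B b"
  and agree: "!!d. d : carrier D ==> pA (iA d) = pB (iB d)"
 obtains p where "star_hom C Q p" "!!x. x : carrier A ==> p (sA x) = pA x" "!!x. x : carrier B ==> p (sB x) = pB x"
proof -
 interpret hA: unital_hom A Q pA by (rule pA)
 interpret hB: unital_hom B Q pB by (rule pB)
 interpret w: word_gen A B Q pA pB a b by unfold_locales (rule a, rule b)
 obtain ph0 :: "'q => real" where p0: "inj_on ph0 w.W" using w.ex_inj_W by blast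
 obtain g :: "real => 'e" where g: "inj g" using univ by blast
 define ph where "ph = g \<circ> ph0"
 have inj: "inj_on ph w.W" unfolding ph_def by (rule comp_inj_on[OF p0]) (rule inj_on_subset[OF g], simp)
 obtain E :: "'e cstar" where E: "cstar_algebra E" "star_hom E Q (inv_into w.W ph)"
  "star_hom (Q\<lparr>carrier := w.W\<rparr>) E ph"
  by (rule transport_subalgebra[OF hA.B.cstar_algebra_axioms w.W_subalgebra inj])
 have "star_hom A (Q\<lparr>carrier := w.W\<rparr>) pA"
  unfolding star_hom_def using w.A_in_W by (auto simp: hA.hom_simps)
 from star_hom_comp[OF this E(3)] have EA: "star_hom A E (%x. ph (pA x))" .
 have "star_hom B (Q\<lparr>carrier := w.W\<rparr>) pB"
  unfolding star_hom_def using w.B_in_W by (auto simp: hB.hom_simps)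
 from star_hom_comp[OF this E(3)] have EB: "star_hom B E (%x. ph (pB x))" .
 have UP: "ALL (E :: 'e cstar) pA pB. cstar_algebra E --> star_hom A E pA --> star_hom B E pB -->
    (ALL d:carrier D. pA (iA d) = pB (iB d)) -->
    (EX p. star_hom C E p & (ALL a:carrier A. p (sA a) = pA a) & (ALL b:carrier B. p (sB b) = pB b))"
  using fp unfolding amalgamated_free_product_def by (elim conjE)
 obtain p where p: "star_hom C E p" "ALL a:carrier A. p (sA a) = ph (pA a)" "ALL b:carrier B. p (sB b) = ph (pB b)"
  using UP[rule_format, OF E(1) EA EB] agree by auto
 have inv: "inv_into w.W ph (ph x) = x" if "x : w.W" for x by (rule inv_into_f_f[OF inj that])
 show thesis
 proof (rule that)
  show "star_hom C Q (%x. inv_into w.W ph (p x))" by (rule star_hom_comp[OF p(1) E(2)])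
  show "inv_into w.W ph (p (sA x)) = pA x" if "x : carrier A" for x
   using p(2) that inv[OF w.A_in_W[OF that]] by simp
  show "inv_into w.W ph (p (sB x)) = pB x" if "x : carrier B" for x
   using p(3) that inv[OF w.B_in_W[OF that]] by simp
 qed
qed

section \<open>Gluing\<close>

context glue
begin

text \<open>With \<open>T\<close> the contraction intertwining the two representations, \<open>S = T + T\<^sup>*\<close> and
  \<open>w = 1 \<oplus> -1\<close>, the symmetry \<open>U = S + \<surd>(1 - S\<^sup>2) w\<close> of the \<open>2 \<times> 2\<close> matrices commutes with the image
  of \<open>D\<close> and exchanges the vectors modelling the two copies of \<open>x\<close>.\<close>

lemma glue_embedding:
 fixes a b
 assumes AF: "AF_algebra D" and fp: "amalgamated_free_product TYPE('e) A B D iA iB C sA sB"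
  and univ: "EX g :: real => 'e. inj g" and a: "dense_seq A a" and b: "dense_seq B b" and a0: "a 0 = 1[A]"
  and dense: "norm_closure C (range (geval C (%i. sA (a i)) (%i. sB (b i)))) = carrier C"
 shows "EX M p. (ALL j. M j > 0) & embedding C (cor M) p"
proof -
 interpret wC: word_gen A B C sA sB a b by unfold_locales (rule a, rule b)
 have dense: "wC.W = carrier C" using dense by (simp add: wC.W_def wC.words_def)
 have ne: "wC.words ~= {}" using wC.words_A by blast
 obtain xs :: "nat => 'c" where xs: "range xs = wC.words" using range_from_nat_into[OF ne wC.words_countable] by blast
 have wc: "x : carrier C" if "x : wC.words" for x using wC.words_carrier that by blast
 have "EX y. A.lift y (a i)" "EX y. B.lift y (b i)" for i
  by (rule A.ex_lift[OF wC.ab_closed(1)], rule B.ex_lift[OF wC.ab_closed(2)])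
 then obtain ya yb where lab: "!!i. A.lift (ya i) (a i)" "!!i. B.lift (yb i) (b i)" by metis
 have xsC: "xs i : carrier C" for i using xs wc by blast
 from glue_sequences[where ya = ya and aa = a and yb = yb and bb = b and xs = xs, OF AF lab xsC, unfolded xs] obtain m F m' G t xj zt S0 where
  g0: "ALL j. rep n j (m j) (F j) & rep n j (m' j) (G j) & t j : cmat (m' j) (m j) & opn (t j) <= 1"
  and gc: "ALL j x. xj j x : cvec (m j) & zt j x : cvec (m' j)"
  and gg: "ALL x:wC.words. ALL x':wC.words. (%j. xj j x *c xj j x') ----> f (star C x' *[C] x) &
    (%j. zt j x *c zt j x') ----> f (star C x' *[C] x)"
  and ga: "ALL i. ALL x:wC.words. sA (a i) *[C] x : wC.words -->
    (%j. nrm (F j (ya i) *v xj j x - xj j (sA (a i) *[C] x))) ----> 0"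
  and gb: "ALL i. ALL x:wC.words. sB (b i) *[C] x : wC.words -->
    (%j. nrm (G j (yb i) *v zt j x - zt j (sB (b i) *[C] x))) ----> 0"
  and gt: "ALL x:wC.words. (%j. nrm (t j *v xj j x - zt j x)) ----> 0"
  and S0: "S0 \<subseteq> carrier D" "approximable D S0"
  and gd: "ALL d:S0. EX y. lift_both y d & (%j. opn (t j * F j y - G j y * t j)) ----> 0 &
   (%j. opn (t j * F j (%k. adj (y k)) - G j (%k. adj (y k)) * t j)) ----> 0"
  by (elim exE conjE) (rule that)
 have repF: "rep n j (m j) (F j)" and repG: "rep n j (m' j) (G j)" and tc: "t j : cmat (m' j) (m j)"
  and t1: "opn (t j) <= 1" for j using g0[rule_format, of j] by simp_all
 have xc: "xj j x : cvec (m j)" and zc: "zt j x : cvec (m' j)" for j x using gc by auto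
 \<comment> \<open>The two models side by side: through \<open>R\<close> the whole product acts on
   the sum of both spaces, so \<open>tt\<close> serves the image of \<open>A\<close> as well as that
   of \<open>B\<close>.\<close>
 define M where "M j = m j + m' j" for j
 have Mpos: "M j > 0" for j using repD(1)[OF repF[of j]] by (simp add: M_def)
 interpret Q: unital_cstar_algebra "cor M" by (rule unital_cstar_corona[OF Mpos])
 let ?Q = "cor M"
 define R where "R j Y = dsum (F j Y) (G j Y)" for j Y
 have repR: "rep n j (M j) (R j)" for j unfolding R_def M_def by (rule rep_dsum[OF repF repG])
 obtain tt where th: "star_hom (cor n) ?Q tt" "tt 1[cor n] = 1[?Q]"
  "!!Y. Y : mprod n ==> tt (cls n Y) = cls M (%j. R j Y)"
  by (rule rep_seq_hom[OF repR]) (rule that)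
 interpret th: unital_hom "cor n" ?Q tt by unfold_locales (rule th(1), rule th(2))

 \<comment> \<open>The hermitian contraction \<open>S\<close>, the grading \<open>w\<close> and the
   symmetry \<open>U\<close>\<close>
 define Sm where "Sm j = offdiag (adj (t j)) (t j)" for j
 define wm where "wm j = dsum (1\<^sub>m (m j)) ((-1) *m 1\<^sub>m (m' j))" for j
 note atc = adj_carrier[OF tc]
 have n1c: "(-1) *m 1\<^sub>m (m' j) : cmat (m' j) (m' j)" for j :: nat by simp
 have n1: "opn ((-1) *m 1\<^sub>m (m' j)) <= 1" for j by (simp add: opnorm_smult opnorm_one_le)
 have Sc: "Sm j : cmat (M j) (M j)" for j unfolding Sm_def M_def by (rule offdiag_carrier[OF atc tc])
 have Sn: "opn (Sm j) <= 1" for j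
  unfolding Sm_def by (rule opnorm_offdiag[OF atc tc _ t1]) (use t1 in \<open>simp add: opnorm_adj\<close>)
 have Smp: "Sm : mprod M" by (rule mprodI[OF Sc Sn])
 have wcm: "wm j : cmat (M j) (M j)" for j unfolding wm_def M_def by (rule dsum_carrier[OF one_carrier_mat n1c])
 have wmp: "wm : mprod M"
  by (rule mprodI[OF wcm]) (unfold wm_def, rule opnorm_dsum[OF one_carrier_mat n1c opnorm_one_le n1])
 define S where "S = cls M Sm"
 define w where "w = cls M wm"
 have SC: "S : carrier ?Q" and wC: "w : carrier ?Q" using Smp wmp by (simp_all add: S_def w_def)
 have S_star: "star ?Q S = S"
 proof -
  have "adj (Sm j) = Sm j" for j
   unfolding Sm_def offdiag_adj[OF atc tc] by (simp add: adj_adj)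
  thus ?thesis unfolding S_def corona_star[OF Smp] by simp
 qed
 have S_norm: "cnorm ?Q S <= 1"
  unfolding S_def by (rule corona_norm_leI[OF Smp]) (use Sn in auto)
 have w_star: "star ?Q w = w"
 proof -
  have "adj (wm j) = wm j" for j
   unfolding wm_def dsum_adj[OF one_carrier_mat n1c, symmetric] by (simp add: adj_smult adj_one)
  thus ?thesis unfolding w_def corona_star[OF wmp] by simp
 qed
 have n1n1: "((-1) *m 1\<^sub>m l) * ((-1) *m 1\<^sub>m l) = (1\<^sub>m l :: complex mat)" for l
  by (simp add: mult_smult_assoc_mat[of _ l l _ l] mult_smult_distrib[of _ l l _ l]) (rule eq_matI, auto)
 have n1P: "((-1) *m 1\<^sub>m l) * P = (-1) *m P" if "P : cmat l l'" for P :: "complex mat" and l l'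
  using that by (simp add: mult_smult_assoc_mat[of _ l l _ l'])
 have Pn1: "P * ((-1) *m 1\<^sub>m l') = (-1) *m P" if "P : cmat l l'" for P :: "complex mat" and l l'
  using that by (simp add: mult_smult_distrib[of _ l l' _ l'])
 have ww: "w *[?Q] w = 1[?Q]"
 proof -
  have "wm j * wm j = 1\<^sub>m (M j)" for j
   unfolding wm_def dsum_mult[OF one_carrier_mat n1c one_carrier_mat n1c, symmetric]
   by (simp add: n1n1 dsum_one M_def)
  thus ?thesis unfolding w_def corona_mult[OF wmp wmp] corona_one by simp
 qed
 have wS: "w *[?Q] S = \<ominus>\<^bsub>?Q\<^esub> (S *[?Q] w)"
 proof -
  have "wm j * Sm j = (-1) *m (Sm j * wm j)" for j
  proof -
   have "wm j * Sm j = offdiag (1\<^sub>m (m j) * adj (t j)) (((-1) *m 1\<^sub>m (m' j)) * t j)"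
    unfolding wm_def Sm_def by (rule offdiag_dsum(2)[OF atc tc one_carrier_mat n1c])
   also have "... = offdiag (adj (t j)) ((-1) *m t j)"
    using left_mult_one_mat[OF atc[of j]] n1P[OF tc[of j]] by simp
   finally have 1: "wm j * Sm j = offdiag (adj (t j)) ((-1) *m t j)" .
   have "Sm j * wm j = offdiag (adj (t j) * ((-1) *m 1\<^sub>m (m' j))) (t j * 1\<^sub>m (m j))"
    unfolding wm_def Sm_def by (rule offdiag_dsum(1)[OF atc tc one_carrier_mat n1c])
   also have "... = offdiag ((-1) *m adj (t j)) (t j)"
    using right_mult_one_mat[OF tc[of j]] Pn1[OF atc[of j]] by simp
   finally have 2: "Sm j * wm j = offdiag ((-1) *m adj (t j)) (t j)" .
   have 3: "(-1) *m ((-1) *m P) = P" for P :: "complex mat" by (rule eq_matI) auto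
   have "(-1) *m (Sm j * wm j) = offdiag ((-1) *m ((-1) *m adj (t j))) ((-1) *m t j)"
    unfolding 2 by (rule offdiag_uminus[OF smult_carrier_mat[OF atc] tc, symmetric])
   thus ?thesis unfolding 1 3 by simp
  qed
  hence "w *[?Q] S = (-1) .[?Q] (S *[?Q] w)"
   unfolding S_def w_def corona_mult[OF wmp Smp] corona_mult[OF Smp wmp] corona_smult[OF mprod_mult[OF Smp wmp]] by simp
  thus ?thesis using SC wC by (simp add: Q.sm_minus_one)
 qed
 obtain r where r: "r : carrier ?Q" "star ?Q r = r" "r *[?Q] r = 1[?Q] -[?Q] S *[?Q] S"
  "star ?Q (S +[?Q] r *[?Q] w) = S +[?Q] r *[?Q] w"
  "(S +[?Q] r *[?Q] w) *[?Q] (S +[?Q] r *[?Q] w) = 1[?Q]"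
  "!!z. z : carrier ?Q ==> z *[?Q] S = S *[?Q] z ==> z *[?Q] w = w *[?Q] z ==>
   z *[?Q] (S +[?Q] r *[?Q] w) = (S +[?Q] r *[?Q] w) *[?Q] z"
  by (rule Q.glue_unitary[OF SC S_star S_norm wC w_star ww wS]) (rule that)
 define U where "U = S +[?Q] r *[?Q] w"
 have UC: "U : carrier ?Q" using SC wC r(1) by (simp add: U_def)
 note U_star = r(4)[folded U_def] and UU = r(5)[folded U_def] and Ucomm = r(6)[folded U_def]

 \<comment> \<open>Commutation of \<open>U\<close> with the image of \<open>D\<close>\<close>
 have w_th: "tt X *[?Q] w = w *[?Q] tt X" if X: "X : carrier (cor n)" for X
 proof -
  obtain Y where Y: "Y : mprod n" "X = cls n Y" using X by (auto simp: carrier_corona)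
  have "R j Y * wm j = wm j * R j Y" for j
  proof -
   note Fy = repD(2)[OF repF[of j] Y(1)] and Gy = repD(2)[OF repG[of j] Y(1)]
   show ?thesis unfolding R_def wm_def dsum_mult[OF Fy Gy one_carrier_mat n1c, symmetric]
     dsum_mult[OF one_carrier_mat n1c Fy Gy, symmetric]
    using left_mult_one_mat[OF Fy] right_mult_one_mat[OF Fy] n1P[OF Gy] Pn1[OF Gy] by simp
  qed
  thus ?thesis unfolding Y(2) th(3)[OF Y(1)] w_def
   corona_mult[OF rep_mprod[OF repR Y(1)] wmp] corona_mult[OF wmp rep_mprod[OF repR Y(1)]] by simp
 qed
 define dl where "dl d = tt (q1 (iA d))" for d
 have dC: "dl d : carrier ?Q" if "d : carrier D" for d using that by (simp add: dl_def)
 have d_lift: "dl d *[?Q] S = S *[?Q] dl d" if d: "d : S0" for d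
 proof -
  obtain y where y: "lift_both y d" "(%j. opn (t j * F j y - G j y * t j)) ----> 0"
   "(%j. opn (t j * F j (%k. adj (y k)) - G j (%k. adj (y k)) * t j)) ----> 0"
   using gd d by blast
  have yA: "A.lift y (iA d)" using y(1) by (simp add: lift_both_def)
  note ym = A.liftD(1)[OF yA]
  have dd: "dl d = cls M (%j. R j y)" unfolding dl_def A.liftD(3)[OF yA] by (rule th(3)[OF ym])
  note Rm = rep_mprod[OF repR ym]
  have "mnull (%j. R j y * Sm j - Sm j * R j y)"
  proof (rule mnull_sandwich)
   fix j
   note Fy = repD(2)[OF repF[of j] ym] and Gy = repD(2)[OF repG[of j] ym]
   \<comment> \<open>The commutator is off-diagonal. Its lower corner is minus the intertwining
     defect of \<open>y\<close>, its upper corner the adjoint of the defect of the adjoint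
     lift.\<close>
   let ?P = "F j y * adj (t j) - adj (t j) * G j y" and ?R = "G j y * t j - t j * F j y"
   have Pc: "?P : cmat (m j) (m' j)" using mmc[OF atc Gy] by (rule minus_carrier_mat)
   have Rc: "?R : cmat (m' j) (m j)" using mmc[OF tc Fy] by (rule minus_carrier_mat)
   have "R j y * Sm j - Sm j * R j y = offdiag ?P ?R"
    unfolding R_def Sm_def offdiag_dsum[OF atc tc Fy Gy]
    by (rule offdiag_minus[OF mmc[OF Fy atc] mmc[OF Gy tc] mmc[OF atc Gy] mmc[OF tc Fy]])
   moreover have nR: "opn ?R = opn (t j * F j y - G j y * t j)"
   proof -
    have "?R = (-1) *m (t j * F j y - G j y * t j)"
     by (rule eq_matI) (use Fy Gy tc[of j] in auto)
    thus ?thesis by (simp add: opnorm_smult)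
   qed
   moreover have nP: "opn ?P = opn (t j * F j (%k. adj (y k)) - G j (%k. adj (y k)) * t j)"
   proof -
    have "adj ?P = t j * F j (%k. adj (y k)) - G j (%k. adj (y k)) * t j"
     unfolding repD(6)[OF repF ym] repD(6)[OF repG ym]
     by (simp add: adj_minus[OF mmc[OF Fy atc] mmc[OF atc Gy]] adj_mult[OF Fy atc] adj_mult[OF atc Gy] adj_adj)
    thus ?thesis using opnorm_adj[of ?P] by simp
   qed
   ultimately show "opn (R j y * Sm j - Sm j * R j y) <= opn (t j * F j y - G j y * t j)
     + opn (t j * F j (%k. adj (y k)) - G j (%k. adj (y k)) * t j)"
    by (simp only:) (rule opnorm_offdiag[OF Pc Rc], simp_all add: nR nP)
  next
   show "(%j. opn (t j * F j y - G j y * t j)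
     + opn (t j * F j (%k. adj (y k)) - G j (%k. adj (y k)) * t j)) ----> 0"
    using tendsto_add[OF y(2,3)] by simp
  qed
  thus ?thesis unfolding dd S_def corona_mult[OF Rm Smp] corona_mult[OF Smp Rm]
   by (simp add: cls_eq_iff[OF mprod_mult[OF Rm Smp] mprod_mult[OF Smp Rm]])
 qed
 have del: "dl (d +[D] d') = dl d +[?Q] dl d'" "dl (d -[D] d') = dl d -[?Q] dl d'"
  if "d : carrier D" "d' : carrier D" for d d'
  using that by (simp_all add: dl_def iA.hom_simps A.q.hom_simps th.hom_simps iA.hom_diff A.q.hom_diff th.hom_diff)
 have del': "dl (c .[D] d) = c .[?Q] dl d" "cnorm ?Q (dl d) <= cnorm D d" if "d : carrier D" for d c
  using that iA.hom_contractive[of d] A.q.hom_contractive[of "iA d"] th.hom_contractive[of "q1 (iA d)"]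
  by (simp_all add: dl_def iA.hom_simps A.q.hom_simps th.hom_simps)
 have del0: "dl 0[D] = 0[?Q]" by (simp add: dl_def)
 have d_comm: "dl d *[?Q] S = S *[?Q] dl d" if d: "d : carrier D" for d
 proof -
  \<comment> \<open>Commuting with \<open>S\<close> is a closed linear condition on
    \<open>d\<close>, so \<open>approximable\<close> extends it from \<open>S0\<close> to
    \<open>D\<close>.\<close>
  define Wd where "Wd = {d : carrier D. dl d *[?Q] S = S *[?Q] dl d}"
  have lin: "lin_subspace D Wd"
   unfolding lin_subspace_def Wd_def using SC dC
   by (auto simp: del del' del0 Q.mult_add_left Q.mult_add_right Q.smult_mult_left Q.smult_mult_right)
  have sub: "S0 \<subseteq> Wd" using S0(1) d_lift by (auto simp: Wd_def)
  have cl: "x : Wd" if x: "x : carrier D" and ap: "ALL e>0. EX y:Wd. cnorm D (x -[D] y) < e" for x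
  proof -
   let ?c = "dl x *[?Q] S -[?Q] S *[?Q] dl x"
   have cC: "?c : carrier ?Q" using SC dC[OF x] by simp
   have "cnorm ?Q ?c <= 0 + e" if e: "e > 0" for e
   proof -
    have e2: "e / 2 > 0" using e by simp
    obtain y where y: "y : carrier D" "dl y *[?Q] S = S *[?Q] dl y" "cnorm D (x -[D] y) < e / 2"
     using ap e2 unfolding Wd_def by blast
    define z where "z = dl (x -[D] y)"
    have zC: "z : carrier ?Q" unfolding z_def by (rule dC) (use x y in simp)
    have zn: "cnorm ?Q z <= e / 2" using del'(2)[of "x -[D] y"] x y unfolding z_def by simp
    have zd: "z = dl x -[?Q] dl y" unfolding z_def by (rule del(2)[OF x y(1)])
    have "?c = z *[?Q] S -[?Q] S *[?Q] z"
    proof -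
     have aux: "p -[?Q] q = (p -[?Q] u) -[?Q] (q -[?Q] u)" if "p : carrier ?Q" "q : carrier ?Q" "u : carrier ?Q" for p q u
      using that by algebra
     have zS: "z *[?Q] S = dl x *[?Q] S -[?Q] dl y *[?Q] S"
      unfolding zd by (rule Q.mult_diff_left[OF SC dC[OF x] dC[OF y(1)]])
     have Sz: "S *[?Q] z = S *[?Q] dl x -[?Q] dl y *[?Q] S"
      unfolding zd y(2) by (rule Q.mult_diff_right[OF SC dC[OF x] dC[OF y(1)]])
     show ?thesis unfolding zS Sz by (rule aux) (use SC dC[OF x] dC[OF y(1)] in auto)
    qed
    also have "cnorm ?Q ... <= cnorm ?Q (z *[?Q] S) + cnorm ?Q (S *[?Q] z)"
     by (rule Q.nm_diff) (use zC SC in auto)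
    also have "... <= cnorm ?Q z * cnorm ?Q S + cnorm ?Q S * cnorm ?Q z"
     by (intro add_mono Q.cnorm_mult zC SC)
    also have "... <= cnorm ?Q z * 1 + 1 * cnorm ?Q z"
     by (intro add_mono mult_left_mono mult_right_mono S_norm Q.nm_nonneg zC)
    finally show ?thesis using zn by linarith
   qed
   hence "cnorm ?Q ?c <= 0" by (rule field_le_epsilon)
   hence "cnorm ?Q ?c = 0" using Q.nm_nonneg[OF cC] by linarith
   hence "?c = 0[?Q]" by (rule Q.cnorm_eq_zero[OF cC])
   hence "dl x *[?Q] S = S *[?Q] dl x" by (rule Q.diff_eq_zero[rotated 2]) (use SC dC[OF x] in auto)
   thus ?thesis using x by (simp add: Wd_def)
  qed
  have "Wd = carrier D" using S0(2) lin sub cl unfolding approximable_def by simp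
  thus ?thesis using d by (auto simp: Wd_def)
 qed
 have U_d: "dl d *[?Q] U = U *[?Q] dl d" if d: "d : carrier D" for d
  by (rule Ucomm[OF dC[OF d] d_comm[OF d]]) (unfold dl_def, rule w_th, use d in simp)

 \<comment> \<open>The twisted pair of homomorphisms and its extension to \<open>C\<close>\<close>
 define pA where "pA x = U *[?Q] (tt (q1 x) *[?Q] U)" for x
 define pB where "pB x = tt (q2 x)" for x
 have conj: "(U *[?Q] (x *[?Q] U)) *[?Q] (U *[?Q] (y *[?Q] U)) = U *[?Q] ((x *[?Q] y) *[?Q] U)"
  if "x : carrier ?Q" "y : carrier ?Q" for x y
 proof -
  have "(U *[?Q] (x *[?Q] U)) *[?Q] (U *[?Q] (y *[?Q] U)) = U *[?Q] (x *[?Q] ((U *[?Q] U) *[?Q] (y *[?Q] U)))"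
   using that UC by (simp add: Q.mult_assoc)
  thus ?thesis unfolding UU using that UC by (simp add: Q.mult_assoc)
 qed
 have homA: "unital_hom A ?Q pA"
 proof unfold_locales
  show "star_hom A ?Q pA"
   unfolding star_hom_def
  proof (intro conjI ballI allI)
   show "pA : carrier A \<rightarrow> carrier ?Q" using UC by (auto simp: pA_def)
   fix x assume x: "x : carrier A"
   note tx = th.hom_simps(1)[OF A.q.hom_simps(1)[OF x]]
   show "pA (c .[A] x) = c .[?Q] pA x" for c
    using x tx UC by (simp add: pA_def A.q.hom_simps(3) th.hom_simps(3) Q.smult_mult_left Q.smult_mult_right)
   show "pA (star A x) = star ?Q (pA x)"
    using x tx UC by (simp add: pA_def A.q.hom_simps(5) th.hom_simps(5) Q.star_mult U_star Q.mult_assoc)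
   fix y assume y: "y : carrier A"
   note ty = th.hom_simps(1)[OF A.q.hom_simps(1)[OF y]]
   show "pA (x +[A] y) = pA x +[?Q] pA y"
    using x y tx ty UC by (simp add: pA_def A.q.hom_simps(2) th.hom_simps(2) Q.mult_add_left Q.mult_add_right)
   show "pA (x *[A] y) = pA x *[?Q] pA y"
    using x y conj[OF tx ty] by (simp add: pA_def A.q.hom_simps(4) th.hom_simps(4))
  qed
  show "pA 1[A] = 1[?Q]" using UC by (simp add: pA_def UU)
 qed
 have homB: "unital_hom B ?Q pB"
 proof unfold_locales
  show "star_hom B ?Q pB" unfolding pB_def by (rule star_hom_comp[OF B.q.hom th(1)])
  show "pB 1[B] = 1[?Q]" by (simp add: pB_def)
 qed
 have agree: "pA (iA d) = pB (iB d)" if d: "d : carrier D" for d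
 proof -
  have "pA (iA d) = U *[?Q] (U *[?Q] dl d)" unfolding pA_def dl_def[symmetric] U_d[OF d] ..
  also have "... = (U *[?Q] U) *[?Q] dl d" by (rule Q.mult_assoc[OF UC UC dC[OF d], symmetric])
  also have "... = pB (iB d)" unfolding UU using dC[OF d] q_eq[OF d] by (simp add: pB_def dl_def)
  finally show ?thesis .
 qed
 obtain p where p: "star_hom C ?Q p" "!!x. x : carrier A ==> p (sA x) = pA x" "!!x. x : carrier B ==> p (sB x) = pB x"
  by (rule universal_extension[OF fp univ homA homB a b agree]) (assumption, rule that)
 have p1: "p 1[C] = 1[?Q]"
  using p(2)[of "1[A]"] unital_hom.hom_one[OF homA] by simp
 interpret p: unital_hom C ?Q p by unfold_locales (rule p(1), rule p1)

 \<comment> \<open>Action of the extension on the model vectors\<close>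
 define V where "V x j = 0\<^sub>v (m j) @\<^sub>v zt j x" for x j
 \<comment> \<open>The \<open>B\<close>-model fills the second summand, the \<open>A\<close>-model
   the first. Words act on the vectors \<open>V x\<close>; a letter from \<open>A\<close> passes
   through \<open>W\<close> by means of \<open>U\<close>.\<close>
 define W where "W x j = xj j x @\<^sub>v 0\<^sub>v (m' j)" for x j
 have napp: "nrm (0\<^sub>v l @\<^sub>v v) = nrm v" "nrm (v @\<^sub>v 0\<^sub>v l) = nrm v" for l v
  using l2norm_append[of "0\<^sub>v l" v] l2norm_append[of v "0\<^sub>v l"] by (simp_all add: power2_eq_iff_nonneg)
 have mapp: "(a1 @\<^sub>v b1) - (a2 @\<^sub>v b2) = (a1 - a2) @\<^sub>v (b1 - b2)"
  if "a1 : cvec l" "a2 : cvec l" "b1 : cvec l'" "b2 : cvec l'" for a1 a2 b1 b2 :: "complex vec" and l l'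
  using that by (intro eq_vecI) auto
 have zero_diff: "0\<^sub>v l - 0\<^sub>v l = (0\<^sub>v l :: complex vec)" for l by auto
 have Vn: "(%j. (nrm (V x j))\<^sup>2) ----> Re (f (star C x *[C] x))"
  and Wn: "(%j. (nrm (W x j))\<^sup>2) ----> Re (f (star C x *[C] x))" if x: "x : wC.words" for x
  using gg x unfolding V_def W_def napp l2norm_Re by (auto intro!: tendsto_Re)
 have bv: "v : bvec M" if c: "!!j. v j : cvec (M j)" and l: "(%j. (nrm (v j))\<^sup>2) ----> al" for v al
 proof -
  have "(%j. sqrt ((nrm (v j))\<^sup>2)) ----> sqrt al" by (rule tendsto_real_sqrt[OF l])
  hence "Bseq (%j. nrm (v j))" by (intro convergent_imp_Bseq convergentI) simp
  then obtain K where "!!j. norm (nrm (v j)) <= K" by (auto simp: Bseq_def)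
  thus ?thesis unfolding bvec_def using c by (auto intro!: exI[of _ K])
 qed
 have Vc: "V x j : cvec (M j)" and Wc: "W x j : cvec (M j)" for x j
  using zc[of j x] xc[of j x] by (simp_all add: V_def W_def M_def)
 have Vb: "V x : bvec M" and Wb: "W x : bvec M" if x: "x : wC.words" for x
  by (rule bv[OF Vc Vn[OF x]], rule bv[OF Wc Wn[OF x]])
 have wmul: "x *[C] y : wC.words" if "x : wC.words" "y : wC.words" for x y by (rule wC.words_mult[OF that])
 have zmul: "X *v 0\<^sub>v l' = 0\<^sub>v l" if "X : cmat l l'" for X :: "complex mat" and l l' using that by auto
 have act_b: "acts M (tt (q2 (b i))) (V x) (V (sB (b i) *[C] x))" if x: "x : wC.words" for i x
 proof -
  note ym = B.liftD(1)[OF lab(2)[of i]]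
  have bx: "sB (b i) *[C] x : wC.words" by (rule wmul[OF wC.words_B x])
  have e: "R j (yb i) *v V x j - V (sB (b i) *[C] x) j = 0\<^sub>v (m j) @\<^sub>v (G j (yb i) *v zt j x - zt j (sB (b i) *[C] x))" for j
  proof -
   note Fy = repD(2)[OF repF[of j] ym] and Gy = repD(2)[OF repG[of j] ym]
   show ?thesis unfolding R_def V_def dsum_mult_vec[OF Fy Gy zero_carrier_vec zc] zmul[OF Fy]
     mapp[OF zero_carrier_vec zero_carrier_vec mvc[OF Gy zc] zc] zero_diff ..
  qed
  show ?thesis unfolding B.liftD(3)[OF lab(2)[of i]] th(3)[OF ym]
   by (rule actsI[OF rep_mprod[OF repR ym] Vb[OF x] Vb[OF bx]]) (unfold e napp, use gb x bx in blast)
 qed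
 have act_a: "acts M (tt (q1 (a i))) (W x) (W (sA (a i) *[C] x))" if x: "x : wC.words" for i x
 proof -
  note ym = A.liftD(1)[OF lab(1)[of i]]
  have ax: "sA (a i) *[C] x : wC.words" by (rule wmul[OF wC.words_A x])
  have e: "R j (ya i) *v W x j - W (sA (a i) *[C] x) j = (F j (ya i) *v xj j x - xj j (sA (a i) *[C] x)) @\<^sub>v 0\<^sub>v (m' j)" for j
  proof -
   note Fy = repD(2)[OF repF[of j] ym] and Gy = repD(2)[OF repG[of j] ym]
   show ?thesis unfolding R_def W_def dsum_mult_vec[OF Fy Gy xc zero_carrier_vec] zmul[OF Gy]
     mapp[OF mvc[OF Fy xc] xc zero_carrier_vec zero_carrier_vec] zero_diff ..
  qed
  show ?thesis unfolding A.liftD(3)[OF lab(1)[of i]] th(3)[OF ym]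
   by (rule actsI[OF rep_mprod[OF repR ym] Wb[OF x] Wb[OF ax]]) (unfold e napp, use ga x ax in blast)
 qed
 have act_U: "acts M U (W x) (V x)" if x: "x : wC.words" for x
 proof -
  have SW: "Sm j *v W x j = 0\<^sub>v (m j) @\<^sub>v (t j *v xj j x)" for j
   unfolding Sm_def W_def offdiag_vec[OF atc tc xc zero_carrier_vec] zmul[OF atc] ..
  have actS: "acts M S (W x) (V x)"
   unfolding S_def
  proof (rule actsI[OF Smp Wb[OF x] Vb[OF x]])
   have "Sm j *v W x j - V x j = 0\<^sub>v (m j) @\<^sub>v (t j *v xj j x - zt j x)" for j
    unfolding SW V_def mapp[OF zero_carrier_vec zero_carrier_vec mvc[OF tc xc] zc] zero_diff ..
   thus "(%j. nrm (Sm j *v W x j - V x j)) ----> 0" using gt x by (simp add: napp)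
  qed
  have actw: "acts M w (W x) (W x)"
   unfolding w_def
  proof (rule actsI[OF wmp Wb[OF x] Wb[OF x]])
   have "wm j *v W x j = W x j" for j
    unfolding wm_def W_def dsum_mult_vec[OF one_carrier_mat n1c xc zero_carrier_vec] zmul[OF n1c]
    using xc by (simp add: one_mult_mat_vec)
   hence "wm j *v W x j - W x j = 0\<^sub>v (M j)" for j using bvecD[OF Wb[OF x], of j] by auto
   thus "(%j. nrm (wm j *v W x j - W x j)) ----> 0" by simp
  qed
  obtain rm where rm: "rm : mprod M" "r = cls M rm" using r(1) by (auto simp: carrier_corona)
  \<comment> \<open>On \<open>W x\<close> the element \<open>S\<close> acts by \<open>t\<close>,
    which is asymptotically isometric there because it carries one model of \<open>x\<close> to the
    other. Hence \<open>r\<close> contributes nothing, and \<open>U\<close> acts like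
    \<open>S\<close>.\<close>
  have actr: "acts M r (W x) (%j. 0\<^sub>v (M j))"
   unfolding rm(2)
  proof (rule acts_zero[OF rm(1) Smp Wb[OF x]])
   have "star ?Q r *[?Q] r = 1[?Q] -[?Q] star ?Q S *[?Q] S" using r(2,3) S_star by simp
   thus "cls M (%k. adj (rm k) * rm k) = cls M (%k. 1\<^sub>m (M k) - adj (Sm k) * Sm k)"
    unfolding rm(2) S_def using rm(1) Smp by (simp add: corona_star corona_mult corona_one corona_minus)
   have tl: "(%j. (nrm (t j *v xj j x))\<^sup>2) ----> Re (f (star C x *[C] x))"
   proof -
    have "(%j. sqrt ((nrm (V x j))\<^sup>2)) ----> sqrt (Re (f (star C x *[C] x)))"
     by (rule tendsto_real_sqrt[OF Vn[OF x]])
    hence zl: "(%j. nrm (zt j x)) ----> sqrt (Re (f (star C x *[C] x)))" by (simp add: V_def napp)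
    have "(%j. nrm (t j *v xj j x) - nrm (zt j x)) ----> 0"
    proof (rule tendsto_rabs_zero_cancel, rule null_sandwich)
     show "\<bar>nrm (t j *v xj j x) - nrm (zt j x)\<bar> <= nrm (t j *v xj j x - zt j x)" for j
      by (rule l2norm_diff_le[OF mvc[OF tc xc] zc])
     show "(%j. nrm (t j *v xj j x - zt j x)) ----> 0" using gt x by blast
    qed simp
    from tendsto_add[OF this zl] have "(%j. nrm (t j *v xj j x)) ----> sqrt (Re (f (star C x *[C] x)))" by simp
    from tendsto_power[OF this, of 2] show ?thesis
     using A.C.pos_functionalD(4)[OF A.f wc[OF x]] by simp
   qed
   show "(%j. (nrm (W x j))\<^sup>2 - (nrm (Sm j *v W x j))\<^sup>2) ----> 0"
    unfolding SW napp using tendsto_diff[OF Wn[OF x] tl] by simp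
  qed
  have "acts M U (W x) (%j. V x j + 0\<^sub>v (M j))"
   unfolding U_def by (rule acts_add[OF actS acts_mult[OF actw actr]])
  moreover have "(%j. V x j + 0\<^sub>v (M j)) = V x" using bvecD[OF Vb[OF x]] by auto
  ultimately show ?thesis by simp
 qed
 have act_words: "acts M (p (geval C (%i. sA (a i)) (%i. sB (b i)) c)) (V x) (V (geval C (%i. sA (a i)) (%i. sB (b i)) c *[C] x))"
  if x: "x : wC.words" for c x
  using x
 proof (induction c arbitrary: x)
  case (GA i)
  have ax: "sA (a i) *[C] x : wC.words" by (rule wmul[OF wC.words_A GA])
  have "acts M (U *[?Q] (tt (q1 (a i)) *[?Q] U)) (V x) (V (sA (a i) *[C] x))"
   by (rule acts_mult[OF acts_mult[OF acts_inverse[OF act_U[OF GA] UC UU] act_a[OF GA]] act_U[OF ax]])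
  thus ?case using p(2)[OF wC.ab_closed(1)] by (simp add: pA_def)
 next
  case (GB i)
  thus ?case using p(3)[OF wC.ab_closed(2)] act_b by (simp add: pB_def)
 next
  case (GAdd c d)
  let ?c = "geval C (%i. sA (a i)) (%i. sB (b i)) c" and ?d = "geval C (%i. sA (a i)) (%i. sB (b i)) d"
  have w: "?c : wC.words" "?d : wC.words" by (auto simp: wC.words_def)
  note cx = wmul[OF w(1) GAdd.prems] and dx = wmul[OF w(2) GAdd.prems]
  have sx: "(?c *[C] x) +[C] (?d *[C] x) : wC.words" (is "?s : _") by (rule wC.words_add[OF cx dx])
  have sum: "(?c +[C] ?d) *[C] x = ?s" using wc[OF w(1)] wc[OF w(2)] wc[OF GAdd.prems] by (simp add: A.C.mult_add_left)
  \<comment> \<open>The assignment of model vectors is not linear in \<open>x\<close>; additivity up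
    to a null sequence is read off from the limits of the Gram matrix.\<close>
  have e: "(nrm (V (?c *[C] x) j + V (?d *[C] x) j - V ?s j))\<^sup>2
   = Re (((zt j (?c *[C] x) *c zt j (?c *[C] x) + zt j (?d *[C] x) *c zt j (?c *[C] x) - zt j ?s *c zt j (?c *[C] x))
    + (zt j (?c *[C] x) *c zt j (?d *[C] x) + zt j (?d *[C] x) *c zt j (?d *[C] x) - zt j ?s *c zt j (?d *[C] x)))
    - (zt j (?c *[C] x) *c zt j ?s + zt j (?d *[C] x) *c zt j ?s - zt j ?s *c zt j ?s))" for j
  proof -
   have "V (?c *[C] x) j + V (?d *[C] x) j - V ?s j = 0\<^sub>v (m j) @\<^sub>v (zt j (?c *[C] x) + zt j (?d *[C] x) - zt j ?s)"
    unfolding V_def using zc[of j "?c *[C] x"] zc[of j "?d *[C] x"] zc[of j ?s] by (intro eq_vecI) auto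
   thus ?thesis using zc[of j "?c *[C] x"] zc[of j "?d *[C] x"] zc[of j ?s]
    by (simp add: napp l2norm_Re cip_simps[of _ "m' j"])
  qed
  define k where "k y z = f (star C z *[C] y)" for y z
  have kl: "(%j. zt j y *c zt j z) ----> k y z" if "y : wC.words" "z : wC.words" for y z
   using gg that unfolding k_def by blast
  have kadd: "k (?c *[C] x) z + k (?d *[C] x) z - k ?s z = 0" if "z : wC.words" for z
   using wc[OF cx] wc[OF dx] wc[OF that] by (simp add: k_def A.C.mult_add_right A.C.pos_functionalD(1)[OF A.f])
  have "(%j. (nrm (V (?c *[C] x) j + V (?d *[C] x) j - V ?s j))\<^sup>2) ---->
   Re (((k (?c *[C] x) (?c *[C] x) + k (?d *[C] x) (?c *[C] x) - k ?s (?c *[C] x))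
    + (k (?c *[C] x) (?d *[C] x) + k (?d *[C] x) (?d *[C] x) - k ?s (?d *[C] x)))
    - (k (?c *[C] x) ?s + k (?d *[C] x) ?s - k ?s ?s))"
   unfolding e by (intro tendsto_Re tendsto_add tendsto_diff kl cx dx sx)
  hence "(%j. (nrm (V (?c *[C] x) j + V (?d *[C] x) j - V ?s j))\<^sup>2) ----> 0"
   unfolding kadd[OF cx] kadd[OF dx] kadd[OF sx] by simp
  hence "(%j. sqrt ((nrm (V (?c *[C] x) j + V (?d *[C] x) j - V ?s j))\<^sup>2)) ----> sqrt 0"
   by (rule tendsto_real_sqrt)
  hence lim: "(%j. nrm (V (?c *[C] x) j + V (?d *[C] x) j - V ?s j)) ----> 0" by simp
  have "p (?c +[C] ?d) = p ?c +[?Q] p ?d" by (rule p.hom_simps(2)[OF wc[OF w(1)] wc[OF w(2)]])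
  thus ?case unfolding geval.simps sum
   by (simp only:) (rule acts_sim[OF acts_add[OF GAdd.IH(1)[OF GAdd.prems] GAdd.IH(2)[OF GAdd.prems]] Vb[OF sx] lim])
 next
  case (GMul c d)
  let ?c = "geval C (%i. sA (a i)) (%i. sB (b i)) c" and ?d = "geval C (%i. sA (a i)) (%i. sB (b i)) d"
  have w: "?c : wC.words" "?d : wC.words" by (auto simp: wC.words_def)
  note dx = wmul[OF w(2) GMul.prems]
  have "acts M (p ?c *[?Q] p ?d) (V x) (V (?c *[C] (?d *[C] x)))"
   by (rule acts_mult[OF GMul.IH(2)[OF GMul.prems] GMul.IH(1)[OF dx]])
  moreover have "p (?c *[C] ?d) = p ?c *[?Q] p ?d" by (rule p.hom_simps(4)[OF wc[OF w(1)] wc[OF w(2)]])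
  moreover have "(?c *[C] ?d) *[C] x = ?c *[C] (?d *[C] x)"
   by (rule A.C.mult_assoc[OF wc[OF w(1)] wc[OF w(2)] wc[OF GMul.prems]])
  ultimately show ?case by simp
 qed

 \<comment> \<open>Injectivity of the extension\<close>
 have one_w: "1[C] : wC.words" using wC.words_A[of 0] a0 by simp
 define f1 where "f1 = Re (f 1[C])"
 have f1: "0 <= f1" using A.C.pos_functionalD(4)[OF A.f A.C.one_closed] by (simp add: f1_def)
 have bound: "Re (f (star C c *[C] c)) <= r\<^sup>2 * f1" if c: "c : wC.words" and r: "cnorm ?Q (p c) < r" for c r
 proof -
  obtain e where e: "c = geval C (%i. sA (a i)) (%i. sB (b i)) e" using c by (auto simp: wC.words_def)
  have "acts M (p c) (V 1[C]) (V c)" using act_words[OF one_w, of e] wc[OF c] e by simp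
  moreover have "(%j. (nrm (V 1[C] j))\<^sup>2) ----> f1" using Vn[OF one_w] by (simp add: f1_def)
  ultimately show ?thesis using acts_norm[OF _ _ Vn[OF c] r] by blast
 qed
 have inj0: "x = 0[C]" if x: "x : carrier C" and px: "p x = 0[?Q]" for x
 proof (rule faith[OF x])
  have "Re (f (star C x *[C] x)) <= 0 + e" if e: "e > 0" for e
  proof -
   \<comment> \<open>After the parallelogram bound the distance of \<open>x\<close> to the word
     contributes \<open>4 * et^2\<close> and the word itself \<open>2 * f1 * et^2\<close>; together
     this is \<open>e\<close>.\<close>
   define et where "et = sqrt (e / (4 + 2 * f1))"
   have eta: "et > 0" "et\<^sup>2 * (4 + 2 * f1) = e" using e f1 by (simp_all add: et_def)
   have "x : wC.W" using x dense by simp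
   then obtain c where c: "c : wC.words" "cnorm C (x -[C] c) < et"
    using eta(1) unfolding wC.W_def norm_closure_def by blast
   note cc = wc[OF c(1)]
   have "0[?Q] -[?Q] p c = \<ominus>\<^bsub>?Q\<^esub> p c" using p.hom_simps(1)[OF cc] by (simp add: a_minus_def)
   hence "p (x -[C] c) = \<ominus>\<^bsub>?Q\<^esub> p c" using p.hom_diff[OF x cc] px by simp
   hence "cnorm ?Q (p c) = cnorm ?Q (p (x -[C] c))" using p.hom_simps(1)[OF cc] by simp
   hence "cnorm ?Q (p c) < et" using p.hom_contractive[of "x -[C] c"] x cc c(2) by simp
   from bound[OF c(1) this] have b1: "Re (f (star C c *[C] c)) <= et\<^sup>2 * f1" .
   have "Re (f (star C (x -[C] c) *[C] (x -[C] c))) <= cmod (f (star C (x -[C] c) *[C] (x -[C] c)))"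
    by (rule complex_Re_le_cmod)
   also have "... <= 2 * cnorm C (star C (x -[C] c) *[C] (x -[C] c))"
    by (rule A.C.pos_functionalD(5)[OF A.f]) (use x cc in simp)
   also have "... = 2 * (cnorm C (x -[C] c))\<^sup>2" using x cc by (simp add: A.C.cnorm_cstar)
   also have "... <= 2 * et\<^sup>2" using c(2) x cc by (intro mult_left_mono power_mono) auto
   finally have b2: "Re (f (star C (x -[C] c) *[C] (x -[C] c))) <= 2 * et\<^sup>2" .
   have "x = (x -[C] c) +[C] c" using A.C.diff_add_cancel[OF x cc] by simp
   hence "Re (f (star C x *[C] x)) <= 2 * Re (f (star C (x -[C] c) *[C] (x -[C] c))) + 2 * Re (f (star C c *[C] c))"
    using A.C.parallelogram[OF A.f, of "x -[C] c" c] x cc by simp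
   also have "... <= et\<^sup>2 * (4 + 2 * f1)" using b1 b2 by (simp add: algebra_simps)
   finally show ?thesis using eta(2) by simp
  qed
  hence "Re (f (star C x *[C] x)) <= 0" by (rule field_le_epsilon)
  thus "Re (f (star C x *[C] x)) = 0" using A.C.pos_functionalD(4)[OF A.f x] by linarith
 qed
 have "inj_on p (carrier C)"
 proof (rule inj_onI)
  fix x y assume x: "x : carrier C" and y: "y : carrier C" and eq: "p x = p y"
  have "p (x -[C] y) = 0[?Q]" using x y eq by (simp add: p.hom_diff)
  hence "x -[C] y = 0[C]" by (intro inj0) (use x y in auto)
  thus "x = y" by (rule A.C.diff_eq_zero[OF x y])
 qed
 hence "embedding C ?Q p" using p(1) by (simp add: embedding_def)
 thus ?thesis using Mpos by blast
qed

end

section \<open>The spectral theorem for hermitian matrices\<close>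

definition krylov :: "complex mat => complex vec => nat => complex vec" where
 "krylov A x j = ((%v. A *v v) ^^ j) x"

lemma krylov_carrier: "A : cmat n n ==> x : cvec n ==> krylov A x j : cvec n"
 by (induction j) (auto simp: krylov_def)

lemma krylov_Suc: "krylov A x (Suc j) = A *v krylov A x j"
 by (simp add: krylov_def)

text \<open>The vector \<open>p(A) x\<close>. Working with vectors instead of the matrix
  \<open>p(A)\<close> keeps the construction inside the Krylov space of \<open>x\<close>.\<close>

definition pevec :: "complex mat => complex vec => complex poly => complex vec" where
 "pevec A x p = vsum (dim_row A) (%j. coeff p j *s krylov A x j) (Suc (degree p))"

lemma pevec_carrier: "A : cmat n n ==> pevec A x p : cvec n"
 by (auto simp: pevec_def)

lemma pevec_bound:
 assumes A: "A : cmat n n" and x: "x : cvec n" and N: "degree p < N"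
 shows "pevec A x p = vsum n (%j. coeff p j *s krylov A x j) N"
proof (rule eq_vecI)
 fix i assume "i < dim_vec (vsum n (%j. coeff p j *s krylov A x j) N)"
 hence i: "i < n" by (simp add: vsum_def)
 have "(SUM j<Suc (degree p). coeff p j * krylov A x j $ i) = (SUM j<N. coeff p j * krylov A x j $ i)"
  by (rule sum.mono_neutral_left) (use N in \<open>auto intro: coeff_eq_0\<close>)
 thus "pevec A x p $ i = vsum n (%j. coeff p j *s krylov A x j) N $ i"
  using A i carrier_vecD[OF krylov_carrier[OF A x]] by (simp add: pevec_def vsum_def)
qed (use A in \<open>simp add: pevec_def vsum_def\<close>)

lemma pevec_linear_factor:
 assumes A: "A : cmat n n" and x: "x : cvec n"
 shows "pevec A x ([:- mm, 1:] * q) = A *v pevec A x q - mm *s pevec A x q"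
proof -
 let ?N = "Suc (degree q)"
 have k: "!!j. krylov A x j : cvec n" by (rule krylov_carrier[OF A x])
 have kd: "dim_vec (krylov A x j) = n" for j using k[of j] by simp
 have d: "degree ([:- mm, 1:] * q) < Suc ?N"
  using degree_mult_le[of "[:- mm, 1:]" q] by simp
 have Aq: "A *v pevec A x q = vsum n (%j. coeff q j *s krylov A x (Suc j)) ?N"
 proof -
  have "A *v vsum n (%j. coeff q j *s krylov A x j) ?N = vsum n (%j. A *v (coeff q j *s krylov A x j)) ?N"
   by (rule mult_mat_vsum[OF A]) (use k in auto)
  also have "... = vsum n (%j. coeff q j *s krylov A x (Suc j)) ?N"
   by (simp add: mult_mat_vec_smult[OF A k] krylov_Suc)
  finally show ?thesis by (simp add: pevec_bound[OF A x, of q ?N])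
 qed
 show ?thesis
 proof (rule eq_vecI)
  show "dim_vec (pevec A x ([:- mm, 1:] * q)) = dim_vec (A *v pevec A x q - mm *s pevec A x q)"
   using A by (simp add: pevec_def vsum_def)
  fix i assume "i < dim_vec (A *v pevec A x q - mm *s pevec A x q)"
  hence i: "i < n" using A by (simp add: pevec_def vsum_def)
  have "pevec A x ([:- mm, 1:] * q) $ i = (SUM j<Suc ?N. coeff ([:- mm, 1:] * q) j * krylov A x j $ i)"
   unfolding pevec_bound[OF A x d] using i kd by (simp add: vsum_def)
  also have "... = (SUM j<Suc ?N. coeff (pCons 0 q) j * krylov A x j $ i) - (SUM j<Suc ?N. mm * (coeff q j * krylov A x j $ i))"
   unfolding sum_subtractf[symmetric] by (intro sum.cong refl) (simp add: algebra_simps)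
  also have "(SUM j<Suc ?N. coeff (pCons 0 q) j * krylov A x j $ i) = (SUM j<?N. coeff q j * krylov A x (Suc j) $ i)"
   by (subst sum.lessThan_Suc_shift) simp
  also have "(SUM j<Suc ?N. mm * (coeff q j * krylov A x j $ i)) = mm * (SUM j<?N. coeff q j * krylov A x j $ i)"
   by (simp add: sum_distrib_left coeff_eq_0 algebra_simps)
  also have "(SUM j<?N. coeff q j * krylov A x (Suc j) $ i) - mm * (SUM j<?N. coeff q j * krylov A x j $ i)
   = (A *v pevec A x q - mm *s pevec A x q) $ i"
  proof -
   have 1: "(A *v pevec A x q) $ i = (SUM j<?N. coeff q j * krylov A x (Suc j) $ i)"
    unfolding Aq using i kd by (simp add: vsum_def)
   have 2: "pevec A x q $ i = (SUM j<?N. coeff q j * krylov A x j $ i)"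
    unfolding pevec_bound[OF A x, of q ?N, OF lessI] using i kd by (simp add: vsum_def)
   have "dim_vec (pevec A x q) = n" using pevec_carrier[OF A, of x q] by simp
   thus ?thesis using i by (simp add: 1 2)
  qed
  finally show "pevec A x ([:- mm, 1:] * q) $ i = (A *v pevec A x q - mm *s pevec A x q) $ i" .
 qed
qed

text \<open>The first \<open>n + 1\<close> Krylov vectors are the columns of a matrix padded with a
  zero row. It is square and singular, and a kernel vector lists the coefficients of
  \<open>p\<close>.\<close>

lemma krylov_dependent:
 assumes A: "A : cmat n n" and x: "x : cvec n"
 shows "EX p. p ~= 0 & pevec A x p = 0\<^sub>v n"
proof -
 have kd: "dim_vec (krylov A x j) = n" for j using krylov_carrier[OF A x, of j] by simp
 define M where "M = mat (Suc n) (Suc n) (%(i, j). if i < n then krylov A x j $ i else 0)"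
 have M: "M : cmat (Suc n) (Suc n)" by (simp add: M_def)
 have "transpose_mat M *v unit_vec (Suc n) n = 0\<^sub>v (Suc n)"
  by (rule eq_vecI) (auto simp: M_def scalar_prod_def unit_vec_def intro!: sum.neutral)
 moreover have "unit_vec (Suc n) n ~= (0\<^sub>v (Suc n) :: complex vec)"
 proof
  assume "unit_vec (Suc n) n = (0\<^sub>v (Suc n) :: complex vec)"
  hence "unit_vec (Suc n) n $ n = (0\<^sub>v (Suc n) :: complex vec) $ n" by simp
  thus False by simp
 qed
 ultimately have "EX v. v : cvec (Suc n) & v ~= 0\<^sub>v (Suc n) & transpose_mat M *v v = 0\<^sub>v (Suc n)"
  by (intro exI[of _ "unit_vec (Suc n) n"]) simp
 hence "det (transpose_mat M) = 0"
  using det_0_iff_vec_prod_zero[of "transpose_mat M" "Suc n"] M by simp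
 hence "det M = 0" using det_transpose[OF M] by simp
 then obtain c where c: "c : cvec (Suc n)" "c ~= 0\<^sub>v (Suc n)" "M *v c = 0\<^sub>v (Suc n)"
  using det_0_iff_vec_prod_zero[OF M] by auto
 define p where "p = Poly (list_of_vec c)"
 have cf: "coeff p j = (if j < Suc n then c $ j else 0)" for j
  using c(1) by (auto simp: p_def coeff_Poly_eq nth_default_def list_of_vec_index)
 have "p ~= 0"
 proof
  assume p0: "p = 0"
  have "c = 0\<^sub>v (Suc n)"
  proof (rule eq_vecI)
   fix i assume "i < dim_vec (0\<^sub>v (Suc n) :: complex vec)"
   thus "c $ i = 0\<^sub>v (Suc n) $ i" using cf[of i] p0 by simp
  qed (use c(1) in simp)
  thus False using c(2) by simp
 qed
 have d: "degree p < Suc n" by (rule degree_lessI) (use `p ~= 0` cf in auto)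
 have "pevec A x p = 0\<^sub>v n"
 proof (rule eq_vecI)
  fix i assume "i < dim_vec (0\<^sub>v n :: complex vec)"
  hence i: "i < n" by simp
  have "pevec A x p $ i = (SUM j<Suc n. c $ j * krylov A x j $ i)"
   unfolding pevec_bound[OF A x d] using i kd by (simp add: vsum_def cf)
  also have "... = (M *v c) $ i"
   using i c(1) by (simp add: M_def scalar_prod_def mult.commute atLeast0LessThan)
  also have "... = 0" unfolding c(3) using i by simp
  finally show "pevec A x p $ i = 0\<^sub>v n $ i" using i by simp
 qed (use A in \<open>simp add: pevec_def vsum_def\<close>)
 thus ?thesis using `p ~= 0` by blast
qed

text \<open>A polynomial \<open>p\<close> of least degree with \<open>p(A)x = 0\<close> factors as \<open>(X - \<mu>)q\<close>, and \<open>q(A)x\<close> is an eigenvector.\<close>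

lemma invariant_eigenvector:
 fixes A :: "complex mat"
 assumes A: "A : cmat n n" and x: "x : cvec n" "x ~= 0\<^sub>v n"
 obtains y mm where "y : cvec n" "y ~= 0\<^sub>v n" "A *v y = mm *s y"
  "!!v. v : cvec n ==> (!!j. krylov A x j *c v = 0) ==> y *c v = 0"
proof -
 define d where "d = (LEAST d. EX p. p ~= 0 & pevec A x p = 0\<^sub>v n & degree p = d)"
 have "EX d p. p ~= 0 & pevec A x p = 0\<^sub>v n & degree p = d" using krylov_dependent[OF A x(1)] by blast
 hence "EX p. p ~= 0 & pevec A x p = 0\<^sub>v n & degree p = d" unfolding d_def by (rule LeastI_ex)
 then obtain p where p: "p ~= 0" "pevec A x p = 0\<^sub>v n" "degree p = d" by blast
 have least: "d <= degree q" if "q ~= 0" "pevec A x q = 0\<^sub>v n" for q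
  unfolding d_def by (rule Least_le) (use that in blast)
 have "d ~= 0"
 proof
  assume "d = 0"
  then obtain c where c: "p = [:c:]" using p(3) degree_eq_zeroE by blast
  hence c0: "c ~= 0" using p(1) by auto
  have "c *s x = 0\<^sub>v n"
  proof -
   have "pevec A x p = c *s x" using x A
    by (intro eq_vecI) (auto simp: pevec_def vsum_def c krylov_def)
   thus ?thesis using p(2) by simp
  qed
  hence "(c *s x) $ i = 0" if "i < n" for i using that by simp
  hence "x = 0\<^sub>v n" using c0 x(1) by (intro eq_vecI) auto
  thus False using x(2) by simp
 qed
 hence "\<not> constant (poly p)" using p(3) by (simp add: constant_degree)
 then obtain mm where "poly p mm = 0" using fundamental_theorem_of_algebra by blast
 then obtain q where q: "p = [:- mm, 1:] * q" by (auto simp: poly_eq_0_iff_dvd)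
 have q0: "q ~= 0" using q p(1) by auto
 have "degree p = Suc (degree q)" unfolding q using q0 by (subst degree_mult_eq) auto
 hence ne: "pevec A x q ~= 0\<^sub>v n" using least[OF q0] p(3) by force
 note yc = pevec_carrier[OF A, of x q]
 have "A *v pevec A x q - mm *s pevec A x q = 0\<^sub>v n"
  using p(2) unfolding q pevec_linear_factor[OF A x(1)] .
 hence ev: "A *v pevec A x q = mm *s pevec A x q"
 proof -
  assume z: "A *v pevec A x q - mm *s pevec A x q = 0\<^sub>v n"
  note Ay = mvc[OF A yc]
  show ?thesis
  proof (rule eq_vecI)
   fix i assume "i < dim_vec (mm *s pevec A x q)"
   hence i: "i < n" using yc by simp
   have "(A *v pevec A x q - mm *s pevec A x q) $ i = 0" using z i by simp
   thus "(A *v pevec A x q) $ i = (mm *s pevec A x q) $ i" using i yc by (simp del: index_mult_mat_vec)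
  qed (use A yc in simp)
 qed
 have perp: "pevec A x q *c v = 0" if v: "v : cvec n" and z: "!!j. krylov A x j *c v = 0" for v
 proof -
  have k: "!!j. krylov A x j : cvec n" by (rule krylov_carrier[OF A x(1)])
  have "pevec A x q *c v = (SUM j<Suc (degree q). (coeff q j *s krylov A x j) *c v)"
   unfolding pevec_bound[OF A x(1) lessI] by (rule cip_vsum_left) (use k v in auto)
  also have "... = 0" by (rule sum.neutral) (use k v z in \<open>simp add: cip_smult_left[of _ n]\<close>)
  finally show ?thesis .
 qed
 show ?thesis by (rule that[OF yc ne ev perp])
qed

definition eigen_system :: "complex mat => nat => nat => (nat => complex vec) => (nat => real) => bool" where
 "eigen_system A n r v ew \<longleftrightarrow> (ALL i<r. v i : cvec n & A *v v i = cr (ew i) *s v i) &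
  (ALL i<r. ALL j<r. v i *c v j = (if i = j then 1 else 0))"

lemma orthonormal_bessel:
 fixes r :: nat and v :: "nat => complex vec"
 assumes v: "!!i. i < r ==> v i : cvec n"
  and on: "!!i j. i < r ==> j < r ==> v i *c v j = (if i = j then 1 else 0)" and x: "x : cvec n"
 shows "(SUM i<r. (cmod (x *c v i))\<^sup>2) <= (nrm x)\<^sup>2"
 using almost_bessel[where ep = 0, OF v _ _ x] on by simp

text \<open>Summed by coordinates instead of by vectors, the squared entries contribute at most 1
  for each coordinate, by Bessel's inequality for a unit vector.\<close>

lemma orthonormal_length_le:
 fixes r :: nat and v :: "nat => complex vec"
 assumes v: "!!i. i < r ==> v i : cvec n"
  and on: "!!i j. i < r ==> j < r ==> v i *c v j = (if i = j then 1 else 0)"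
 shows "r <= n"
proof -
 have "real r = (SUM i<r. (nrm (v i))\<^sup>2)" using on by (simp add: l2norm_Re)
 also have "... = (SUM i<r. SUM k<n. (cmod (v i $ k))\<^sup>2)" by (intro sum.cong refl l2norm_sq v) simp
 also have "... = (SUM k<n. SUM i<r. (cmod (v i $ k))\<^sup>2)" by (rule sum.swap)
 also have "... <= (SUM k<n. 1)"
 proof (rule sum_mono)
  fix k assume "k : {..<n}"
  hence k: "k < n" by simp
  have u: "unit_vec n k *c v i = cnj (v i $ k)" if "i < r" for i
  proof -
   have "unit_vec n k *c v i = (SUM l<n. if l = k then cnj (v i $ k) else 0)"
    unfolding cip_sum[OF v[OF that]] using k by (intro sum.cong refl) (simp add: unit_vec_def)
   thus ?thesis using k by simp
  qed
  have "(nrm (unit_vec n k))\<^sup>2 = 1" using k by (simp add: l2norm_unit_vec)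
  hence "(SUM i<r. (cmod (unit_vec n k *c v i))\<^sup>2) <= 1"
   using orthonormal_bessel[OF v on, of r "unit_vec n k"] by simp
  thus "(SUM i<r. (cmod (v i $ k))\<^sup>2) <= 1" using u by simp
 qed
 finally show ?thesis by simp
qed

text \<open>Take an orthonormal eigensystem of maximal length. A nonzero \<open>x\<close> orthogonal
  to it has its whole Krylov space orthogonal to it; an eigenvector found there would lengthen the
  system after normalisation.\<close>

lemma hermitian_eigenbasis:
 fixes A :: "complex mat"
 assumes A: "A : cmat n n" and h: "adj A = A"
 obtains r v ew where "eigen_system A n r v ew" "!!x. x : cvec n ==> (!!i. i < r ==> x *c v i = 0) ==> x = 0\<^sub>v n"
proof -
 define R where "R = {r. EX v ew. eigen_system A n r v ew}"
 have "0 : R" by (simp add: R_def eigen_system_def)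
 have "R \<subseteq> {..n}"
 proof
  fix r assume "r : R"
  then obtain v ew where "eigen_system A n r v ew" by (auto simp: R_def)
  hence "!!i. i < r ==> v i : cvec n" "!!i j. i < r ==> j < r ==> v i *c v j = (if i = j then 1 else 0)"
   unfolding eigen_system_def by auto
  from orthonormal_length_le[OF this] show "r : {..n}" by simp
 qed
 hence fin: "finite R" by (rule finite_subset) simp
 have "Max R : R" using fin \<open>0 : R\<close> by (intro Max_in) auto
 then obtain v ew where es: "eigen_system A n (Max R) v ew" by (auto simp: R_def)
 let ?r = "Max R"
 have vc: "v i : cvec n" and ev: "A *v v i = cr (ew i) *s v i" if "i < ?r" for i
  using es that by (auto simp: eigen_system_def)
 have on: "v i *c v j = (if i = j then 1 else 0)" if "i < ?r" "j < ?r" for i j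
  using es that by (auto simp: eigen_system_def)
 have sym: "(A *v x) *c y = x *c (A *v y)" if "x : cvec n" "y : cvec n" for x y
  using cip_adj[OF A that] h by simp
 have "x = 0\<^sub>v n" if x: "x : cvec n" and perp: "!!i. i < ?r ==> x *c v i = 0" for x
 proof (rule ccontr)
  assume x0: "x ~= 0\<^sub>v n"
  obtain y mm where y: "y : cvec n" "y ~= 0\<^sub>v n" "A *v y = mm *s y"
   "!!v. v : cvec n ==> (!!j. krylov A x j *c v = 0) ==> y *c v = 0"
   using invariant_eigenvector[OF A x x0] by blast
  have kp: "krylov A x j *c v i = 0" if i: "i < ?r" for i j
  proof (induction j)
   case 0 show ?case using perp[OF i] by (simp add: krylov_def)
  next
   case (Suc j)
   have "krylov A x (Suc j) *c v i = krylov A x j *c (cr (ew i) *s v i)"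
    unfolding krylov_Suc sym[OF krylov_carrier[OF A x] vc[OF i]] ev[OF i] ..
   also have "... = 0" using Suc vc[OF i] krylov_carrier[OF A x, of j] by (simp add: cip_smult_right[of _ n])
   finally show ?case .
  qed
  have yv: "y *c v i = 0" if "i < ?r" for i by (rule y(4)[OF vc[OF that] kp[OF that]])
  have vy: "v i *c y = 0" if "i < ?r" for i using cip_commute[OF y(1) vc[OF that]] yv[OF that] by simp
  define g where "g = nrm y"
  have "nrm y ~= 0" using l2norm_eq_zero[OF y(1)] y(2) by blast
  hence g: "g > 0" using l2norm_nonneg[of y] unfolding g_def by linarith
  have yy: "y *c y = cr (g * g)" unfolding g_def cip_self_l2norm by (simp add: power2_eq_square)
  have "mm * (y *c y) = cnj mm * (y *c y)"
   using sym[OF y(1,1)] y(1) by (simp add: y(3) cip_smult_left[of _ n] cip_smult_right[of _ n])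
  hence "mm = cnj mm" using yy g by simp
  hence mu: "mm = cr (Re mm)" by (simp add: complex_eq_iff)
  define u where "u = cr (1 / g) *s y"
  have uc: "u : cvec n" using y(1) by (simp add: u_def)
  have uu: "u *c u = 1"
   using y(1) g by (simp add: u_def cip_smult_left[of _ n] cip_smult_right[of _ n] yy)
  have uv: "u *c v i = 0" "v i *c u = 0" if "i < ?r" for i
   using y(1) vc[OF that] yv[OF that] vy[OF that] by (simp_all add: u_def cip_smult_left[of _ n] cip_smult_right[of _ n])
  have Au: "A *v u = cr (Re mm) *s u"
   unfolding u_def mult_mat_vec_smult[OF A y(1)] y(3) mu[symmetric] by (simp add: smult_smult_assoc mult.commute)
  have "eigen_system A n (Suc ?r) (v(?r := u)) (ew(?r := Re mm))"
   unfolding eigen_system_def using vc ev on uc uu uv Au by (auto simp: less_Suc_eq)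
  hence "Suc ?r : R" by (auto simp: R_def)
  thus False using Max_ge[OF fin] by fastforce
 qed
 thus ?thesis using that es by blast
qed

text \<open>For an eigenvalue the product of its distances to 0 and 1 is at most \<open>dl\<close>
  and the larger one is at least \<open>1/2\<close>, so rounding moves it by at most
  \<open>2 * dl\<close>. The columns of \<open>V\<close> are the eigenvectors whose eigenvalue
  rounds to 1, possibly none.\<close>

lemma almost_projection_isometry:
 fixes A :: "complex mat"
 assumes A: "A : cmat n n" and h: "adj A = A" and dl: "opn (A * A - A) <= dl"
 obtains m V where "V : cmat n m" "adj V * V = 1\<^sub>m m" "opn (V * adj V - A) <= 2 * dl"
proof -
 obtain r v ew where es: "eigen_system A n r v ew"
  and total: "!!x. x : cvec n ==> (!!i. i < r ==> x *c v i = 0) ==> x = 0\<^sub>v n"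
  using hermitian_eigenbasis[OF A h] by blast
 have vc: "v i : cvec n" and ev: "A *v v i = cr (ew i) *s v i" if "i < r" for i
  using es that by (auto simp: eigen_system_def)
 have on: "v i *c v j = (if i = j then 1 else 0)" if "i < r" "j < r" for i j
  using es that by (auto simp: eigen_system_def)
 have d0: "0 <= dl" using dl order_trans[OF opnorm_nonneg] by blast
 have lam: "\<bar>ew i * ew i - ew i\<bar> <= dl" if i: "i < r" for i
 proof -
  have Av: "A *v v i : cvec n" by (rule mvc[OF A vc[OF i]])
  have "(A * A - A) *v v i = cr (ew i * ew i - ew i) *s v i"
  proof -
   have "(A * A - A) *v v i = A *v (A *v v i) - A *v v i"
    by (simp add: minus_mult_distrib_mat_vec[OF mmc[OF A A] A vc[OF i]] assoc_mult_mat_vec[OF A A vc[OF i]])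
   also have "... = cr (ew i) *s (cr (ew i) *s v i) - cr (ew i) *s v i"
    by (simp add: ev[OF i] mult_mat_vec_smult[OF A vc[OF i]])
   also have "... = cr (ew i * ew i - ew i) *s v i"
    using vc[OF i] by (intro eq_vecI) (auto simp: algebra_simps)
   finally show ?thesis .
  qed
  hence "nrm (cr (ew i * ew i - ew i) *s v i) <= opn (A * A - A) * nrm (v i)"
   using opnorm_vec[OF minus_carrier_mat[OF A, of "A * A"] vc[OF i]] by simp
  moreover have "nrm (v i) = 1" using on[OF i i] by (simp add: vec_l2norm_def)
  ultimately show ?thesis using dl by (simp only: l2norm_smult norm_of_real mult_1_right)
 qed
 define ch :: "nat => real" where "ch i = (if ew i >= 1/2 then 1 else 0)" for i
 have chi: "\<bar>ch i - ew i\<bar> <= 2 * dl" if i: "i < r" for i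
 proof (cases "ew i >= 1/2")
  case True
  have "ew i * ew i - ew i = ew i * (ew i - 1)" by (simp add: algebra_simps)
  hence "\<bar>ew i\<bar> * \<bar>ew i - 1\<bar> <= dl" using lam[OF i] by (simp add: abs_mult)
  moreover have "(1/2) * \<bar>ew i - 1\<bar> <= \<bar>ew i\<bar> * \<bar>ew i - 1\<bar>" using True by (intro mult_right_mono) auto
  ultimately show ?thesis using True by (simp add: ch_def abs_minus_commute)
 next
  case False
  have "ew i * ew i - ew i = ew i * (ew i - 1)" by (simp add: algebra_simps)
  hence "\<bar>ew i\<bar> * \<bar>ew i - 1\<bar> <= dl" using lam[OF i] by (simp add: abs_mult)
  moreover have "\<bar>ew i\<bar> * (1/2) <= \<bar>ew i\<bar> * \<bar>ew i - 1\<bar>" using False by (intro mult_left_mono) auto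
  ultimately show ?thesis using False by (simp add: ch_def)
 qed
 define L where "L = filter (%i. ew i >= 1/2) [0..<r]"
 define m where "m = length L"
 define b where "b p = v (L ! p)" for p
 have Ld: "distinct L" by (simp add: L_def)
 have Ls: "set L = {i. i < r & ew i >= 1/2}" by (auto simp: L_def)
 have Lr: "L ! p < r" if "p < m" for p using nth_mem[of p L] that Ls by (auto simp: m_def)
 have bc: "b p : cvec n" if "p < m" for p using vc[OF Lr[OF that]] by (simp add: b_def)
 have bon: "b p *c b q = (if p = q then 1 else 0)" if "p < m" "q < m" for p q
  using on[OF Lr[OF that(1)] Lr[OF that(2)]] nth_eq_iff_index_eq[OF Ld, of p q] that by (simp add: b_def m_def)
 define V where "V = mat n m (%(i, p). b p $ i)"
 have V: "V : cmat n m" by (simp add: V_def)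
 have VV: "adj V * V = 1\<^sub>m m"
 proof (rule eq_matI)
  fix p q assume pq: "p < dim_row (1\<^sub>m m :: complex mat)" "q < dim_col (1\<^sub>m m :: complex mat)"
  have "(adj V * V) $$ (p, q) = (SUM i<n. cnj (b p $ i) * b q $ i)"
   using pq V by (simp add: scalar_prod_def adj_index atLeast0LessThan V_def)
  also have "... = b q *c b p" using pq by (simp add: cip_sum[OF bc] mult.commute)
  finally show "(adj V * V) $$ (p, q) = 1\<^sub>m m $$ (p, q)" using bon[of q p] pq by auto
 qed (use V in auto)
 have proj: "V * adj V = rank_sum n n b b m"
  using V by (intro eq_matI) (auto simp: rank_sum_def scalar_prod_def adj_index V_def atLeast0LessThan)
 have expand: "x = vsum n (%i. (x *c v i) *s v i) r" if x: "x : cvec n" for x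
 proof -
  let ?w = "vsum n (%i. (x *c v i) *s v i) r"
  have "x - ?w = 0\<^sub>v n"
  proof (rule total)
   fix j assume j: "j < r"
   have "?w *c v j = (SUM i<r. ((x *c v i) *s v i) *c v j)" by (rule cip_vsum_left) (use vc j in auto)
   also have "... = (SUM i<r. if i = j then x *c v i else 0)"
    by (intro sum.cong refl) (use vc j on in \<open>simp add: cip_smult_left[of _ n]\<close>)
   also have "... = x *c v j" using j by simp
   finally show "(x - ?w) *c v j = 0" using x vc[OF j] by (simp add: cip_minus_left[of _ n])
  qed (use x in simp)
  hence "(x - ?w) $ i = 0" if "i < n" for i using that by simp
  thus ?thesis using x by (intro eq_vecI) (auto simp: vsum_def)
 qed
 have "opn (V * adj V - A) <= 2 * dl"
 proof (rule opnorm_le)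
  show "0 <= 2 * dl" using d0 by simp
  fix x :: "complex vec" assume "x : cvec (dim_col (V * adj V - A))"
  hence x: "x : cvec n" using A by simp
  define c where "c i = x *c v i" for i
  have bs: "c i *s v i : cvec n" if "i < r" for i using vc[OF that] by simp
  have Ax: "A *v x = vsum n (%i. (cr (ew i) * c i) *s v i) r"
  proof -
   have "A *v x = A *v vsum n (%i. c i *s v i) r" using expand[OF x] by (simp add: c_def)
   also have "... = vsum n (%i. A *v (c i *s v i)) r" by (rule mult_mat_vsum[OF A bs])
   also have "... = vsum n (%i. (cr (ew i) * c i) *s v i) r"
    unfolding vsum_def by (intro eq_vecI) (auto intro!: sum.cong simp: mult_mat_vec_smult[OF A vc] ev carrier_vecD[OF vc])
   finally show ?thesis .
  qed
  have Px: "rank_sum n n b b m *v x = vsum n (%i. (cr (ch i) * c i) *s v i) r"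
  proof -
   have "rank_sum n n b b m *v x = vsum n (%p. (x *c b p) *s b p) m" by (rule rank_sum_vec[OF bc bc x])
   also have "... = vsum n (%i. (cr (ch i) * c i) *s v i) r"
   proof (rule eq_vecI)
    fix k assume "k < dim_vec (vsum n (%i. (cr (ch i) * c i) *s v i) r)"
    hence k: "k < n" by (simp add: vsum_def)
    have "(SUM p<m. (x *c b p) * b p $ k) = (SUM p<m. c (L ! p) * v (L ! p) $ k)" by (simp add: b_def c_def)
    also have "... = (SUM i:set L. c i * v i $ k)"
     using bij_betw_nth[OF Ld refl refl] unfolding m_def by (rule sum.reindex_bij_betw)
    also have "... = (SUM i<r. cr (ch i) * c i * v i $ k)"
     unfolding Ls by (rule sum.mono_neutral_cong_left) (auto simp: ch_def)
    finally show "vsum n (%p. (x *c b p) *s b p) m $ k = vsum n (%i. (cr (ch i) * c i) *s v i) r $ k"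
     using k by (simp add: vsum_def carrier_vecD[OF bc] carrier_vecD[OF vc])
   qed (simp add: vsum_def)
   finally show ?thesis .
  qed
  have "(V * adj V - A) *v x = rank_sum n n b b m *v x - A *v x"
   unfolding proj by (rule minus_mult_distrib_mat_vec[OF rank_sum_carrier A x])
  also have "... = vsum n (%i. (cr (ch i - ew i) * c i) *s v i) r"
   unfolding Ax Px by (rule eq_vecI)
    (auto simp: vsum_def carrier_vecD[OF vc] sum_subtractf[symmetric] algebra_simps intro!: sum.cong)
  finally have "(nrm ((V * adj V - A) *v x))\<^sup>2 <= (1 + real r * 0) * (SUM i<r. (cmod (cr (ch i - ew i) * c i))\<^sup>2)"
   by (simp only:) (rule almost_orthonormal_norm[OF vc], simp_all add: on)
  also have "... = (SUM i<r. (cmod (cr (ch i - ew i) * c i))\<^sup>2)" by simp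
  also have "... <= (SUM i<r. (2 * dl)\<^sup>2 * (cmod (c i))\<^sup>2)"
  proof (rule sum_mono)
   fix i assume "i : {..<r}"
   hence "\<bar>ch i - ew i\<bar>\<^sup>2 <= (2 * dl)\<^sup>2" using chi by (intro power_mono) auto
   thus "(cmod (cr (ch i - ew i) * c i))\<^sup>2 <= (2 * dl)\<^sup>2 * (cmod (c i))\<^sup>2"
    unfolding norm_mult norm_of_real power_mult_distrib by (rule mult_right_mono) simp
  qed
  also have "... = (2 * dl)\<^sup>2 * (SUM i<r. (cmod (c i))\<^sup>2)" by (simp add: sum_distrib_left)
  also have "... <= (2 * dl)\<^sup>2 * (nrm x)\<^sup>2"
   unfolding c_def by (intro mult_left_mono orthonormal_bessel[OF vc on x]) auto
  also have "... = (2 * dl * nrm x)\<^sup>2" by (simp add: power_mult_distrib)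
  finally show "nrm ((V * adj V - A) *v x) <= 2 * dl * nrm x"
   by (rule power2_le_imp_le) (use d0 in simp)
 qed
 thus ?thesis using that V VV by blast
qed

section \<open>Compressing to a corner\<close>

lemma isometry_opnorm:
 assumes V: "V : cmat n m" and VV: "adj V * V = 1\<^sub>m m"
 shows "opn V <= 1"
proof (rule opnorm_le)
 fix v :: "complex vec" assume "v : cvec (dim_col V)"
 hence v: "v : cvec m" using V by simp
 have "adj V *v (V *v v) = v"
  using assoc_mult_mat_vec[OF adj_carrier[OF V] V v] VV v by simp
 hence "(nrm (V *v v))\<^sup>2 = (nrm v)\<^sup>2"
  using cip_adj'[OF V mvc[OF V v] v] by (simp add: l2norm_Re)
 thus "nrm (V *v v) <= 1 * nrm v" by (simp add: power2_eq_iff_nonneg)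
qed simp

lemma opnorm_contract:
 assumes A: "A : cmat k l" and B: "B : cmat l m" and C: "C : cmat m o'"
  and n: "opn A <= 1" "opn C <= 1"
 shows "opn (A * B * C) <= opn B"
proof -
 have "opn (A * B * C) <= opn (A * B) * opn C" by (rule opnorm_mult[OF mmc[OF A B] C])
 also have "... <= opn (A * B) * 1" using n by (intro mult_left_mono) auto
 also have "... <= opn A * opn B" using opnorm_mult[OF A B] by simp
 also have "... <= 1 * opn B" using n by (intro mult_right_mono) auto
 finally show ?thesis by simp
qed

text \<open>Compression by isometries onto the lifted projections is multiplicative on the range of
  \<open>h\<close>, since there the image of the unit may be inserted between two factors.\<close>

theorem unital_embedding_of_embedding:
 fixes C :: "'c cstar"
 assumes C: "unital_cstar_algebra C" and n: "!!k. n k > 0" and h: "embedding C (cor n) h"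
 shows "EX M g. (ALL k. M k > 0) & unital_embedding C (cor M) g"
proof -
 interpret C: unital_cstar_algebra C by (rule C)
 let ?Q = "cor n"
 interpret Q: unital_cstar_algebra ?Q by (rule unital_cstar_corona[OF n])
 interpret h: star_hom_loc C ?Q h
  by unfold_locales (use h in \<open>simp add: embedding_def\<close>)
 have inj: "inj_on h (carrier C)" using h by (simp add: embedding_def)
 define e where "e = h 1[C]"
 have eC: "e : carrier ?Q" by (simp add: e_def)
 have ee: "e *[?Q] e = e" "star ?Q e = e"
  using h.hom_simps(4)[of "1[C]" "1[C]"] h.hom_simps(5)[of "1[C]"] by (simp_all add: e_def)
 have eh: "e *[?Q] h x = h x" "h x *[?Q] e = h x" if "x : carrier C" for x
  using h.hom_simps(4)[of "1[C]" x] h.hom_simps(4)[of x "1[C]"] that by (simp_all add: e_def)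
 obtain y where y: "y : mprod n" "e = cls n y" using eC by (auto simp: carrier_corona)
 \<comment> \<open>Averaging with the adjoint makes the lift hermitian and keeps its class, because
   \<open>e\<close> is hermitian.\<close>
 define a where "a k = (1/2) *m (y k + adj (y k))" for k
 have am: "a : mprod n" unfolding a_def by (intro mprod_smult mprod_add mprod_adj y)
 note ak = mpm[OF am]
 have ah: "adj (a k) = a k" for k
  using mpm[OF y(1), of k] by (simp add: a_def adj_smult adj_add[of _ "n k" "n k"] adj_adj comm_add_mat[of _ "n k" "n k"])
 have "(1/2) .[?Q] (e +[?Q] star ?Q e) = e"
  unfolding ee(2) using eC by (simp add: Q.sm_add_right)
 hence ea: "e = cls n a"
  unfolding y(2) a_def using y(1) by (simp add: corona_star corona_add corona_smult)
 define dl where "dl k = opn (a k * a k - a k)" for k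
 have d0: "dl ----> 0"
  using ee(1) unfolding ea corona_mult[OF am am] cls_eq_iff[OF mprod_mult[OF am am] am] mnull_def dl_def .
 have "EX m V. V : cmat (n k) m & adj V * V = 1\<^sub>m m & opn (V * adj V - a k) <= 2 * dl k" for k
  by (rule almost_projection_isometry[OF ak ah, of k "dl k"]) (auto simp: dl_def)
 then obtain m V where V: "!!k. V k : cmat (n k) (m k)" "!!k. adj (V k) * V k = 1\<^sub>m (m k)"
  "!!k. opn (V k * adj (V k) - a k) <= 2 * dl k" by metis
 note aV = adj_carrier[OF V(1)]
 have Vn: "opn (V k) <= 1" for k by (rule isometry_opnorm[OF V(1,2)])
 have aVn: "opn (adj (V k)) <= 1" for k using Vn by (simp add: opnorm_adj)
 define P where "P k = V k * adj (V k)" for k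
 have Pc: "P k : cmat (n k) (n k)" for k unfolding P_def by (rule mmc[OF V(1) aV])
 have Pm: "P : mprod n"
 proof (rule mprodI[OF Pc])
  fix k
  have "opn (P k) <= opn (V k) * opn (adj (V k))" unfolding P_def by (rule opnorm_mult[OF V(1) aV])
  also have "... <= 1 * 1" by (intro mult_mono Vn aVn) auto
  finally show "opn (P k) <= 1" by simp
 qed
 have eP: "e = cls n P"
 proof -
  have "mnull (%k. P k - a k)"
  proof (rule mnull_sandwich)
   show "opn (P k - a k) <= 2 * dl k" for k unfolding P_def by (rule V(3))
   show "(%k. 2 * dl k) ----> 0" using tendsto_mult[OF tendsto_const[of 2] d0] by simp
  qed
  thus ?thesis unfolding ea using cls_eq_iff[OF Pm am] by simp
 qed
 have pos_inf: "EX l>=k. m l > 0" for k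
 proof (rule ccontr)
  assume "\<not> (EX l>=k. m l > 0)"
  hence m0: "m l = 0" if "l >= k" for l using that by auto
  have "P l = 0\<^sub>m (n l) (n l)" if "l >= k" for l
   unfolding P_def by (rule eq_matI) (use V(1)[of l] aV[of l] m0[OF that] in \<open>auto simp: scalar_prod_def\<close>)
  hence "EV l. opn (P l - 0\<^sub>m (n l) (n l)) = 0"
   unfolding eventually_sequentially by (intro exI[of _ k]) auto
  hence "mnull (%l. P l - 0\<^sub>m (n l) (n l))" unfolding mnull_def by (rule tendsto_eventually)
  hence "e = 0[?Q]" unfolding eP corona_zero using cls_eq_iff[OF Pm mprod_zero] by simp
  hence "h 1[C] = h 0[C]" by (simp add: e_def)
  hence "1[C] = 0[C]" by (rule inj_onD[OF inj]) auto
  thus False using C.one_neq_zero by simp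
 qed
 \<comment> \<open>A compressed size may be 0; such a coordinate is replaced by the next one of
   positive size. As \<open>s k = k\<close> whenever the size is positive, no nonzero coordinate is
   lost for injectivity.\<close>
 define s where "s k = (LEAST l. l >= k & m l > 0)" for k
 have s: "s k >= k" "m (s k) > 0" for k
 proof -
  have "EX l. l >= k & m l > 0" using pos_inf[of k] by blast
  from LeastI_ex[OF this] show "s k >= k" "m (s k) > 0" by (simp_all add: s_def)
 qed
 have s_id: "s k = k" if "m k > 0" for k
  unfolding s_def by (rule Least_equality) (use that in auto)
 define M where "M k = m (s k)" for k
 have Mpos: "M k > 0" for k using s(2) by (simp add: M_def)
 define K where "K k Y = adj (V k) * Y k * V k" for k and Y :: "nat => complex mat"
 have Kc: "K k Y : cmat (m k) (m k)" if "Y : mprod n" for k Y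
  unfolding K_def by (rule mmc[OF mmc[OF aV mpm[OF that]] V(1)])
 have Kn: "opn (K k Y) <= opn (Y k)" if "Y : mprod n" for k Y
  unfolding K_def by (rule opnorm_contract[OF aV mpm[OF that] V(1) aVn Vn])
 define J where "J Y = (%k. K (s k) Y)" for Y
 have Jm: "J Y : mprod M" if Y: "Y : mprod n" for Y
 proof -
  obtain B where B: "!!k. opn (Y k) <= B" "B >= 0" using mprod_bound[OF Y] by blast
  show ?thesis unfolding J_def M_def
   by (rule mprodI[OF Kc[OF Y] order_trans[OF Kn[OF Y] B(1)]])
 qed
 have Jnull: "mnull (J Y)" if Y: "Y : mprod n" and nl: "mnull Y" for Y
  unfolding mnull_def
 proof (rule LIMSEQ_I)
  fix r :: real assume r: "0 < r"
  obtain N where N: "!!k. k >= N ==> opn (Y k) < r"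
   using mnull_eventually[OF nl r] by (auto simp: eventually_sequentially)
  have "opn (J Y k) < r" if "k >= N" for k
   using Kn[OF Y, of "s k"] N[of "s k"] s(1)[of k] that unfolding J_def by linarith
  thus "EX no. ALL k>=no. norm (opn (J Y k) - 0) < r" by (intro exI[of _ N]) simp
 qed
 have Jadd: "J (%k. Y k + Z k) = (%k. J Y k + J Z k)" and Jminus: "J (%k. Y k - Z k) = (%k. J Y k - J Z k)"
  if Y: "Y : mprod n" and Z: "Z : mprod n" for Y Z
 proof -
  show "J (%k. Y k + Z k) = (%k. J Y k + J Z k)"
   unfolding J_def K_def
   by (simp add: mult_add_distrib_mat[OF aV mpm[OF Y] mpm[OF Z]]
     add_mult_distrib_mat[OF mmc[OF aV mpm[OF Y]] mmc[OF aV mpm[OF Z]] V(1)])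
  show "J (%k. Y k - Z k) = (%k. J Y k - J Z k)"
   unfolding J_def K_def
   by (simp add: mult_minus_distrib_mat[OF aV mpm[OF Y] mpm[OF Z]]
     minus_mult_distrib_mat[OF mmc[OF aV mpm[OF Y]] mmc[OF aV mpm[OF Z]] V(1)])
 qed
 have Jsmult: "J (%k. c *m Y k) = (%k. c *m J Y k)" if Y: "Y : mprod n" for c Y
  unfolding J_def K_def
  by (simp add: mult_smult_distrib[OF aV mpm[OF Y]] mult_smult_assoc_mat[OF mmc[OF aV mpm[OF Y]] V(1)])
 have Jadj: "J (%k. adj (Y k)) = (%k. adj (J Y k))" if Y: "Y : mprod n" for Y
  unfolding J_def K_def
  by (simp add: adj_mult[OF mmc[OF aV mpm[OF Y]] V(1)] adj_mult[OF aV mpm[OF Y]] adj_adj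
    assoc_mult_mat[OF aV adj_carrier[OF mpm[OF Y]] V(1)])
 \<comment> \<open>Multiplying two compressions puts the projection \<open>P\<close> between the
   factors; on the range of \<open>h\<close> it is absorbed.\<close>
 have Jmult: "(%k. J Y k * J Z k) = J (%k. Y k * (P k * Z k))" if Y: "Y : mprod n" and Z: "Z : mprod n" for Y Z
 proof -
  have "K k Y * K k Z = K k (%k. Y k * (P k * Z k))" for k
  proof -
   note Yk = mpm[OF Y, of k] and Zk = mpm[OF Z, of k] and Vk = V(1)[of k] and aVk = aV[of k]
   let ?a = "adj (V k)"
   note ZV = mmc[OF Zk Vk]
   note aZV = mmc[OF aVk ZV]
   have "K k Y * K k Z = (?a * (Y k * V k)) * (?a * (Z k * V k))"
    unfolding K_def by (simp add: assoc_mult_mat[OF aVk Yk Vk] assoc_mult_mat[OF aVk Zk Vk])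
   also have "... = ?a * ((Y k * V k) * (?a * (Z k * V k)))"
    by (rule assoc_mult_mat[OF aVk mmc[OF Yk Vk] aZV])
   also have "(Y k * V k) * (?a * (Z k * V k)) = Y k * (V k * (?a * (Z k * V k)))"
    by (rule assoc_mult_mat[OF Yk Vk aZV])
   also have "V k * (?a * (Z k * V k)) = P k * (Z k * V k)"
    unfolding P_def by (rule assoc_mult_mat[OF Vk aVk ZV, symmetric])
   also have "P k * (Z k * V k) = (P k * Z k) * V k" by (rule assoc_mult_mat[OF Pc Zk Vk, symmetric])
   also have "Y k * ((P k * Z k) * V k) = (Y k * (P k * Z k)) * V k"
    by (rule assoc_mult_mat[OF Yk mmc[OF Pc Zk] Vk, symmetric])
   also have "?a * ((Y k * (P k * Z k)) * V k) = K k (%k. Y k * (P k * Z k))"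
    unfolding K_def by (rule assoc_mult_mat[OF aVk mmc[OF Yk mmc[OF Pc Zk]] Vk, symmetric])
   finally show ?thesis .
  qed
  thus ?thesis unfolding J_def by simp
 qed
 define rp where "rp X = (SOME Y. Y : mprod n & X = cls n Y)" for X
 define G where "G X = cls M (J (rp X))" for X
 have Gc: "G (cls n Y) = cls M (J Y)" if Y: "Y : mprod n" for Y
 proof -
  have "rp (cls n Y) : mprod n & cls n Y = cls n (rp (cls n Y))"
   unfolding rp_def by (rule someI[of _ Y]) (simp add: Y)
  hence r: "rp (cls n Y) : mprod n" "mnull (%k. rp (cls n Y) k - Y k)" using Y cls_eq_iff by metis+
  have "mnull (%k. J (rp (cls n Y)) k - J Y k)"
   using Jnull[OF mprod_minus[OF r(1) Y] r(2)] unfolding Jminus[OF r(1) Y] .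
  thus ?thesis unfolding G_def using cls_eq_iff[OF Jm[OF r(1)] Jm[OF Y]] by simp
 qed
 have hl: "EX Y. Y : mprod n & h x = cls n Y" if "x : carrier C" for x
  using h.hom_simps(1)[OF that] by (auto simp: carrier_corona)
 define g where "g x = G (h x)" for x
 have hom: "star_hom C (cor M) g"
  unfolding star_hom_def
 proof (intro conjI ballI allI)
  show "g : carrier C \<rightarrow> carrier (cor M)"
  proof
   fix x assume "x : carrier C"
   then obtain Y where "Y : mprod n" "h x = cls n Y" using hl by blast
   thus "g x : carrier (cor M)" using Jm by (simp add: g_def Gc)
  qed
  fix x assume x: "x : carrier C"
  obtain Y where Y: "Y : mprod n" "h x = cls n Y" using hl[OF x] by blast
  show "g (c .[C] x) = c .[cor M] g x" for c
   unfolding g_def h.hom_simps(3)[OF x] Y(2) corona_smult[OF Y(1)] Gc[OF mprod_smult[OF Y(1)]] Gc[OF Y(1)]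
    corona_smult[OF Jm[OF Y(1)]] Jsmult[OF Y(1)] ..
  show "g (star C x) = star (cor M) (g x)"
   unfolding g_def h.hom_simps(5)[OF x] Y(2) corona_star[OF Y(1)] Gc[OF mprod_adj[OF Y(1)]] Gc[OF Y(1)]
    corona_star[OF Jm[OF Y(1)]] Jadj[OF Y(1)] ..
  fix z assume z: "z : carrier C"
  obtain Z where Z: "Z : mprod n" "h z = cls n Z" using hl[OF z] by blast
  show "g (x +[C] z) = g x +[cor M] g z"
   unfolding g_def h.hom_simps(2)[OF x z] Y(2) Z(2) corona_add[OF Y(1) Z(1)] Gc[OF mprod_add[OF Y(1) Z(1)]] Gc[OF Y(1)] Gc[OF Z(1)]
    corona_add[OF Jm[OF Y(1)] Jm[OF Z(1)]] Jadd[OF Y(1) Z(1)] ..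
  have "h (x *[C] z) = h x *[?Q] (e *[?Q] h z)" using eh(1)[OF z] h.hom_simps(4)[OF x z] by simp
  also have "... = cls n (%k. Y k * (P k * Z k))"
   unfolding Y(2) Z(2) eP corona_mult[OF Pm Z(1)] corona_mult[OF Y(1) mprod_mult[OF Pm Z(1)]] ..
  finally have hx: "h (x *[C] z) = cls n (%k. Y k * (P k * Z k))" .
  show "g (x *[C] z) = g x *[cor M] g z"
   unfolding g_def hx Gc[OF mprod_mult[OF Y(1) mprod_mult[OF Pm Z(1)]]] Y(2) Z(2) Gc[OF Y(1)] Gc[OF Z(1)]
    corona_mult[OF Jm[OF Y(1)] Jm[OF Z(1)]] Jmult[OF Y(1) Z(1)] ..
 qed
 have one: "g 1[C] = 1[cor M]"
 proof -
  have "K k P = 1\<^sub>m (m k)" for k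
  proof -
   have "adj (V k) * (V k * adj (V k)) = (adj (V k) * V k) * adj (V k)"
    by (rule assoc_mult_mat[OF aV V(1) aV, symmetric])
   thus ?thesis unfolding K_def P_def V(2) using left_mult_one_mat[OF aV, of k] V(2)[of k] by simp
  qed
  hence "J P = (%k. 1\<^sub>m (M k))" by (simp add: J_def M_def)
  thus ?thesis unfolding g_def e_def[symmetric] eP Gc[OF Pm] corona_one by simp
 qed
 have inj0: "x = 0[C]" if x: "x : carrier C" and gx: "g x = 0[cor M]" for x
 proof -
  obtain Y where Y: "Y : mprod n" "h x = cls n Y" using hl[OF x] by blast
  have "cls M (J Y) = cls M (%k. 0\<^sub>m (M k) (M k))" using gx unfolding g_def Y(2) Gc[OF Y(1)] corona_zero .
  hence "mnull (%k. J Y k - 0\<^sub>m (M k) (M k))" using cls_eq_iff[OF Jm[OF Y(1)] mprod_zero] by simp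
  moreover have "J Y k - 0\<^sub>m (M k) (M k) = J Y k" for k using mpm[OF Jm[OF Y(1)], of k] by auto
  ultimately have Jn: "mnull (J Y)" by simp
  \<comment> \<open>A null compression forces the corner \<open>P k * (Y k * P k)\<close> to be
    null, and for lifts of elements \<open>h x\<close> this corner represents \<open>h x\<close>
    again.\<close>
  have PYP: "opn (P k * (Y k * P k)) <= opn (K k Y)" for k
  proof -
   note Yk = mpm[OF Y(1), of k] and Vk = V(1)[of k] and aVk = aV[of k]
   let ?a = "adj (V k)"
   have "P k * (Y k * P k) = V k * (?a * (Y k * P k))"
    unfolding P_def by (rule assoc_mult_mat[OF Vk aVk]) (rule mmc[OF Yk mmc[OF Vk aVk]])
   also have "?a * (Y k * P k) = (?a * Y k) * P k" by (rule assoc_mult_mat[OF aVk Yk Pc, symmetric])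
   also have "... = K k Y * ?a"
    unfolding K_def P_def by (rule assoc_mult_mat[OF mmc[OF aVk Yk] Vk aVk, symmetric])
   also have "V k * (K k Y * ?a) = V k * K k Y * ?a" by (rule assoc_mult_mat[OF Vk Kc[OF Y(1)] aVk, symmetric])
   finally show ?thesis using opnorm_contract[OF Vk Kc[OF Y(1)] aVk Vn aVn] by simp
  qed
  have "mnull (%k. P k * (Y k * P k))"
   unfolding mnull_def
  proof (rule LIMSEQ_I)
   fix r :: real assume r: "0 < r"
   obtain N where N: "!!k. k >= N ==> opn (J Y k) < r"
    using mnull_eventually[OF Jn r] by (auto simp: eventually_sequentially)
   have "opn (K k Y) < r" if k: "k >= N" for k
   proof (cases "m k > 0")
    case True thus ?thesis using N[OF k] s_id[of k] by (simp add: J_def)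
   next
    case False
    hence "K k Y = 0\<^sub>m 0 0" using Kc[OF Y(1), of k] by auto
    thus ?thesis using r by simp
   qed
   hence "opn (P k * (Y k * P k)) < r" if "k >= N" for k using PYP[of k] that by (meson le_less_trans)
   thus "EX no. ALL k>=no. norm (opn (P k * (Y k * P k)) - 0) < r" by (intro exI[of _ N]) simp
  qed
  moreover have PYm: "(%k. P k * (Y k * P k)) : mprod n" by (intro mprod_mult Pm Y(1))
  moreover have "P k * (Y k * P k) - 0\<^sub>m (n k) (n k) = P k * (Y k * P k)" for k using mpm[OF PYm, of k] by auto
  ultimately have "cls n (%k. P k * (Y k * P k)) = 0[?Q]" unfolding corona_zero using cls_eq_iff[OF PYm mprod_zero] by simp
  moreover have "h x = cls n (%k. P k * (Y k * P k))"
  proof -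
   have "h x = e *[?Q] (h x *[?Q] e)" using eh[OF x] by simp
   thus ?thesis unfolding Y(2) eP corona_mult[OF Y(1) Pm] corona_mult[OF Pm mprod_mult[OF Y(1) Pm]] .
  qed
  ultimately have "h x = h 0[C]" by simp
  thus ?thesis by (rule inj_onD[OF inj]) (use x in auto)
 qed
 interpret g: unital_hom C "cor M" g
  by (intro unital_hom.intro star_hom_loc.intro star_hom_loc_axioms.intro unital_hom_axioms.intro C hom one
    unital_cstar_corona[OF Mpos] C.cstar_algebra_axioms unital_cstar_algebra.axioms(1)[OF unital_cstar_corona[OF Mpos]])
 have "inj_on g (carrier C)"
 proof (rule inj_onI)
  fix x y assume x: "x : carrier C" and y: "y : carrier C" and eq: "g x = g y"
  have "g (x -[C] y) = 0[cor M]" using x y eq by (simp add: g.hom_diff)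
  hence "x -[C] y = 0[C]" by (intro inj0) (use x y in auto)
  thus "x = y" by (rule C.diff_eq_zero[OF x y])
 qed
 hence "unital_embedding C (cor M) g" using hom one by (simp add: unital_embedding_def embedding_def)
 thus ?thesis using Mpos by blast
qed

lemma unital_embedding_comp:
 "unital_embedding A B f ==> unital_embedding B E g ==> unital_embedding A E (%x. g (f x))"
 unfolding unital_embedding_def embedding_def
 by (auto simp: star_homD inj_on_def intro: star_hom_comp)

theorem theorem5p3:
  fixes A :: "'a cstar" and B :: "'b cstar" and D :: "'d cstar" and C :: "'c cstar"
    and iA :: "'d \<Rightarrow> 'a" and iB :: "'d \<Rightarrow> 'b" and sA :: "'a \<Rightarrow> 'c" and sB :: "'b \<Rightarrow> 'c"
  assumes "unital_cstar_algebra A" and "MF_algebra A"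
    and "unital_cstar_algebra B" and "MF_algebra B"
    and "unital_cstar_algebra D" and "AF_algebra D"
    and "unital_embedding D A iA" and "unital_embedding D B iB"
    and universe: "\<exists>f :: real \<Rightarrow> 'e. inj f"
    and "amalgamated_free_product TYPE('e) A B D iA iB C sA sB"
  shows "MF_algebra C \<longleftrightarrow>
    (\<exists>n :: nat \<Rightarrow> nat. (\<forall>k. n k > 0) \<and>
      (\<exists>q1 q2. unital_embedding A (mat_corona n) q1 \<and> unital_embedding B (mat_corona n) q2 \<and>
        (\<forall>d\<in>carrier D. q1 (iA d) = q2 (iB d))))"
proof -
 note fp = assms(10)
 have C: "unital_cstar_algebra C" and sA: "unital_embedding A C sA" and sB: "unital_embedding B C sB"
  and sd: "ALL d:carrier D. sA (iA d) = sB (iB d)"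
  and gen: "generated_by C (sA ` carrier A \<union> sB ` carrier B)"
  using fp unfolding amalgamated_free_product_def by simp_all
 interpret A: unital_cstar_algebra A by (rule assms(1))
 interpret B: unital_cstar_algebra B by (rule assms(3))
 interpret C: unital_cstar_algebra C by (rule C)
 show ?thesis
 proof
  assume "MF_algebra C"
  then obtain n h where n: "ALL k. n k > 0" and h: "embedding C (cor n) h" unfolding MF_algebra_def by blast
  obtain M g where M: "ALL k. M k > 0" "unital_embedding C (cor M) g"
   using unital_embedding_of_embedding[OF C _ h] n by blast
  show "EX n :: nat => nat. (ALL k. n k > 0) &
   (EX q1 q2. unital_embedding A (cor n) q1 & unital_embedding B (cor n) q2 &
    (ALL d:carrier D. q1 (iA d) = q2 (iB d)))"
   using M(1) unital_embedding_comp[OF sA M(2)] unital_embedding_comp[OF sB M(2)] sd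
   by (intro exI[of _ M] conjI exI[of _ "%x. g (sA x)"] exI[of _ "%x. g (sB x)"]) auto
 next
  assume "EX n :: nat => nat. (ALL k. n k > 0) &
   (EX q1 q2. unital_embedding A (cor n) q1 & unital_embedding B (cor n) q2 &
    (ALL d:carrier D. q1 (iA d) = q2 (iB d)))"
  then obtain n q1 q2 where n: "ALL k. n k > 0" and q: "unital_embedding A (cor n) q1" "unital_embedding B (cor n) q2"
   "ALL d:carrier D. q1 (iA d) = q2 (iB d)" by blast
  obtain a0 where a0: "dense_seq A a0" using A.separable_dense_seq assms(2) unfolding MF_algebra_def by blast
  obtain b where b: "dense_seq B b" using B.separable_dense_seq assms(4) unfolding MF_algebra_def by blast
  \<comment> \<open>The unit is prepended so that it becomes a word: the norm of \<open>p c\<close>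
    is estimated at the model vector of the unit.\<close>
  define a where "a = case_nat 1[A] a0"
  have a: "dense_seq A a"
   unfolding dense_seq_def
  proof (intro conjI allI ballI impI)
   show "a i : carrier A" for i using a0 by (cases i) (auto simp: a_def dense_seq_def)
   fix x e assume "x : carrier A" "(e::real) > 0"
   then obtain i where "cnorm A (x -[A] a0 i) < e" using a0 unfolding dense_seq_def by blast
   thus "EX i. cnorm A (x -[A] a i) < e" by (intro exI[of _ "Suc i"]) (simp add: a_def)
  qed
  interpret sA: unital_hom A C sA by unfold_locales (use sA in \<open>auto simp: unital_embedding_def embedding_def\<close>)
  interpret sB: unital_hom B C sB by unfold_locales (use sB in \<open>auto simp: unital_embedding_def embedding_def\<close>)
  interpret w: word_gen A B C sA sB a b by unfold_locales (rule a, rule b)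
  \<comment> \<open>The closure of the words is a subalgebra containing both images, hence all of
    \<open>C\<close>; as the words are countable, \<open>C\<close> is separable.\<close>
  have W: "w.W = carrier C"
   using gen w.W_subalgebra w.A_in_W w.B_in_W unfolding generated_by_def by blast
  have sep: "separable_cstar C"
   unfolding separable_cstar_def
  proof (intro exI conjI ballI allI impI)
   show "countable w.words" "w.words \<subseteq> carrier C" by (rule w.words_countable, rule w.words_carrier)
   fix x e assume "x : carrier C" "(e::real) > 0"
   hence "x : w.W" using W by simp
   thus "EX s:w.words. cdist C x s < e" using `e > 0` unfolding w.W_def norm_closure_def cdist_def by blast
  qed
  obtain f where f: "C.pos_functional f" "!!x. x : carrier C ==> Re (f (star C x *[C] x)) = 0 ==> x = 0[C]"
   using C.exists_faithful_functional[OF sep] by blast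
  interpret gA: gram_side A C n q1 sA f by unfold_locales (use n q sA f in auto)
  interpret gB: gram_side B C n q2 sB f by unfold_locales (use n q sB f in auto)
  interpret D: unital_cstar_algebra D by (rule assms(5))
  interpret glue A B C D n q1 q2 sA sB f iA iB
   by unfold_locales (use f(2) assms(7,8) sd q(3) in auto)
  have "a 0 = 1[A]" by (simp add: a_def)
  from glue_embedding[OF assms(6) fp universe a b this W[unfolded w.W_def w.words_def]]
  obtain M p where "ALL j. M j > 0" "embedding C (cor M) p" by blast
  thus "MF_algebra C" unfolding MF_algebra_def using sep C.cstar_algebra_axioms by blast
 qed
qed

end
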